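(* For every $K \in \mathbb{N}\setminus\{0\}$, the class of (possibly non-deterministic) well-formed cons-free programs with data order $K$ characterises $\mathsf{ELEMENTARY}$: a decision problem $X\subseteq\{0,1\}^+$ is accepted by some well-formed cons-free program with data order $K$ (which may use $\mathsf{choose}$) if and only if $X\in\mathsf{ELEMENTARY}$.
   Context: Types are built from a finite set $\mathcal{S}$ of sorts (containing $\mathsf{bool}$ and $\mathsf{list}$) by $\sigma ::= \iota \mid \sigma \times \tau \mid \sigma \Rightarrow \tau$, with $\Rightarrow$ right-associative. Type order: $\mathrm{ord}(\iota)=0$ for sorts, $\mathrm{ord}(\sigma\times\tau)=\max(\mathrm{ord}(\sigma),\mathrm{ord}(\tau))$, $\mathrm{ord}(\sigma\Rightarrow\tau)=\max(\mathrm{ord}(\sigma)+1,\mathrm{ord}(\tau))$. Write $\kappa$ for a type that is a sort or a product; every type is uniquely $\sigma_1\Rightarrow\cdots\Rightarrow\sigma_m\Rightarrow\kappa$. Syntax. Fix pairwise disjoint sets of variables, data constructors $\mathcal{C}$ (containing $\mathsf{true},\mathsf{false}$) and defined symbols $\mathcal{D}$. Patterns: $\ell ::= x \mid c\,\ell_1\cdots\ell_m$ ($c\in\mathcal{C}$). Expressions: $s ::= x \mid c \mid f \mid \mathsf{if}\ s_1\ \mathsf{then}\ s_2\ \mathsf{else}\ s_3 \mid \mathsf{choose}\ s_1\cdots s_n \mid (s,t) \mid s\,t$ (application left-associative). A program is a finite list of clauses $f\,\ell_1\cdots\ell_k = s$ with $f \in \mathcal{D}$; its main function $f_1$ is the defined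 symbol of the first clause. Sub-expressions: $s \unrhd t$ iff $s = t$ or $s \rhd t$, where $(s_1,s_2)\rhd t$, $\mathsf{if}\ s_1\ \mathsf{then}\ s_2\ \mathsf{else}\ s_3 \rhd t$ and $\mathsf{choose}\ s_1\cdots s_n\rhd t$ hold if $s_i \unrhd t$ for some $i$, and $s_1\,s_2 \rhd t$ holds if $s_1 \rhd t$ or $s_2 \unrhd t$. Typing. A program is well-typed if there is an assignment $\mathcal{F}$ of simple types to $\mathcal{C}\cup\mathcal{D}$ such that: $f_1 : \kappa_1\Rightarrow\cdots\Rightarrow\kappa_M\Rightarrow\kappa$ with all $\kappa_i,\kappa$ of order $0$; each $c\in\mathcal{C}$ has type $\kappa_1\Rightarrow\cdots\Rightarrow\kappa_m\Rightarrow\iota$ with $\iota$ a sort and all $\kappa_i$ of order $0$; and for every clause $f\,\ell_1\cdots\ell_k=s$, all variables of $s$ occur in the left-hand side, each variable occurs at most once in the left-hand side, and there is a type environment $\Gamma$ for the left-hand side variables under which both sides have the same type (standard simple typing: $(s,t):\sigma\times\tau$, application of $\sigma\Rightarrow\tau$ to $\sigma$ gives $\tau$, $\mathsf{if}$ needs a $\mathsf{bool}$ condition and two branches of a common type, $\mathsf{choose}$ needs all arguments of a common type). It is well-formed if moreover constructors always occur fully applied and all clauses with the same root $f$ have the same number $\mathrm{arity}(f)$ of arguments. A program has data order $K$ if all clauses can be typed with environments assigning every variable a type of order $\le K$. A program is deterministic if $\mathsf{choose}$ does not occur in it; otherwise it may be non-deterministic. Semantics. Data expressions $d ::= c\,d_1\cdots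 d_m \mid (d,d')$; values $v ::= d \mid (v,w) \mid f\,v_1\cdots v_n$ with $n<\mathrm{arity}(f)$; environments $\gamma$ map variables to values and $\ell\gamma$ is instantiation. Judgements $p,\gamma\vdash s\to w$, $p,\gamma\vdash^{\mathrm{if}} d,s_2,s_3\to w$ and $p\vdash^{\mathrm{call}} f\,v_1\cdots v_n\to w$ are derived by: $p,\gamma\vdash x\to\gamma(x)$; $p,\gamma\vdash f\to w$ if $p\vdash^{\mathrm{call}} f\to w$; $p,\gamma\vdash c\,s_1\cdots s_m\to c\,b_1\cdots b_m$ if $p,\gamma\vdash s_i\to b_i$ for all $i$; $p,\gamma\vdash(s,t)\to(v,w)$ if $p,\gamma\vdash s\to v$ and $p,\gamma\vdash t\to w$; $p,\gamma\vdash \mathsf{choose}\ s_1\cdots s_n\to w$ if $p,\gamma\vdash s_i\to w$ for some $i$; $p,\gamma\vdash\mathsf{if}\ s_1\ \mathsf{then}\ s_2\ \mathsf{else}\ s_3\to w$ if $p,\gamma\vdash s_1\to d$ and $p,\gamma\vdash^{\mathrm{if}} d,s_2,s_3\to w$, where $p,\gamma\vdash^{\mathrm{if}}\mathsf{true},s_2,s_3\to w$ if $p,\gamma\vdash s_2\to w$ and $p,\gamma\vdash^{\mathrm{if}}\mathsf{false},s_2,s_3\to w$ if $p,\gamma\vdash s_3\to w$; $p,\gamma\vdash s\,t\to w$ if $p,\gamma\vdash s\to f\,v_1\cdots v_n$, $p,\gamma\vdash t\to v_{n+1}$ and $p\vdash^{\mathrm{call}} f\,v_1\cdots v_{n+1}\to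 w$; $p\vdash^{\mathrm{call}} f\,v_1\cdots v_n\to f\,v_1\cdots v_n$ if $n<\mathrm{arity}(f)$; $p\vdash^{\mathrm{call}} f\,v_1\cdots v_k\to w$ if $p,\gamma\vdash s\to w$ where $f\,\ell_1\cdots\ell_k=s$ is the first clause of $p$ for which there is $\gamma$ with domain the left-hand side variables and $v_i=\ell_i\gamma$ for all $i$. Finally $[\![p]\!](d_1,\dots,d_M)\mapsto b$ iff $p,[x_1:=d_1,\dots,x_M:=d_M]\vdash f_1\,x_1\cdots x_M\to b$. Cons-freeness. A clause $f\,\ell_1\cdots\ell_k=s$ is cons-free if every $t$ with $s\unrhd t$ of the form $c\,s_1\cdots s_m$ with $c\in\mathcal{C}$ is a data expression or satisfies $\ell_i\unrhd t$ for some $i$; a program is cons-free if all its clauses are. Acceptance and complexity. Consider programs with constructors $\mathsf{true},\mathsf{false}:\mathsf{bool}$, $[]:\mathsf{list}$, infix $::\ :\mathsf{bool}\Rightarrow\mathsf{list}\Rightarrow\mathsf{list}$ and main function of type $\mathsf{list}\Rightarrow\mathsf{bool}$. Such a program accepts $a_1\cdots a_n\in\{0,1\}^*$ if $[\![p]\!](\overline{a_1}::\cdots::\overline{a_n}::[])\mapsto\mathsf{true}$, where $\overline{1}=\mathsf{true}$, $\overline{0}=\mathsf{false}$; it accepts the decision problem consisting of all strings it accepts. $\exp_2^0(n)=n$, $\exp_2^{K+1}(n)=2^{\exp_2^K(n)}$. $\mathsf{TIME}(h(n))$ is the set of $X\subseteq\{0,1\}^+$ decided by some deterministic single-tape Turing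 machine which, for some constant $a>0$, reaches its accept or reject state within $a\cdot h(n)$ steps on every input of length $n\ge1$. $\mathsf{EXPTIME}_K=\bigcup_{a,b\in\mathbb{N}}\mathsf{TIME}(\exp_2^K(a\cdot n^b))$ and $\mathsf{ELEMENTARY}=\bigcup_{K\in\mathbb{N}}\mathsf{EXPTIME}_K$. A class of programs characterises a complexity class $\mathcal{K}$ if the decision problems accepted by programs in the class are exactly the members of $\mathcal{K}$. *)

theory Defs
  imports Main
begin

datatype ty = Sort string | Prod ty ty | Arrow ty ty

fun ord_ty :: "ty \<Rightarrow> nat" where
  "ord_ty (Sort _) = 0"
| "ord_ty (Prod s t) = max (ord_ty s) (ord_ty t)"
| "ord_ty (Arrow s t) = max (ord_ty s + 1) (ord_ty t)"

definition boolT :: ty where "boolT = Sort ''bool''"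
definition listT :: ty where "listT = Sort ''list''"

fun arrows :: "ty list \<Rightarrow> ty \<Rightarrow> ty" where
  "arrows [] t = t"
| "arrows (s # ss) t = Arrow s (arrows ss t)"

fun arity_ty :: "ty \<Rightarrow> nat" where
  "arity_ty (Arrow _ t) = Suc (arity_ty t)"
| "arity_ty _ = 0"

text \<open>Variables, constructors and defined symbols are kept disjoint by tagging.
  The constructors true, false, [] and (::) are named ''true'', ''false'', ''nil'', ''cons''.\<close>

datatype pat = PVar string | PCon string "pat list"

datatype expr =
    EVar string | ECon string | EFun string
  | EIf expr expr expr | EChoose "expr list" | EPair expr expr | EApp expr expr

type_synonym clause = "string \<times> pat list \<times> expr"
type_synonym prog = "clause list"

definition apps :: "expr \<Rightarrow> expr list \<Rightarrow> expr" where
  "apps h es = foldl EApp h es"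

fun pexp :: "pat \<Rightarrow> expr" where
  "pexp (PVar x) = EVar x"
| "pexp (PCon c ps) = apps (ECon c) (map pexp ps)"

fun pvars :: "pat \<Rightarrow> string list" where
  "pvars (PVar x) = [x]"
| "pvars (PCon c ps) = concat (map pvars ps)"

definition lhs_vars :: "pat list \<Rightarrow> string list" where
  "lhs_vars ls = concat (map pvars ls)"

fun evars :: "expr \<Rightarrow> string set" where
  "evars (EVar x) = {x}"
| "evars (ECon _) = {}"
| "evars (EFun _) = {}"
| "evars (EIf a b c) = evars a \<union> evars b \<union> evars c"
| "evars (EChoose es) = \<Union> (set (map evars es))"
| "evars (EPair a b) = evars a \<union> evars b"
| "evars (EApp a b) = evars a \<union> evars b"

text \<open>Strict sub-expressions (\<rhd>); note that the function part of an application is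
  not itself a sub-expression, only its strict sub-expressions are.\<close>
fun strict_subs :: "expr \<Rightarrow> expr set" where
  "strict_subs (EVar _) = {}"
| "strict_subs (ECon _) = {}"
| "strict_subs (EFun _) = {}"
| "strict_subs (EIf a b c) = insert a (strict_subs a) \<union> insert b (strict_subs b) \<union> insert c (strict_subs c)"
| "strict_subs (EChoose es) = \<Union> (set (map (\<lambda>e. insert e (strict_subs e)) es))"
| "strict_subs (EPair a b) = insert a (strict_subs a) \<union> insert b (strict_subs b)"
| "strict_subs (EApp a b) = strict_subs a \<union> insert b (strict_subs b)"

definition subs :: "expr \<Rightarrow> expr set" where
  "subs e = insert e (strict_subs e)"

inductive is_dexp :: "expr \<Rightarrow> bool" where
  "(\<forall>d\<in>set ds. is_dexp d) \<Longrightarrow> is_dexp (apps (ECon c) ds)"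
| "is_dexp a \<Longrightarrow> is_dexp b \<Longrightarrow> is_dexp (EPair a b)"

inductive typed :: "(string \<Rightarrow> ty) \<Rightarrow> (string \<Rightarrow> ty) \<Rightarrow> (string \<Rightarrow> ty) \<Rightarrow> expr \<Rightarrow> ty \<Rightarrow> bool"
  for FC FD where
  "typed FC FD \<Gamma> (EVar x) (\<Gamma> x)"
| "typed FC FD \<Gamma> (ECon c) (FC c)"
| "typed FC FD \<Gamma> (EFun f) (FD f)"
| "typed FC FD \<Gamma> a boolT \<Longrightarrow> typed FC FD \<Gamma> b t \<Longrightarrow> typed FC FD \<Gamma> c t
     \<Longrightarrow> typed FC FD \<Gamma> (EIf a b c) t"
| "es \<noteq> [] \<Longrightarrow> (\<forall>e\<in>set es. typed FC FD \<Gamma> e t) \<Longrightarrow> typed FC FD \<Gamma> (EChoose es) t"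
| "typed FC FD \<Gamma> a s \<Longrightarrow> typed FC FD \<Gamma> b t \<Longrightarrow> typed FC FD \<Gamma> (EPair a b) (Prod s t)"
| "typed FC FD \<Gamma> a (Arrow s t) \<Longrightarrow> typed FC FD \<Gamma> b s \<Longrightarrow> typed FC FD \<Gamma> (EApp a b) t"

definition ctor_type :: "ty \<Rightarrow> bool" where
  "ctor_type t \<longleftrightarrow> (\<exists>ks i. t = arrows ks (Sort i) \<and> (\<forall>k\<in>set ks. ord_ty k = 0))"

definition main_fun :: "prog \<Rightarrow> string" where
  "main_fun p = fst (hd p)"

definition typed_prog_order :: "(string \<Rightarrow> ty) \<Rightarrow> (string \<Rightarrow> ty) \<Rightarrow> nat \<Rightarrow> prog \<Rightarrow> bool" where
  "typed_prog_order FC FD K p \<longleftrightarrow>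
     p \<noteq> [] \<and>
     FD (main_fun p) = Arrow listT boolT \<and>
     FC ''true'' = boolT \<and> FC ''false'' = boolT \<and> FC ''nil'' = listT \<and>
     FC ''cons'' = Arrow boolT (Arrow listT listT) \<and>
     (\<forall>c. ctor_type (FC c)) \<and>
     (\<forall>(f, ls, s) \<in> set p.
        distinct (lhs_vars ls) \<and> evars s \<subseteq> set (lhs_vars ls) \<and>
        (\<exists>\<Gamma> t. typed FC FD \<Gamma> (apps (EFun f) (map pexp ls)) t \<and> typed FC FD \<Gamma> s t \<and>
               (\<forall>x\<in>set (lhs_vars ls). ord_ty (\<Gamma> x) \<le> K)))"

text \<open>\<open>fa FC n e\<close>: every constructor in e occurs fully applied, where e itself is
  applied to n further arguments.\<close>
fun fa :: "(string \<Rightarrow> ty) \<Rightarrow> nat \<Rightarrow> expr \<Rightarrow> bool" where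
  "fa FC n (EVar _) = True"
| "fa FC n (ECon c) = (n = arity_ty (FC c))"
| "fa FC n (EFun _) = True"
| "fa FC n (EIf a b c) = (fa FC 0 a \<and> fa FC 0 b \<and> fa FC 0 c)"
| "fa FC n (EChoose es) = list_all (fa FC 0) es"
| "fa FC n (EPair a b) = (fa FC 0 a \<and> fa FC 0 b)"
| "fa FC n (EApp a b) = (fa FC (Suc n) a \<and> fa FC 0 b)"

fun pat_fa :: "(string \<Rightarrow> ty) \<Rightarrow> pat \<Rightarrow> bool" where
  "pat_fa FC (PVar _) = True"
| "pat_fa FC (PCon c ps) = (length ps = arity_ty (FC c) \<and> list_all (pat_fa FC) ps)"

definition same_arities :: "prog \<Rightarrow> bool" where
  "same_arities p \<longleftrightarrow>
     (\<forall>(f, ls, s) \<in> set p. \<forall>(g, ls', s') \<in> set p. f = g \<longrightarrow> length ls = length ls')"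

definition cons_free :: "prog \<Rightarrow> bool" where
  "cons_free p \<longleftrightarrow>
     (\<forall>(f, ls, s) \<in> set p. \<forall>t \<in> subs s.
        (\<exists>c ss. t = apps (ECon c) ss) \<longrightarrow>
        is_dexp t \<or> (\<exists>l\<in>set ls. t \<in> subs (pexp l)))"

definition wf_cf_prog :: "nat \<Rightarrow> prog \<Rightarrow> bool" where
  "wf_cf_prog K p \<longleftrightarrow>
     (\<exists>FC FD. typed_prog_order FC FD K p \<and>
        (\<forall>(f, ls, s) \<in> set p. fa FC 0 s \<and> list_all (pat_fa FC) ls)) \<and>
     same_arities p \<and> cons_free p"

datatype val = VCon string "val list" | VPair val val | VFun string "val list"

definition arity :: "prog \<Rightarrow> string \<Rightarrow> nat" where
  "arity p f = (case find (\<lambda>(g, _, _). g = f) p of Some (_, ls, _) \<Rightarrow> length ls | None \<Rightarrow> 0)"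

fun pinst :: "(string \<Rightarrow> val option) \<Rightarrow> pat \<Rightarrow> val" where
  "pinst \<gamma> (PVar x) = the (\<gamma> x)"
| "pinst \<gamma> (PCon c ps) = VCon c (map (pinst \<gamma>) ps)"

definition match_env :: "pat list \<Rightarrow> val list \<Rightarrow> (string \<Rightarrow> val option) \<Rightarrow> bool" where
  "match_env ls vs \<gamma> \<longleftrightarrow> dom \<gamma> = set (lhs_vars ls) \<and> vs = map (pinst \<gamma>) ls"

definition clause_matches :: "clause \<Rightarrow> string \<Rightarrow> val list \<Rightarrow> bool" where
  "clause_matches cl f vs \<longleftrightarrow>
     (case cl of (g, ls, s) \<Rightarrow> g = f \<and> (\<exists>\<gamma>. match_env ls vs \<gamma>))"

definition vtrue :: val where "vtrue = VCon ''true'' []"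
definition vfalse :: val where "vfalse = VCon ''false'' []"

inductive eval :: "prog \<Rightarrow> (string \<Rightarrow> val option) \<Rightarrow> expr \<Rightarrow> val \<Rightarrow> bool"
  and call :: "prog \<Rightarrow> string \<Rightarrow> val list \<Rightarrow> val \<Rightarrow> bool"
  for p where
  ev_var: "\<gamma> x = Some w \<Longrightarrow> eval p \<gamma> (EVar x) w"
| ev_fun: "call p f [] w \<Longrightarrow> eval p \<gamma> (EFun f) w"
| ev_con: "length bs = length ss \<Longrightarrow> (\<forall>i<length ss. eval p \<gamma> (ss ! i) (bs ! i))
     \<Longrightarrow> eval p \<gamma> (apps (ECon c) ss) (VCon c bs)"
| ev_pair: "eval p \<gamma> a v \<Longrightarrow> eval p \<gamma> b w \<Longrightarrow> eval p \<gamma> (EPair a b) (VPair v w)"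
| ev_choose: "e \<in> set es \<Longrightarrow> eval p \<gamma> e w \<Longrightarrow> eval p \<gamma> (EChoose es) w"
| ev_if_true: "eval p \<gamma> a vtrue \<Longrightarrow> eval p \<gamma> b w \<Longrightarrow> eval p \<gamma> (EIf a b c) w"
| ev_if_false: "eval p \<gamma> a vfalse \<Longrightarrow> eval p \<gamma> c w \<Longrightarrow> eval p \<gamma> (EIf a b c) w"
| ev_app: "eval p \<gamma> a (VFun f vs) \<Longrightarrow> eval p \<gamma> b v \<Longrightarrow> call p f (vs @ [v]) w
     \<Longrightarrow> eval p \<gamma> (EApp a b) w"
| call_partial: "length vs < arity p f \<Longrightarrow> call p f vs (VFun f vs)"
| call_clause: "j < length p \<Longrightarrow> p ! j = (f, ls, s) \<Longrightarrow> match_env ls vs \<gamma>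
     \<Longrightarrow> (\<forall>i<j. \<not> clause_matches (p ! i) f vs) \<Longrightarrow> eval p \<gamma> s w \<Longrightarrow> call p f vs w"

fun enc_list :: "bool list \<Rightarrow> val" where
  "enc_list [] = VCon ''nil'' []"
| "enc_list (b # w) = VCon ''cons'' [if b then vtrue else vfalse, enc_list w]"

definition prog_accepts :: "prog \<Rightarrow> bool list \<Rightarrow> bool" where
  "prog_accepts p w \<longleftrightarrow>
     eval p [''x'' \<mapsto> enc_list w] (EApp (EFun (main_fun p)) (EVar ''x'')) vtrue"

definition accepted_problem :: "prog \<Rightarrow> bool list set" where
  "accepted_problem p = {w. prog_accepts p w}"

text \<open>Deterministic single-tape Turing machines over a two-way infinite tape.
  Tape symbol 0 is the blank; input bit False (0) is written as 1, True (1) as 2.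
  Head moves are -1, 0, 1.\<close>
record tm =
  tm_states :: "nat set"
  tm_symbols :: "nat set"
  tm_delta :: "nat \<Rightarrow> nat \<Rightarrow> nat \<times> nat \<times> int"
  tm_start :: nat
  tm_acc :: nat
  tm_rej :: nat

definition valid_tm :: "tm \<Rightarrow> bool" where
  "valid_tm M \<longleftrightarrow>
     finite (tm_states M) \<and> finite (tm_symbols M) \<and> {0, 1, 2} \<subseteq> tm_symbols M \<and>
     tm_start M \<in> tm_states M \<and> tm_acc M \<in> tm_states M \<and> tm_rej M \<in> tm_states M \<and>
     tm_acc M \<noteq> tm_rej M \<and>
     (\<forall>q\<in>tm_states M. \<forall>a\<in>tm_symbols M.
        case tm_delta M q a of (q', a', d) \<Rightarrow>
          q' \<in> tm_states M \<and> a' \<in> tm_symbols M \<and> d \<in> {-1, 0, 1})"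

type_synonym config = "nat \<times> (int \<Rightarrow> nat) \<times> int"

definition tm_step :: "tm \<Rightarrow> config \<Rightarrow> config" where
  "tm_step M c = (case c of (q, tp, h) \<Rightarrow>
     if q = tm_acc M \<or> q = tm_rej M then c
     else (case tm_delta M q (tp h) of (q', a', d) \<Rightarrow> (q', tp(h := a'), h + d)))"

definition tm_init :: "tm \<Rightarrow> bool list \<Rightarrow> config" where
  "tm_init M w = (tm_start M,
     (\<lambda>i. if 0 \<le> i \<and> i < int (length w) then (if w ! nat i then 2 else 1) else 0), 0)"

definition tm_run :: "tm \<Rightarrow> bool list \<Rightarrow> nat \<Rightarrow> config" where
  "tm_run M w t = (tm_step M ^^ t) (tm_init M w)"

definition decides_in_time :: "tm \<Rightarrow> bool list set \<Rightarrow> (nat \<Rightarrow> nat) \<Rightarrow> bool" where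
  "decides_in_time M X h \<longleftrightarrow> valid_tm M \<and>
     (\<exists>a::nat. a > 0 \<and> (\<forall>w. w \<noteq> [] \<longrightarrow>
        (\<exists>t. t \<le> a * h (length w) \<and>
             (fst (tm_run M w t) = tm_acc M \<or> fst (tm_run M w t) = tm_rej M) \<and>
             (fst (tm_run M w t) = tm_acc M \<longleftrightarrow> w \<in> X))))"

definition TIME :: "(nat \<Rightarrow> nat) \<Rightarrow> bool list set set" where
  "TIME h = {X. [] \<notin> X \<and> (\<exists>M. decides_in_time M X h)}"

fun exp2 :: "nat \<Rightarrow> nat \<Rightarrow> nat" where
  "exp2 0 n = n"
| "exp2 (Suc K) n = 2 ^ exp2 K n"

definition EXPTIME :: "nat \<Rightarrow> bool list set set" where
  "EXPTIME K = (\<Union>a b. TIME (\<lambda>n. exp2 K (a * n ^ b)))"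

definition ELEMENTARY :: "bool list set set" where
  "ELEMENTARY = (\<Union>K. EXPTIME K)"

end

theory Submission
  imports Defs "HOL-Library.Nat_Bijection" "HOL-Library.Countable" "HOL-Library.FuncSet"
begin

text \<open>A cons-free program handles only suffixes of its input, constants of the program and partial
  applications. Over an input of length \<open>n\<close>, the behaviour of a functional value of a fixed type is
  approximated by a finite set of argument/result pairs, hence by a number below an exponential tower in \<open>n\<close>
  whose height depends only on the program. Acceptance then becomes a formula with quantifiers over these
  numbers, and such formulas are decided by Turing machines in elementary time.

  Conversely, a non-deterministic function \<open>bool \<Rightarrow> \<sigma>\<close> represents the set of values of type \<open>\<sigma>\<close>
  that it may return on \<open>true\<close>, the complement being returned on \<open>false\<close>. Iterating this gives the
  numbers below a tower of any height with types of order 1 only, enough to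
  address the tape of any elementary Turing machine.\<close>

section \<open>Towers of exponentials\<close>

text \<open>The height of the tower is not governed by the order of the types:
  \<open>bool \<Rightarrow> bool \<Rightarrow> ... \<Rightarrow> list\<close> has order 1 for any
  number of arguments, so already order 1 reaches every height, while the height extracted from a
  given program comes from the sizes of its types. The obstacle in the first direction is that a
  functional value may return a different result at each use. A code therefore lists only the pairs
  that a derivation actually uses, and demands made on one value at several places are merged by
  uniting listings. The derivable calls between codes form a least fixed point; written as "every
  closed relation reaches the goal", it becomes a single bounded quantifier, because finite
  relations are numbers too. Running times are never analysed: a tower-bounded piece of tape has
  only a tower-bounded number of configurations. In the second direction a program cannot observe
  that a branch has no result. A set given by its members alone could never answer no; carrying the
  complement along gives membership and non-membership one succeeding branch each.\<close>

lemma exp2_mono: "m \<le> n \<Longrightarrow> exp2 K m \<le> exp2 K n"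
  by (induction K) auto

lemma exp2_Suc_ge: "exp2 K m \<le> exp2 (Suc K) m"
  by (simp add: less_imp_le less_exp)

lemma exp2_mono_height: "J \<le> K \<Longrightarrow> exp2 J m \<le> exp2 K m"
  by (rule lift_Suc_mono_le[of "\<lambda>K. exp2 K m"]) (rule exp2_Suc_ge)

lemma exp2_ge: "m \<le> exp2 K m"
  using exp2_mono_height[of 0 K m] by simp

lemma exp2_exp2: "exp2 J (exp2 K m) = exp2 (J + K) m"
  by (induction J) auto

lemma exp2_add_height: "m + c \<le> exp2 c m"
proof (induction c)
  case (Suc c)
  have "exp2 c m < exp2 (Suc c) m" by (simp add: less_exp)
  then show ?case using Suc by linarith
qed simp

text \<open>The height is existential, so that sums, products, powers and exponentials are absorbed
  without tracking it. The argument \<open>n + 1\<close> is the number of suffixes of an input of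
  length \<open>n\<close>, which is the size of the lowest level of numbers in the simulation. Time
  bounds constrain non-empty inputs only, hence \<open>n \<ge> 1\<close>.\<close>

definition tower_bounded :: "(nat \<Rightarrow> nat) \<Rightarrow> bool" where
  "tower_bounded f \<longleftrightarrow> (\<exists>J. \<forall>n\<ge>1. f n \<le> exp2 J (n + 1))"

lemma tower_bounded_const: "tower_bounded (\<lambda>_. c)"
  unfolding tower_bounded_def
  by (rule exI[of _ c]) (meson add_leD2 exp2_add_height order_trans)

lemma tower_bounded_id: "tower_bounded (\<lambda>n. n)"
  unfolding tower_bounded_def by (rule exI[of _ 0]) simp

lemma tower_bounded_common:
  assumes "tower_bounded f" "tower_bounded g"
  obtains J where "\<And>n. n \<ge> 1 \<Longrightarrow> f n \<le> exp2 J (n + 1) \<and> g n \<le> exp2 J (n + 1)"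
proof -
  obtain J1 J2 where "\<forall>n\<ge>1. f n \<le> exp2 J1 (n + 1)" "\<forall>n\<ge>1. g n \<le> exp2 J2 (n + 1)"
    using assms unfolding tower_bounded_def by blast
  moreover have "exp2 J1 m \<le> exp2 (max J1 J2) m" "exp2 J2 m \<le> exp2 (max J1 J2) m" for m
    by (auto intro: exp2_mono_height)
  ultimately show ?thesis by (intro that[of "max J1 J2"]) (meson order_trans)
qed

lemma double_le_exp: "2 * (x::nat) \<le> 2 ^ x"
proof (cases x)
  case (Suc y)
  have "Suc y \<le> 2 ^ y" using less_exp[of y] by (rule Suc_leI)
  then show ?thesis using Suc by simp
qed simp

lemma tower_bounded_add:
  assumes "tower_bounded f" "tower_bounded g" shows "tower_bounded (\<lambda>n. f n + g n)"
proof -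
  obtain J where J: "\<And>n. n \<ge> 1 \<Longrightarrow> f n \<le> exp2 J (n + 1) \<and> g n \<le> exp2 J (n + 1)"
    using tower_bounded_common[OF assms] by blast
  have "f n + g n \<le> exp2 (Suc J) (n + 1)" if "n \<ge> 1" for n
    using J[OF that] double_le_exp[of "exp2 J (n + 1)"] by simp
  then show ?thesis unfolding tower_bounded_def by blast
qed

lemma tower_bounded_mult:
  assumes "tower_bounded f" "tower_bounded g" shows "tower_bounded (\<lambda>n. f n * g n)"
proof -
  obtain J where J: "\<And>n. n \<ge> 1 \<Longrightarrow> f n \<le> exp2 J (n + 1) \<and> g n \<le> exp2 J (n + 1)"
    using tower_bounded_common[OF assms] by blast
  have "f n * g n \<le> exp2 (Suc (Suc J)) (n + 1)" if "n \<ge> 1" for n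
  proof -
    let ?x = "exp2 J (n + 1)"
    have "f n * g n \<le> ?x * ?x" using J[OF that] by (simp add: mult_mono)
    also have "\<dots> \<le> 2 ^ ?x * 2 ^ ?x" by (intro mult_mono) (auto intro: less_imp_le)
    also have "\<dots> = 2 ^ (2 * ?x)" by (simp add: mult_2 power_add)
    also have "\<dots> \<le> 2 ^ (2 ^ ?x)" using double_le_exp by (intro power_increasing) auto
    finally show ?thesis by simp
  qed
  then show ?thesis unfolding tower_bounded_def by blast
qed

lemma tower_bounded_power: "tower_bounded f \<Longrightarrow> tower_bounded (\<lambda>n. f n ^ b)"
  by (induction b) (auto intro: tower_bounded_const tower_bounded_mult)

lemma tower_bounded_exp2: "tower_bounded f \<Longrightarrow> tower_bounded (\<lambda>n. exp2 K (f n))"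
  unfolding tower_bounded_def by (metis exp2_exp2 exp2_mono)

lemma tower_bounded_mono:
  "tower_bounded g \<Longrightarrow> (\<And>n. n \<ge> 1 \<Longrightarrow> f n \<le> g n) \<Longrightarrow> tower_bounded f"
  unfolding tower_bounded_def by (meson order_trans)

lemma tower_bounded_exp:
  assumes "tower_bounded f" shows "tower_bounded (\<lambda>n. c ^ f n)"
proof (rule tower_bounded_mono)
  show "tower_bounded (\<lambda>n. exp2 1 (c * f n))"
    by (intro tower_bounded_exp2 tower_bounded_mult tower_bounded_const assms)
  have "c ^ m \<le> (2 ^ c) ^ m" for m by (intro power_mono) (auto intro: less_imp_le)
  then show "c ^ f n \<le> exp2 1 (c * f n)" for n by (simp add: power_mult)
qed

lemma ELEMENTARY_I:
  assumes "[] \<notin> X" "valid_tm M" "tower_bounded f"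
    and run: "\<And>w. w \<noteq> [] \<Longrightarrow> \<exists>t \<le> f (length w).
      (fst (tm_run M w t) = tm_acc M \<or> fst (tm_run M w t) = tm_rej M) \<and>
      (fst (tm_run M w t) = tm_acc M \<longleftrightarrow> w \<in> X)"
  shows "X \<in> ELEMENTARY"
proof -
  obtain J where J: "\<And>n. n \<ge> 1 \<Longrightarrow> f n \<le> exp2 J (n + 1)"
    using assms(3) unfolding tower_bounded_def by blast
  \<comment> \<open>The shape \<open>a * n ^ b\<close> required by \<open>EXPTIME\<close> is met
    with a = 2 and b = 1, as n + 1 \<le> 2 * n for n \<ge> 1.\<close>
  have le: "f (length w) \<le> 1 * exp2 J (2 * length w ^ 1)" if "w \<noteq> []" for w :: "bool list"
  proof -
    have "length w \<ge> 1" using that by (simp add: Suc_leI)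
    then show ?thesis using J[of "length w"] exp2_mono[of "length w + 1" "2 * length w" J] by simp
  qed
  have "decides_in_time M X (\<lambda>n. exp2 J (2 * n ^ 1))"
    unfolding decides_in_time_def
  proof (rule conjI[OF _ exI[of _ 1]], fact, intro conjI allI impI)
    fix w :: "bool list" assume w: "w \<noteq> []"
    obtain t where t: "t \<le> f (length w)"
      "fst (tm_run M w t) = tm_acc M \<or> fst (tm_run M w t) = tm_rej M"
      "fst (tm_run M w t) = tm_acc M \<longleftrightarrow> w \<in> X" using run[OF w] by blast
    then show "\<exists>t\<le>1 * exp2 J (2 * length w ^ 1).
       (fst (tm_run M w t) = tm_acc M \<or> fst (tm_run M w t) = tm_rej M) \<and>
       (fst (tm_run M w t) = tm_acc M) = (w \<in> X)"
      using le[OF w] le_trans by blast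
  qed (use assms in auto)
  then have "X \<in> TIME (\<lambda>n. exp2 J (2 * n ^ 1))" using assms unfolding TIME_def by blast
  then show ?thesis unfolding ELEMENTARY_def EXPTIME_def by blast
qed

section \<open>Structured tape programs\<close>

text \<open>A program works on the cells \<open>0..B\<close> of a tape holding the input, which is never
  overwritten; every mark \<open>x\<close> is a set \<open>M x\<close> of cells. Each command returns a truth value, and
  \<open>Rep c\<close> repeats \<open>c\<close> until it returns \<open>True\<close>.\<close>

datatype cmd = Put nat | Del nat | Lft | Rgt | Has nat | Sym nat | Ret bool
  | Ite cmd cmd cmd | Rep cmd

definition inp :: "bool list \<Rightarrow> nat \<Rightarrow> nat" where
  "inp w i = (if i < length w then (if w ! i then 2 else 1) else 0)"

text \<open>A derivation is a terminating run. The premise \<open>h \<le> B\<close> of every rule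
  says that each command starts on the cells \<open>0..B\<close>, which is what later bounds the
  configurations passed through. \<open>Lft\<close> cannot leave cell 0, whereas a final
  \<open>Rgt\<close> may end on cell \<open>B + 1\<close>.\<close>

inductive exec :: "bool list \<Rightarrow> nat \<Rightarrow> cmd \<Rightarrow> (nat \<Rightarrow> nat set) \<Rightarrow> nat \<Rightarrow>
    (nat \<Rightarrow> nat set) \<Rightarrow> nat \<Rightarrow> bool \<Rightarrow> bool" for w B where
  Put: "h \<le> B \<Longrightarrow> exec w B (Put x) M h (M(x := insert h (M x))) h True"
| Del: "h \<le> B \<Longrightarrow> exec w B (Del x) M h (M(x := M x - {h})) h True"
| Lft: "Suc h \<le> B \<Longrightarrow> exec w B Lft M (Suc h) M h True"
| Rgt: "h \<le> B \<Longrightarrow> exec w B Rgt M h M (Suc h) True"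
| Has: "h \<le> B \<Longrightarrow> b = (h \<in> M x) \<Longrightarrow> exec w B (Has x) M h M h b"
| Sym: "h \<le> B \<Longrightarrow> b = (inp w h = a) \<Longrightarrow> exec w B (Sym a) M h M h b"
| Ret: "h \<le> B \<Longrightarrow> exec w B (Ret b) M h M h b"
| IteT: "h \<le> B \<Longrightarrow> exec w B c M h M' h' True \<Longrightarrow> exec w B d M' h' M'' h'' b \<Longrightarrow>
    exec w B (Ite c d e) M h M'' h'' b"
| IteF: "h \<le> B \<Longrightarrow> exec w B c M h M' h' False \<Longrightarrow> exec w B e M' h' M'' h'' b \<Longrightarrow>
    exec w B (Ite c d e) M h M'' h'' b"
| RepT: "h \<le> B \<Longrightarrow> exec w B c M h M' h' True \<Longrightarrow> exec w B (Rep c) M h M' h' True"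
| RepF: "h \<le> B \<Longrightarrow> exec w B c M h M' h' False \<Longrightarrow> exec w B (Rep c) M' h' M'' h'' b \<Longrightarrow>
    exec w B (Rep c) M h M'' h'' b"

fun marks :: "cmd \<Rightarrow> nat set" where
  "marks (Put x) = {x}"
| "marks (Del x) = {x}"
| "marks (Ite a b c) = marks a \<union> marks b \<union> marks c"
| "marks (Rep a) = marks a"
| "marks _ = {}"

lemma finite_marks: "finite (marks c)"
  by (induction c) auto

definition marks_in :: "nat \<Rightarrow> nat set \<Rightarrow> (nat \<Rightarrow> nat set) \<Rightarrow> bool" where
  "marks_in B A M \<longleftrightarrow> (\<forall>x. M x \<subseteq> {..B}) \<and> (\<forall>x. x \<notin> A \<longrightarrow> M x = {})"

lemma exec_marks:
  "exec w B c M h M' h' b \<Longrightarrow> marks_in B A M \<Longrightarrow> marks c \<subseteq> A \<Longrightarrow> marks_in B A M'"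
  by (induction rule: exec.induct) (auto simp: marks_in_def)

text \<open>Compilation to a Turing machine: the control state of the machine is the continuation
  that remains to be executed, with one branch for either truth value.\<close>

datatype kont = Halt bool | Run cmd kont kont

instance cmd :: countable by countable_datatype
instance kont :: countable by countable_datatype

text \<open>The continuations that can occur while a command runs. The set stays finite because a
  loop is its own continuation for the answer \<open>False\<close>, instead of being
  unfolded.\<close>

fun states :: "cmd \<Rightarrow> kont \<Rightarrow> kont \<Rightarrow> kont set" where
  "states (Ite a b c) t f = {Run (Ite a b c) t f} \<union> states a (Run b t f) (Run c t f)
     \<union> states b t f \<union> states c t f"
| "states (Rep a) t f = {Run (Rep a) t f} \<union> states a t (Run (Rep a) t f)"
| "states c t f = {Run c t f}"

lemma finite_states: "finite (states c t f)"
  by (induction c arbitrary: t f) auto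

lemma Run_in_states: "Run c t f \<in> states c t f"
  by (cases c) auto

text \<open>The residue modulo 3 is the original symbol and the quotient encodes the set of marks.
  An unmarked cell is thus numbered like its original symbol, so that the initial tape of the
  machine is already a tape without marks.\<close>

definition cell :: "nat \<Rightarrow> nat set \<Rightarrow> nat" where
  "cell a S = a + 3 * set_encode S"

lemma cell_mod: "a < 3 \<Longrightarrow> cell a S mod 3 = a"
  by (simp add: cell_def)

lemma cell_div: "a < 3 \<Longrightarrow> finite S \<Longrightarrow> set_decode (cell a S div 3) = S"
  by (simp add: cell_def)

fun tstep :: "kont \<Rightarrow> nat \<Rightarrow> kont \<times> nat \<times> int" where
  "tstep (Halt b) s = (Halt b, s, 0)"
| "tstep (Run (Put x) t f) s = (t, cell (s mod 3) (insert x (set_decode (s div 3))), 0)"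
| "tstep (Run (Del x) t f) s = (t, cell (s mod 3) (set_decode (s div 3) - {x}), 0)"
| "tstep (Run Lft t f) s = (t, s, -1)"
| "tstep (Run Rgt t f) s = (t, s, 1)"
| "tstep (Run (Has x) t f) s = (if x \<in> set_decode (s div 3) then t else f, s, 0)"
| "tstep (Run (Sym a) t f) s = (if s mod 3 = a then t else f, s, 0)"
| "tstep (Run (Ret b) t f) s = (if b then t else f, s, 0)"
| "tstep (Run (Ite a b c) t f) s = (Run a (Run b t f) (Run c t f), s, 0)"
| "tstep (Run (Rep a) t f) s = (Run a t (Run (Rep a) t f), s, 0)"

definition konts :: "cmd \<Rightarrow> kont set" where
  "konts c = states c (Halt True) (Halt False) \<union> range Halt"

definition symbols :: "cmd \<Rightarrow> nat set" where
  "symbols c = {cell a S | a S. a < 3 \<and> S \<subseteq> marks c}"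

definition machine :: "cmd \<Rightarrow> tm" where
  "machine c = \<lparr>tm_states = to_nat ` konts c, tm_symbols = symbols c,
     tm_delta = (\<lambda>q s. case tstep (from_nat q) s of (k, s', d) \<Rightarrow> (to_nat k, s', d)),
     tm_start = to_nat (Run c (Halt True) (Halt False)),
     tm_acc = to_nat (Halt True), tm_rej = to_nat (Halt False)\<rparr>"

lemma tstep_states:
  assumes "k \<in> states c t f" "tstep k s = (k', s', d)"
  shows "k' \<in> states c t f \<union> {t, f}"
  using assms
proof (induction c arbitrary: t f)
  case (Ite a b c)
  have I: "Run a (Run b t f) (Run c t f) \<in> states a (Run b t f) (Run c t f)"
    "Run b t f \<in> states b t f" "Run c t f \<in> states c t f" by (rule Run_in_states)+
  consider "k = Run (Ite a b c) t f" | "k \<in> states a (Run b t f) (Run c t f)"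
    | "k \<in> states b t f" | "k \<in> states c t f" using Ite.prems by auto
  then show ?case
  proof cases
    case 1 then show ?thesis using Ite.prems(2) I by auto
  next
    case 2 from Ite.IH(1)[OF this Ite.prems(2)] show ?thesis using I by auto
  next
    case 3 from Ite.IH(2)[OF this Ite.prems(2)] show ?thesis by auto
  next
    case 4 from Ite.IH(3)[OF this Ite.prems(2)] show ?thesis by auto
  qed
next
  case (Rep a)
  have I: "Run a t (Run (Rep a) t f) \<in> states a t (Run (Rep a) t f)" by (rule Run_in_states)
  consider "k = Run (Rep a) t f" | "k \<in> states a t (Run (Rep a) t f)" using Rep.prems by auto
  then show ?case
  proof cases
    case 1 then show ?thesis using Rep.prems(2) I by auto
  next
    case 2 from Rep.IH[OF this Rep.prems(2)] show ?thesis by auto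
  qed
qed (auto split: if_splits)

lemma states_marks:
  "Run d t' f' \<in> states c t f \<Longrightarrow> marks d \<subseteq> marks c"
  by (induction c arbitrary: t f) fastforce+

lemma finite_symbols: "finite (symbols c)"
proof -
  have "symbols c \<subseteq> (\<lambda>(a, S). cell a S) ` ({..<3} \<times> Pow (marks c))"
    unfolding symbols_def by auto
  then show ?thesis using finite_marks finite_subset by fastforce
qed

lemma finite_konts: "finite (konts c)"
proof -
  have "range Halt = {Halt True, Halt False}" by (simp add: UNIV_bool insert_commute)
  then show ?thesis unfolding konts_def using finite_states by simp
qed

lemma tstep_symbols:
  assumes "k \<in> konts c" "s \<in> symbols c" "tstep k s = (k', s', d)"
  shows "k' \<in> konts c \<and> s' \<in> symbols c \<and> d \<in> {-1, 0, 1}"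
proof -
  obtain a S where s: "s = cell a S" "a < 3" "S \<subseteq> marks c" using assms by (auto simp: symbols_def)
  then have S: "set_decode (s div 3) \<subseteq> marks c" "s mod 3 < 3"
    using finite_subset[OF _ finite_marks] by (auto simp: cell_mod cell_div)
  have k': "k' \<in> konts c"
  proof (cases k)
    case (Run x21 x22 x23)
    then show ?thesis using tstep_states[OF _ assms(3)] assms(1) unfolding konts_def by blast
  qed (use assms in auto)
  show ?thesis
  proof (cases k)
    case (Run e t f)
    then have m: "marks e \<subseteq> marks c" using assms(1) states_marks unfolding konts_def by blast
    have I: "a < 3 \<Longrightarrow> S' \<subseteq> marks c \<Longrightarrow> cell a S' \<in> symbols c" for a S'
      unfolding symbols_def by blast
    show ?thesis using k' assms(2,3) Run m S by (cases e) (auto intro!: I)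
  qed (use assms k' in auto)
qed

lemma machine_sel[simp]: "tm_states (machine c) = to_nat ` konts c"
  "tm_symbols (machine c) = symbols c"
  "tm_delta (machine c) (to_nat k) s = (case tstep k s of (k, s', d) \<Rightarrow> (to_nat k, s', d))"
  "tm_start (machine c) = to_nat (Run c (Halt True) (Halt False))"
  "tm_acc (machine c) = to_nat (Halt True)" "tm_rej (machine c) = to_nat (Halt False)"
  by (simp_all add: machine_def)

lemma valid_machine: "valid_tm (machine c)"
proof -
  have "Halt b \<in> konts c" for b by (simp add: konts_def)
  moreover have "cell a {} \<in> symbols c" if "a < 3" for a using that unfolding symbols_def by blast
  from this[of 0] this[of 1] this[of 2] have "{0, 1, 2} \<subseteq> symbols c" by (simp add: cell_def)
  moreover have "Run c (Halt True) (Halt False) \<in> konts c"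
    by (simp add: konts_def Run_in_states)
  moreover have "case tm_delta (machine c) q a of (q', a', d) \<Rightarrow>
      q' \<in> to_nat ` konts c \<and> a' \<in> symbols c \<and> d \<in> {- 1, 0, 1}"
    if q: "q \<in> to_nat ` konts c" and a: "a \<in> symbols c" for q a
  proof -
    obtain k where "q = to_nat k" "k \<in> konts c" using q by auto
    then show ?thesis using tstep_symbols[OF _ a] by (cases "tstep k a") fastforce
  qed
  ultimately show ?thesis unfolding valid_tm_def
    by (simp add: finite_konts finite_symbols)
qed

section \<open>Correctness of the compilation and the number of configurations\<close>

definition tape :: "bool list \<Rightarrow> (nat \<Rightarrow> nat set) \<Rightarrow> int \<Rightarrow> nat" where
  "tape w M i = (if i < 0 then 0 else cell (inp w (nat i)) {x. nat i \<in> M x})"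

definition conf :: "bool list \<Rightarrow> kont \<Rightarrow> (nat \<Rightarrow> nat set) \<Rightarrow> nat \<Rightarrow> config" where
  "conf w k M h = (to_nat k, tape w M, int h)"

definition confs :: "bool list \<Rightarrow> nat \<Rightarrow> cmd \<Rightarrow> config set" where
  "confs w B c = {conf w k M h | k M h. k \<in> konts c \<and> h \<le> B \<and> marks_in B (marks c) M}"

text \<open>The end point \<open>y\<close> is exempt from \<open>A\<close>: the last command of a
  run may leave the head outside the counted cells.\<close>

definition steps_in :: "('a \<Rightarrow> 'a) \<Rightarrow> 'a set \<Rightarrow> 'a \<Rightarrow> 'a \<Rightarrow> bool" where
  "steps_in f A x y \<longleftrightarrow> (\<exists>t. (f ^^ t) x = y \<and> (\<forall>i<t. (f ^^ i) x \<in> A))"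

lemma steps_in_1: "x \<in> A \<Longrightarrow> f x = y \<Longrightarrow> steps_in f A x y"
  unfolding steps_in_def by (rule exI[of _ 1]) auto

lemma steps_in_trans:
  assumes "steps_in f A x y" "steps_in f A y z" shows "steps_in f A x z"
proof -
  obtain t s where t: "(f ^^ t) x = y" "\<forall>i<t. (f ^^ i) x \<in> A"
    and s: "(f ^^ s) y = z" "\<forall>i<s. (f ^^ i) y \<in> A"
    using assms unfolding steps_in_def by blast
  have eq: "(f ^^ (i + t)) x = (f ^^ i) y" for i using t(1) by (simp add: funpow_add)
  have "(f ^^ i) x \<in> A" if "i < s + t" for i
  proof (cases "i < t")
    case False
    then show ?thesis using eq[of "i - t"] s(2) that by (simp add: less_diff_conv2)
  qed (use t in auto)
  then show ?thesis unfolding steps_in_def using eq[of s] s(1) by blast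
qed

text \<open>A shortest run has no repeated configuration.\<close>
lemma steps_in_card:
  assumes "steps_in f A x y" "finite A"
  shows "\<exists>t \<le> card A. (f ^^ t) x = y"
proof -
  obtain t0 where t0: "(f ^^ t0) x = y" "\<forall>i<t0. (f ^^ i) x \<in> A"
    using assms unfolding steps_in_def by blast
  define t where "t = (LEAST t. (f ^^ t) x = y)"
  have t: "(f ^^ t) x = y" unfolding t_def using t0(1) by (rule LeastI)
  have le: "t \<le> s" if "(f ^^ s) x = y" for s unfolding t_def using that by (rule Least_le)
  have ne: "(f ^^ i) x \<noteq> (f ^^ j) x" if "i < j" "j < t" for i j
  proof
    assume eq: "(f ^^ i) x = (f ^^ j) x"
    have "(f ^^ ((t - j) + i)) x = (f ^^ (t - j)) ((f ^^ j) x)" by (simp add: funpow_add eq)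
    also have "\<dots> = (f ^^ t) x" using that by (simp flip: funpow_add comp_apply[of "f ^^ (t - j)"])
    finally show False using le[of "t - j + i"] t that by simp
  qed
  have "inj_on (\<lambda>i. (f ^^ i) x) {..<t}"
    by (rule inj_onI) (metis lessThan_iff linorder_neqE_nat ne)
  moreover have "(\<lambda>i. (f ^^ i) x) ` {..<t} \<subseteq> A" using t0 le by fastforce
  ultimately have "card {..<t} \<le> card A" using assms(2) by (rule card_inj_on_le)
  then show ?thesis using t by auto
qed

lemma machine_step:
  assumes "k \<in> konts c" "h \<le> B" "marks_in B (marks c) M" "k = Run d t f"
    "tstep k (cell (inp w h) {x. h \<in> M x}) = (k', cell (inp w h) {x. h \<in> M' x}, int h' - int h)"
    "\<And>x. M' x - {h} = M x - {h}"
  shows "steps_in (tm_step (machine c)) (confs w B c) (conf w k M h) (conf w k' M' h')"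
proof (rule steps_in_1)
  show "conf w k M h \<in> confs w B c" using assms unfolding confs_def by blast
  have "(tape w M)(int h := cell (inp w h) {x. h \<in> M' x}) = tape w M'"
  proof
    fix i :: int
    have "(nat i \<in> M x) = (nat i \<in> M' x)" if "i \<noteq> int h" "i \<ge> 0" for x
      using assms(6)[of x] that by (metis Diff_iff insertE nat_0_le empty_iff)
    then show "((tape w M)(int h := cell (inp w h) {x. h \<in> M' x})) i = tape w M' i"
      by (auto simp: tape_def)
  qed
  then show "tm_step (machine c) (conf w k M h) = conf w k' M' h'"
    using assms by (simp add: tm_step_def conf_def) (simp add: tape_def)
qed

text \<open>By induction on the derivation with arbitrary continuations \<open>t\<close> and
  \<open>f\<close>, since \<open>Ite\<close> and \<open>Rep\<close> run their components under
  continuations of their own. The truth value returned by the command becomes the choice between the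
  two.\<close>

lemma exec_machine:
  assumes "exec w B c M h M' h' b" "marks_in B (marks d) M"
    "marks c \<subseteq> marks d" "states c t f \<subseteq> konts d"
  shows "steps_in (tm_step (machine d)) (confs w B d)
    (conf w (Run c t f) M h) (conf w (if b then t else f) M' h')"
proof -
  have k: "Run e t f \<in> konts d" if "states e t f \<subseteq> konts d" for e t f
    using that Run_in_states by blast
  have a: "inp w h < 3" for h by (simp add: inp_def)
  have fin: "finite {x. h \<in> M x}" if "marks_in B (marks d) M" for h M
    by (rule finite_subset[OF _ finite_marks[of d]]) (use that in \<open>auto simp: marks_in_def\<close>)
  note step = machine_step[OF k] and dec = cell_mod[OF a] cell_div[OF a fin]
  have inv: "marks_in B (marks d) M'" if "exec w B c M h M' h' b" "marks_in B (marks d) M"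
    "marks c \<subseteq> marks d" for c M h M' h' b using exec_marks that by blast
  show ?thesis using assms
  proof (induction arbitrary: t f rule: exec.induct)
    case (Put h x M)
    have "{y. h \<in> (M(x := insert h (M x))) y} = insert x {y. h \<in> M y}" by auto
    with Put show ?case by (intro step) (auto simp: dec)
  next
    case (Del h x M)
    have "{y. h \<in> (M(x := M x - {h})) y} = {y. h \<in> M y} - {x}" by auto
    with Del show ?case by (intro step) (auto simp: dec)
  next
    case (Lft h M) then show ?case by (intro step) auto
  next
    case (Rgt h M) then show ?case by (intro step) auto
  next
    case (Has h b M x) then show ?case by (intro step) (auto simp: dec)
  next
    case (Sym h b a M) then show ?case by (intro step) (auto simp: dec)
  next
    case (Ret h b M) then show ?case by (intro step) auto
  next
    case (IteT h c M M' h' d1 M'' h'' b e)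
    have "steps_in (tm_step (machine d)) (confs w B d) (conf w (Run (Ite c d1 e) t f) M h)
        (conf w (Run c (Run d1 t f) (Run e t f)) M h)"
      using IteT by (intro step) auto
    moreover have "steps_in (tm_step (machine d)) (confs w B d)
        (conf w (Run c (Run d1 t f) (Run e t f)) M h) (conf w (Run d1 t f) M' h')"
      using IteT.IH(1)[of "Run d1 t f" "Run e t f"] IteT.prems by auto
    moreover have "marks_in B (marks d) M'" using inv[OF IteT.hyps(2)] IteT.prems by auto
    then have "steps_in (tm_step (machine d)) (confs w B d)
        (conf w (Run d1 t f) M' h') (conf w (if b then t else f) M'' h'')"
      using IteT.IH(2)[of t f] IteT.prems by auto
    ultimately show ?case by (meson steps_in_trans)
  next
    case (IteF h c M M' h' e M'' h'' b d1)
    have "steps_in (tm_step (machine d)) (confs w B d) (conf w (Run (Ite c d1 e) t f) M h)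
        (conf w (Run c (Run d1 t f) (Run e t f)) M h)"
      using IteF by (intro step) auto
    moreover have "steps_in (tm_step (machine d)) (confs w B d)
        (conf w (Run c (Run d1 t f) (Run e t f)) M h) (conf w (Run e t f) M' h')"
      using IteF.IH(1)[of "Run d1 t f" "Run e t f"] IteF.prems by auto
    moreover have "marks_in B (marks d) M'" using inv[OF IteF.hyps(2)] IteF.prems by auto
    then have "steps_in (tm_step (machine d)) (confs w B d)
        (conf w (Run e t f) M' h') (conf w (if b then t else f) M'' h'')"
      using IteF.IH(2)[of t f] IteF.prems by auto
    ultimately show ?case by (meson steps_in_trans)
  next
    case (RepT h c M M' h')
    have "steps_in (tm_step (machine d)) (confs w B d) (conf w (Run (Rep c) t f) M h)
        (conf w (Run c t (Run (Rep c) t f)) M h)"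
      using RepT by (intro step) auto
    moreover have "steps_in (tm_step (machine d)) (confs w B d)
        (conf w (Run c t (Run (Rep c) t f)) M h) (conf w t M' h')"
      using RepT.IH[of t "Run (Rep c) t f"] RepT.prems by auto
    ultimately show ?case by (simp, meson steps_in_trans)
  next
    case (RepF h c M M' h' M'' h'' b)
    have "steps_in (tm_step (machine d)) (confs w B d) (conf w (Run (Rep c) t f) M h)
        (conf w (Run c t (Run (Rep c) t f)) M h)"
      using RepF by (intro step) auto
    moreover have "steps_in (tm_step (machine d)) (confs w B d)
        (conf w (Run c t (Run (Rep c) t f)) M h) (conf w (Run (Rep c) t f) M' h')"
      using RepF.IH(1)[of t "Run (Rep c) t f"] RepF.prems by auto
    moreover have "marks_in B (marks d) M'" using inv[OF RepF.hyps(2)] RepF.prems by auto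
    then have "steps_in (tm_step (machine d)) (confs w B d)
        (conf w (Run (Rep c) t f) M' h') (conf w (if b then t else f) M'' h'')"
      using RepF.IH(2)[of t f] RepF.prems by auto
    ultimately show ?case by (meson steps_in_trans)
  qed
qed

lemma finite_confs: "finite (confs w B c)"
  and card_confs: "card (confs w B c) \<le>
    card (konts c) * (card (symbols c) ^ (B + 1 + length w) * (B + 1))"
proof -
  \<comment> \<open>Marks live on \<open>0..B\<close> and the input on the first
    \<open>length w\<close> cells; every other cell holds the number 0. A configuration is therefore
    determined by the symbols of these \<open>?m\<close> cells, the control state and the head
    position.\<close>
  let ?m = "B + 1 + length w"
  let ?dec = "\<lambda>g i. if i < 0 \<or> i \<ge> int ?m then 0 else g (nat i)"
  let ?D = "konts c \<times> (({..<?m} \<rightarrow>\<^sub>E symbols c) \<times> {..B})"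
  let ?F = "\<lambda>(k, g, h). (to_nat k, ?dec g, int h)"
  have sub: "confs w B c \<subseteq> ?F ` ?D"
  proof
    fix x assume "x \<in> confs w B c"
    then obtain k M h where x: "x = (to_nat k, tape w M, int h)" "k \<in> konts c" "h \<le> B"
      and M: "marks_in B (marks c) M" unfolding confs_def conf_def by blast
    let ?g = "\<lambda>i\<in>{..<?m}. tape w M (int i)"
    have "cell (inp w i) {x. i \<in> M x} \<in> symbols c" for i
      unfolding symbols_def using M by (auto simp: inp_def marks_in_def intro!: exI)
    then have g: "?g \<in> {..<?m} \<rightarrow>\<^sub>E symbols c" by (auto simp: tape_def)
    have "tape w M = ?dec ?g"
    proof
      fix i :: int
      show "tape w M i = ?dec ?g i"
      proof (cases "i < 0 \<or> i < int ?m")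
        case False
        then have "nat i \<notin> M x" for x using M unfolding marks_in_def by fastforce
        then show ?thesis using False by (auto simp: tape_def inp_def cell_def)
      qed (auto simp: tape_def)
    qed
    then have "x = ?F (k, ?g, h)" unfolding x(1) by (simp only: prod.case)
    then show "x \<in> ?F ` ?D" using x g by blast
  qed
  have fin: "finite ?D" by (intro finite_cartesian_product finite_PiE finite_konts finite_symbols) auto
  show "finite (confs w B c)" using sub fin finite_surj by blast
  have "card (confs w B c) \<le> card ?D" using sub fin by (rule surj_card_le[rotated])
  then show "card (confs w B c) \<le> card (konts c) * (card (symbols c) ^ ?m * (B + 1))"
    by (simp add: card_cartesian_product card_PiE)
qed

text \<open>Turns space into time: a terminating run on tower-bounded space passes through
  tower-bounded many configurations, and by \<open>steps_in_card\<close> its end is reached within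
  that number of steps.\<close>

theorem ELEMENTARY_cmdI:
  assumes "[] \<notin> X" "tower_bounded B"
    and run: "\<And>w. w \<noteq> [] \<Longrightarrow> \<exists>M h. exec w (B (length w)) c (\<lambda>_. {}) 0 M h (w \<in> X)"
  shows "X \<in> ELEMENTARY"
proof (rule ELEMENTARY_I)
  let ?f = "\<lambda>n. card (konts c) * (card (symbols c) ^ (B n + 1 + n) * (B n + 1))"
  show "tower_bounded ?f"
    by (intro tower_bounded_mult tower_bounded_exp tower_bounded_add tower_bounded_const
      tower_bounded_id assms)
  fix w :: "bool list" assume w: "w \<noteq> []"
  let ?n = "length w"
  obtain M h where ex: "exec w (B ?n) c (\<lambda>_. {}) 0 M h (w \<in> X)" using run[OF w] by blast
  have init: "tm_init (machine c) w = conf w (Run c (Halt True) (Halt False)) (\<lambda>_. {}) 0"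
    by (auto simp: tm_init_def conf_def tape_def cell_def inp_def fun_eq_iff)
  have "steps_in (tm_step (machine c)) (confs w (B ?n) c) (tm_init (machine c) w)
      (conf w (if w \<in> X then Halt True else Halt False) M h)"
    unfolding init
    by (rule exec_machine[OF ex]) (auto simp: marks_in_def konts_def)
  from steps_in_card[OF this finite_confs] obtain t where
    t: "t \<le> card (confs w (B ?n) c)"
       "tm_run (machine c) w t = conf w (if w \<in> X then Halt True else Halt False) M h"
    unfolding tm_run_def by blast
  moreover have "card (confs w (B ?n) c) \<le> ?f ?n" by (rule card_confs)
  ultimately show "\<exists>t \<le> ?f ?n.
      (fst (tm_run (machine c) w t) = tm_acc (machine c) \<or>
       fst (tm_run (machine c) w t) = tm_rej (machine c)) \<and>
      (fst (tm_run (machine c) w t) = tm_acc (machine c) \<longleftrightarrow> w \<in> X)"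
    by (intro exI[of _ t]) (auto simp: conf_def)
qed (use assms valid_machine in auto)

section \<open>Bounded first-order formulas\<close>

text \<open>Variables are de Bruijn levels: \<open>FEx y \<phi>\<close> at level \<open>k\<close> binds variable \<open>k\<close>, which ranges
  over the numbers below the value of \<open>y\<close>. Atoms with variables out of scope are false.
  \<open>FMem x y\<close> is Ackermann's membership: bit \<open>x\<close> of \<open>y\<close> is set.\<close>

datatype fm = FEq nat nat | FSuc nat nat | FSym nat nat | FMem nat nat
  | FNeg fm | FAnd fm fm | FEx nat fm

fun sat :: "bool list \<Rightarrow> nat \<Rightarrow> (nat \<Rightarrow> nat) \<Rightarrow> fm \<Rightarrow> bool" where
  "sat w k e (FEq x y) \<longleftrightarrow> x < k \<and> y < k \<and> e x = e y"
| "sat w k e (FSuc x y) \<longleftrightarrow> x < k \<and> y < k \<and> e y = Suc (e x)"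
| "sat w k e (FSym a x) \<longleftrightarrow> x < k \<and> inp w (e x) = a"
| "sat w k e (FMem x y) \<longleftrightarrow> x < k \<and> y < k \<and> e x \<in> set_decode (e y)"
| "sat w k e (FNeg \<phi>) \<longleftrightarrow> \<not> sat w k e \<phi>"
| "sat w k e (FAnd \<phi> \<psi>) \<longleftrightarrow> sat w k e \<phi> \<and> sat w k e \<psi>"
| "sat w k e (FEx y \<phi>) \<longleftrightarrow> y < k \<and> (\<exists>v < e y. sat w (Suc k) (e(k := v)) \<phi>)"

lemma sat_cong: "(\<And>i. i < k \<Longrightarrow> e i = e' i) \<Longrightarrow> sat w k e \<phi> = sat w k e' \<phi>"
proof (induction \<phi> arbitrary: k e e')
  case (FEx y \<phi>)
  have "sat w (Suc k) (e(k := v)) \<phi> = sat w (Suc k) (e'(k := v)) \<phi>" for v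
    by (rule FEx.IH) (auto simp: FEx.prems less_Suc_eq)
  then show ?case using FEx.prems by auto
next
  case (FAnd \<phi> \<psi>)
  from FAnd.IH[OF FAnd.prems] show ?case by simp
next
  case (FNeg \<phi>)
  from FNeg.IH[OF FNeg.prems] show ?case by simp
qed auto

text \<open>The number of variables that can be in scope beyond the current level, hence the number
  of additional pebbles to provide.\<close>

fun qdepth :: "fm \<Rightarrow> nat" where
  "qdepth (FNeg \<phi>) = qdepth \<phi>"
| "qdepth (FAnd \<phi> \<psi>) = max (qdepth \<phi>) (qdepth \<psi>)"
| "qdepth (FEx y \<phi>) = Suc (qdepth \<phi>)"
| "qdepth _ = 0"

text \<open>Mark 0 is a scratch track holding the binary digits of a number, mark 1 is a counter, and
  mark \<open>i + 2\<close> sits on the cell numbered by the value of variable \<open>i\<close>. Variable 0 has value 0 and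
  thus marks the left end of the tape.\<close>

definition pebbles :: "nat \<Rightarrow> nat set \<Rightarrow> nat \<Rightarrow> (nat \<Rightarrow> nat) \<Rightarrow> nat \<Rightarrow> nat set" where
  "pebbles m S c e x = (if x = 0 then S else if x = 1 then {c} else if x - 2 < m then {e (x - 2)} else {})"

abbreviation Seq :: "cmd \<Rightarrow> cmd \<Rightarrow> cmd" (infixr ";;" 60) where
  "a ;; b \<equiv> Ite a b b"

definition home :: cmd where
  "home = Rep (Ite (Has 2) (Ret True) (Lft ;; Ret False))"

definition goto :: "nat \<Rightarrow> cmd" where
  "goto x = home ;; Rep (Ite (Has x) (Ret True) (Rgt ;; Ret False))"

definition incr :: "nat \<Rightarrow> cmd" where
  "incr x = goto x ;; Del x ;; Rgt ;; Put x"

definition reset :: "nat \<Rightarrow> cmd" where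
  "reset x = goto x ;; Del x ;; home ;; Put x"

definition eqp :: "nat \<Rightarrow> nat \<Rightarrow> cmd" where
  "eqp x y = goto x ;; Has y"

definition inc_track :: cmd where
  "inc_track = home ;; Rep (Ite (Has 0) (Del 0 ;; Rgt ;; Ret False) (Put 0))"

definition clear_track :: "nat \<Rightarrow> cmd" where
  "clear_track x = home ;; Rep (Del 0 ;; Ite (Has x) (Ret True) (Rgt ;; Ret False))"

text \<open>A variable is given in unary, as a pebble on a cell, but its binary digits are asked
  for. They are produced by counting: the counter 1 walks from cell 0 to the pebble \<open>y\<close>
  while the track is incremented once per step, after which the track is the set of digits of
  \<open>y\<close>. It must be empty before and is cleared afterwards.\<close>

definition memp :: "nat \<Rightarrow> nat \<Rightarrow> cmd" where
  "memp x y = reset 1 ;; Rep (Ite (eqp 1 y) (Ret True) (inc_track ;; incr 1 ;; Ret False)) ;;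
     Ite (goto x ;; Has 0) (clear_track y ;; Ret True) (clear_track y ;; Ret False)"

text \<open>In the case of a quantifier the loop always ends with \<open>True\<close>, be it by a
  witness or by exhausting the range. The comparison after the loop separates the two: the pebble
  has reached \<open>y\<close> exactly if no witness exists.\<close>

fun fm_cmd :: "nat \<Rightarrow> fm \<Rightarrow> cmd" where
  "fm_cmd k (FEq x y) = (if x < k \<and> y < k then eqp (x + 2) (y + 2) else Ret False)"
| "fm_cmd k (FSuc x y) = (if x < k \<and> y < k then goto (x + 2) ;; Rgt ;; Has (y + 2) else Ret False)"
| "fm_cmd k (FSym a x) = (if x < k then goto (x + 2) ;; Sym a else Ret False)"
| "fm_cmd k (FMem x y) = (if x < k \<and> y < k then memp (x + 2) (y + 2) else Ret False)"
| "fm_cmd k (FNeg \<phi>) = Ite (fm_cmd k \<phi>) (Ret False) (Ret True)"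
| "fm_cmd k (FAnd \<phi> \<psi>) = Ite (fm_cmd k \<phi>) (fm_cmd k \<psi>) (Ret False)"
| "fm_cmd k (FEx y \<phi>) = (if y < k then
     reset (k + 2) ;;
     Rep (Ite (eqp (k + 2) (y + 2)) (Ret True)
           (Ite (fm_cmd (Suc k) \<phi>) (Ret True) (incr (k + 2) ;; Ret False))) ;;
     Ite (eqp (k + 2) (y + 2)) (Ret False) (Ret True)
   else Ret False)"

section \<open>Correctness of the tape commands\<close>

lemma exec_Seq:
  "h \<le> B \<Longrightarrow> exec w B a M h M' h' b' \<Longrightarrow> exec w B b M' h' M'' h'' r \<Longrightarrow> exec w B (a ;; b) M h M'' h'' r"
  by (cases b') (auto intro: exec.intros)

lemma exec_home:
  assumes "h \<le> B" "M 2 = {0}" shows "exec w B home M h M 0 True"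
  using assms(1)
proof (induction h)
  case 0
  show ?case unfolding home_def
    by (rule RepT[OF _ IteT[OF _ Has Ret]]) (use assms in auto)
next
  case (Suc h)
  show ?case unfolding home_def
    by (rule RepF[OF _ IteF[OF _ Has exec_Seq[OF _ Lft Ret]]])
      (use Suc assms in \<open>auto simp flip: home_def\<close>)
qed

lemma exec_goto:
  assumes "h \<le> B" "M 2 = {0}" "M x = {p}" "p \<le> B" shows "exec w B (goto x) M h M p True"
proof -
  have "exec w B (Rep (Ite (Has x) (Ret True) (Rgt ;; Ret False))) M (p - d) M p True"
    if "d \<le> p" for d using that
  proof (induction d)
    case 0
    show ?case by (simp only: diff_zero, rule RepT[OF _ IteT[OF _ Has Ret]]) (use assms in auto)
  next
    case (Suc d)
    have e: "Suc (p - Suc d) = p - d" using Suc by auto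
    show ?case
      by (rule RepF[OF _ IteF[OF _ Has exec_Seq[OF _ Rgt Ret]]])
        (use Suc assms e in auto)
  qed
  from this[of p] show ?thesis unfolding goto_def
    by (intro exec_Seq[OF _ exec_home]) (use assms in auto)
qed

lemma exec_incr:
  assumes "h \<le> B" "M 2 = {0}" "M x = {p}" "p < B"
  shows "exec w B (incr x) M h (M(x := {Suc p})) (Suc p) True"
proof -
  have e: "M(x := {Suc p}) = (M(x := M x - {p}))(x := insert (Suc p) ((M(x := M x - {p})) x))"
    using assms by auto
  show ?thesis unfolding incr_def e
    by (intro exec_Seq[OF _ exec_goto[where p = p]] exec_Seq[OF _ Del] exec_Seq[OF _ Rgt] Put) (use assms in auto)
qed

lemma exec_reset:
  assumes "h \<le> B" "M 2 = {0}" "M x = {p}" "p \<le> B" "x \<noteq> 2"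
  shows "exec w B (reset x) M h (M(x := {0})) 0 True"
proof -
  have e: "M(x := {0}) = (M(x := M x - {p}))(x := insert 0 ((M(x := M x - {p})) x))"
    using assms by auto
  show ?thesis unfolding reset_def e
    by (intro exec_Seq[OF _ exec_goto[where p = p]] exec_Seq[OF _ Del] exec_Seq[OF _ exec_home] Put) (use assms in auto)
qed

lemma exec_eqp:
  assumes "h \<le> B" "M 2 = {0}" "M x = {p}" "M y = {q}" "p \<le> B"
  shows "exec w B (eqp x y) M h M p (p = q)"
  unfolding eqp_def by (rule exec_Seq[OF _ exec_goto Has]) (use assms in auto)

text \<open>Binary increment by carrying: \<open>S\<close> holds the digits of \<open>j\<close>, shifted by \<open>h\<close> cells.\<close>
lemma exec_inc_track:
  assumes "h \<le> B" "M 2 = {0}" "M 0 = set_decode j" "j \<le> B"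
  shows "\<exists>h' \<le> B. exec w B inc_track M h (M(0 := set_decode (Suc j))) h' True"
proof -
  define upd where "upd S = M(0 := S)" for S
  have upd[simp]: "upd S 0 = S" "x \<noteq> 0 \<Longrightarrow> upd S x = M x" "(upd S)(0 := S') = upd S'" for S S' x
    by (auto simp: upd_def)
  let ?L = "Rep (Ite (Has 0) (Del 0 ;; Rgt ;; Ret False) (Put 0))"
  \<comment> \<open>Generalised to a carry that has arrived at cell \<open>h\<close>: the cells
    below are final, and from \<open>h\<close> on the track holds the digits of \<open>j\<close>.
    For j = 2 * l + 1 the digit is erased and the carry continues one cell further with l, which
    preserves \<open>h + j \<le> B\<close>.\<close>
  have loop: "\<exists>h' \<le> B. exec w B ?L (upd (S)) h
      (upd ({i \<in> S. i < h} \<union> {i. i \<ge> h \<and> i - h \<in> set_decode (Suc j)})) h' True"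
    if "\<forall>i\<ge>h. i \<in> S \<longleftrightarrow> i - h \<in> set_decode j" "h + j \<le> B" for h j S
    using that
  proof (induction j arbitrary: h S rule: less_induct)
    case (less j)
    show ?case
    proof (cases "even j")
      case True
      have "i - h \<in> set_decode (Suc j) \<longleftrightarrow> i = h \<or> i - h \<in> set_decode j" if "i \<ge> h" for i
        using that True by (cases "i - h") auto
      then have e: "{i \<in> S. i < h} \<union> {i. i \<ge> h \<and> i - h \<in> set_decode (Suc j)} = insert h S"
        using less.prems by (intro set_eqI) (metis (lifting) UnCI UnE insertCI insertE mem_Collect_eq not_le order_refl)
      have "h \<notin> S" using less.prems True by auto
      then have "exec w B (Ite (Has 0) (Del 0 ;; Rgt ;; Ret False) (Put 0))
          (upd (S)) h ((upd S)(0 := insert h (upd S 0))) h True"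
        by (intro IteF[OF _ Has Put]) (use less.prems in auto)
      from RepT[OF _ this] have "exec w B ?L (upd (S)) h (upd (insert h S)) h True"
        using less.prems by simp
      with less.prems show ?thesis unfolding e by (intro exI[of _ h] conjI) auto
    next
      case False
      then obtain l where l: "j = Suc (2 * l)" by (auto elim: oddE)
      have h: "h \<in> S" using less.prems False by auto
      have S: "\<forall>i\<ge>Suc h. i \<in> S - {h} \<longleftrightarrow> i - Suc h \<in> set_decode l"
      proof (intro allI impI)
        fix i assume i: "i \<ge> Suc h"
        then have "i - h = Suc (i - Suc h)" by simp
        then show "i \<in> S - {h} \<longleftrightarrow> i - Suc h \<in> set_decode l" using less.prems(1) i l by auto
      qed
      obtain h' where h': "h' \<le> B" "exec w B ?L (upd (S - {h})) (Suc h)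
        (upd ({i \<in> S - {h}. i < Suc h} \<union> {i. i \<ge> Suc h \<and> i - Suc h \<in> set_decode (Suc l)})) h' True"
        using less.IH[OF _ S] less.prems l by auto
      have tail: "i - Suc h \<in> set_decode (Suc l) \<longleftrightarrow> i - h \<in> set_decode (Suc j)" if "i \<ge> Suc h" for i
      proof -
        have "i - h = Suc (i - Suc h)" using that by simp
        then show ?thesis using l by simp
      qed
      have e: "{i \<in> S - {h}. i < Suc h} \<union> {i. i \<ge> Suc h \<and> i - Suc h \<in> set_decode (Suc l)}
         = {i \<in> S. i < h} \<union> {i. i \<ge> h \<and> i - h \<in> set_decode (Suc j)}"
      proof (intro set_eqI)
        fix i
        consider "i < h" | "i = h" | "Suc h \<le> i" by linarith
        then show "i \<in> {i \<in> S - {h}. i < Suc h} \<union> {i. i \<ge> Suc h \<and> i - Suc h \<in> set_decode (Suc l)} \<longleftrightarrow>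
           i \<in> {i \<in> S. i < h} \<union> {i. i \<ge> h \<and> i - h \<in> set_decode (Suc j)}"
          by cases (use False tail in auto)
      qed
      have "exec w B (Ite (Has 0) (Del 0 ;; Rgt ;; Ret False) (Put 0))
          (upd (S)) h ((upd S)(0 := upd S 0 - {h})) (Suc h) False"
        by (intro IteT[OF _ Has] exec_Seq[OF _ Del] exec_Seq[OF _ Rgt] Ret) (use less.prems l h in auto)
      from RepF[OF _ this] h' show ?thesis unfolding e using less.prems by auto
    qed
  qed
  have "upd (set_decode j) = M" using assms(3)[symmetric] by (simp add: upd_def)
  with loop[of 0 "set_decode j" j] assms obtain h' where
    "h' \<le> B" "exec w B ?L M 0 (upd (set_decode (Suc j))) h' True" by auto
  then show ?thesis unfolding inc_track_def upd_def
    by (intro exI[of _ h']) (auto intro!: exec_Seq[OF _ exec_home] simp: assms)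
qed

lemma exec_clear_track:
  assumes "h \<le> B" "M 2 = {0}" "M x = {p}" "p \<le> B" "M 0 \<subseteq> {..p}" "x \<noteq> 0"
  shows "exec w B (clear_track x) M h (M(0 := {})) p True"
proof -
  define upd where "upd S = M(0 := S)" for S
  have upd[simp]: "upd S 0 = S" "x \<noteq> 0 \<Longrightarrow> upd S x = M x" "(upd S)(0 := S') = upd S'" for S S' x
    by (auto simp: upd_def)
  let ?b = "Del 0 ;; Ite (Has x) (Ret True) (Rgt ;; Ret False)"
  have "exec w B (Rep ?b) (upd (S)) (p - d) (upd ({})) p True"
    if "d \<le> p" "S \<subseteq> {p - d..p}" for d S using that
  proof (induction d arbitrary: S)
    case 0
    then have "S - {p} = {}" by auto
    then have e: "upd ({}) = (upd S)(0 := upd S 0 - {p})" by (simp only: upd)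
    show ?case unfolding e
      by (simp only: diff_zero, rule RepT[OF _ exec_Seq[OF _ Del IteT[OF _ Has Ret]]]) (use assms in auto)
  next
    case (Suc d)
    have e: "Suc (p - Suc d) = p - d" using Suc by auto
    have "S - {p - Suc d} \<subseteq> {p - d..p}"
    proof
      fix i assume "i \<in> S - {p - Suc d}"
      then have "i \<noteq> p - Suc d" "p - Suc d \<le> i" "i \<le> p" using Suc.prems(2) by auto
      then show "i \<in> {p - d..p}" by auto
    qed
    then have IH: "exec w B (Rep ?b) (upd (S - {p - Suc d})) (p - d) (upd ({})) p True"
      by (intro Suc.IH) (use Suc.prems in simp)
    have "exec w B ?b (upd (S)) (p - Suc d)
       ((upd S)(0 := upd S 0 - {p - Suc d})) (Suc (p - Suc d)) False"
      by (intro exec_Seq[OF _ Del] IteF[OF _ Has] exec_Seq[OF _ Rgt] Ret) (use Suc assms e in auto)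
    then have "exec w B ?b (upd (S)) (p - Suc d) (upd (S - {p - Suc d})) (p - d) False"
      unfolding e by simp
    from RepF[OF _ this IH] show ?case using Suc assms by simp
  qed
  moreover have "upd (M 0) = M" by (simp add: upd_def)
  moreover have "M 0 \<subseteq> {p - p..p}" using assms by auto
  ultimately have "exec w B (Rep ?b) M 0 (upd ({})) p True" by (metis diff_self_eq_0 order_refl)
  then show ?thesis unfolding clear_track_def upd_def
    by (intro exec_Seq[OF _ exec_home]) (use assms in auto)
qed

lemma pebbles_simps[simp]:
  "pebbles m S c e 0 = S" "pebbles m S c e 1 = {c}" "pebbles m S c e (Suc 0) = {c}"
  "i < m \<Longrightarrow> pebbles m S c e (i + 2) = {e i}"
  "i < m \<Longrightarrow> pebbles m S c e (Suc (Suc i)) = {e i}"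
  "0 < m \<Longrightarrow> pebbles m S c e 2 = {e 0}"
  "(pebbles m S c e)(0 := S') = pebbles m S' c e"
  "(pebbles m S c e)(1 := {c'}) = pebbles m S c' e"
  "(pebbles m S c e)(Suc 0 := {c'}) = pebbles m S c' e"
  "i < m \<Longrightarrow> (pebbles m S c e)(i + 2 := {v}) = pebbles m S c (e(i := v))"
  "i < m \<Longrightarrow> (pebbles m S c e)(Suc (Suc i) := {v}) = pebbles m S c (e(i := v))"
  by (auto simp: pebbles_def fun_eq_iff)

lemma set_decode_bound: "i \<in> set_decode x \<Longrightarrow> i < x"
proof (rule ccontr)
  assume i: "i \<in> set_decode x" and "\<not> i < x"
  then have "x < 2 ^ i" using less_exp[of i] by linarith
  then show False using i by (simp add: set_decode_def)
qed

lemma exec_memp: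
  assumes "h \<le> B" "c < B" "e 0 = 0" "x < m" "y < m" "e x < B" "e y < B" "0 < m"
  shows "\<exists>c' < B. \<exists>h' \<le> B. exec w B (memp (x + 2) (y + 2)) (pebbles m {} c e) h
    (pebbles m {} c' e) h' (e x \<in> set_decode (e y))"
proof -
  let ?M = "\<lambda>j. pebbles m (set_decode j) j e"
  let ?b = "Ite (eqp 1 (y + 2)) (Ret True) (inc_track ;; incr 1 ;; Ret False)"
  have loop: "\<exists>h'\<le>B. exec w B (Rep ?b) (?M (e y - d)) h (?M (e y)) h' True"
    if "d \<le> e y" "h \<le> B" for d h using that
  proof (induction d arbitrary: h)
    case 0
    have "exec w B (eqp 1 (y + 2)) (?M (e y)) h (?M (e y)) (e y) True"
      using exec_eqp[of h B "?M (e y)" 1 "e y" "y + 2" "e y"] assms 0 by auto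
    then have "exec w B (Rep ?b) (?M (e y)) h (?M (e y)) (e y) True"
      by (intro RepT IteT[OF _ _ Ret]) (use assms 0 in auto)
    then show ?case using assms by (auto intro!: exI[of _ "e y"])
  next
    case (Suc d)
    let ?j = "e y - Suc d"
    have j: "Suc ?j = e y - d" using Suc by auto
    have 1: "exec w B (eqp 1 (y + 2)) (?M ?j) h (?M ?j) ?j False"
    proof -
      have ne: "(?j = e y) = False" using Suc.prems by auto
      show ?thesis unfolding ne[symmetric] by (rule exec_eqp) (use assms Suc.prems in auto)
    qed
    have jB: "?j \<le> B" and jB2: "e y - d \<le> B" using assms by auto
    obtain h1 where h1: "h1 \<le> B" "exec w B inc_track (?M ?j) ?j (pebbles m (set_decode (Suc ?j)) ?j e) h1 True"
      using exec_inc_track[OF jB, of "?M ?j" ?j w] assms jB by auto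
    have 2: "exec w B (incr 1) (pebbles m (set_decode (Suc ?j)) ?j e) h1 (?M (Suc ?j)) (Suc ?j) True"
      using exec_incr[of h1 B "pebbles m (set_decode (Suc ?j)) ?j e" 1 ?j w] assms h1 by auto
    have 3: "exec w B ?b (?M ?j) h (?M (Suc ?j)) (Suc ?j) False"
      by (rule IteF[OF _ 1 exec_Seq[OF _ h1(2) exec_Seq[OF _ 2 Ret]]]) (use assms Suc h1 in auto)
    obtain h' where "h' \<le> B" "exec w B (Rep ?b) (?M (Suc ?j)) (Suc ?j) (?M (e y)) h' True"
      using Suc.IH[of "Suc ?j"] Suc.prems jB2 unfolding j by auto
    with RepF[OF _ 3] show ?case using Suc.prems by blast
  qed
  have 1: "exec w B (reset 1) (pebbles m {} c e) h (?M 0) 0 True"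
    using exec_reset[of h B "pebbles m {} c e" 1 c w] assms by auto
  obtain h2 where h2: "h2 \<le> B" "exec w B (Rep ?b) (?M 0) 0 (?M (e y)) h2 True"
    using loop[of "e y" 0] by auto
  have 3: "exec w B (goto (x + 2) ;; Has 0) (?M (e y)) h2 (?M (e y)) (e x) (e x \<in> set_decode (e y))"
    by (rule exec_Seq[OF _ exec_goto Has]) (use assms h2 in auto)
  have "set_decode (e y) \<subseteq> {..e y}" using set_decode_bound by fastforce
  then have 4: "exec w B (clear_track (y + 2)) (?M (e y)) (e x) (pebbles m {} (e y) e) (e y) True"
    using exec_clear_track[of "e x" B "?M (e y)" "y + 2" "e y" w] assms by auto
  have "exec w B (Ite (goto (x + 2) ;; Has 0) (clear_track (y + 2) ;; Ret True) (clear_track (y + 2) ;; Ret False))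
    (?M (e y)) h2 (pebbles m {} (e y) e) (e y) (e x \<in> set_decode (e y))"
  proof (cases "e x \<in> set_decode (e y)")
    case True
    show ?thesis
      by (rule IteT[OF _ 3[unfolded eqTrueI[OF True]] exec_Seq[OF _ 4]])
        (use True assms h2 in \<open>auto intro: Ret\<close>)
  next
    case False
    then have f: "(e x \<in> set_decode (e y)) = False" by simp
    show ?thesis
      by (rule IteF[OF _ 3[unfolded f] exec_Seq[OF _ 4]])
        (use False assms h2 in \<open>auto intro: Ret\<close>)
  qed
  then have "exec w B (memp (x + 2) (y + 2)) (pebbles m {} c e) h
    (pebbles m {} (e y) e) (e y) (e x \<in> set_decode (e y))"
    unfolding memp_def by (intro exec_Seq[OF _ 1] exec_Seq[OF _ h2(2)]) (use assms h2 in auto)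
  then show ?thesis using assms(7) by (meson less_imp_le)
qed

lemma comp_resultI:
  "exec w B a M h (pebbles m {} c' e') h' b \<Longrightarrow> c' < B \<Longrightarrow> h' \<le> B \<Longrightarrow> \<forall>i<k. e' i = e i \<Longrightarrow> \<forall>i<m. e' i < B \<Longrightarrow>
   \<exists>c' e' h'. exec w B a M h (pebbles m {} c' e') h' b
    \<and> c' < B \<and> h' \<le> B \<and> (\<forall>i<k. e' i = e i) \<and> (\<forall>i<m. e' i < B)"
  by blast

text \<open>The strict bound \<open>e i < B\<close> leaves a spare cell, so that the increments and
  the step to the right in \<open>FSuc\<close> stay inside the tape. Pebbles from level
  \<open>k\<close> upwards are scratch; only the values below \<open>k\<close> survive, and by
  \<open>sat_cong\<close> these are all that \<open>sat\<close> depends on.\<close>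

lemma exec_comp:
  assumes "h \<le> B" "c < B" "e 0 = 0" "0 < k" "k + qdepth \<phi> \<le> m" "\<And>i. i < m \<Longrightarrow> e i < B"
  shows "\<exists>c' e' h'. exec w B (fm_cmd k \<phi>) (pebbles m {} c e) h (pebbles m {} c' e') h' (sat w k e \<phi>)
    \<and> c' < B \<and> h' \<le> B \<and> (\<forall>i<k. e' i = e i) \<and> (\<forall>i<m. e' i < B)"
  using assms
proof (induction \<phi> arbitrary: h c e k)
  case (FEq x y)
  show ?case
  proof (cases "x < k \<and> y < k")
    case True
    then have xy: "x < m" "y < m" "0 < m" "e x < B" using FEq by auto
    then have "exec w B (eqp (x + 2) (y + 2)) (pebbles m {} c e) h (pebbles m {} c e) (e x) (e x = e y)"
      by (intro exec_eqp) (use FEq xy in \<open>auto intro: less_imp_le\<close>)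
    then show ?thesis using True FEq xy by (intro comp_resultI[of _ _ _ _ _ _ c e "e x"]) (auto intro: less_imp_le)
  qed (rule comp_resultI[of _ _ _ _ _ _ c e h], use FEq in \<open>auto intro: Ret\<close>)
next
  case (FSuc x y)
  show ?case
  proof (cases "x < k \<and> y < k")
    case True
    then have xy: "x < m" "y < m" "0 < m" "e x < B" using FSuc by auto
    then have "exec w B (goto (x + 2) ;; Rgt ;; Has (y + 2)) (pebbles m {} c e) h
        (pebbles m {} c e) (Suc (e x)) (e y = Suc (e x))"
      by (intro exec_Seq[OF _ exec_goto[where p = "e x"]] exec_Seq[OF _ Rgt] Has) (use FSuc xy in \<open>auto intro: less_imp_le Suc_leI\<close>)
    then show ?thesis using True FSuc xy by (intro comp_resultI[of _ _ _ _ _ _ c e "Suc (e x)"]) (auto intro: Suc_leI)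
  qed (rule comp_resultI[of _ _ _ _ _ _ c e h], use FSuc in \<open>auto intro: Ret\<close>)
next
  case (FSym a x)
  show ?case
  proof (cases "x < k")
    case True
    then have x: "x < m" "0 < m" "e x < B" using FSym by auto
    then have "exec w B (goto (x + 2) ;; Sym a) (pebbles m {} c e) h
        (pebbles m {} c e) (e x) (inp w (e x) = a)"
      by (intro exec_Seq[OF _ exec_goto[where p = "e x"]] Sym) (use FSym x in \<open>auto intro: less_imp_le\<close>)
    then show ?thesis using True FSym x by (intro comp_resultI[of _ _ _ _ _ _ c e "e x"]) (auto intro: less_imp_le)
  qed (rule comp_resultI[of _ _ _ _ _ _ c e h], use FSym in \<open>auto intro: Ret\<close>)
next
  case (FMem x y)
  show ?case
  proof (cases "x < k \<and> y < k")
    case True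
    then have "x < m" "y < m" "0 < m" using FMem by auto
    then show ?thesis using exec_memp[of h B c e x m y w] True FMem by auto
  qed (rule comp_resultI[of _ _ _ _ _ _ c e h], use FMem in \<open>auto intro: Ret\<close>)
next
  case (FNeg \<phi>)
  obtain c' e' h' where 1: "exec w B (fm_cmd k \<phi>) (pebbles m {} c e) h (pebbles m {} c' e') h' (sat w k e \<phi>)"
    "c' < B" "h' \<le> B" "\<forall>i<k. e' i = e i" "\<forall>i<m. e' i < B"
    using FNeg.IH[of h c e k] FNeg.prems by auto
  have "exec w B (fm_cmd k (FNeg \<phi>)) (pebbles m {} c e) h (pebbles m {} c' e') h' (\<not> sat w k e \<phi>)"
    using 1 FNeg.prems(1) by (cases "sat w k e \<phi>") (auto intro: IteT[OF _ _ Ret] IteF[OF _ _ Ret])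
  with 1 show ?case by (intro exI conjI) auto
next
  case (FAnd \<phi> \<psi>)
  have d: "k + qdepth \<phi> \<le> m" "k + qdepth \<psi> \<le> m" using FAnd.prems by auto
  obtain c' e' h' where 1: "exec w B (fm_cmd k \<phi>) (pebbles m {} c e) h (pebbles m {} c' e') h' (sat w k e \<phi>)"
    "c' < B" "h' \<le> B" "\<forall>i<k. e' i = e i" "\<forall>i<m. e' i < B"
    using FAnd.IH(1)[of h c e k] FAnd.prems d by auto
  show ?case
  proof (cases "sat w k e \<phi>")
    case True
    obtain c2 e2 h2 where 2: "exec w B (fm_cmd k \<psi>) (pebbles m {} c' e') h' (pebbles m {} c2 e2) h2 (sat w k e' \<psi>)"
      "c2 < B" "h2 \<le> B" "\<forall>i<k. e2 i = e' i" "\<forall>i<m. e2 i < B"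
      using FAnd.IH(2)[of h' c' e' k] FAnd.prems d 1 by auto
    have "sat w k e' \<psi> = sat w k e \<psi>" using 1 by (intro sat_cong) auto
    then show ?thesis using True 1 2 FAnd.prems(1)
      by (intro comp_resultI[of _ _ _ _ _ _ c2 e2 h2]) (auto intro: IteT)
  next
    case False
    then show ?thesis using 1 FAnd.prems(1)
      by (intro comp_resultI[of _ _ _ _ _ _ c' e' h']) (auto intro: IteF[OF _ _ Ret])
  qed
next
  case (FEx y \<phi>)
  show ?case
  proof (cases "y < k")
    case y: True
    let ?b = "Ite (eqp (k + 2) (y + 2)) (Ret True)
           (Ite (fm_cmd (Suc k) \<phi>) (Ret True) (incr (k + 2) ;; Ret False))"
    have k: "k < m" "y < m" "0 < m" "k \<noteq> y" "k \<noteq> 0" using y FEx.prems by auto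
    have eyB: "e y < B" and ekB: "e k \<le> B" using FEx.prems(6) k by (auto intro: less_imp_le)
    let ?P = "\<lambda>v. sat w (Suc k) (e(k := v)) \<phi>"
    \<comment> \<open>Stated for a search that has already advanced to \<open>e1 k\<close>, with
      \<open>d\<close> candidates left: the pebble stops short of \<open>e y\<close> exactly if a
      witness exists from there on.\<close>
    have loop: "\<exists>c' e' h'. exec w B (Rep ?b) (pebbles m {} c1 e1) h1 (pebbles m {} c' e') h' True
      \<and> c' < B \<and> h' \<le> B \<and> (\<forall>i<k. e' i = e i) \<and> (\<forall>i<m. e' i < B)
      \<and> (e' k < e y \<longleftrightarrow> (\<exists>v<e y. v \<ge> e1 k \<and> ?P v)) \<and> e' k \<le> e y"
      if "e1 k = e y - d" "d \<le> e y" "h1 \<le> B" "c1 < B" "\<forall>i<k. e1 i = e i" "\<forall>i<m. e1 i < B"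
      for d c1 e1 h1 using that
    proof (induction d arbitrary: c1 e1 h1)
      case 0
      have e0: "e1 0 = 0" "e1 y = e y" using 0 k y FEx.prems by auto
      have "exec w B (eqp (k + 2) (y + 2)) (pebbles m {} c1 e1) h1 (pebbles m {} c1 e1) (e1 k) (e1 k = e1 y)"
        by (intro exec_eqp) (use 0 k e0 in \<open>auto intro: less_imp_le\<close>)
      then have "exec w B (Rep ?b) (pebbles m {} c1 e1) h1 (pebbles m {} c1 e1) (e1 k) True"
        by (intro RepT IteT[OF _ _ Ret]) (use 0 k e0 in \<open>auto intro: less_imp_le\<close>)
      note ex = this
      show ?case
        by (rule exI[of _ c1], rule exI[of _ e1], rule exI[of _ "e1 k"]) (use ex 0 k in \<open>auto intro: less_imp_le\<close>)
    next
      case (Suc d)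
      have e0: "e1 0 = 0" "e1 y = e y" "e1 k < e y" using Suc k y FEx.prems by auto
      have ne: "(e1 k = e1 y) = False" using e0 by simp
      have 1: "exec w B (eqp (k + 2) (y + 2)) (pebbles m {} c1 e1) h1 (pebbles m {} c1 e1) (e1 k) False"
        unfolding ne[symmetric] by (intro exec_eqp) (use Suc.prems k e0 in \<open>auto intro: less_imp_le\<close>)
      have e1k: "e1 k < B" using Suc.prems k by auto
      obtain c2 e2 h2 where 2: "exec w B (fm_cmd (Suc k) \<phi>) (pebbles m {} c1 e1) (e1 k)
          (pebbles m {} c2 e2) h2 (sat w (Suc k) e1 \<phi>)"
        "c2 < B" "h2 \<le> B" "\<forall>i<Suc k. e2 i = e1 i" "\<forall>i<m. e2 i < B"
        using FEx.IH[of "e1 k" c1 e1 "Suc k"] FEx.prems Suc.prems e0 k e1k by auto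
      have eq: "sat w (Suc k) e1 \<phi> = ?P (e1 k)"
        by (rule sat_cong) (use Suc.prems in \<open>auto simp: less_Suc_eq\<close>)
      show ?case
      proof (cases "?P (e1 k)")
        case True
        have "exec w B (Rep ?b) (pebbles m {} c1 e1) h1 (pebbles m {} c2 e2) h2 True"
          by (rule RepT[OF _ IteF[OF _ 1 IteT[OF _ 2(1)[unfolded eq eqTrueI[OF True]] Ret]]])
            (use Suc.prems e0 e1k 2 in auto)
        moreover have "\<exists>v<e y. v \<ge> e1 k \<and> ?P v" using e0 True by blast
        moreover have "e2 k = e1 k" "\<forall>i<k. e2 i = e i" using 2 Suc.prems by auto
        ultimately show ?thesis using 2 e0 by (metis less_imp_le)
      next
        case False
        let ?e3 = "e2(k := Suc (e2 k))"
        have e2: "e2 0 = 0" "e2 k = e1 k" using 2 e0 by auto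
        have 3: "exec w B (incr (k + 2)) (pebbles m {} c2 e2) h2 (pebbles m {} c2 ?e3) (Suc (e2 k)) True"
          using exec_incr[of h2 B "pebbles m {} c2 e2" "k + 2" "e2 k" w] 2 e2 k by auto
        have F: "sat w (Suc k) e1 \<phi> = False" using eq False by simp
        have 4: "exec w B ?b (pebbles m {} c1 e1) h1 (pebbles m {} c2 ?e3) (Suc (e2 k)) False"
          by (rule IteF[OF _ 1 IteF[OF _ 2(1)[unfolded F] exec_Seq[OF _ 3 Ret]]])
            (use Suc.prems e0 e1k 2 e2 in auto)
        have p: "?e3 k = e y - d" "d \<le> e y" "Suc (e2 k) \<le> B" "c2 < B"
          "\<forall>i<k. ?e3 i = e i" "\<forall>i<m. ?e3 i < B" using 2 e2 e0 e1k eyB Suc.prems by auto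
        obtain c' e' h' where 5:
          "exec w B (Rep ?b) (pebbles m {} c2 ?e3) (Suc (e2 k)) (pebbles m {} c' e') h' True"
          "c' < B" "h' \<le> B" "\<forall>i<k. e' i = e i" "\<forall>i<m. e' i < B"
          "e' k < e y \<longleftrightarrow> (\<exists>v<e y. v \<ge> ?e3 k \<and> ?P v)" "e' k \<le> e y"
          using Suc.IH[OF p] by blast
        have "v \<ge> ?e3 k \<and> ?P v \<longleftrightarrow> v \<ge> e1 k \<and> ?P v" for v
          using e2 False by (cases "v = e1 k") (auto simp del: fun_upd_apply simp: fun_upd_same)
        then have "e' k < e y \<longleftrightarrow> (\<exists>v<e y. v \<ge> e1 k \<and> ?P v)" using 5(6) by metis
        with RepF[OF _ 4 5(1)] 5 Suc.prems(3) show ?thesis by metis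
      qed
    qed
    have 1: "exec w B (reset (k + 2)) (pebbles m {} c e) h (pebbles m {} c (e(k := 0))) 0 True"
      using exec_reset[of h B "pebbles m {} c e" "k + 2" "e k" w] FEx.prems k ekB by auto
    obtain c' e' h' where 2:
      "exec w B (Rep ?b) (pebbles m {} c (e(k := 0))) 0 (pebbles m {} c' e') h' True"
      "c' < B" "h' \<le> B" "\<forall>i<k. e' i = e i" "\<forall>i<m. e' i < B"
      "e' k < e y \<longleftrightarrow> (\<exists>v<e y. ?P v)" "e' k \<le> e y"
    proof -
      have p: "(e(k := 0)) k = e y - e y" "e y \<le> e y" "0 \<le> B" "c < B" "\<forall>i<k. (e(k := 0)) i = e i"
        "\<forall>i<m. (e(k := 0)) i < B" using FEx.prems by auto
      have z: "(\<exists>v<e y. (e(k := 0)) k \<le> v \<and> ?P v) = (\<exists>v<e y. ?P v)" by simp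
      show ?thesis using loop[OF p] unfolding z using that by blast
    qed
    have e': "e' 0 = 0" "e' y = e y" using 2 y k FEx.prems by auto
    have 3: "exec w B (eqp (k + 2) (y + 2)) (pebbles m {} c' e') h' (pebbles m {} c' e') (e' k) (e' k = e' y)"
      by (intro exec_eqp) (use 2 k e' in \<open>auto intro: less_imp_le\<close>)
    have ekB': "e' k \<le> B" using 2(5) k by (auto intro: less_imp_le)
    have "exec w B (Ite (eqp (k + 2) (y + 2)) (Ret False) (Ret True)) (pebbles m {} c' e') h'
        (pebbles m {} c' e') (e' k) (e' k \<noteq> e' y)"
      using 3 2(3) ekB' by (cases "e' k = e' y") (auto intro: IteT[OF _ _ Ret] IteF[OF _ _ Ret])
    moreover have "e' k \<noteq> e' y \<longleftrightarrow> (\<exists>v<e y. ?P v)" using 2(6,7) e' by auto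
    ultimately have 4: "exec w B (Ite (eqp (k + 2) (y + 2)) (Ret False) (Ret True)) (pebbles m {} c' e') h'
        (pebbles m {} c' e') (e' k) (\<exists>v<e y. ?P v)" by simp
    have "exec w B (fm_cmd k (FEx y \<phi>)) (pebbles m {} c e) h (pebbles m {} c' e') (e' k) (sat w k e (FEx y \<phi>))"
      using exec_Seq[OF _ 1 exec_Seq[OF _ 2(1) 4]] y FEx.prems by simp
    then show ?thesis using 2 ekB' by (intro comp_resultI[of _ _ _ _ _ _ c' e' "e' k"]) auto
  qed (rule comp_resultI[of _ _ _ _ _ _ c e h], use FEx in \<open>auto intro: Ret\<close>)
qed

fun puts :: "nat \<Rightarrow> cmd" where
  "puts 0 = Put 1"
| "puts (Suc m) = puts m ;; Put (m + 2)"

lemma exec_puts: "exec w B (puts m) (\<lambda>_. {}) 0 (pebbles m {} 0 (\<lambda>_. 0)) 0 True"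
proof (induction m)
  case 0
  have "pebbles 0 {} 0 (\<lambda>_. 0) = (\<lambda>_. {})(1 := insert 0 {})"
    by (auto simp: pebbles_def fun_eq_iff)
  then show ?case unfolding puts.simps by (metis Put le0)
next
  case (Suc m)
  have "(pebbles m {} 0 (\<lambda>_. 0))(m + 2 := insert 0 (pebbles m {} 0 (\<lambda>_. 0) (m + 2)))
      = pebbles (Suc m) {} 0 (\<lambda>_. 0)"
    by (auto simp: pebbles_def fun_eq_iff)
  then show ?case
    unfolding puts.simps by (metis exec_Seq Suc Put le0)
qed

text \<open>The machine puts variables 1 and 2 on the end of the input, increases variable 2 until
  \<open>\<phi>\<close> becomes true, and answers \<open>\<psi>\<close>.\<close>
definition decider :: "fm \<Rightarrow> fm \<Rightarrow> cmd" where
  "decider \<phi> \<psi> = puts (3 + max (qdepth \<phi>) (qdepth \<psi>)) ;;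
     Rep (Ite (goto 3 ;; Sym 0) (Ret True) (incr 3 ;; incr 4 ;; Ret False)) ;;
     Rep (Ite (fm_cmd 3 \<phi>) (Ret True) (incr 4 ;; Ret False)) ;; fm_cmd 3 \<psi>"

definition env3 :: "nat \<Rightarrow> nat \<Rightarrow> nat \<Rightarrow> nat" where
  "env3 n t = (\<lambda>_. 0)(1 := n, 2 := t)"

text \<open>The bound \<open>T\<close> is not computed but recognised: \<open>\<phi>\<close> is
  false from the length of the input up to \<open>T\<close> and true at \<open>T\<close>, so trying
  successive values of variable 2 finds it. All quantifiers range below values of variables already
  placed, so that no pebble moves beyond cell \<open>T\<close> while \<open>\<psi>\<close> is
  evaluated.\<close>

theorem ELEMENTARY_fmI:
  assumes "[] \<notin> X" "tower_bounded T"
    and T: "\<And>w. w \<noteq> [] \<Longrightarrow> length w \<le> T (length w) \<and>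
      sat w 3 (env3 (length w) (T (length w))) \<phi> \<and>
      (\<forall>t. length w \<le> t \<longrightarrow> t < T (length w) \<longrightarrow> \<not> sat w 3 (env3 (length w) t) \<phi>) \<and>
      (sat w 3 (env3 (length w) (T (length w))) \<psi> \<longleftrightarrow> w \<in> X)"
  shows "X \<in> ELEMENTARY"
proof (rule ELEMENTARY_cmdI[of X "\<lambda>n. T n + 1" "decider \<phi> \<psi>"])
  show "tower_bounded (\<lambda>n. T n + 1)" by (intro tower_bounded_add tower_bounded_const assms)
  fix w :: "bool list" assume "w \<noteq> []"
  define n where "n = length w"
  define B where "B = T n + 1"
  define m where "m = 3 + max (qdepth \<phi>) (qdepth \<psi>)"
  note T = T[OF \<open>w \<noteq> []\<close>, folded n_def]
  have m: "3 + qdepth \<phi> \<le> m" "3 + qdepth \<psi> \<le> m" "3 \<le> m" by (auto simp: m_def)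
  have n: "n < B" using T by (simp add: B_def)
  let ?M = "\<lambda>c e. pebbles m {} c e"
  let ?l1 = "Rep (Ite (goto 3 ;; Sym 0) (Ret True) (incr 3 ;; incr 4 ;; Ret False))"
  have inp0: "inp w i = 0 \<longleftrightarrow> n \<le> i" for i by (auto simp: inp_def n_def)
  have loop1: "\<exists>h'\<le>B. exec w B ?l1 (?M 0 (env3 i i)) h (?M 0 (env3 n n)) h' True"
    if "i + d = n" "h \<le> B" for i d h using that
  proof (induction d arbitrary: i h)
    case 0
    have "exec w B (goto 3 ;; Sym 0) (?M 0 (env3 i i)) h (?M 0 (env3 i i)) i (inp w i = 0)"
      by (intro exec_Seq[OF _ exec_goto[where p = i]] Sym)
        (use 0 n m pebbles_simps(4)[of 1] in \<open>auto simp: env3_def numeral_3_eq_3\<close>)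
    then have "exec w B (goto 3 ;; Sym 0) (?M 0 (env3 i i)) h (?M 0 (env3 i i)) i True"
      using inp0 0 by simp
    from RepT[OF _ IteT[OF _ this Ret]] 0 n have "exec w B ?l1 (?M 0 (env3 i i)) h (?M 0 (env3 i i)) i True"
      by simp
    then show ?case using 0 n by (intro exI[of _ i]) simp
  next
    case (Suc d)
    have "exec w B (goto 3 ;; Sym 0) (?M 0 (env3 i i)) h (?M 0 (env3 i i)) i (inp w i = 0)"
      by (intro exec_Seq[OF _ exec_goto[where p = i]] Sym)
        (use Suc n m pebbles_simps(4)[of 1] in \<open>auto simp: env3_def numeral_3_eq_3\<close>)
    then have 1: "exec w B (goto 3 ;; Sym 0) (?M 0 (env3 i i)) h (?M 0 (env3 i i)) i False"
      using inp0 Suc by simp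
    have 2: "exec w B (incr 3) (?M 0 (env3 i i)) i (?M 0 (env3 (Suc i) i)) (Suc i) True"
      using exec_incr[of i B "?M 0 (env3 i i)" 3 i w] pebbles_simps(4)[of 1 m]
        pebbles_simps(10)[of 1 m] Suc n m
      by (auto simp: env3_def numeral_3_eq_3 fun_upd_twist)
    have 3: "exec w B (incr 4) (?M 0 (env3 (Suc i) i)) (Suc i) (?M 0 (env3 (Suc i) (Suc i))) (Suc i) True"
      using exec_incr[of "Suc i" B "?M 0 (env3 (Suc i) i)" 4 i w] pebbles_simps(4)[of 2 m]
        pebbles_simps(10)[of 2 m] Suc n m
      by (auto simp: env3_def)
    obtain h' where "h' \<le> B" "exec w B ?l1 (?M 0 (env3 (Suc i) (Suc i))) (Suc i) (?M 0 (env3 n n)) h' True"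
      using Suc.IH[of "Suc i" "Suc i"] Suc.prems n by auto
    moreover have "i \<le> B" "h \<le> B" "Suc i \<le> B" using Suc.prems n by auto
    ultimately show ?case using RepF[OF _ IteF[OF _ 1 exec_Seq[OF _ 2 exec_Seq[OF _ 3 Ret]]]] by blast
  qed
  let ?l2 = "Rep (Ite (fm_cmd 3 \<phi>) (Ret True) (incr 4 ;; Ret False))"
  have loop2: "\<exists>c' e' h'. exec w B ?l2 (?M c e) h (?M c' e') h' True
      \<and> c' < B \<and> h' \<le> B \<and> (\<forall>i<3. e' i = env3 n (T n) i) \<and> (\<forall>i<m. e' i < B)"
    if "n \<le> t" "t + d = T n" "h \<le> B" "c < B" "\<forall>i<3. e i = env3 n t i" "\<forall>i<m. e i < B" for t d h c e
    using that
  proof (induction d arbitrary: t h c e)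
    case 0
    have e0: "e 0 = 0" using 0 by (auto simp: env3_def)
    obtain c' e' h' where 1: "exec w B (fm_cmd 3 \<phi>) (?M c e) h (?M c' e') h' (sat w 3 e \<phi>)"
      "c' < B" "h' \<le> B" "\<forall>i<3. e' i = e i" "\<forall>i<m. e' i < B"
      using exec_comp[of h B c e 3 \<phi> m w] 0 m e0 by auto
    have "sat w 3 e \<phi>" using T 0 sat_cong[of 3 e "env3 n t" w \<phi>] by auto
    with 1 have "exec w B ?l2 (?M c e) h (?M c' e') h' True"
      using 0 by (auto intro!: RepT IteT[OF _ _ Ret])
    then show ?case using 1 0 by (intro comp_resultI) auto
  next
    case (Suc d)
    have e0: "e 0 = 0" "e 2 = t" using Suc by (auto simp: env3_def)
    obtain c' e' h' where 1: "exec w B (fm_cmd 3 \<phi>) (?M c e) h (?M c' e') h' (sat w 3 e \<phi>)"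
      "c' < B" "h' \<le> B" "\<forall>i<3. e' i = e i" "\<forall>i<m. e' i < B"
      using exec_comp[of h B c e 3 \<phi> m w] Suc.prems m e0 by auto
    have "\<not> sat w 3 e \<phi>" using T Suc.prems sat_cong[of 3 e "env3 n t" w \<phi>] by auto
    with 1 have neg: "exec w B (fm_cmd 3 \<phi>) (?M c e) h (?M c' e') h' False" by simp
    have 2: "exec w B (incr 4) (?M c' e') h' (?M c' (e'(2 := Suc t))) (Suc t) True"
      using exec_incr[of h' B "?M c' e'" 4 t w] pebbles_simps(4)[of 2 m]
        pebbles_simps(10)[of 2 m] Suc.prems m 1 e0 by (auto simp: B_def)
    have p: "n \<le> Suc t" "Suc t + d = T n" "Suc t \<le> B" "c' < B"
        "\<forall>i<3. (e'(2 := Suc t)) i = env3 n (Suc t) i" "\<forall>i<m. (e'(2 := Suc t)) i < B"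
      using 1 Suc.prems by (auto simp: B_def env3_def)
    obtain c2 e2 h2 where "exec w B ?l2 (?M c' (e'(2 := Suc t))) (Suc t) (?M c2 e2) h2 True"
      "c2 < B" "h2 \<le> B" "\<forall>i<3. e2 i = env3 n (T n) i" "\<forall>i<m. e2 i < B"
      using Suc.IH[OF p] by blast
    with RepF[OF _ IteF[OF _ neg exec_Seq[OF _ 2 Ret]]] Suc.prems(3) 1(3) p(3) show ?case by blast
  qed
  have e00: "env3 0 0 = (\<lambda>_. 0)" by (auto simp: env3_def)
  obtain h1 where h1: "h1 \<le> B" "exec w B ?l1 (?M 0 (env3 0 0)) 0 (?M 0 (env3 n n)) h1 True"
    using loop1[of 0 n 0] by auto
  obtain c2 e2 h2 where 2: "exec w B ?l2 (?M 0 (env3 n n)) h1 (?M c2 e2) h2 True"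
      "c2 < B" "h2 \<le> B" "\<forall>i<3. e2 i = env3 n (T n) i" "\<forall>i<m. e2 i < B"
  proof -
    have p: "n \<le> n" "n + (T n - n) = T n" "h1 \<le> B" "0 < B"
        "\<forall>i<3. env3 n n i = env3 n n i" "\<forall>i<m. env3 n n i < B"
      using T h1 n by (auto simp: B_def env3_def)
    show ?thesis using loop2[OF p] that by blast
  qed
  have e0: "e2 0 = 0" using 2 by (auto simp: env3_def)
  obtain c3 e3 h3 where 3: "exec w B (fm_cmd 3 \<psi>) (?M c2 e2) h2 (?M c3 e3) h3 (sat w 3 e2 \<psi>)"
    using exec_comp[of h2 B c2 e2 3 \<psi> m w] 2 m e0 by auto
  have "sat w 3 e2 \<psi> \<longleftrightarrow> w \<in> X" using T 2 sat_cong[of 3 e2 "env3 n (T n)" w \<psi>] by auto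
  with 3 have 4: "exec w B (fm_cmd 3 \<psi>) (?M c2 e2) h2 (?M c3 e3) h3 (w \<in> X)" by simp
  have "exec w B (decider \<phi> \<psi>) (\<lambda>_. {}) 0 (?M c3 e3) h3 (w \<in> X)"
    unfolding decider_def m_def[symmetric]
    by (rule exec_Seq[OF _ exec_puts exec_Seq[OF _ h1(2)[unfolded e00] exec_Seq[OF _ 2(1)[folded e00] 4]]])
      (use h1 2 in auto)
  then show "\<exists>M h. exec w (T (length w) + 1) (decider \<phi> \<psi>) (\<lambda>_. {}) 0 M h (w \<in> X)"
    unfolding B_def n_def by blast
qed (rule assms)

section \<open>A finitary semantics of cons-free programs\<close>

text \<open>Kuratowski pairs in Ackermann's coding of the hereditarily finite sets.\<close>
definition pr :: "nat \<Rightarrow> nat \<Rightarrow> nat" where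
  "pr x y = set_encode {set_encode {x}, set_encode {x, y}}"

lemma pr_inject[simp]: "pr x y = pr x' y' \<longleftrightarrow> x = x' \<and> y = y'"
proof
  assume "pr x y = pr x' y'"
  then have "{set_encode {x}, set_encode {x, y}} = {set_encode {x'}, set_encode {x', y'}}"
    unfolding pr_def by (subst (asm) set_encode_eq) simp_all
  then have "{x} = {x'} \<and> {x, y} = {x', y'} \<or> {x} = {x', y'} \<and> {x, y} = {x'}"
    by (simp only: doubleton_eq_iff[of "set_encode _"] set_encode_eq finite.intros)
  then show "x = x' \<and> y = y'" by (auto simp: doubleton_eq_iff)
qed simp

lemma mem_less_set_encode: "finite A \<Longrightarrow> x \<in> A \<Longrightarrow> x < set_encode A"
  using set_decode_bound[of x "set_encode A"] by simp

lemma pr_less: "x < pr x y" "y < pr x y"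
proof -
  have "x < set_encode {x, y}" "y < set_encode {x, y}" by (auto intro!: mem_less_set_encode)
  moreover have "set_encode {x, y} < pr x y" unfolding pr_def by (rule mem_less_set_encode) auto
  ultimately show "x < pr x y" "y < pr x y" by auto
qed

text \<open>A set code is odd exactly if 0 is a member, and both members of a Kuratowski pair encode
  non-empty sets. Odd numbers are thereby free to serve as elements that cannot be confused with
  pairs.\<close>

lemma even_pr: "even (pr x y)"
proof -
  have "set_encode {x} > 0" "set_encode {x, y} > 0"
    using mem_less_set_encode[of "{x}" x] mem_less_set_encode[of "{x, y}" x] by auto
  then show ?thesis unfolding pr_def by (subst even_set_encode_iff) auto
qed

text \<open>Patterns cannot look into pairs, so all pairs are identified.\<close>
definition vstar :: val where "vstar = VPair vtrue vtrue"

fun col :: "val \<Rightarrow> val" where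
  "col (VCon c vs) = VCon c (map col vs)"
| "col (VPair _ _) = vstar"
| "col (VFun f vs) = VFun f vs"

lemma col_VCon: "col v = VCon c us \<longleftrightarrow> (\<exists>vs. v = VCon c vs \<and> us = map col vs)"
  by (cases v) (auto simp: vstar_def)

lemma col_enc_list[simp]: "col (enc_list w) = enc_list w"
  by (induction w) (auto simp: vtrue_def vfalse_def)

fun shape :: "pat \<Rightarrow> val \<Rightarrow> bool" where
  "shape (PVar x) v = True"
| "shape (PCon c ps) v = (\<exists>vs. v = VCon c vs \<and> list_all2 shape ps vs)"

lemma pinst_cong: "(\<And>x. x \<in> set (pvars l) \<Longrightarrow> \<gamma> x = \<gamma>' x) \<Longrightarrow> pinst \<gamma> l = pinst \<gamma>' l"
  by (induction l) auto

lemma shape_pinst: "shape l (pinst \<gamma> l)"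
  by (induction l) (auto simp: list_all2_conv_all_nth)

lemma shapes_match_env:
  assumes "\<And>l v. l \<in> set ls \<Longrightarrow> shape l v \<Longrightarrow> distinct (pvars l) \<Longrightarrow>
      \<exists>\<gamma>. dom \<gamma> = set (pvars l) \<and> v = pinst \<gamma> l"
    and "list_all2 shape ls vs" "distinct (lhs_vars ls)"
  shows "\<exists>\<gamma>. match_env ls vs \<gamma>"
  using assms(2,3,1)
proof (induction rule: list_all2_induct)
  case Nil
  show ?case by (auto simp: match_env_def lhs_vars_def intro!: exI[of _ Map.empty])
next
  case (Cons l ls v vs)
  obtain \<gamma>1 where 1: "dom \<gamma>1 = set (pvars l)" "v = pinst \<gamma>1 l"
    using Cons.prems(2)[of l v] Cons.prems(1) Cons.hyps(1) by (auto simp: lhs_vars_def)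
  obtain \<gamma>2 where 2: "dom \<gamma>2 = set (lhs_vars ls)" "vs = map (pinst \<gamma>2) ls"
    using Cons.IH Cons.prems by (auto simp: lhs_vars_def match_env_def)
  have disj: "set (pvars l) \<inter> set (lhs_vars ls) = {}" using Cons.prems(1) by (auto simp: lhs_vars_def)
  have "pinst (\<gamma>1 ++ \<gamma>2) l = pinst \<gamma>1 l"
    by (rule pinst_cong) (use disj 1 2 in \<open>auto simp: map_add_def split: option.split\<close>)
  moreover have "pinst (\<gamma>1 ++ \<gamma>2) l' = pinst \<gamma>2 l'" if "l' \<in> set ls" for l'
  proof (rule pinst_cong)
    fix x assume "x \<in> set (pvars l')"
    then have "x \<in> dom \<gamma>2" using that 2 by (auto simp: lhs_vars_def)
    then show "(\<gamma>1 ++ \<gamma>2) x = \<gamma>2 x" by (auto simp: map_add_def)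
  qed
  ultimately show ?case using 1 2
    by (intro exI[of _ "\<gamma>1 ++ \<gamma>2"]) (auto simp: match_env_def lhs_vars_def)
qed

lemma shape_match:
  "shape l v \<Longrightarrow> distinct (pvars l) \<Longrightarrow> \<exists>\<gamma>. dom \<gamma> = set (pvars l) \<and> v = pinst \<gamma> l"
proof (induction l arbitrary: v)
  case (PVar x)
  have "dom [x \<mapsto> v] = set (pvars (PVar x)) \<and> v = pinst [x \<mapsto> v] (PVar x)" by (auto simp: dom_def)
  then show ?case by blast
next
  case (PCon c ps)
  then obtain vs where vs: "v = VCon c vs" "list_all2 shape ps vs" by auto
  obtain \<gamma> where "match_env ps vs \<gamma>"
    using shapes_match_env[OF PCon.IH vs(2)] PCon.prems(2) by (auto simp: lhs_vars_def)
  then show ?case using vs by (auto simp: match_env_def lhs_vars_def intro!: exI[of _ \<gamma>])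
qed

text \<open>For linear patterns no two occurrences of a variable have to agree, so the existence of
  a matching environment is a condition on the shape alone. Such a condition can be read off
  codes.\<close>

lemma clause_matches_iff:
  assumes "distinct (lhs_vars ls)"
  shows "clause_matches (g, ls, s) f vs \<longleftrightarrow> g = f \<and> list_all2 shape ls vs"
proof
  assume "clause_matches (g, ls, s) f vs"
  then show "g = f \<and> list_all2 shape ls vs"
    by (auto simp: clause_matches_def match_env_def list_all2_conv_all_nth shape_pinst)
next
  assume "g = f \<and> list_all2 shape ls vs"
  then show "clause_matches (g, ls, s) f vs"
    using shapes_match_env[OF shape_match _ assms] by (auto simp: clause_matches_def)
qed

lemma apps_simps[simp]: "apps h [] = h" "apps h (e # es) = apps (EApp h e) es"
  "apps h (es @ [e]) = EApp (apps h es) e"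
  by (auto simp: apps_def)

text \<open>\<open>cst\<close> contains the data that clauses write down explicitly, closed under
  components, and \<open>u\<close> is the common bound below which all codes are chosen. The data
  codes themselves are strictly below \<open>u\<close>.\<close>

locale abstraction =
  fixes p :: prog and cst :: "val list" and w :: "bool list" and u :: nat
  assumes code_bound: "length w + length cst < u"
    and cst_closed: "VCon c vs \<in> set cst \<Longrightarrow> v \<in> set vs \<Longrightarrow> v \<in> set cst"
    and cst_bool: "vtrue \<in> set cst" "vfalse \<in> set cst"
    and linear: "(f, ls, s) \<in> set p \<Longrightarrow> distinct (lhs_vars ls)"
begin

text \<open>Codes up to \<open>M\<close> stand for data: \<open>d \<le> length w\<close> for a suffix of the input, larger ones for
  the constants of the program. A code above \<open>M\<close> stands for a functional value, of which it
  lists some argument/result pairs. A datum may have several codes.\<close>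

definition M :: nat where "M = length w + length cst"

definition vl :: "nat \<Rightarrow> val" where
  "vl d = (if d \<le> length w then enc_list (drop d w) else cst ! (d - length w - 1))"

definition con :: "string \<Rightarrow> nat list \<Rightarrow> nat \<Rightarrow> bool" where
  "con c ys d \<longleftrightarrow> d \<le> M \<and> (\<forall>y \<in> set ys. y \<le> M) \<and> vl d = VCon c (map vl ys)"

text \<open>An order of information: a larger functional code lists more behaviour, while data can
  only be replaced by another code of the same value.\<close>

definition le :: "nat \<Rightarrow> nat \<Rightarrow> bool" where
  "le d d' \<longleftrightarrow> (d \<le> M \<and> d' \<le> M \<and> vl d = vl d') \<or>
     (M < d \<and> M < d' \<and> set_decode d \<subseteq> set_decode d')"

text \<open>Evaluation to codes, relative to a relation \<open>R\<close> for calls. The list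
  \<open>ys\<close> holds the codes of arguments pending above the expression and is used only to
  reach a constructor at the head of an application; every other head requires it to be empty. A
  variable may be used at any smaller code, which discards pairs that are not wanted here. A
  functional application succeeds if some code of the function lists the required pair.\<close>

fun aev :: "(string \<Rightarrow> nat list \<Rightarrow> nat \<Rightarrow> bool) \<Rightarrow> (string \<Rightarrow> nat) \<Rightarrow> expr \<Rightarrow> nat list \<Rightarrow> nat \<Rightarrow> bool" where
  "aev R \<rho> (EVar x) ys d \<longleftrightarrow> ys = [] \<and> le d (\<rho> x)"
| "aev R \<rho> (ECon c) ys d \<longleftrightarrow> con c ys d"
| "aev R \<rho> (EFun f) ys d \<longleftrightarrow> ys = [] \<and> R f [] d"
| "aev R \<rho> (EIf a b c) ys d \<longleftrightarrow> ys = [] \<and>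
     ((\<exists>z<u. z \<le> M \<and> vl z = vtrue \<and> aev R \<rho> a [] z) \<and> aev R \<rho> b [] d \<or>
      (\<exists>z<u. z \<le> M \<and> vl z = vfalse \<and> aev R \<rho> a [] z) \<and> aev R \<rho> c [] d)"
| "aev R \<rho> (EChoose es) ys d \<longleftrightarrow> ys = [] \<and> (\<exists>e \<in> set es. aev R \<rho> e [] d)"
| "aev R \<rho> (EPair a b) ys d \<longleftrightarrow> ys = [] \<and> d \<le> M \<and> vl d = vstar \<and>
     (\<exists>z<u. aev R \<rho> a [] z) \<and> (\<exists>z<u. aev R \<rho> b [] z)"
| "aev R \<rho> (EApp a b) ys d \<longleftrightarrow> (\<exists>y<u. aev R \<rho> b [] y \<and>
     (aev R \<rho> a (y # ys) d \<or>
      ys = [] \<and> (\<exists>A<u. M < A \<and> pr y d \<in> set_decode A \<and> aev R \<rho> a [] A)))"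

fun ashape :: "pat \<Rightarrow> nat \<Rightarrow> bool" where
  "ashape (PVar x) d = True"
| "ashape (PCon c ps) d = (\<exists>ys. con c ys d \<and> list_all2 ashape ps ys)"

fun amatch :: "(string \<Rightarrow> nat) \<Rightarrow> pat \<Rightarrow> nat \<Rightarrow> bool" where
  "amatch \<rho> (PVar x) d = (\<rho> x = d)"
| "amatch \<rho> (PCon c ps) d = (\<exists>ys. con c ys d \<and> list_all2 (amatch \<rho>) ps ys)"

definition clause_closed :: "(string \<Rightarrow> nat list \<Rightarrow> nat \<Rightarrow> bool) \<Rightarrow> nat \<Rightarrow> bool" where
  "clause_closed R j \<longleftrightarrow> (case p ! j of (f, ls, s) \<Rightarrow> \<forall>\<rho> ds d.
        (\<forall>x \<in> set (lhs_vars ls). \<rho> x < u) \<longrightarrow> (\<forall>d \<in> set ds. d < u) \<longrightarrow> d < u \<longrightarrow>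
        list_all2 (amatch \<rho>) ls ds \<longrightarrow>
        (\<forall>i<j. fst (p ! i) = f \<longrightarrow> \<not> list_all2 ashape (fst (snd (p ! i))) ds) \<longrightarrow>
        aev R \<rho> s [] d \<longrightarrow> R f ds d)"

definition closed :: "(string \<Rightarrow> nat list \<Rightarrow> nat \<Rightarrow> bool) \<Rightarrow> bool" where
  "closed R \<longleftrightarrow>
     (\<forall>f \<in> fst ` set p. \<forall>ds A. length ds < arity p f \<longrightarrow> (\<forall>d \<in> set ds. d < u) \<longrightarrow> M < A \<longrightarrow> A < u \<longrightarrow>
        (\<forall>x<u. \<forall>y<u. pr x y \<in> set_decode A \<longrightarrow> R f (ds @ [x]) y) \<longrightarrow> R f ds A) \<and>
     (\<forall>j < length p. clause_closed R j)"

definition goal_expr :: expr where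
  "goal_expr = EApp (EFun (main_fun p)) (EVar ''x'')"

definition goal :: "(string \<Rightarrow> nat list \<Rightarrow> nat \<Rightarrow> bool) \<Rightarrow> bool" where
  "goal R \<longleftrightarrow> (\<exists>z<u. z \<le> M \<and> vl z = vtrue \<and> aev R (\<lambda>_. 0) goal_expr [] z)"

text \<open>The least closed relation, written as an intersection: quantification over all closed
  relations is the form that turns into a quantifier over numbers in the final formula.\<close>

definition acall :: "string \<Rightarrow> nat list \<Rightarrow> nat \<Rightarrow> bool" where
  "acall f ds d \<longleftrightarrow> (\<forall>R. closed R \<longrightarrow> R f ds d)"

lemma le_refl[simp]: "le d d"
  by (auto simp: le_def)

lemma le_trans: "le a b \<Longrightarrow> le b c \<Longrightarrow> le a c"
  by (auto simp: le_def)

text \<open>Evaluation consults \<open>R\<close> only at calls without arguments, since all other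
  calls are made through listings. Two relations need therefore be compared on the empty argument
  list only.\<close>

lemma aev_mono:
  assumes "\<And>f d. R f [] d \<Longrightarrow> R' f [] d" "\<And>x. x \<in> evars e \<Longrightarrow> le (\<rho> x) (\<rho>' x)"
  shows "aev R \<rho> e ys d \<Longrightarrow> aev R' \<rho>' e ys d"
  using assms(2)
proof (induction e arbitrary: ys d)
  case (EVar x)
  then show ?case using le_trans by auto
next
  case (EFun f)
  then show ?case using assms(1) by auto
next
  case (EIf a b c)
  have "aev R' \<rho>' a ys d" if "aev R \<rho> a ys d" for ys d using EIf.IH(1)[OF that] EIf.prems by auto
  moreover have "aev R' \<rho>' b ys d" if "aev R \<rho> b ys d" for ys d using EIf.IH(2)[OF that] EIf.prems by auto
  moreover have "aev R' \<rho>' c ys d" if "aev R \<rho> c ys d" for ys d using EIf.IH(3)[OF that] EIf.prems by auto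
  ultimately show ?case using EIf.prems(1) unfolding aev.simps by blast
next
  case (EChoose es)
  then show ?case by fastforce
next
  case (EPair a b)
  have "aev R' \<rho>' a ys d" if "aev R \<rho> a ys d" for ys d using EPair.IH(1)[OF that] EPair.prems by auto
  moreover have "aev R' \<rho>' b ys d" if "aev R \<rho> b ys d" for ys d using EPair.IH(2)[OF that] EPair.prems by auto
  ultimately show ?case using EPair.prems(1) unfolding aev.simps by blast
next
  case (EApp a b)
  have "aev R' \<rho>' a ys d" if "aev R \<rho> a ys d" for ys d using EApp.IH(1)[OF that] EApp.prems by auto
  moreover have "aev R' \<rho>' b ys d" if "aev R \<rho> b ys d" for ys d using EApp.IH(2)[OF that] EApp.prems by auto
  ultimately show ?case using EApp.prems(1) unfolding aev.simps by blast
qed auto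

lemma goal_mono: "(\<And>f d. R f [] d \<Longrightarrow> R' f [] d) \<Longrightarrow> goal R \<Longrightarrow> goal R'"
  unfolding goal_def using aev_mono[of R R' goal_expr "\<lambda>_. 0" "\<lambda>_. 0"] le_refl by blast

lemma closed_acall: "closed acall"
proof -
  have 1: "acall f ds A" if "f \<in> fst ` set p" "length ds < arity p f" "\<forall>d \<in> set ds. d < u" "M < A" "A < u"
    "\<forall>x<u. \<forall>y<u. pr x y \<in> set_decode A \<longrightarrow> acall f (ds @ [x]) y" for f ds A
    unfolding acall_def
  proof (intro allI impI)
    fix R assume R: "closed R"
    then have "\<forall>x<u. \<forall>y<u. pr x y \<in> set_decode A \<longrightarrow> R f (ds @ [x]) y"
      using that unfolding acall_def by blast
    then show "R f ds A" using R that unfolding closed_def by blast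
  qed
  have 2: "acall f ds d" if j: "j < length p" "p ! j = (f, ls, s)" and prems: "\<forall>x \<in> set (lhs_vars ls). \<rho> x < u"
    "\<forall>d \<in> set ds. d < u" "d < u" "list_all2 (amatch \<rho>) ls ds"
    "\<forall>i<j. fst (p ! i) = f \<longrightarrow> \<not> list_all2 ashape (fst (snd (p ! i))) ds"
    "aev acall \<rho> s [] d" for f ls s j \<rho> ds d
    unfolding acall_def
  proof (intro allI impI)
    fix R assume R: "closed R"
    then have "aev R \<rho> s [] d" using prems(6) by (rule_tac aev_mono[of acall]) (auto simp: acall_def)
    moreover have "clause_closed R j" using R j(1) unfolding closed_def by blast
    ultimately show "R f ds d" using prems unfolding clause_closed_def j(2) prod.case by blast
  qed
  show ?thesis unfolding closed_def
  proof (intro conjI)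
    show "\<forall>j < length p. clause_closed acall j" using 2 unfolding clause_closed_def by (auto split: prod.split)
  qed (use 1 in blast)
qed

lemmas acall_fun = closed_acall[unfolded closed_def, THEN conjunct1, rule_format]

lemma acall_clause:
  assumes "j < length p" "p ! j = (f, ls, s)" "\<And>x. x \<in> set (lhs_vars ls) \<Longrightarrow> \<rho> x < u"
    "\<And>d. d \<in> set ds \<Longrightarrow> d < u" "d < u" "list_all2 (amatch \<rho>) ls ds"
    "\<And>i. i < j \<Longrightarrow> fst (p ! i) = f \<Longrightarrow> \<not> list_all2 ashape (fst (snd (p ! i))) ds"
    "aev acall \<rho> s [] d"
  shows "acall f ds d"
proof -
  have "clause_closed acall j"
    using closed_acall assms(1) unfolding closed_def by blast
  then show ?thesis unfolding clause_closed_def assms(2) prod.case using assms by blast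
qed

subsection \<open>Soundness\<close>

text \<open>A non-empty suffix of the input splits into a truth value, which is among the constants,
  and the next suffix; the constants are closed under components by assumption.\<close>

lemma codes_closed: "vl d = VCon c vs \<Longrightarrow> d \<le> M \<Longrightarrow> v \<in> set vs \<Longrightarrow> \<exists>y \<le> M. vl y = v"
proof -
  assume d: "vl d = VCon c vs" "d \<le> M" and v: "v \<in> set vs"
  have const: "\<exists>y \<le> M. vl y = z" if "z \<in> set cst" for z
  proof -
    obtain i where "i < length cst" "cst ! i = z" using \<open>z \<in> set cst\<close> by (metis in_set_conv_nth)
    then show ?thesis by (intro exI[of _ "length w + 1 + i"]) (auto simp: M_def vl_def)
  qed
  show ?thesis
  proof (cases "d \<le> length w")
    case True
    show ?thesis
    proof (cases "drop d w")
      case Nil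
      then show ?thesis using d True v by (auto simp: vl_def)
    next
      case (Cons b w')
      then have "d < length w" by (metis drop_all leI list.distinct(1))
      moreover have "w' = drop (Suc d) w" using Cons by (metis drop_Suc list.sel(3) tl_drop)
      ultimately have tl: "vl (Suc d) = enc_list w'" "Suc d \<le> M" by (auto simp: vl_def M_def)
      have "v = enc_list w' \<or> v = vtrue \<or> v = vfalse"
        using d(1) True v Cons by (auto simp: vl_def split: if_splits)
      then show ?thesis using tl const[OF cst_bool(1)] const[OF cst_bool(2)] by blast
    qed
  next
    case False
    then have "vl d \<in> set cst" using d(2) by (auto simp: vl_def M_def)
    then show ?thesis using d v cst_closed const by auto
  qed
qed

text \<open>A logical relation by recursion on the code instead of the type, which keeps soundness
  free of typing. It is well-founded because elements of a set are smaller than its code, and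
  components smaller than their pair.\<close>

function real :: "val \<Rightarrow> nat \<Rightarrow> bool" where
  "real v d = (if d \<le> M then col v = vl d else
     (\<exists>f vs. v = VFun f vs \<and> (\<forall>x y. pr x y \<in> set_decode d \<longrightarrow>
        (\<forall>v'. real v' x \<longrightarrow> (\<exists>z. call p f (vs @ [v']) z \<and> real z y)))))"
  by pat_completeness auto
termination
proof (relation "measure snd")
  fix d x y assume "pr x y \<in> set_decode d"
  then have "pr x y < d" by (rule set_decode_bound)
  with pr_less[of x y] pr_less[of y x] have "x < d" "y < d" using pr_less less_trans by blast+
  then show "((v', x), (v, d)) \<in> measure snd" "((z, y), (v, d)) \<in> measure snd"
    for v v' z by auto
qed auto

declare real.simps[simp del]

lemma real_le: "real v d' \<Longrightarrow> le d d' \<Longrightarrow> real v d"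
  unfolding le_def by (subst (asm) real.simps, subst real.simps) fastforce

text \<open>Both directions matter: a clause is selected if its own patterns match and those of all
  earlier clauses do not, so failure to match has to be transferred as well as success. Components
  of a coded datum have codes, which provides the witnesses for the direction from values to
  codes.\<close>

lemma shape_ashape:
  assumes "(d \<le> M \<and> col v = vl d) \<or> (M < d \<and> (\<exists>f vs. v = VFun f vs))"
  shows "ashape l d \<longleftrightarrow> shape l v"
  using assms
proof (induction l arbitrary: v d)
  case (PCon c ps)
  show ?case
  proof (cases "d \<le> M")
    case True
    then have cv: "col v = vl d" using PCon.prems by auto
    show ?thesis
    proof
      assume "ashape (PCon c ps) d"
      then obtain ys where ys: "con c ys d" "list_all2 ashape ps ys" by auto
      then obtain vs where vs: "v = VCon c vs" "map vl ys = map col vs"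
        using cv by (auto simp: con_def col_VCon)
      have l: "length vs = length ps" using ys(2) vs(2) by (metis length_map list_all2_lengthD)
      have "list_all2 shape ps vs" unfolding list_all2_conv_all_nth
      proof (intro conjI allI impI)
        fix i assume i: "i < length ps"
        then have "ashape (ps ! i) (ys ! i)" using ys(2) by (auto simp: list_all2_conv_all_nth)
        moreover have "ys ! i \<le> M" using ys i l vs(2) by (auto simp: con_def list_all2_conv_all_nth)
        moreover have "col (vs ! i) = vl (ys ! i)"
          using vs(2) i l by (metis length_map nth_map)
        ultimately show "shape (ps ! i) (vs ! i)" using PCon.IH[of "ps ! i" "ys ! i" "vs ! i"] i by auto
      qed (simp add: l)
      then show "shape (PCon c ps) v" using vs by simp
    next
      assume "shape (PCon c ps) v"
      then obtain vs where vs: "v = VCon c vs" "list_all2 shape ps vs" by auto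
      then have "\<forall>i. i < length vs \<longrightarrow> (\<exists>y \<le> M. vl y = col (vs ! i))"
        using cv codes_closed[of d c "map col vs"] True by auto
      then obtain g where g: "\<And>i. i < length vs \<Longrightarrow> g i \<le> M \<and> vl (g i) = col (vs ! i)" by metis
      let ?ys = "map g [0..<length vs]"
      have l: "length vs = length ps" using vs(2) by (metis list_all2_lengthD)
      have e: "map vl ?ys = map col vs" using g by (auto intro: nth_equalityI)
      have "vl d = VCon c (map col vs)" using cv vs by simp
      then have "con c ?ys d" using True g e unfolding con_def by auto
      moreover have "list_all2 ashape ps ?ys" unfolding list_all2_conv_all_nth
      proof (intro conjI allI impI)
        fix i assume i: "i < length ps"
        then show "ashape (ps ! i) (?ys ! i)"
          using PCon.IH[of "ps ! i" "g i" "vs ! i"] g[of i] l vs(2) by (auto simp: list_all2_conv_all_nth)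
      qed (simp add: l)
      ultimately show "ashape (PCon c ps) d" by auto
    qed
  next
    case False
    then show ?thesis using PCon.prems by (auto simp: con_def)
  qed
qed auto

lemma real_cases: "real v d \<Longrightarrow> (d \<le> M \<and> col v = vl d) \<or> (M < d \<and> (\<exists>f vs. v = VFun f vs))"
  by (subst (asm) real.simps) (auto split: if_splits)

lemma real_data: "d \<le> M \<Longrightarrow> real v d \<longleftrightarrow> col v = vl d"
  by (subst real.simps) simp

lemma real_fun: "real v d \<Longrightarrow> M < d \<Longrightarrow> \<exists>f vs. v = VFun f vs \<and> (\<forall>x y. pr x y \<in> set_decode d \<longrightarrow>
        (\<forall>v'. real v' x \<longrightarrow> (\<exists>z. call p f (vs @ [v']) z \<and> real z y)))"
  by (subst (asm) real.simps) simp

lemma con_VCon: "con c ys d \<Longrightarrow> col v = vl d \<Longrightarrow>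
  \<exists>vs. v = VCon c vs \<and> length vs = length ys \<and> (\<forall>i<length ys. ys ! i \<le> M \<and> col (vs ! i) = vl (ys ! i))"
proof -
  assume a: "con c ys d" "col v = vl d"
  then obtain vs where vs: "v = VCon c vs" "map vl ys = map col vs" by (auto simp: con_def col_VCon)
  then have l: "length vs = length ys" by (metis length_map)
  moreover have "col (vs ! i) = vl (ys ! i)" if "i < length ys" for i
    using vs(2) that l by (metis nth_map)
  ultimately show ?thesis using vs a(1) by (auto simp: con_def)
qed

lemma amatch_real:
  assumes "amatch \<rho> l d" "real (pinst \<gamma> l) d" "x \<in> set (pvars l)"
  shows "real (the (\<gamma> x)) (\<rho> x)"
  using assms
proof (induction l arbitrary: d)
  case (PCon c ps)
  then obtain ys where ys: "con c ys d" "list_all2 (amatch \<rho>) ps ys" by auto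
  then have "col (pinst \<gamma> (PCon c ps)) = vl d" using PCon.prems(2) real_data con_def by blast
  from con_VCon[OF ys(1) this] have *: "\<forall>i<length ys. ys ! i \<le> M \<and> col (pinst \<gamma> (ps ! i)) = vl (ys ! i)"
    by auto
  obtain l where "l \<in> set ps" "x \<in> set (pvars l)" using PCon.prems(3) by auto
  then obtain i where i: "i < length ps" "x \<in> set (pvars (ps ! i))" by (metis in_set_conv_nth)
  then have "amatch \<rho> (ps ! i) (ys ! i)" "i < length ys" using ys(2) by (auto simp: list_all2_conv_all_nth)
  with PCon.IH[of "ps ! i" "ys ! i"] i * show ?case by (auto simp: real_data)
qed auto

lemma amatch_ashape: "amatch \<rho> l d \<Longrightarrow> ashape l d"
proof (induction l arbitrary: d)
  case (PCon c ps)
  then obtain ys where "con c ys d" "list_all2 (amatch \<rho>) ps ys" by auto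
  moreover then have "list_all2 ashape ps ys" using PCon.IH by (auto simp: list_all2_conv_all_nth)
  ultimately show ?case by auto
qed auto

text \<open>The closed relation at which the assumption "every closed relation reaches the goal"
  will be instantiated. Its closedness is the soundness of the abstract rules.\<close>

definition sound_call :: "string \<Rightarrow> nat list \<Rightarrow> nat \<Rightarrow> bool" where
  "sound_call f ds d \<longleftrightarrow> (\<forall>vs. list_all2 real vs ds \<longrightarrow> (\<exists>z. call p f vs z \<and> real z d))"

text \<open>The list \<open>es\<close> collects the arguments of a constructor at the head of \<open>e\<close>.\<close>
lemma aev_sound:
  assumes "aev sound_call \<rho> e ys d" "\<And>x. x \<in> evars e \<Longrightarrow> \<exists>v. \<gamma> x = Some v \<and> real v (\<rho> x)"
    "list_all2 (eval p \<gamma>) es vs" "list_all2 real vs ys"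
  shows "\<exists>z. eval p \<gamma> (apps e es) z \<and> real z d"
  using assms
proof (induction e arbitrary: ys d es vs)
  case (EVar x)
  then have "es = []" "le d (\<rho> x)" by auto
  then show ?case using EVar.prems(2)[of x] by (auto intro: ev_var real_le)
next
  case (ECon c)
  then have d: "d \<le> M" "\<forall>y \<in> set ys. y \<le> M" "vl d = VCon c (map vl ys)" by (auto simp: con_def)
  have "eval p \<gamma> (apps (ECon c) es) (VCon c vs)"
    using ECon.prems(3) by (intro ev_con) (auto simp: list_all2_conv_all_nth)
  moreover have "map col vs = map vl ys"
    using ECon.prems(4) d(2) by (intro nth_equalityI) (auto simp: list_all2_conv_all_nth real_data)
  then have "real (VCon c vs) d" using d by (simp add: real_data)
  ultimately show ?case by blast
next
  case (EFun f)
  then have "es = []" "sound_call f [] d" by auto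
  then show ?case by (auto simp: sound_call_def intro: ev_fun)
next
  case (EIf a b c)
  then have es: "es = []" "ys = []" by auto
  have a: "\<exists>v. eval p \<gamma> a v \<and> real v z" if "aev sound_call \<rho> a [] z" for z
    using EIf.IH(1)[OF that, of "[]" "[]"] EIf.prems by auto
  have b: "\<exists>v. eval p \<gamma> b v \<and> real v z" if "aev sound_call \<rho> b [] z" for z
    using EIf.IH(2)[OF that, of "[]" "[]"] EIf.prems by auto
  have c: "\<exists>v. eval p \<gamma> c v \<and> real v z" if "aev sound_call \<rho> c [] z" for z
    using EIf.IH(3)[OF that, of "[]" "[]"] EIf.prems by auto
  have t: "eval p \<gamma> a vtrue" if "aev sound_call \<rho> a [] z" "z \<le> M" "vl z = vtrue" for z
    using a[OF that(1)] that by (auto simp: real_data vtrue_def col_VCon)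
  have f: "eval p \<gamma> a vfalse" if "aev sound_call \<rho> a [] z" "z \<le> M" "vl z = vfalse" for z
    using a[OF that(1)] that by (auto simp: real_data vfalse_def col_VCon)
  from EIf.prems(1) consider z where "z \<le> M" "vl z = vtrue" "aev sound_call \<rho> a [] z" "aev sound_call \<rho> b [] d"
    | z where "z \<le> M" "vl z = vfalse" "aev sound_call \<rho> a [] z" "aev sound_call \<rho> c [] d" by auto
  then show ?case
  proof cases
    case 1
    then show ?thesis using t[of z] b[of d] es by (auto intro: ev_if_true)
  next
    case 2
    then show ?thesis using f[of z] c[of d] es by (auto intro: ev_if_false)
  qed
next
  case (EChoose es')
  then have es: "es = []" "ys = []" by auto
  obtain e where e: "e \<in> set es'" "aev sound_call \<rho> e [] d" using EChoose.prems by auto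
  then obtain z where "eval p \<gamma> e z" "real z d"
    using EChoose.IH[OF e(1) e(2), of "[]" "[]"] EChoose.prems(2) by auto
  then show ?case using e es by (auto intro: ev_choose)
next
  case (EPair a b)
  then have es: "es = []" "ys = []" by auto
  have a: "\<exists>v. eval p \<gamma> a v \<and> real v z" if "aev sound_call \<rho> a [] z" for z
    using EPair.IH(1)[OF that, of "[]" "[]"] EPair.prems by auto
  have b: "\<exists>v. eval p \<gamma> b v \<and> real v z" if "aev sound_call \<rho> b [] z" for z
    using EPair.IH(2)[OF that, of "[]" "[]"] EPair.prems by auto
  have "\<exists>v1. eval p \<gamma> a v1" "\<exists>v2. eval p \<gamma> b v2" "d \<le> M" "vl d = vstar"
    using a b EPair.prems(1) by auto
  then obtain v1 v2 where "eval p \<gamma> a v1" "eval p \<gamma> b v2" "d \<le> M" "vl d = vstar" by blast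
  then show ?case using es by (auto simp: real_data intro!: exI[of _ "VPair v1 v2"] ev_pair)
next
  case (EApp a b)
  then obtain y where y: "aev sound_call \<rho> b [] y" and
    disj: "aev sound_call \<rho> a (y # ys) d \<or>
      ys = [] \<and> (\<exists>A<u. M < A \<and> pr y d \<in> set_decode A \<and> aev sound_call \<rho> a [] A)" by auto
  obtain v where v: "eval p \<gamma> b v" "real v y"
    using EApp.IH(2)[OF y, of "[]" "[]"] EApp.prems by auto
  from disj show ?case
  proof
    assume "aev sound_call \<rho> a (y # ys) d"
    from EApp.IH(1)[OF this, of "b # es" "v # vs"] show ?thesis using EApp.prems v by auto
  next
    assume "ys = [] \<and> (\<exists>A<u. M < A \<and> pr y d \<in> set_decode A \<and> aev sound_call \<rho> a [] A)"
    then obtain A where A: "ys = []" "M < A" "pr y d \<in> set_decode A" "aev sound_call \<rho> a [] A" by auto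
    obtain z where z: "eval p \<gamma> a z" "real z A"
      using EApp.IH(1)[OF A(4), of "[]" "[]"] EApp.prems by auto
    from real_fun[OF z(2) A(2)] A(3) v(2) obtain f fs z' where
      "z = VFun f fs" "call p f (fs @ [v]) z'" "real z' d" by blast
    then show ?thesis using EApp.prems(3,4) A(1) z(1) v(1) by (auto intro: ev_app)
  qed
qed

lemma closed_sound_call:
  assumes vars: "\<And>f ls s. (f, ls, s) \<in> set p \<Longrightarrow> evars s \<subseteq> set (lhs_vars ls)"
  shows "closed sound_call"
  unfolding closed_def
proof (intro conjI ballI allI impI)
  fix f ds A
  assume len: "length ds < arity p f" and A: "M < A" "A < u"
    and R: "\<forall>x<u. \<forall>y<u. pr x y \<in> set_decode A \<longrightarrow> sound_call f (ds @ [x]) y"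
  show "sound_call f ds A" unfolding sound_call_def
  proof (intro allI impI)
    fix vs assume vs: "list_all2 real vs ds"
    then have "length vs = length ds" by (rule list_all2_lengthD)
    then have "call p f vs (VFun f vs)" using len by (intro call_partial) simp
    moreover have "real (VFun f vs) A"
    proof -
      have "\<exists>z. call p f (vs @ [v']) z \<and> real z y" if m: "pr x y \<in> set_decode A" and v': "real v' x" for x y v'
      proof -
        have "x < u" "y < u" using set_decode_bound[OF m] pr_less[of x y] pr_less[of y x] A pr_less(2)[where x = x and y = y] by auto
        then have "sound_call f (ds @ [x]) y" using R m by blast
        moreover have "list_all2 real (vs @ [v']) (ds @ [x])" using vs v' by (simp add: list_all2_appendI)
        ultimately show ?thesis unfolding sound_call_def by blast
      qed
      then show ?thesis using A by (subst real.simps) auto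
    qed
    ultimately show "\<exists>z. call p f vs z \<and> real z A" by blast
  qed
next
  fix j assume j: "j < length p"
  obtain f ls s where pj: "p ! j = (f, ls, s)" by (cases "p ! j")
  then have mem: "(f, ls, s) \<in> set p" using j nth_mem by metis
  have "sound_call f ds d" if am: "list_all2 (amatch \<rho>) ls ds"
    and no: "\<forall>i<j. fst (p ! i) = f \<longrightarrow> \<not> list_all2 ashape (fst (snd (p ! i))) ds"
    and ev: "aev sound_call \<rho> s [] d" for \<rho> ds d
    unfolding sound_call_def
  proof (intro allI impI)
    fix vs assume vs: "list_all2 real vs ds"
    have sh: "list_all2 ashape ls' ds \<longleftrightarrow> list_all2 shape ls' vs" for ls'
    proof -
      have "ashape l (ds ! i) \<longleftrightarrow> shape l (vs ! i)" if "i < length ds" for l i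
        using vs that by (intro shape_ashape real_cases) (auto simp: list_all2_conv_all_nth)
      then show ?thesis using vs by (auto simp: list_all2_conv_all_nth)
    qed
    have "list_all2 ashape ls ds" using am by (auto simp: list_all2_conv_all_nth intro: amatch_ashape)
    then obtain \<gamma> where \<gamma>: "match_env ls vs \<gamma>"
      using clause_matches_iff[OF linear[OF mem], of f s f vs] sh by (auto simp: clause_matches_def)
    have "\<not> clause_matches (p ! i) f vs" if "i < j" for i
    proof -
      obtain g ls' s' where pi: "p ! i = (g, ls', s')" by (cases "p ! i")
      then have mem': "(g, ls', s') \<in> set p" using that j nth_mem by (metis less_trans)
      show ?thesis unfolding pi clause_matches_iff[OF linear[OF mem']]
        using no that pi sh by fastforce
    qed
    moreover have "\<exists>v. \<gamma> x = Some v \<and> real v (\<rho> x)" if x: "x \<in> evars s" for x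
    proof -
      have xl: "x \<in> set (lhs_vars ls)" using vars[OF mem] x by auto
      then obtain v where v: "\<gamma> x = Some v" using \<gamma> by (auto simp: match_env_def)
      obtain l where "l \<in> set ls" "x \<in> set (pvars l)" using xl by (auto simp: lhs_vars_def)
      then obtain i where i: "i < length ls" "x \<in> set (pvars (ls ! i))" by (metis in_set_conv_nth)
      have "vs ! i = pinst \<gamma> (ls ! i)" using \<gamma> i by (auto simp: match_env_def)
      then have "real (pinst \<gamma> (ls ! i)) (ds ! i)" using vs i am by (auto simp: list_all2_conv_all_nth)
      from amatch_real[OF _ this i(2)] have "real (the (\<gamma> x)) (\<rho> x)"
        using am i by (auto simp: list_all2_conv_all_nth)
      then show ?thesis using v by auto
    qed
    then obtain z where "eval p \<gamma> s z" "real z d" using aev_sound[OF ev, of \<gamma> "[]" "[]"] by auto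
    ultimately show "\<exists>z. call p f vs z \<and> real z d" using call_clause[OF j pj \<gamma>] by blast
  qed
  then show "clause_closed sound_call j" unfolding clause_closed_def pj by auto
qed

theorem goal_sound:
  assumes "\<And>f ls s. (f, ls, s) \<in> set p \<Longrightarrow> evars s \<subseteq> set (lhs_vars ls)"
    and "\<And>R. closed R \<Longrightarrow> goal R"
  shows "prog_accepts p w"
proof -
  have "closed sound_call" by (rule closed_sound_call) (use assms(1) in blast)
  then obtain z where z: "z \<le> M" "vl z = vtrue" "aev sound_call (\<lambda>_. 0) goal_expr [] z"
    using assms(2) by (auto simp: goal_def)
  have "real (enc_list w) 0" by (simp add: real_data vl_def)
  then obtain v where "eval p [''x'' \<mapsto> enc_list w] goal_expr v" "real v z"
    using aev_sound[OF z(3), of "[''x'' \<mapsto> enc_list w]" "[]" "[]"] by (auto simp: goal_expr_def)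
  then show ?thesis using z by (auto simp: prog_accepts_def goal_expr_def real_data vtrue_def col_VCon)
qed

end

subsection \<open>Completeness\<close>

context abstraction
begin

lemma con_le: "con c ys d \<Longrightarrow> le d d' \<Longrightarrow> con c ys d'"
  by (auto simp: con_def le_def)

lemma le_sym_data: "le d d' \<Longrightarrow> ashape l d' \<Longrightarrow> ashape l d"
  by (cases l) (auto simp: con_def le_def)

lemma amatch_cong: "(\<And>x. x \<in> set (pvars l) \<Longrightarrow> \<rho> x = \<rho>' x) \<Longrightarrow> amatch \<rho> l d \<longleftrightarrow> amatch \<rho>' l d"
proof (induction l arbitrary: d)
  case (PCon c ps)
  then have "amatch \<rho> l' = amatch \<rho>' l'" if "l' \<in> set ps" for l' using that by (intro ext) auto
  then have "list_all2 (amatch \<rho>) ps ys = list_all2 (amatch \<rho>') ps ys" for ys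
    by (auto simp: list_all2_conv_all_nth)
  then show ?case by simp
qed auto

lemma amatch_le:
  assumes "amatch \<rho> l d" "le d d'"
  shows "\<exists>\<rho>'. amatch \<rho>' l d' \<and> (\<forall>x. le (\<rho> x) (\<rho>' x)) \<and> (\<forall>x. x \<notin> set (pvars l) \<longrightarrow> \<rho>' x = \<rho> x)"
proof (cases l)
  case (PVar x)
  then show ?thesis using assms by (intro exI[of _ "\<rho>(x := d')"]) auto
next
  case (PCon c ps)
  then obtain ys where "con c ys d" "list_all2 (amatch \<rho>) ps ys" using assms(1) by auto
  then have "amatch \<rho> l d'" using PCon con_le[OF _ assms(2)] by auto
  then show ?thesis by (intro exI[of _ \<rho>]) auto
qed

lemma amatches_le:
  assumes "list_all2 (amatch \<rho>) ls ds" "list_all2 le ds ds'" "distinct (lhs_vars ls)"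
  shows "\<exists>\<rho>'. list_all2 (amatch \<rho>') ls ds' \<and> (\<forall>x. le (\<rho> x) (\<rho>' x)) \<and>
    (\<forall>x. x \<notin> set (lhs_vars ls) \<longrightarrow> \<rho>' x = \<rho> x)"
  using assms
proof (induction ls arbitrary: \<rho> ds ds')
  case Nil
  then show ?case by (intro exI[of _ \<rho>]) auto
next
  case (Cons l ls)
  obtain d es where d: "ds = d # es" "amatch \<rho> l d" "list_all2 (amatch \<rho>) ls es"
    using Cons.prems(1) by (auto simp: list_all2_Cons1)
  obtain d' es' where d': "ds' = d' # es'" "le d d'" "list_all2 le es es'"
    using Cons.prems(2) d(1) by (auto simp: list_all2_Cons1)
  have disj: "set (pvars l) \<inter> set (lhs_vars ls) = {}" "distinct (lhs_vars ls)"
    using Cons.prems(3) by (auto simp: lhs_vars_def)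
  obtain \<rho>1 where 1: "amatch \<rho>1 l d'" "\<And>x. le (\<rho> x) (\<rho>1 x)" "\<And>x. x \<notin> set (pvars l) \<Longrightarrow> \<rho>1 x = \<rho> x"
    using amatch_le[OF d(2) d'(2)] by blast
  have "amatch \<rho>1 l' = amatch \<rho> l'" if "l' \<in> set ls" for l'
    by (intro ext amatch_cong 1(3)) (use disj that in \<open>auto simp: lhs_vars_def\<close>)
  then have "list_all2 (amatch \<rho>1) ls es" using d(3) by (auto simp: list_all2_conv_all_nth)
  from Cons.IH[OF this d'(3) disj(2)] obtain \<rho>2 where 2: "list_all2 (amatch \<rho>2) ls es'"
    "\<And>x. le (\<rho>1 x) (\<rho>2 x)" "\<And>x. x \<notin> set (lhs_vars ls) \<Longrightarrow> \<rho>2 x = \<rho>1 x" by blast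
  have "amatch \<rho>2 l d'" using 1(1) by (subst amatch_cong[of l \<rho>2 \<rho>1]) (use 2(3) disj in auto)
  moreover have "\<forall>x. le (\<rho> x) (\<rho>2 x)" using 1(2) 2(2) le_trans by blast
  ultimately show ?case using 1(3) 2 d' by (intro exI[of _ \<rho>2]) (auto simp: lhs_vars_def)
qed

lemma con_bound: "con c ys d \<Longrightarrow> y \<in> set ys \<Longrightarrow> y < u"
  using code_bound by (auto simp: con_def M_def)

lemma amatch_bound: "amatch \<rho> l d \<Longrightarrow> d < u \<Longrightarrow> x \<in> set (pvars l) \<Longrightarrow> \<rho> x < u"
proof (induction l arbitrary: d)
  case (PCon c ps)
  then obtain ys where ys: "con c ys d" "list_all2 (amatch \<rho>) ps ys" by auto
  obtain l where "l \<in> set ps" "x \<in> set (pvars l)" using PCon.prems(3) by auto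
  then obtain i where i: "i < length ps" "x \<in> set (pvars (ps ! i))" by (metis in_set_conv_nth)
  then have "amatch \<rho> (ps ! i) (ys ! i)" "ys ! i \<in> set ys" using ys(2) by (auto simp: list_all2_conv_all_nth)
  then show ?case using PCon.IH[of "ps ! i" "ys ! i"] i con_bound[OF ys(1)] by auto
qed auto

lemma amatches_bound: "list_all2 (amatch \<rho>) ls ds \<Longrightarrow> \<forall>d \<in> set ds. d < u \<Longrightarrow> x \<in> set (lhs_vars ls) \<Longrightarrow> \<rho> x < u"
proof -
  assume a: "list_all2 (amatch \<rho>) ls ds" "\<forall>d \<in> set ds. d < u" "x \<in> set (lhs_vars ls)"
  then obtain l where "l \<in> set ls" "x \<in> set (pvars l)" by (auto simp: lhs_vars_def)
  then obtain i where "i < length ls" "x \<in> set (pvars (ls ! i))" by (metis in_set_conv_nth)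
  then show ?thesis using a(1,2) amatch_bound[of \<rho> "ls ! i" "ds ! i"]
    by (auto simp: list_all2_conv_all_nth)
qed

text \<open>Calls remain derivable when the arguments list more behaviour. Instead of an induction
  over derivations, the calls with this property are shown to be closed, so that they include the
  least closed relation.\<close>

definition weak_call :: "string \<Rightarrow> nat list \<Rightarrow> nat \<Rightarrow> bool" where
  "weak_call f ds d \<longleftrightarrow> (\<forall>ds'. list_all2 le ds ds' \<longrightarrow> (\<forall>d' \<in> set ds'. d' < u) \<longrightarrow> acall f ds' d)"

lemma closed_weak_call: "closed weak_call"
  unfolding closed_def
proof (intro conjI ballI allI impI)
  fix f ds A
  assume f: "f \<in> fst ` set p" and len: "length ds < arity p f" and A: "M < A" "A < u"
    and R: "\<forall>x<u. \<forall>y<u. pr x y \<in> set_decode A \<longrightarrow> weak_call f (ds @ [x]) y"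
  show "weak_call f ds A" unfolding weak_call_def
  proof (intro allI impI)
    fix ds' assume le: "list_all2 le ds ds'" and b: "\<forall>d' \<in> set ds'. d' < u"
    have l: "length ds' = length ds" using le by (simp add: list_all2_lengthD)
    show "acall f ds' A"
    proof (rule acall_fun)
      fix x y assume xy: "x < u" "y < u" "pr x y \<in> set_decode A"
      then have "weak_call f (ds @ [x]) y" using R by blast
      moreover have "list_all2 le (ds @ [x]) (ds' @ [x])" using le by (simp add: list_all2_appendI)
      ultimately show "acall f (ds' @ [x]) y" using xy b unfolding weak_call_def by simp
    qed (use f len l A b in auto)
  qed
next
  fix j assume j: "j < length p"
  obtain f ls s where pj: "p ! j = (f, ls, s)" by (cases "p ! j")
  then have mem: "(f, ls, s) \<in> set p" using j nth_mem by metis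
  have "acall f ds' d" if d: "d < u" and am: "list_all2 (amatch \<rho>) ls ds"
    and no: "\<forall>i<j. fst (p ! i) = f \<longrightarrow> \<not> list_all2 ashape (fst (snd (p ! i))) ds"
    and ev: "aev weak_call \<rho> s [] d" and le: "list_all2 le ds ds'" and b: "\<forall>d' \<in> set ds'. d' < u"
    for \<rho> ds ds' d
  proof -
    obtain \<rho>' where \<rho>': "list_all2 (amatch \<rho>') ls ds'" "\<And>x. le (\<rho> x) (\<rho>' x)"
      using amatches_le[OF am le linear[OF mem]] by blast
    show ?thesis
    proof (rule acall_clause[OF j pj _ _ d \<rho>'(1)])
      show "\<rho>' x < u" if "x \<in> set (lhs_vars ls)" for x using amatches_bound[OF \<rho>'(1) b that] .
      show "\<not> list_all2 ashape (fst (snd (p ! i))) ds'" if "i < j" "fst (p ! i) = f" for i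
      proof
        assume "list_all2 ashape (fst (snd (p ! i))) ds'"
        then have "list_all2 ashape (fst (snd (p ! i))) ds"
          using le le_sym_data by (fastforce simp: list_all2_conv_all_nth)
        then show False using no that by blast
      qed
      show "aev acall \<rho>' s [] d"
        by (rule aev_mono[OF _ _ ev]) (use \<rho>' in \<open>auto simp: weak_call_def\<close>)
    qed (use b in auto)
  qed
  then show "clause_closed weak_call j" unfolding clause_closed_def pj
    by (auto simp: weak_call_def)
qed

lemma acall_le: "acall f ds d \<Longrightarrow> list_all2 le ds ds' \<Longrightarrow> \<forall>d' \<in> set ds'. d' < u \<Longrightarrow> acall f ds' d"
  using closed_weak_call unfolding acall_def[of f ds d] weak_call_def by blast

text \<open>The codes of type \<open>\<sigma>\<close>. The odd number \<open>2 * M + 1\<close> is no pair; as an element it lifts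
  functional codes above \<open>M\<close>.\<close>
fun codes :: "ty \<Rightarrow> nat set" where
  "codes (Sort _) = {..M}"
| "codes (Prod _ _) = {..M}"
| "codes (Arrow s t) = {A. M < A \<and>
     (\<forall>z \<in> set_decode A. z = 2 * M + 1 \<or> (\<exists>x \<in> codes s. \<exists>y \<in> codes t. z = pr x y))}"

definition fcode :: "(nat \<times> nat) set \<Rightarrow> nat" where
  "fcode G = set_encode (insert (2 * M + 1) ((\<lambda>(x, y). pr x y) ` G))"

lemma pr_odd: "pr x y \<noteq> Suc (2 * M)" "Suc (2 * M) \<noteq> pr x y"
  using even_pr[of x y] by (metis even_Suc even_mult_iff even_numeral)+

lemma fcode_mem: "finite G \<Longrightarrow> pr x y \<in> set_decode (fcode G) \<longleftrightarrow> (x, y) \<in> G"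
  by (auto simp: fcode_def pr_odd)

lemma fcode_codes: "finite G \<Longrightarrow> G \<subseteq> codes s \<times> codes t \<Longrightarrow> fcode G \<in> codes (Arrow s t)"
proof -
  assume G: "finite G" "G \<subseteq> codes s \<times> codes t"
  have "2 * M + 1 < fcode G" unfolding fcode_def by (rule mem_less_set_encode) (use G in auto)
  then show ?thesis using G by (fastforce simp: fcode_def)
qed

end

subsection \<open>Typing\<close>

text \<open>Typing with a uniform bound on the sizes of the types involved. The bound is imposed at
  the leaves and at pairs, whence it holds for every expression. A program has finitely many
  clauses, so one \<open>H\<close> serves all of them and a single number bounds all codes
  needed.\<close>

inductive btyped :: "nat \<Rightarrow> (string \<Rightarrow> ty) \<Rightarrow> (string \<Rightarrow> ty) \<Rightarrow> (string \<Rightarrow> ty) \<Rightarrow> expr \<Rightarrow> ty \<Rightarrow> bool"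
  for H FC FD \<Gamma> where
  bVar: "size (\<Gamma> x) \<le> H \<Longrightarrow> btyped H FC FD \<Gamma> (EVar x) (\<Gamma> x)"
| bCon: "size (FC c) \<le> H \<Longrightarrow> btyped H FC FD \<Gamma> (ECon c) (FC c)"
| bFun: "size (FD f) \<le> H \<Longrightarrow> btyped H FC FD \<Gamma> (EFun f) (FD f)"
| bIf: "btyped H FC FD \<Gamma> a boolT \<Longrightarrow> btyped H FC FD \<Gamma> b t \<Longrightarrow> btyped H FC FD \<Gamma> c t
     \<Longrightarrow> btyped H FC FD \<Gamma> (EIf a b c) t"
| bChoose: "es \<noteq> [] \<Longrightarrow> (\<forall>e\<in>set es. btyped H FC FD \<Gamma> e t) \<Longrightarrow> btyped H FC FD \<Gamma> (EChoose es) t"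
| bPair: "size (Prod s t) \<le> H \<Longrightarrow> btyped H FC FD \<Gamma> a s \<Longrightarrow> btyped H FC FD \<Gamma> b t \<Longrightarrow> btyped H FC FD \<Gamma> (EPair a b) (Prod s t)"
| bApp: "btyped H FC FD \<Gamma> a (Arrow s t) \<Longrightarrow> btyped H FC FD \<Gamma> b s \<Longrightarrow> btyped H FC FD \<Gamma> (EApp a b) t"

lemma btyped_mono: "btyped H FC FD \<Gamma> e t \<Longrightarrow> H \<le> H' \<Longrightarrow> btyped H' FC FD \<Gamma> e t"
  by (induction rule: btyped.induct) (auto intro: btyped.intros)

lemma btyped_size: "btyped H FC FD \<Gamma> e t \<Longrightarrow> size t \<le> H"
proof (induction rule: btyped.induct)
  case (bChoose es t)
  then show ?case by (cases es) auto
qed auto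

lemma common_bound:
  assumes "\<forall>e\<in>set es. \<exists>H::nat. P H e" "\<And>H H' e. P H e \<Longrightarrow> H \<le> H' \<Longrightarrow> P H' e"
  shows "\<exists>H. \<forall>e\<in>set es. P H e"
  using assms(1)
proof (induction es)
  case (Cons e es)
  then obtain H H' where "P H e" "\<forall>e\<in>set es. P H' e" by auto
  then have "P (max H H') e" "\<forall>e\<in>set es. P (max H H') e" using assms(2) by (meson max.cobounded1 max.cobounded2)+
  then have "\<forall>e\<in>set (e # es). P (max H H') e" by simp
  then show ?case by blast
qed auto

lemma typed_btyped: "typed FC FD \<Gamma> e t \<Longrightarrow> \<exists>H. btyped H FC FD \<Gamma> e t"
proof (induction rule: typed.induct)
  case (4 \<Gamma> a b t c)
  then obtain H1 H2 H3 where "btyped H1 FC FD \<Gamma> a boolT" "btyped H2 FC FD \<Gamma> b t" "btyped H3 FC FD \<Gamma> c t" by auto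
  then have "btyped (H1 + H2 + H3) FC FD \<Gamma> a boolT" "btyped (H1 + H2 + H3) FC FD \<Gamma> b t"
    "btyped (H1 + H2 + H3) FC FD \<Gamma> c t" by (auto elim: btyped_mono)
  then show ?case by (blast intro: bIf)
next
  case (5 es \<Gamma> t)
  have "\<exists>H. \<forall>e\<in>set es. btyped H FC FD \<Gamma> e t"
    by (rule common_bound) (use 5 btyped_mono in auto)
  then show ?case using 5(1) by (blast intro: bChoose)
next
  case (6 \<Gamma> a s b t)
  then obtain H1 H2 where "btyped H1 FC FD \<Gamma> a s" "btyped H2 FC FD \<Gamma> b t" by auto
  then have "btyped (H1 + H2 + size (Prod s t)) FC FD \<Gamma> a s" "btyped (H1 + H2 + size (Prod s t)) FC FD \<Gamma> b t"
    by (auto elim: btyped_mono)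
  then show ?case using bPair[of s t "H1 + H2 + size (Prod s t)"] by (meson le_add2)
next
  case (7 \<Gamma> a s t b)
  then obtain H1 H2 where "btyped H1 FC FD \<Gamma> a (Arrow s t)" "btyped H2 FC FD \<Gamma> b s" by auto
  then have "btyped (H1 + H2) FC FD \<Gamma> a (Arrow s t)" "btyped (H1 + H2) FC FD \<Gamma> b s" by (auto elim: btyped_mono)
  then show ?case by (blast intro: bApp)
qed (auto intro: btyped.intros)

lemma arrows_append: "arrows (ss @ ts) t = arrows ss (arrows ts t)"
  by (induction ss) auto

lemma arrows_eq: "arrows ss t = arrows ss' t' \<Longrightarrow> length ss = length ss' \<Longrightarrow> ss = ss' \<and> t = t'"
proof (induction ss arbitrary: ss')
  case (Cons s ss)
  then show ?case by (cases ss') auto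
qed simp

lemma arrows_Sort_eq: "arrows ss (Sort i) = arrows ss' (Sort i') \<Longrightarrow> ss = ss' \<and> i = i'"
proof (induction ss arbitrary: ss')
  case Nil
  then show ?case by (cases ss') auto
next
  case (Cons s ss)
  then show ?case by (cases ss') auto
qed

lemma arity_ty_arrows: "arity_ty (arrows ks (Sort i)) = length ks"
  by (induction ks) auto

lemma size_arrows: "size t \<le> size (arrows ss t)" "s \<in> set ss \<Longrightarrow> size s < size (arrows ss t)"
  by (induction ss) auto

lemma btyped_apps:
  "btyped H FC FD \<Gamma> (apps h es) t \<Longrightarrow> \<exists>ts. length ts = length es \<and>
     btyped H FC FD \<Gamma> h (arrows ts t) \<and> (\<forall>i<length es. btyped H FC FD \<Gamma> (es ! i) (ts ! i))"
proof (induction es arbitrary: t rule: rev_induct)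
  case (snoc e es)
  then have "btyped H FC FD \<Gamma> (EApp (apps h es) e) t" by simp
  then obtain s where s: "btyped H FC FD \<Gamma> (apps h es) (Arrow s t)" "btyped H FC FD \<Gamma> e s"
    by (cases rule: btyped.cases) auto
  from snoc.IH[OF s(1)] obtain ts where "length ts = length es"
    "btyped H FC FD \<Gamma> h (arrows ts (Arrow s t))" "\<forall>i<length es. btyped H FC FD \<Gamma> (es ! i) (ts ! i)" by blast
  then show ?case using s by (intro exI[of _ "ts @ [s]"]) (auto simp: arrows_append nth_append less_Suc_eq)
qed (auto intro: exI[of _ "[]"])

fun con_headed :: "expr \<Rightarrow> bool" where
  "con_headed (ECon _) = True"
| "con_headed (EApp a _) = con_headed a"
| "con_headed _ = False"

lemma con_headed_apps: "con_headed (apps h es) = con_headed h"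
  by (induction es arbitrary: h) auto

lemma con_headed_iff: "con_headed e \<longleftrightarrow> (\<exists>c ss. e = apps (ECon c) ss)"
proof
  show "con_headed e \<Longrightarrow> \<exists>c ss. e = apps (ECon c) ss"
  proof (induction e)
    case (ECon c)
    then show ?case by (intro exI[of _ c] exI[of _ "[]"]) simp
  next
    case (EApp a b)
    then obtain c ss where "a = apps (ECon c) ss" by auto
    then show ?case by (intro exI[of _ c] exI[of _ "ss @ [b]"]) simp
  qed auto
qed (auto simp: con_headed_apps)

lemma apps_inject: "apps (ECon c) ss = apps (ECon c') ss' \<Longrightarrow> c = c' \<and> ss = ss'"
proof (induction ss arbitrary: ss' rule: rev_induct)
  case Nil
  then show ?case by (cases ss' rule: rev_cases) auto
next
  case (snoc s ss)
  then show ?case by (cases ss' rule: rev_cases) auto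
qed

lemma eval_con_headed: "eval p \<gamma> e z \<Longrightarrow> con_headed e \<Longrightarrow> \<exists>c bs. z = VCon c bs"
proof -
  have "(eval p \<gamma> e z \<longrightarrow> con_headed e \<longrightarrow> (\<exists>c bs. z = VCon c bs)) \<and> (call p f vs z' \<longrightarrow> True)" for f vs z'
  proof (rule impI[THEN conjI[OF _ impI]])
    assume "eval p \<gamma> e z"
    then show "con_headed e \<longrightarrow> (\<exists>c bs. z = VCon c bs)"
      by (induction rule: eval_call.inducts(1)[where ?P2.0 = "\<lambda>_ _ _. True"]) auto
  qed simp
  then show "eval p \<gamma> e z \<Longrightarrow> con_headed e \<Longrightarrow> \<exists>c bs. z = VCon c bs" by blast
qed

text \<open>The number of pending arguments is consulted only by a constructor at the head. An
  expression whose value is a function has no such head, so it can be treated as standing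
  alone.\<close>

lemma fa_nonhead: "\<not> con_headed e \<Longrightarrow> fa FC n e \<Longrightarrow> fa FC m e"
  by (induction e arbitrary: n m) auto

lemma fa_apps: "fa FC n (apps h es) \<longleftrightarrow> fa FC (n + length es) h \<and> (\<forall>e \<in> set es. fa FC 0 e)"
  by (induction es arbitrary: h n) auto

lemma subs_apps: "subs a \<subseteq> subs (EApp a b) \<union> {a}" "subs b \<subseteq> subs (EApp a b)"
  by (auto simp: subs_def)

lemma strict_subs_con: "strict_subs (apps (ECon c) es) = \<Union> (subs ` set es)"
  by (induction es rule: rev_induct) (auto simp: subs_def)

lemma evars_apps: "evars (apps h es) = evars h \<union> \<Union> (evars ` set es)"
  by (induction es rule: rev_induct) auto

lemma eval_apps_con:
  assumes "eval p \<gamma> (apps (ECon c) ss) z"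
  shows "\<exists>bs. z = VCon c bs \<and> length bs = length ss \<and> (\<forall>i<length ss. eval p \<gamma> (ss ! i) (bs ! i))"
proof -
  have h: "con_headed (apps (ECon c) ss)" by (simp add: con_headed_apps)
  from assms show ?thesis
  proof (cases rule: eval.cases)
    case (ev_con bs ss' c')
    then show ?thesis using apps_inject[of c ss c' ss'] by auto
  next
    case (ev_app a f vs b v)
    then have "con_headed a" using h by simp
    then show ?thesis using eval_con_headed[OF ev_app(2)] by simp
  qed (use h in auto)
qed

lemma apps_con_neq[simp]:
  "EVar x \<noteq> apps (ECon c) ss" "EFun f \<noteq> apps (ECon c) ss" "EIf e1 e2 e3 \<noteq> apps (ECon c) ss"
  "EChoose es \<noteq> apps (ECon c) ss" "EPair e1 e2 \<noteq> apps (ECon c) ss"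
  using con_headed_apps[of "ECon c" ss] by (auto dest: sym)

lemma eval_pexp: "eval p \<gamma> (pexp l) z \<Longrightarrow> z = pinst \<gamma> l"
proof (induction l arbitrary: z)
  case (PVar x)
  then have "eval p \<gamma> (EVar x) z" by simp
  then show ?case by cases auto
next
  case (PCon c ps)
  obtain bs where bs: "z = VCon c bs" "length bs = length ps"
    "\<forall>i<length ps. eval p \<gamma> (map pexp ps ! i) (bs ! i)"
    using eval_apps_con[of p \<gamma> c "map pexp ps" z] PCon.prems by auto
  have "bs ! i = pinst \<gamma> (ps ! i)" if "i < length ps" for i
    using PCon.IH[of "ps ! i" "bs ! i"] bs(3) that by auto
  then have "bs = map (pinst \<gamma>) ps" using bs(2) by (intro nth_equalityI) auto
  then show ?case using bs(1) by simp
qed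

lemma arity_clause: "n < arity p f \<Longrightarrow> \<exists>ls s. (f, ls, s) \<in> set p \<and> length ls = arity p f"
proof (cases "find (\<lambda>(g, _, _). g = f) p")
  case (Some cl)
  obtain g ls s where cl: "cl = (g, ls, s)" by (cases cl)
  have "cl \<in> set p" "g = f" using Some cl nth_mem by (fastforce simp: find_Some_iff)+
  then show ?thesis using Some cl by (auto simp: arity_def)
qed (simp add: arity_def)

locale typed_abstraction = abstraction +
  fixes FC FD :: "string \<Rightarrow> ty" and H :: nat
  assumes star_cst: "vstar \<in> set cst"
    and ctor: "ctor_type (FC c)"
    and clause_typed: "(f, ls, s) \<in> set p \<Longrightarrow> \<exists>\<Gamma> t.
       btyped H FC FD \<Gamma> (apps (EFun f) (map pexp ls)) t \<and> btyped H FC FD \<Gamma> s t"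
    and clause_fa: "(f, ls, s) \<in> set p \<Longrightarrow> fa FC 0 s \<and> list_all (pat_fa FC) ls"
    and arity_eq: "same_arities p"
    and cf: "cons_free p"
    and clause_vars: "(f, ls, s) \<in> set p \<Longrightarrow> evars s \<subseteq> set (lhs_vars ls)"
    and dexp_cst: "(f, ls, s) \<in> set p \<Longrightarrow> t \<in> subs s \<Longrightarrow> is_dexp t \<Longrightarrow> eval p \<gamma> t z \<Longrightarrow> col z \<in> set cst"
    and codes_bound: "size \<sigma> \<le> H \<Longrightarrow> codes \<sigma> \<subseteq> {..<u}"
begin

text \<open>The invariant maintained by cons-freeness: no datum arises during evaluation that is
  neither a suffix of the input nor, after collapsing pairs, one of the constants.\<close>

definition coded :: "val \<Rightarrow> bool" where
  "coded v \<longleftrightarrow> (\<exists>d \<le> M. vl d = col v)"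

lemma cst_coded: "col v \<in> set cst \<Longrightarrow> coded v"
proof -
  assume "col v \<in> set cst"
  then obtain i where "i < length cst" "cst ! i = col v" by (metis in_set_conv_nth)
  then show ?thesis unfolding coded_def
    by (intro exI[of _ "length w + 1 + i"]) (auto simp: M_def vl_def)
qed

text \<open>Typing of values together with the requirement that their data are \<open>coded\<close>.
  Pairs carry no such requirement of their own, since the constant \<open>vstar\<close> stands for
  all of them.\<close>

inductive vt :: "ty \<Rightarrow> val \<Rightarrow> bool" where
  vt_con: "FC c = arrows ks (Sort i) \<Longrightarrow> length vs = length ks \<Longrightarrow> (\<forall>j<length ks. vt (ks ! j) (vs ! j)) \<Longrightarrow>
     coded (VCon c vs) \<Longrightarrow> vt (Sort i) (VCon c vs)"
| vt_pair: "vt s a \<Longrightarrow> vt t b \<Longrightarrow> vt (Prod s t) (VPair a b)"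
| vt_fun: "FD f = arrows ss (Arrow s t) \<Longrightarrow> length vs = length ss \<Longrightarrow> (\<forall>j<length ss. vt (ss ! j) (vs ! j)) \<Longrightarrow>
     length vs < arity p f \<Longrightarrow> size (FD f) \<le> H \<Longrightarrow> vt (Arrow s t) (VFun f vs)"

text \<open>\<open>frc \<sigma> v d\<close>: the behaviour of \<open>v\<close> includes what the code \<open>d\<close> lists.\<close>
inductive frc :: "ty \<Rightarrow> val \<Rightarrow> nat \<Rightarrow> bool" where
  frc_data: "(\<And>s t. \<sigma> \<noteq> Arrow s t) \<Longrightarrow> vt \<sigma> v \<Longrightarrow> d \<le> M \<Longrightarrow> vl d = col v \<Longrightarrow> frc \<sigma> v d"
| frc_fun: "vt (Arrow s t) (VFun f vs) \<Longrightarrow> FD f = arrows ss (Arrow s t) \<Longrightarrow> length vs = length ss \<Longrightarrow>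
     length ds = length ss \<Longrightarrow> (\<forall>j<length ss. frc (ss ! j) (vs ! j) (ds ! j)) \<Longrightarrow>
     A \<in> codes (Arrow s t) \<Longrightarrow> (\<forall>x y. pr x y \<in> set_decode A \<longrightarrow> acall f (ds @ [x]) y) \<Longrightarrow>
     frc (Arrow s t) (VFun f vs) A"

lemma vt_Arrow: "vt (Arrow s t) v \<Longrightarrow> \<exists>f vs ss. v = VFun f vs \<and> FD f = arrows ss (Arrow s t) \<and>
    length vs = length ss \<and> (\<forall>j<length ss. vt (ss ! j) (vs ! j)) \<and> length vs < arity p f \<and> size (FD f) \<le> H"
  by (cases rule: vt.cases) auto

lemma frc_codes: assumes "frc \<sigma> v d" shows "d \<in> codes \<sigma>"
  using assms
proof cases
  case frc_data
  then show "d \<in> codes \<sigma>" by (cases \<sigma>) auto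
next
  case frc_fun
  then show "d \<in> codes \<sigma>" by simp
qed

lemma frc_less: "frc \<sigma> v d \<Longrightarrow> size \<sigma> \<le> H \<Longrightarrow> d < u"
  using frc_codes codes_bound by blast

lemma frc_cases: "frc \<sigma> v d \<Longrightarrow> (d \<le> M \<and> col v = vl d) \<or> (M < d \<and> (\<exists>f vs. v = VFun f vs))"
  by (cases rule: frc.cases) auto

lemma frc_data_iff:
  assumes "\<And>s t. \<sigma> \<noteq> Arrow s t"
  shows "frc \<sigma> v d \<longleftrightarrow> vt \<sigma> v \<and> d \<le> M \<and> vl d = col v"
proof
  assume "frc \<sigma> v d"
  then show "vt \<sigma> v \<and> d \<le> M \<and> vl d = col v" by cases (use assms in auto)
qed (use assms in \<open>auto intro: frc_data\<close>)

lemma frc_exists: "vt \<sigma> v \<Longrightarrow> \<exists>d. frc \<sigma> v d"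
proof (induction rule: vt.induct)
  case (vt_con c ks i vs)
  then have "vt (Sort i) (VCon c vs)" by (intro vt.vt_con) auto
  then show ?case using vt_con by (auto simp: frc_data_iff coded_def)
next
  case (vt_pair s a t b)
  then have "vt (Prod s t) (VPair a b)" by (intro vt.vt_pair)
  moreover have "coded (VPair a b)" by (rule cst_coded) (simp add: star_cst)
  ultimately show ?case by (auto simp: frc_data_iff coded_def simp del: col.simps)
next
  case (vt_fun f ss s t vs)
  then have v: "vt (Arrow s t) (VFun f vs)" by (intro vt.vt_fun) auto
  have "\<forall>j. \<exists>d. j < length ss \<longrightarrow> frc (ss ! j) (vs ! j) d" using vt_fun by blast
  then obtain g where "\<And>j. j < length ss \<Longrightarrow> frc (ss ! j) (vs ! j) (g j)" by metis
  \<comment> \<open>A listing without pairs claims nothing, hence is justified for every function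
    and any codes of its captured arguments.\<close>
  then have "frc (Arrow s t) (VFun f vs) (fcode {})"
    using vt_fun by (intro frc_fun[OF v, of ss "map g [0..<length ss]"] fcode_codes) (auto simp: fcode_mem)
  then show ?case by blast
qed

lemma acall_app_le:
  assumes "acall f (ds @ [x]) y" "length ds = length ds'" "\<And>j. j < length ds \<Longrightarrow> le (ds ! j) (ds' ! j)"
    "\<And>j. j < length ds' \<Longrightarrow> ds' ! j < u" "x < u"
  shows "acall f (ds' @ [x]) y"
  by (rule acall_le[OF assms(1)])
    (use assms in \<open>auto simp: list_all2_conv_all_nth nth_append in_set_conv_nth less_Suc_eq\<close>)

lemma codes_Arrow_mem: "A \<in> codes (Arrow s t) \<Longrightarrow> pr x y \<in> set_decode A \<Longrightarrow> x \<in> codes s \<and> y \<in> codes t"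
  using pr_odd by fastforce

text \<open>Different occurrences of a variable may demand different codes of its value, and
  evaluation needs one code that serves them all. For functions the captured arguments are joined by
  the induction hypothesis and the two listings are united; the calls that justify either listing
  survive the passage to larger arguments.\<close>

lemma frc_join: "frc \<sigma> v d1 \<Longrightarrow> frc \<sigma> v d2 \<Longrightarrow> size \<sigma> \<le> H \<Longrightarrow> \<exists>d. frc \<sigma> v d \<and> le d1 d \<and> le d2 d"
proof (induction arbitrary: d2 rule: frc.induct)
  case (frc_data \<sigma> v d)
  then have "frc \<sigma> v d" "vl d2 = col v" "d2 \<le> M" by (auto simp: frc_data_iff)
  then show ?case using frc_data by (intro exI[of _ d]) (auto simp: le_def)
next
  case (frc_fun s t f vs ss ds A)
  from frc_fun.prems(1) obtain ss' ds2 where 2: "FD f = arrows ss' (Arrow s t)" "length vs = length ss'"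
    "length ds2 = length ss'" "\<forall>j<length ss'. frc (ss' ! j) (vs ! j) (ds2 ! j)"
    "d2 \<in> codes (Arrow s t)" "\<forall>x y. pr x y \<in> set_decode d2 \<longrightarrow> acall f (ds2 @ [x]) y"
    by (cases rule: frc.cases) auto
  have ss: "ss' = ss" using arrows_eq[of ss "Arrow s t" ss' "Arrow s t"] 2 frc_fun.hyps by auto
  have sz: "size (FD f) \<le> H" using vt_Arrow[OF frc_fun.hyps(1)] by auto
  have szs: "size (ss ! j) \<le> H" if "j < length ss" for j
    using size_arrows(2)[of "ss ! j" ss "Arrow s t"] that sz frc_fun.hyps(2) by auto
  have "\<exists>d. frc (ss ! j) (vs ! j) d \<and> le (ds ! j) d \<and> le (ds2 ! j) d" if j: "j < length ss" for j
    using frc_fun.IH[rule_format, OF j] 2(4) szs[OF j] j ss by simp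
  then obtain g where g: "\<And>j. j < length ss \<Longrightarrow>
     frc (ss ! j) (vs ! j) (g j) \<and> le (ds ! j) (g j) \<and> le (ds2 ! j) (g j)" by metis
  let ?ds = "map g [0..<length ss]"
  have ub: "?ds ! j < u" if "j < length ?ds" for j using g[of j] frc_less szs that by auto
  have xu: "x < u" if "x \<in> codes s" for x
  proof -
    have "size s \<le> H" using frc_fun.prems(2) by simp
    then show ?thesis using codes_bound that by blast
  qed
  let ?S = "set_decode A \<union> set_decode d2"
  let ?A = "set_encode ?S"
  have S: "set_decode ?A = ?S" by simp
  have "A \<le> ?A" by (rule subset_decode_imp_le) simp
  then have MA: "M < ?A" using frc_fun.hyps(5) by simp
  then have "?A \<in> codes (Arrow s t)" using frc_fun.hyps(5) 2(5) by (auto simp: S)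
  moreover have "acall f (?ds @ [x]) y" if "pr x y \<in> ?S" for x y
  proof -
    have "x < u" using that codes_Arrow_mem frc_fun.hyps(5) 2(5) xu by blast
    from that consider "pr x y \<in> set_decode A" | "pr x y \<in> set_decode d2" by blast
    then show ?thesis
    proof cases
      case 1
      then have "acall f (ds @ [x]) y" using frc_fun.hyps(6) by blast
      then show ?thesis by (rule acall_app_le) (use ub g \<open>x < u\<close> frc_fun.hyps in auto)
    next
      case 2
      then have "acall f (ds2 @ [x]) y" using \<open>\<forall>x y. pr x y \<in> set_decode d2 \<longrightarrow> _ x y\<close> by blast
      then show ?thesis by (rule acall_app_le)
        (use ub g \<open>x < u\<close> \<open>length ds2 = length ss'\<close> ss in auto)
    qed
  qed
  ultimately have "frc (Arrow s t) (VFun f vs) ?A"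
    using frc_fun.hyps g by (intro frc.frc_fun[of s t f vs ss ?ds]) (auto simp: S)
  moreover have "M < A" "M < d2" using frc_fun.hyps(5) 2(5) by auto
  ultimately show ?case using MA by (intro exI[of _ ?A]) (auto simp: le_def S)
qed

definition venv :: "(string \<Rightarrow> ty) \<Rightarrow> (string \<Rightarrow> val option) \<Rightarrow> bool" where
  "venv \<Gamma> \<gamma> \<longleftrightarrow> (\<forall>x v. \<gamma> x = Some v \<longrightarrow> vt (\<Gamma> x) v \<and> size (\<Gamma> x) \<le> H)"

definition fenv :: "(string \<Rightarrow> ty) \<Rightarrow> (string \<Rightarrow> val option) \<Rightarrow> (string \<Rightarrow> nat) \<Rightarrow> bool" where
  "fenv \<Gamma> \<gamma> \<rho> \<longleftrightarrow> (\<forall>x v. \<gamma> x = Some v \<longrightarrow> frc (\<Gamma> x) v (\<rho> x))"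

lemma fenv_exists: "venv \<Gamma> \<gamma> \<Longrightarrow> \<exists>\<rho>. fenv \<Gamma> \<gamma> \<rho>"
proof -
  assume v: "venv \<Gamma> \<gamma>"
  have "\<forall>x. \<exists>d. \<forall>v. \<gamma> x = Some v \<longrightarrow> frc (\<Gamma> x) v d"
  proof
    fix x
    show "\<exists>d. \<forall>v. \<gamma> x = Some v \<longrightarrow> frc (\<Gamma> x) v d"
      using v frc_exists by (cases "\<gamma> x") (auto simp: venv_def)
  qed
  then show ?thesis unfolding fenv_def by metis
qed

lemma fenv_join:
  assumes "venv \<Gamma> \<gamma>" "fenv \<Gamma> \<gamma> \<rho>1" "fenv \<Gamma> \<gamma> \<rho>2"
  shows "\<exists>\<rho>. fenv \<Gamma> \<gamma> \<rho> \<and> (\<forall>x \<in> dom \<gamma>. le (\<rho>1 x) (\<rho> x) \<and> le (\<rho>2 x) (\<rho> x))"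
proof -
  have "\<forall>x. \<exists>d. \<forall>v. \<gamma> x = Some v \<longrightarrow> frc (\<Gamma> x) v d \<and> le (\<rho>1 x) d \<and> le (\<rho>2 x) d"
  proof
    fix x
    show "\<exists>d. \<forall>v. \<gamma> x = Some v \<longrightarrow> frc (\<Gamma> x) v d \<and> le (\<rho>1 x) d \<and> le (\<rho>2 x) d"
      using assms frc_join[of "\<Gamma> x" _ "\<rho>1 x" "\<rho>2 x"] by (cases "\<gamma> x") (auto simp: venv_def fenv_def)
  qed
  then obtain g where "\<And>x v. \<gamma> x = Some v \<Longrightarrow> frc (\<Gamma> x) v (g x) \<and> le (\<rho>1 x) (g x) \<and> le (\<rho>2 x) (g x)" by metis
  then show ?thesis by (intro exI[of _ g]) (auto simp: fenv_def)
qed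

lemma fenv_joins:
  assumes "venv \<Gamma> \<gamma>" "\<And>i. i < (n::nat) \<Longrightarrow> fenv \<Gamma> \<gamma> (\<rho> i)"
  shows "\<exists>\<rho>'. fenv \<Gamma> \<gamma> \<rho>' \<and> (\<forall>i<n. \<forall>x \<in> dom \<gamma>. le (\<rho> i x) (\<rho>' x))"
  using assms(2)
proof (induction n)
  case 0
  then show ?case using fenv_exists[OF assms(1)] by auto
next
  case (Suc n)
  then obtain \<rho>' where 1: "fenv \<Gamma> \<gamma> \<rho>'" "\<And>i x. i < n \<Longrightarrow> x \<in> dom \<gamma> \<Longrightarrow> le (\<rho> i x) (\<rho>' x)" by fastforce
  obtain \<rho>2 where 2: "fenv \<Gamma> \<gamma> \<rho>2" "\<And>x. x \<in> dom \<gamma> \<Longrightarrow> le (\<rho>' x) (\<rho>2 x) \<and> le (\<rho> n x) (\<rho>2 x)"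
    using fenv_join[OF assms(1) 1(1) Suc.prems[of n]] by auto
  have "le (\<rho> i x) (\<rho>2 x)" if "i < Suc n" "x \<in> dom \<gamma>" for i x
    using 1(2)[of i x] 2(2)[OF that(2)] that le_trans by (cases "i = n") (auto simp: less_Suc_eq)
  then show ?case using 2(1) by blast
qed

lemma ctor_full:
  assumes "btyped H FC FD \<Gamma> (apps (ECon c) es) \<sigma>" "length es = arity_ty (FC c)"
  shows "\<exists>ks i. FC c = arrows ks (Sort i) \<and> \<sigma> = Sort i \<and> length es = length ks \<and>
    (\<forall>k \<in> set ks. ord_ty k = 0) \<and> (\<forall>j<length ks. btyped H FC FD \<Gamma> (es ! j) (ks ! j))"
proof -
  obtain ts where ts: "length ts = length es" "btyped H FC FD \<Gamma> (ECon c) (arrows ts \<sigma>)"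
    "\<forall>i<length es. btyped H FC FD \<Gamma> (es ! i) (ts ! i)" using btyped_apps[OF assms(1)] by blast
  from ts(2) have "FC c = arrows ts \<sigma>" by (cases rule: btyped.cases) auto
  moreover obtain ks i where ks: "FC c = arrows ks (Sort i)" "\<forall>k \<in> set ks. ord_ty k = 0"
    using ctor[of c] by (auto simp: ctor_type_def)
  moreover have "length ks = length ts" using assms(2) ts(1) ks by (simp add: arity_ty_arrows)
  ultimately have "ts = ks" "\<sigma> = Sort i" using arrows_eq[of ts \<sigma> ks "Sort i"] by auto
  then show ?thesis using ks ts by auto
qed

lemma vt_Sort:
  assumes "vt (Sort i) (VCon c vs)" "FC c = arrows ks (Sort i')"
  shows "length vs = length ks \<and> (\<forall>j<length ks. vt (ks ! j) (vs ! j)) \<and> coded (VCon c vs)"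
  using assms(1)
proof cases
  case (vt_con ks')
  then have "ks' = ks" using assms(2) arrows_Sort_eq[of ks' i ks i'] by simp
  then show ?thesis using vt_con by auto
qed

lemma pat_vt:
  assumes "btyped H FC FD \<Gamma> (pexp l) \<sigma>" "pat_fa FC l" "vt \<sigma> (pinst \<gamma> l)" "x \<in> set (pvars l)"
  shows "vt (\<Gamma> x) (the (\<gamma> x)) \<and> size (\<Gamma> x) \<le> H"
  using assms
proof (induction l arbitrary: \<sigma>)
  case (PVar y)
  from PVar(1) have "btyped H FC FD \<Gamma> (EVar y) \<sigma>" by simp
  then have "\<sigma> = \<Gamma> y \<and> size (\<Gamma> y) \<le> H" by cases auto
  then show ?case using PVar by auto
next
  case (PCon c ps)
  obtain ks i where k: "FC c = arrows ks (Sort i)" "\<sigma> = Sort i" "length ps = length ks"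
    "\<forall>j<length ks. btyped H FC FD \<Gamma> (map pexp ps ! j) (ks ! j)"
    using ctor_full[of \<Gamma> c "map pexp ps" \<sigma>] PCon.prems by auto
  have v: "\<forall>j<length ks. vt (ks ! j) (pinst \<gamma> (ps ! j))"
    using vt_Sort[of i c "map (pinst \<gamma>) ps" ks i] PCon.prems(3) k by auto
  obtain l where "l \<in> set ps" "x \<in> set (pvars l)" using PCon.prems(4) by auto
  then obtain j where j: "j < length ps" "x \<in> set (pvars (ps ! j))" by (metis in_set_conv_nth)
  moreover have "pat_fa FC (ps ! j)" using PCon.prems(2) j by (auto simp: list_all_length)
  ultimately show ?case using PCon.IH[of "ps ! j" "ks ! j"] k v by auto
qed

lemma pat_coded:
  assumes "btyped H FC FD \<Gamma> (pexp l) \<sigma>" "pat_fa FC l" "vt \<sigma> (pinst \<gamma> l)"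
    "t \<in> subs (pexp l)" "con_headed t" "eval p \<gamma> t z"
  shows "coded z"
  using assms
proof (induction l arbitrary: \<sigma>)
  case (PVar y)
  then show ?case by (auto simp: subs_def)
next
  case (PCon c ps)
  obtain ks i where k: "FC c = arrows ks (Sort i)" "\<sigma> = Sort i" "length ps = length ks"
    "\<forall>j<length ks. btyped H FC FD \<Gamma> (map pexp ps ! j) (ks ! j)"
    using ctor_full[of \<Gamma> c "map pexp ps" \<sigma>] PCon.prems by auto
  have v: "\<forall>j<length ks. vt (ks ! j) (pinst \<gamma> (ps ! j))" "coded (pinst \<gamma> (PCon c ps))"
    using vt_Sort[of i c "map (pinst \<gamma>) ps" ks i] PCon.prems(3) k by auto
  show ?case
  proof (cases "t = pexp (PCon c ps)")
    case True
    then have "z = pinst \<gamma> (PCon c ps)" using eval_pexp PCon.prems(6) by blast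
    then show ?thesis using v by simp
  next
    case False
    then obtain l where "l \<in> set ps" "t \<in> subs (pexp l)"
      using PCon.prems(4) by (auto simp: subs_def[of "apps _ _"] strict_subs_con)
    then obtain j where j: "j < length ps" "t \<in> subs (pexp (ps ! j))" by (metis in_set_conv_nth)
    moreover have "pat_fa FC (ps ! j)" using PCon.prems(2) j by (auto simp: list_all_length)
    ultimately show ?thesis using PCon.IH[of "ps ! j" "ks ! j"] k v PCon.prems by auto
  qed
qed

text \<open>The codes that the body demands of its variables determine a code of the whole argument.
  A variable pattern passes its code on. Below a constructor all arguments have order 0, where a
  code says nothing but the value, so that any code of the datum fits.\<close>

lemma pat_frc:
  assumes "btyped H FC FD \<Gamma> (pexp l) \<sigma>" "pat_fa FC l" "vt \<sigma> (pinst \<gamma> l)"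
    "\<And>x. x \<in> set (pvars l) \<Longrightarrow> frc (\<Gamma> x) (the (\<gamma> x)) (\<rho> x)"
  shows "\<exists>d. frc \<sigma> (pinst \<gamma> l) d \<and> amatch \<rho> l d"
  using assms
proof (induction l arbitrary: \<sigma>)
  case (PVar y)
  from PVar(1) have "btyped H FC FD \<Gamma> (EVar y) \<sigma>" by simp
  then have "\<sigma> = \<Gamma> y" by cases auto
  then show ?case using PVar by auto
next
  case (PCon c ps)
  obtain ks i where k: "FC c = arrows ks (Sort i)" "\<sigma> = Sort i" "length ps = length ks"
    "\<forall>k \<in> set ks. ord_ty k = 0" "\<forall>j<length ks. btyped H FC FD \<Gamma> (map pexp ps ! j) (ks ! j)"
    using ctor_full[of \<Gamma> c "map pexp ps" \<sigma>] PCon.prems by auto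
  have v: "\<forall>j<length ks. vt (ks ! j) (pinst \<gamma> (ps ! j))" "coded (pinst \<gamma> (PCon c ps))"
    using vt_Sort[of i c "map (pinst \<gamma>) ps" ks i] PCon.prems(3) k by auto
  have "\<exists>d. frc (ks ! j) (pinst \<gamma> (ps ! j)) d \<and> amatch \<rho> (ps ! j) d" if j: "j < length ps" for j
  proof -
    have "pat_fa FC (ps ! j)" using PCon.prems(2) j by (auto simp: list_all_length)
    moreover have "frc (\<Gamma> x) (the (\<gamma> x)) (\<rho> x)" if "x \<in> set (pvars (ps ! j))" for x
      using PCon.prems(4)[of x] that nth_mem[OF j] by auto
    ultimately show ?thesis using PCon.IH[of "ps ! j" "ks ! j"] k v j by auto
  qed
  then obtain g where g: "\<And>j. j < length ps \<Longrightarrow> frc (ks ! j) (pinst \<gamma> (ps ! j)) (g j) \<and> amatch \<rho> (ps ! j) (g j)"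
    by metis
  have g2: "g j \<le> M \<and> vl (g j) = col (pinst \<gamma> (ps ! j))" if "j < length ps" for j
  proof -
    have "ord_ty (ks ! j) = 0" using k that by auto
    then have "\<And>s t. ks ! j \<noteq> Arrow s t" by auto
    then show ?thesis using g[OF that] by (simp add: frc_data_iff)
  qed
  obtain d where d: "d \<le> M" "vl d = col (pinst \<gamma> (PCon c ps))" using v(2) by (auto simp: coded_def)
  let ?ys = "map g [0..<length ps]"
  have "map vl ?ys = map (col \<circ> pinst \<gamma>) ps" using g2 by (intro nth_equalityI) auto
  then have "con c ?ys d" using d g2 by (auto simp: con_def)
  moreover have "list_all2 (amatch \<rho>) ps ?ys" using g by (auto simp: list_all2_conv_all_nth)
  ultimately have "amatch \<rho> (PCon c ps) d" by auto
  moreover have "frc \<sigma> (pinst \<gamma> (PCon c ps)) d"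
    unfolding k(2) by (rule frc_data) (use d PCon.prems k in auto)
  ultimately show ?case by blast
qed

text \<open>The semantic content of cons-freeness in a given environment. Like \<open>subs\<close>
  it skips the function part of an application, so an incomplete constructor application is never
  asked to have a code.\<close>

definition cfok :: "(string \<Rightarrow> val option) \<Rightarrow> expr \<Rightarrow> bool" where
  "cfok \<gamma> e \<longleftrightarrow> (\<forall>t \<in> subs e. con_headed t \<longrightarrow> (\<forall>z. eval p \<gamma> t z \<longrightarrow> coded z))"

lemma cfok_sub: "cfok \<gamma> e \<Longrightarrow> subs e' \<subseteq> subs e \<Longrightarrow> cfok \<gamma> e'"
  unfolding cfok_def by blast

text \<open>The order of choices is essential: the code \<open>d\<close> of the result is given, and
  only then codes of the environment are found that suffice for it. Information thus flows from the
  demand on a result back to the variables, and no description of their complete behaviour is ever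
  needed.\<close>

definition complete_for :: "(string \<Rightarrow> val option) \<Rightarrow> expr \<Rightarrow> val \<Rightarrow> bool" where
  "complete_for \<gamma> e z \<longleftrightarrow> (\<forall>\<Gamma> \<sigma>. btyped H FC FD \<Gamma> e \<sigma> \<longrightarrow> fa FC 0 e \<longrightarrow> cfok \<gamma> e \<longrightarrow> venv \<Gamma> \<gamma> \<longrightarrow>
     evars e \<subseteq> dom \<gamma> \<longrightarrow> vt \<sigma> z \<and> (\<forall>d. frc \<sigma> z d \<longrightarrow> (\<exists>\<rho>. fenv \<Gamma> \<gamma> \<rho> \<and> aev acall \<rho> e [] d)))"

lemma complete_forD:
  assumes "complete_for \<gamma> e z" "btyped H FC FD \<Gamma> e \<sigma>" "fa FC 0 e" "cfok \<gamma> e" "venv \<Gamma> \<gamma>" "evars e \<subseteq> dom \<gamma>"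
  shows "vt \<sigma> z" "frc \<sigma> z d \<Longrightarrow> \<exists>\<rho>. fenv \<Gamma> \<gamma> \<rho> \<and> aev acall \<rho> e [] d"
  using assms unfolding complete_for_def by blast+

definition complete_call :: "string \<Rightarrow> val list \<Rightarrow> val \<Rightarrow> bool" where
  "complete_call f vs z \<longleftrightarrow> (\<forall>ss \<tau>. FD f = arrows ss \<tau> \<longrightarrow> length vs = length ss \<longrightarrow>
     (\<forall>j<length ss. vt (ss ! j) (vs ! j)) \<longrightarrow> size (FD f) \<le> H \<longrightarrow> vt \<tau> z \<and>
     (\<forall>d. frc \<tau> z d \<longrightarrow> (\<exists>ds. length ds = length ss \<and> (\<forall>j<length ss. frc (ss ! j) (vs ! j) (ds ! j)) \<and>
        acall f ds d)))"

lemma complete_callD: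
  assumes "complete_call f vs z" "FD f = arrows ss \<tau>" "length vs = length ss"
     "\<And>j. j<length ss \<Longrightarrow> vt (ss ! j) (vs ! j)" "size (FD f) \<le> H"
  shows "vt \<tau> z" "frc \<tau> z d \<Longrightarrow> \<exists>ds. length ds = length ss \<and> (\<forall>j<length ss. frc (ss ! j) (vs ! j) (ds ! j)) \<and>
        acall f ds d"
  using assms unfolding complete_call_def by blast+

lemma aev_join:
  assumes "venv \<Gamma> \<gamma>" "fenv \<Gamma> \<gamma> \<rho>1" "fenv \<Gamma> \<gamma> \<rho>2" "aev acall \<rho>1 a ys d" "aev acall \<rho>2 b ys' d'"
    "evars a \<subseteq> dom \<gamma>" "evars b \<subseteq> dom \<gamma>"
  shows "\<exists>\<rho>. fenv \<Gamma> \<gamma> \<rho> \<and> aev acall \<rho> a ys d \<and> aev acall \<rho> b ys' d'"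
proof -
  obtain \<rho> where \<rho>: "fenv \<Gamma> \<gamma> \<rho>" "\<And>x. x \<in> dom \<gamma> \<Longrightarrow> le (\<rho>1 x) (\<rho> x) \<and> le (\<rho>2 x) (\<rho> x)"
    using fenv_join[OF assms(1-3)] by blast
  have "aev acall \<rho> a ys d" by (rule aev_mono[OF _ _ assms(4)]) (use \<rho>(2) assms(6) in blast)+
  moreover have "aev acall \<rho> b ys' d'" by (rule aev_mono[OF _ _ assms(5)]) (use \<rho>(2) assms(7) in blast)+
  ultimately show ?thesis using \<rho> by blast
qed

lemma aev_apps:
  assumes "list_all2 (\<lambda>e y. y < u \<and> aev R \<rho> e [] y) es ys" "aev R \<rho> h (ys @ zs) d"
  shows "aev R \<rho> (apps h es) zs d"
  using assms
proof (induction es arbitrary: ys zs rule: rev_induct)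
  case (snoc e es)
  obtain ys' y where ys: "ys = ys' @ [y]" "list_all2 (\<lambda>e y. y < u \<and> aev R \<rho> e [] y) es ys'" "y < u"
    "aev R \<rho> e [] y" using snoc.prems(1) by (auto simp: list_all2_append1 list_all2_Cons1)
  have "aev R \<rho> (apps h es) (y # zs) d" using snoc.IH[OF ys(2)] snoc.prems(2) ys(1) by simp
  then show ?case using ys by auto
qed simp

lemma complete_con:
  assumes len: "length bs = length ss" and IH: "\<And>i. i < length ss \<Longrightarrow> complete_for \<gamma> (ss ! i) (bs ! i)"
    and ev: "eval p \<gamma> (apps (ECon c) ss) (VCon c bs)"
  shows "complete_for \<gamma> (apps (ECon c) ss) (VCon c bs)"
  unfolding complete_for_def
proof (intro allI impI)
  fix \<Gamma> \<sigma>
  assume t: "btyped H FC FD \<Gamma> (apps (ECon c) ss) \<sigma>" and fa: "fa FC 0 (apps (ECon c) ss)"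
    and cf: "cfok \<gamma> (apps (ECon c) ss)" and ve: "venv \<Gamma> \<gamma>" and ev': "evars (apps (ECon c) ss) \<subseteq> dom \<gamma>"
  obtain ks i where k: "FC c = arrows ks (Sort i)" "\<sigma> = Sort i" "length ss = length ks"
    "\<forall>k \<in> set ks. ord_ty k = 0" "\<forall>j<length ks. btyped H FC FD \<Gamma> (ss ! j) (ks ! j)"
    using ctor_full[OF t] fa by (auto simp: fa_apps)
  have sub: "fa FC 0 (ss ! j)" "cfok \<gamma> (ss ! j)" "evars (ss ! j) \<subseteq> dom \<gamma>" if "j < length ss" for j
  proof -
    have m: "ss ! j \<in> set ss" using that by simp
    then show "fa FC 0 (ss ! j)" using fa by (auto simp: fa_apps)
    show "cfok \<gamma> (ss ! j)" by (rule cfok_sub[OF cf]) (use m in \<open>auto simp: subs_def[of "apps _ _"] strict_subs_con\<close>)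
    show "evars (ss ! j) \<subseteq> dom \<gamma>" using ev' m by (auto simp: evars_apps)
  qed
  have vj: "vt (ks ! j) (bs ! j)" if "j < length ks" for j
    using complete_forD(1)[OF IH[of j] _ sub(1,2) ve sub(3)] that k by auto
  have "coded (VCon c bs)" using cf ev by (auto simp: cfok_def subs_def con_headed_apps)
  then have v: "vt \<sigma> (VCon c bs)" unfolding k(2) using vj len k by (intro vt_con) auto
  have "\<exists>\<rho>. fenv \<Gamma> \<gamma> \<rho> \<and> aev acall \<rho> (apps (ECon c) ss) [] d" if d: "frc \<sigma> (VCon c bs) d" for d
  proof -
    have d': "d \<le> M" "vl d = VCon c (map col bs)" using d k(2) by (auto simp: frc_data_iff)
    have "\<exists>y. y \<le> M \<and> vl y = col (bs ! j) \<and> frc (ks ! j) (bs ! j) y" if "j < length ks" for j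
    proof -
      obtain y where y: "frc (ks ! j) (bs ! j) y" using frc_exists vj \<open>j < length ks\<close> by blast
      have "ord_ty (ks ! j) = 0" using k \<open>j < length ks\<close> by auto
      then have "\<And>s t. ks ! j \<noteq> Arrow s t" by auto
      then show ?thesis using y by (auto simp: frc_data_iff)
    qed
    then obtain y where y: "\<And>j. j < length ks \<Longrightarrow> y j \<le> M \<and> vl (y j) = col (bs ! j) \<and> frc (ks ! j) (bs ! j) (y j)"
      by metis
    have "\<exists>\<rho>. fenv \<Gamma> \<gamma> \<rho> \<and> aev acall \<rho> (ss ! j) [] (y j)" if "j < length ks" for j
      using complete_forD(2)[OF IH[of j] _ sub(1,2) ve sub(3)] that k y by auto
    then obtain r where r: "\<And>j. j < length ks \<Longrightarrow> fenv \<Gamma> \<gamma> (r j) \<and> aev acall (r j) (ss ! j) [] (y j)" by metis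
    obtain \<rho> where \<rho>: "fenv \<Gamma> \<gamma> \<rho>" "\<forall>i<length ks. \<forall>x \<in> dom \<gamma>. le (r i x) (\<rho> x)"
      using fenv_joins[OF ve, of "length ks" r] r by auto
    have a: "aev acall \<rho> (ss ! j) [] (y j)" if "j < length ks" for j
    proof (rule aev_mono[of acall _ _ "r j"])
      show "le (r j x) (\<rho> x)" if "x \<in> evars (ss ! j)" for x
        using \<rho>(2) sub(3)[of j] \<open>j < length ks\<close> that k(3) by (metis subsetD)
    qed (use r that in blast)+
    let ?ys = "map y [0..<length ks]"
    have "map vl ?ys = map col bs" using y len k by (intro nth_equalityI) auto
    then have "con c ?ys d" using d' y by (auto simp: con_def)
    moreover have "list_all2 (\<lambda>e y. y < u \<and> aev acall \<rho> e [] y) ss ?ys"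
      using a y k code_bound by (auto simp: list_all2_conv_all_nth M_def intro: le_less_trans)
    ultimately have "aev acall \<rho> (apps (ECon c) ss) [] d" by (intro aev_apps) auto
    then show ?thesis using \<rho> by blast
  qed
  then show "vt \<sigma> (VCon c bs) \<and> (\<forall>d. frc \<sigma> (VCon c bs) d \<longrightarrow>
      (\<exists>\<rho>. fenv \<Gamma> \<gamma> \<rho> \<and> aev acall \<rho> (apps (ECon c) ss) [] d))" using v by blast
qed

lemma complete_app:
  assumes IHa: "complete_for \<gamma> a (VFun f vs)" and IHb: "complete_for \<gamma> b v"
    and IHc: "complete_call f (vs @ [v]) z" and ev: "eval p \<gamma> a (VFun f vs)"
  shows "complete_for \<gamma> (EApp a b) z"
  unfolding complete_for_def
proof (intro allI impI)
  fix \<Gamma> \<sigma>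
  assume t: "btyped H FC FD \<Gamma> (EApp a b) \<sigma>" and fa: "fa FC 0 (EApp a b)"
    and cf: "cfok \<gamma> (EApp a b)" and ve: "venv \<Gamma> \<gamma>" and vars: "evars (EApp a b) \<subseteq> dom \<gamma>"
  have nc: "\<not> con_headed a" using eval_con_headed[OF ev] by auto
  from t obtain s where s: "btyped H FC FD \<Gamma> a (Arrow s \<sigma>)" "btyped H FC FD \<Gamma> b s"
    by (cases rule: btyped.cases) auto
  have fa': "fa FC 0 a" "fa FC 0 b" using fa fa_nonhead[OF nc] by auto
  have "cfok \<gamma> a" using cf nc unfolding cfok_def by (auto simp: subs_def)
  moreover have "cfok \<gamma> b" by (rule cfok_sub[OF cf subs_apps(2)])
  moreover have vars': "evars a \<subseteq> dom \<gamma>" "evars b \<subseteq> dom \<gamma>" using vars by auto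
  ultimately have A: "vt (Arrow s \<sigma>) (VFun f vs)"
    "\<And>d. frc (Arrow s \<sigma>) (VFun f vs) d \<Longrightarrow> \<exists>\<rho>. fenv \<Gamma> \<gamma> \<rho> \<and> aev acall \<rho> a [] d"
    and B: "vt s v" "\<And>d. frc s v d \<Longrightarrow> \<exists>\<rho>. fenv \<Gamma> \<gamma> \<rho> \<and> aev acall \<rho> b [] d"
    using complete_forD[OF IHa s(1) fa'(1) _ ve] complete_forD[OF IHb s(2) fa'(2) _ ve] by blast+
  from vt_Arrow[OF A(1)] obtain ss where ss: "FD f = arrows ss (Arrow s \<sigma>)" "length vs = length ss"
    "\<forall>j<length ss. vt (ss ! j) (vs ! j)" "size (FD f) \<le> H" by auto
  have FD: "FD f = arrows (ss @ [s]) \<sigma>" using ss by (simp add: arrows_append)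
  have vts: "vt ((ss @ [s]) ! j) ((vs @ [v]) ! j)" if "j < length (ss @ [s])" for j
    using ss B(1) that by (auto simp: nth_append less_Suc_eq)
  have sz: "size (Arrow s \<sigma>) \<le> H" using size_arrows(1)[of "Arrow s \<sigma>" ss] ss by simp
  note C = complete_callD[OF IHc FD _ vts ss(4)]
  have "vt \<sigma> z" using C(1) ss(2) by simp
  moreover have "\<exists>\<rho>. fenv \<Gamma> \<gamma> \<rho> \<and> aev acall \<rho> (EApp a b) [] d" if d: "frc \<sigma> z d" for d
  proof -
    obtain ds' where ds': "length ds' = length (ss @ [s])"
      "\<forall>j<length (ss @ [s]). frc ((ss @ [s]) ! j) ((vs @ [v]) ! j) (ds' ! j)" "acall f ds' d"
      using C(2)[OF _ _ d] ss(2) by auto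
    obtain ds x where dx: "ds' = ds @ [x]" "length ds = length ss"
      using ds'(1) by (cases ds' rule: rev_cases) auto
    have ds: "frc (ss ! j) (vs ! j) (ds ! j)" if "j < length ss" for j
      using ds'(2)[rule_format, of j] that ss(2) dx by (auto simp: nth_append)
    have x: "frc s v x" using ds'(2)[rule_format, of "length ss"] ss(2) dx by (auto simp: nth_append)
    \<comment> \<open>This application uses the function once, on the argument code \<open>x\<close>
      with result code \<open>d\<close>; a listing of this one pair is all that is demanded of
      \<open>a\<close>.\<close>
    let ?A = "fcode {(x, d)}"
    have cA: "?A \<in> codes (Arrow s \<sigma>)" by (rule fcode_codes) (use frc_codes x d in auto)
    have "frc (Arrow s \<sigma>) (VFun f vs) ?A"
      by (rule frc_fun[OF A(1) ss(1,2) dx(2) _ cA]) (use ds ds'(3) dx in \<open>auto simp: fcode_mem\<close>)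
    then obtain \<rho>1 where r1: "fenv \<Gamma> \<gamma> \<rho>1" "aev acall \<rho>1 a [] ?A" using A(2) by blast
    obtain \<rho>2 where r2: "fenv \<Gamma> \<gamma> \<rho>2" "aev acall \<rho>2 b [] x" using B(2) x by blast
    obtain \<rho> where r: "fenv \<Gamma> \<gamma> \<rho>" "aev acall \<rho> a [] ?A" "aev acall \<rho> b [] x"
      using aev_join[OF ve r1(1) r2(1) r1(2) r2(2) vars'] by blast
    have "?A < u" using cA codes_bound[OF sz] by blast
    moreover have "x < u" using frc_less[OF x] sz by simp
    moreover have "M < ?A" using cA by simp
    moreover have "pr x d \<in> set_decode ?A" by (simp add: fcode_mem)
    ultimately have "aev acall \<rho> (EApp a b) [] d" using r by auto
    then show ?thesis using r by blast
  qed
  ultimately show "vt \<sigma> z \<and> (\<forall>d. frc \<sigma> z d \<longrightarrow> (\<exists>\<rho>. fenv \<Gamma> \<gamma> \<rho> \<and> aev acall \<rho> (EApp a b) [] d))" by blast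
qed

text \<open>Some typed clause for \<open>f\<close> has more patterns than there are arguments, so
  the type left over is an arrow. A code of the value is then a listing, justified by calls with one
  more argument, and \<open>acall_fun\<close> applies to it.\<close>

lemma complete_partial:
  assumes "length vs < arity p f" shows "complete_call f vs (VFun f vs)"
  unfolding complete_call_def
proof (intro allI impI)
  fix ss \<tau>
  assume FD: "FD f = arrows ss \<tau>" and len: "length vs = length ss" and v: "\<forall>j<length ss. vt (ss ! j) (vs ! j)"
    and sz: "size (FD f) \<le> H"
  obtain ls s where cl: "(f, ls, s) \<in> set p" "length ls = arity p f" using arity_clause[OF assms] by blast
  obtain \<Gamma> t where "btyped H FC FD \<Gamma> (apps (EFun f) (map pexp ls)) t" using clause_typed[OF cl(1)] by blast
  from btyped_apps[OF this] obtain ts where ts: "length ts = length ls" "btyped H FC FD \<Gamma> (EFun f) (arrows ts t)"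
    by auto
  from ts(2) have "FD f = arrows ts t" by (cases rule: btyped.cases) auto
  also have "\<dots> = arrows (take (length ss) ts) (arrows (drop (length ss) ts) t)"
    by (metis append_take_drop_id arrows_append)
  finally have "\<tau> = arrows (drop (length ss) ts) t"
    using arrows_eq[of ss \<tau> "take (length ss) ts"] FD ts(1) cl(2) assms len by simp
  moreover have "drop (length ss) ts \<noteq> []" using ts(1) cl(2) assms len by simp
  ultimately obtain s' t' where \<tau>: "\<tau> = Arrow s' t'" by (cases "drop (length ss) ts") auto
  have "vt \<tau> (VFun f vs)" unfolding \<tau> using FD \<tau> len v assms sz by (intro vt_fun) auto
  moreover have "\<exists>ds. length ds = length ss \<and> (\<forall>j<length ss. frc (ss ! j) (vs ! j) (ds ! j)) \<and> acall f ds A"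
    if A: "frc \<tau> (VFun f vs) A" for A
  proof -
    from A obtain ss' ds where 2: "FD f = arrows ss' (Arrow s' t')" "length vs = length ss'"
      "length ds = length ss'" "\<forall>j<length ss'. frc (ss' ! j) (vs ! j) (ds ! j)"
      "A \<in> codes (Arrow s' t')" "\<forall>x y. pr x y \<in> set_decode A \<longrightarrow> acall f (ds @ [x]) y"
      unfolding \<tau> by (cases rule: frc.cases) auto
    have ss: "ss' = ss" using arrows_eq[of ss "Arrow s' t'" ss' "Arrow s' t'"] 2 FD \<tau> len by auto
    have "acall f ds A"
    proof (rule acall_fun)
      show "f \<in> fst ` set p" using cl by force
      show "length ds < arity p f" using 2 assms by simp
      fix d assume "d \<in> set ds"
      then obtain j where j: "j < length ds" "d = ds ! j" by (metis in_set_conv_nth)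
      have "size (ss ! j) < size (FD f)" using size_arrows(2)[of "ss ! j" ss \<tau>] FD j 2(3) ss by simp
      then show "d < u" using frc_less[of "ss ! j" "vs ! j" d] 2 j ss sz by auto
    next
      show "A < u" using frc_less[OF A] size_arrows(1)[of \<tau> ss] FD sz by simp
    qed (use 2 in auto)
    then show ?thesis using 2 ss by auto
  qed
  ultimately show "vt \<tau> (VFun f vs) \<and> (\<forall>d. frc \<tau> (VFun f vs) d \<longrightarrow>
     (\<exists>ds. length ds = length ss \<and> (\<forall>j<length ss. frc (ss ! j) (vs ! j) (ds ! j)) \<and> acall f ds d))" by blast
qed

lemma complete_clause:
  assumes j: "j < length p" and pj: "p ! j = (f, ls, s)" and m: "match_env ls vs \<gamma>"
    and no: "\<forall>i<j. \<not> clause_matches (p ! i) f vs" and IH: "complete_for \<gamma> s z"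
  shows "complete_call f vs z"
  unfolding complete_call_def
proof (intro allI impI)
  fix ss \<tau>
  assume FD: "FD f = arrows ss \<tau>" and len: "length vs = length ss" and v: "\<forall>j<length ss. vt (ss ! j) (vs ! j)"
    and sz: "size (FD f) \<le> H"
  have mem: "(f, ls, s) \<in> set p" using j pj nth_mem by metis
  obtain \<Gamma> t where t: "btyped H FC FD \<Gamma> (apps (EFun f) (map pexp ls)) t" "btyped H FC FD \<Gamma> s t"
    using clause_typed[OF mem] by blast
  obtain ts where ts: "length ts = length ls" "btyped H FC FD \<Gamma> (EFun f) (arrows ts t)"
    "\<forall>i<length ls. btyped H FC FD \<Gamma> (pexp (ls ! i)) (ts ! i)"
    using btyped_apps[OF t(1)] by auto
  have FDt: "FD f = arrows ts t" using ts(2) by (cases rule: btyped.cases) auto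
  have vs: "vs = map (pinst \<gamma>) ls" and dom: "dom \<gamma> = set (lhs_vars ls)" using m by (auto simp: match_env_def)
  have "ts = ss" "t = \<tau>" using arrows_eq[of ts t ss \<tau>] FD FDt ts(1) len vs by auto
  note ts = ts(3)[unfolded this(1)] and t = t(2)[unfolded this(2)]
  have lls: "length ls = length ss" using vs len by simp
  have pf: "pat_fa FC (ls ! i)" if "i < length ls" for i using clause_fa[OF mem] that by (auto simp: list_all_length)
  have vi: "vt (ss ! i) (pinst \<gamma> (ls ! i))" if "i < length ls" for i using v that vs lls by auto
  have nthv: "\<exists>i<length ls. x \<in> set (pvars (ls ! i))" if "x \<in> dom \<gamma>" for x
  proof -
    have "x \<in> set (lhs_vars ls)" using that dom by simp
    then obtain l where "l \<in> set ls" "x \<in> set (pvars l)" by (auto simp: lhs_vars_def)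
    then show ?thesis by (metis in_set_conv_nth)
  qed
  have ve: "venv \<Gamma> \<gamma>" unfolding venv_def
  proof (intro allI impI)
    fix x v assume x: "\<gamma> x = Some v"
    then obtain i where i: "i < length ls" "x \<in> set (pvars (ls ! i))" using nthv[of x] by auto
    show "vt (\<Gamma> x) v \<and> size (\<Gamma> x) \<le> H"
      using pat_vt[of \<Gamma> "ls ! i" "ss ! i" \<gamma> x] ts pf vi i x by auto
  qed
  \<comment> \<open>A constructor term in the body is either a constant, whose value is in
    \<open>cst\<close>, or occurs in a pattern, where it evaluates to a part of an argument that
    already had a code.\<close>
  have cfs: "cfok \<gamma> s" unfolding cfok_def
  proof (intro ballI impI allI)
    fix e z assume e: "e \<in> subs s" "con_headed e" "eval p \<gamma> e z"
    then have "\<exists>c ss. e = apps (ECon c) ss" by (simp add: con_headed_iff)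
    with cf mem e(1) have "is_dexp e \<or> (\<exists>l\<in>set ls. e \<in> subs (pexp l))" unfolding cons_free_def by fast
    then show "coded z"
    proof
      assume "is_dexp e"
      then show ?thesis using dexp_cst[OF mem e(1) _ e(3)] cst_coded by blast
    next
      assume "\<exists>l\<in>set ls. e \<in> subs (pexp l)"
      then obtain i where i: "i < length ls" "e \<in> subs (pexp (ls ! i))" by (metis in_set_conv_nth)
      show ?thesis using pat_coded[of \<Gamma> "ls ! i" "ss ! i" \<gamma> e z] ts pf vi i e by auto
    qed
  qed
  have vars: "evars s \<subseteq> dom \<gamma>" using clause_vars[OF mem] dom by simp
  note C = complete_forD[OF IH t _ cfs ve vars]
  have fa: "fa FC 0 s" using clause_fa[OF mem] by simp
  have "\<exists>ds. length ds = length ss \<and> (\<forall>j<length ss. frc (ss ! j) (vs ! j) (ds ! j)) \<and> acall f ds d"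
    if d: "frc \<tau> z d" for d
  proof -
    obtain \<rho> where \<rho>: "fenv \<Gamma> \<gamma> \<rho>" "aev acall \<rho> s [] d" using C(2)[OF fa d] by blast
    have "\<exists>d. frc (ss ! i) (pinst \<gamma> (ls ! i)) d \<and> amatch \<rho> (ls ! i) d" if i: "i < length ls" for i
    proof (rule pat_frc)
      fix x assume x: "x \<in> set (pvars (ls ! i))"
      then have "x \<in> dom \<gamma>" using i dom by (auto simp: lhs_vars_def)
      then show "frc (\<Gamma> x) (the (\<gamma> x)) (\<rho> x)" using \<rho>(1) by (auto simp: fenv_def)
    qed (use ts pf vi i in auto)
    then obtain g where g: "\<And>i. i < length ls \<Longrightarrow> frc (ss ! i) (pinst \<gamma> (ls ! i)) (g i) \<and> amatch \<rho> (ls ! i) (g i)"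
      by metis
    let ?ds = "map g [0..<length ls]"
    have f: "frc (ss ! i) (vs ! i) (?ds ! i)" if "i < length ss" for i using g that lls vs by simp
    have du: "e < u" if "e \<in> set ?ds" for e
    proof -
      obtain i where i: "i < length ls" "e = g i" using \<open>e \<in> set ?ds\<close> by auto
      have "size (ss ! i) < size (FD f)" using size_arrows(2)[of "ss ! i" ss \<tau>] FD i lls by simp
      then show ?thesis using frc_less[of "ss ! i" _ "g i"] g[of i] i sz by auto
    qed
    have am: "list_all2 (amatch \<rho>) ls ?ds" using g by (auto simp: list_all2_conv_all_nth)
    have "acall f ?ds d"
    proof (rule acall_clause[OF j pj _ du _ am _ \<rho>(2)])
      show "\<rho> x < u" if "x \<in> set (lhs_vars ls)" for x using amatches_bound[OF am _ that] du by blast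
      show "d < u" using frc_less[OF d] size_arrows(1)[of \<tau> ss] FD sz by simp
      fix i assume i: "i < j" "fst (p ! i) = f"
      obtain ls' s' where pi: "p ! i = (f, ls', s')" using i by (cases "p ! i") auto
      then have mem': "(f, ls', s') \<in> set p" using i j nth_mem by (metis less_trans)
      have "\<not> list_all2 shape ls' vs"
        using no i pi clause_matches_iff[OF linear[OF mem'], of f s' f vs] by auto
      moreover have "ashape l (?ds ! i) \<longleftrightarrow> shape l (vs ! i)" if "i < length ls" for l i
        using f[of i] that lls by (intro shape_ashape frc_cases) auto
      ultimately show "\<not> list_all2 ashape (fst (snd (p ! i))) ?ds"
        using pi vs by (auto simp: list_all2_conv_all_nth)
    qed
    then show ?thesis using f lls by (intro exI[of _ ?ds]) auto
  qed
  then show "vt \<tau> z \<and> (\<forall>d. frc \<tau> z d \<longrightarrow>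
     (\<exists>ds. length ds = length ss \<and> (\<forall>j<length ss. frc (ss ! j) (vs ! j) (ds ! j)) \<and> acall f ds d))"
    using C(1)[OF fa] by blast
qed

lemma complete_if:
  assumes IHa: "complete_for \<gamma> a v" and IHe: "complete_for \<gamma> e z"
    and v: "v = vtrue \<and> e = b \<or> v = vfalse \<and> e = c"
  shows "complete_for \<gamma> (EIf a b c) z"
  unfolding complete_for_def
proof (intro allI impI)
  fix \<Gamma> \<sigma> assume t: "btyped H FC FD \<Gamma> (EIf a b c) \<sigma>" and fa: "fa FC 0 (EIf a b c)"
    and cf: "cfok \<gamma> (EIf a b c)" and ve: "venv \<Gamma> \<gamma>" and vars: "evars (EIf a b c) \<subseteq> dom \<gamma>"
  from t have st: "btyped H FC FD \<Gamma> a boolT" "btyped H FC FD \<Gamma> e \<sigma>"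
    using v by (cases rule: btyped.cases; auto)+
  have cf': "cfok \<gamma> a" "cfok \<gamma> e" by (rule cfok_sub[OF cf], use v in \<open>auto simp: subs_def\<close>)+
  have f: "fa FC 0 a" "fa FC 0 e" "evars a \<subseteq> dom \<gamma>" "evars e \<subseteq> dom \<gamma>" using fa vars v by auto
  note A = complete_forD[OF IHa st(1) f(1) cf'(1) ve f(3)]
  note B = complete_forD[OF IHe st(2) f(2) cf'(2) ve f(4)]
  have "\<exists>\<rho>. fenv \<Gamma> \<gamma> \<rho> \<and> aev acall \<rho> (EIf a b c) [] d" if d: "frc \<sigma> z d" for d
  proof -
    obtain d1 where d1: "frc boolT v d1" using frc_exists A(1) by blast
    have "col v = v" using v by (auto simp: vtrue_def vfalse_def)
    then have d1': "d1 \<le> M" "vl d1 = v" "d1 < u" using d1 code_bound by (auto simp: boolT_def frc_data_iff M_def)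
    obtain \<rho>1 \<rho>2 where "fenv \<Gamma> \<gamma> \<rho>1" "aev acall \<rho>1 a [] d1" "fenv \<Gamma> \<gamma> \<rho>2" "aev acall \<rho>2 e [] d"
      using A(2)[OF d1] B(2)[OF d] by blast
    then obtain \<rho> where "fenv \<Gamma> \<gamma> \<rho>" "aev acall \<rho> a [] d1" "aev acall \<rho> e [] d"
      using aev_join[OF ve _ _ _ _ f(3,4)] by blast
    then show ?thesis using d1' v by (intro exI[of _ \<rho>]) auto
  qed
  then show "vt \<sigma> z \<and> (\<forall>d. frc \<sigma> z d \<longrightarrow> (\<exists>\<rho>. fenv \<Gamma> \<gamma> \<rho> \<and> aev acall \<rho> (EIf a b c) [] d))"
    using B(1) by blast
qed

lemma eval_complete: "eval p \<gamma> e z \<Longrightarrow> complete_for \<gamma> e z"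
  and call_complete: "call p f vs z' \<Longrightarrow> complete_call f vs z'"
proof (induction rule: eval_call.inducts)
  case (ev_var \<gamma> x w)
  show ?case unfolding complete_for_def
  proof (intro allI impI)
    fix \<Gamma> \<sigma> assume "btyped H FC FD \<Gamma> (EVar x) \<sigma>" and ve: "venv \<Gamma> \<gamma>"
    then have \<sigma>: "\<sigma> = \<Gamma> x" by (cases rule: btyped.cases) auto
    obtain \<rho> where \<rho>: "fenv \<Gamma> \<gamma> \<rho>" using fenv_exists[OF ve] by blast
    have "fenv \<Gamma> \<gamma> (\<rho>(x := d))" if "frc \<sigma> w d" for d
      using \<rho> that ev_var \<sigma> by (auto simp: fenv_def)
    then have "\<exists>\<rho>. fenv \<Gamma> \<gamma> \<rho> \<and> aev acall \<rho> (EVar x) [] d" if "frc \<sigma> w d" for d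
      using that by (intro exI[of _ "\<rho>(x := d)"]) auto
    then show "vt \<sigma> w \<and> (\<forall>d. frc \<sigma> w d \<longrightarrow> (\<exists>\<rho>. fenv \<Gamma> \<gamma> \<rho> \<and> aev acall \<rho> (EVar x) [] d))"
      using ve ev_var \<sigma> by (auto simp: venv_def)
  qed
next
  case (ev_fun f w \<gamma>)
  show ?case unfolding complete_for_def
  proof (intro allI impI)
    fix \<Gamma> \<sigma> assume t: "btyped H FC FD \<Gamma> (EFun f) \<sigma>" and ve: "venv \<Gamma> \<gamma>"
    then have \<sigma>: "FD f = arrows [] \<sigma>" "size (FD f) \<le> H" by (cases rule: btyped.cases; simp)+
    note C = complete_callD[OF ev_fun.IH(2) \<sigma>(1) _ _ \<sigma>(2)]
    have "\<exists>\<rho>. fenv \<Gamma> \<gamma> \<rho> \<and> aev acall \<rho> (EFun f) [] d" if "frc \<sigma> w d" for d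
      using C(2)[of d] that fenv_exists[OF ve] by auto
    then show "vt \<sigma> w \<and> (\<forall>d. frc \<sigma> w d \<longrightarrow> (\<exists>\<rho>. fenv \<Gamma> \<gamma> \<rho> \<and> aev acall \<rho> (EFun f) [] d))"
      using C(1) by auto
  qed
next
  case (ev_con bs ss \<gamma> c)
  then show ?case by (intro complete_con eval_call.ev_con) auto
next
  case (ev_pair \<gamma> a v b w')
  show ?case unfolding complete_for_def
  proof (intro allI impI)
    fix \<Gamma> \<sigma> assume t: "btyped H FC FD \<Gamma> (EPair a b) \<sigma>" and fa: "fa FC 0 (EPair a b)"
      and cf: "cfok \<gamma> (EPair a b)" and ve: "venv \<Gamma> \<gamma>" and vars: "evars (EPair a b) \<subseteq> dom \<gamma>"
    from t obtain s t' where st: "\<sigma> = Prod s t'" "btyped H FC FD \<Gamma> a s" "btyped H FC FD \<Gamma> b t'"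
      by (cases rule: btyped.cases) auto
    have cf': "cfok \<gamma> a" "cfok \<gamma> b" by (rule cfok_sub[OF cf], auto simp: subs_def)+
    have f: "fa FC 0 a" "fa FC 0 b" "evars a \<subseteq> dom \<gamma>" "evars b \<subseteq> dom \<gamma>" using fa vars by auto
    note A = complete_forD[OF ev_pair.IH(2) st(2) f(1) cf'(1) ve f(3)]
    note B = complete_forD[OF ev_pair.IH(4) st(3) f(2) cf'(2) ve f(4)]
    have v: "vt \<sigma> (VPair v w')" unfolding st(1) by (rule vt_pair[OF A(1) B(1)])
    have "\<exists>\<rho>. fenv \<Gamma> \<gamma> \<rho> \<and> aev acall \<rho> (EPair a b) [] d" if "frc \<sigma> (VPair v w') d" for d
    proof -
      have d: "d \<le> M" "vl d = vstar" using that st(1) by (auto simp: frc_data_iff)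
      obtain d1 d2 where d12: "frc s v d1" "frc t' w' d2" using frc_exists A(1) B(1) by blast
      have u: "d1 < u" "d2 < u" using d12 frc_less btyped_size st(2,3) by blast+
      obtain \<rho>1 \<rho>2 where "fenv \<Gamma> \<gamma> \<rho>1" "aev acall \<rho>1 a [] d1" "fenv \<Gamma> \<gamma> \<rho>2" "aev acall \<rho>2 b [] d2"
        using A(2)[OF d12(1)] B(2)[OF d12(2)] by blast
      then obtain \<rho> where "fenv \<Gamma> \<gamma> \<rho>" "aev acall \<rho> a [] d1" "aev acall \<rho> b [] d2"
        using aev_join[OF ve _ _ _ _ f(3,4)] by blast
      then show ?thesis using d u by (intro exI[of _ \<rho>]) auto
    qed
    then show "vt \<sigma> (VPair v w') \<and> (\<forall>d. frc \<sigma> (VPair v w') d \<longrightarrow>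
       (\<exists>\<rho>. fenv \<Gamma> \<gamma> \<rho> \<and> aev acall \<rho> (EPair a b) [] d))" using v by blast
  qed
next
  case (ev_choose e es \<gamma> w)
  show ?case unfolding complete_for_def
  proof (intro allI impI)
    fix \<Gamma> \<sigma> assume t: "btyped H FC FD \<Gamma> (EChoose es) \<sigma>" and fa: "fa FC 0 (EChoose es)"
      and cf: "cfok \<gamma> (EChoose es)" and ve: "venv \<Gamma> \<gamma>" and vars: "evars (EChoose es) \<subseteq> dom \<gamma>"
    from t ev_choose.hyps(1) have "btyped H FC FD \<Gamma> e \<sigma>" by (cases rule: btyped.cases) auto
    moreover have "cfok \<gamma> e" by (rule cfok_sub[OF cf]) (use ev_choose.hyps(1) in \<open>auto simp: subs_def\<close>)
    moreover have "fa FC 0 e" "evars e \<subseteq> dom \<gamma>" using fa vars ev_choose.hyps(1) by (auto simp: list_all_iff)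
    ultimately have "vt \<sigma> w" "frc \<sigma> w d \<Longrightarrow> \<exists>\<rho>. fenv \<Gamma> \<gamma> \<rho> \<and> aev acall \<rho> e [] d" for d
      using complete_forD[OF ev_choose.IH(2) _ _ _ ve] by blast+
    then show "vt \<sigma> w \<and> (\<forall>d. frc \<sigma> w d \<longrightarrow> (\<exists>\<rho>. fenv \<Gamma> \<gamma> \<rho> \<and> aev acall \<rho> (EChoose es) [] d))"
      using ev_choose.hyps(1) by (meson aev.simps(5))
  qed
next
  case (ev_if_true \<gamma> a b w c)
  then show ?case using complete_if[of \<gamma> a vtrue b w b c] by auto
next
  case (ev_if_false \<gamma> a c w b)
  then show ?case using complete_if[of \<gamma> a vfalse c w b c] by auto
next
  case (ev_app \<gamma> a f vs b v w)
  then show ?case by (intro complete_app)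
next
  case (call_partial vs f)
  then show ?case by (rule complete_partial)
next
  case (call_clause j f ls s vs \<gamma> w)
  then show ?case by (intro complete_clause) auto
qed

theorem goal_complete:
  assumes p: "p \<noteq> []" and main: "FD (main_fun p) = Arrow listT boolT"
    and FC: "FC ''true'' = boolT" "FC ''false'' = boolT" "FC ''nil'' = listT"
      "FC ''cons'' = Arrow boolT (Arrow listT listT)"
    and acc: "prog_accepts p w" and R: "closed R"
  shows "goal R"
proof -
  let ?\<Gamma> = "\<lambda>_. listT" and ?\<gamma> = "[''x'' \<mapsto> enc_list w]"
  obtain ls s where "(main_fun p, ls, s) \<in> set p"
    using p by (metis hd_in_set main_fun_def prod.collapse)
  then obtain \<Gamma> t where "btyped H FC FD \<Gamma> (apps (EFun (main_fun p)) (map pexp ls)) t" using clause_typed by blast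
  then obtain ts where "btyped H FC FD \<Gamma> (EFun (main_fun p)) (arrows ts t)" using btyped_apps by blast
  then have sz: "size (FD (main_fun p)) \<le> H" by cases auto
  then have szL: "size listT \<le> H" using main by simp
  have bf: "btyped H FC FD ?\<Gamma> (EFun (main_fun p)) (Arrow listT boolT)"
    using bFun[of FD "main_fun p" H FC ?\<Gamma>] sz main by simp
  have bx: "btyped H FC FD ?\<Gamma> (EVar ''x'') listT" using bVar[of ?\<Gamma> "''x''" H FC FD] szL by simp
  have t: "btyped H FC FD ?\<Gamma> goal_expr boolT"
    unfolding goal_expr_def by (rule bApp[OF bf bx])
  have bool: "vt boolT (if b then vtrue else vfalse)" for b
  proof -
    have "coded vtrue" "coded vfalse" by (rule cst_coded, use cst_bool in \<open>simp add: vtrue_def vfalse_def\<close>)+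
    then show ?thesis unfolding boolT_def vtrue_def vfalse_def
      using FC by (auto intro!: vt_con[where ks = "[]"] simp: boolT_def)
  qed
  \<comment> \<open>By induction on the length \<open>k\<close> of the suffix, since typing a list
    cell requires typing its tail. The code of this suffix is its starting position
    \<open>length w - k\<close>.\<close>
  have list: "vt listT (enc_list (drop (length w - k) w))" if "k \<le> length w" for k
    using that
  proof (induction k)
    case 0
    have "coded (VCon ''nil'' [])" unfolding coded_def
      by (rule exI[of _ "length w"]) (auto simp: M_def vl_def)
    then show ?case unfolding listT_def using FC
      by (auto intro!: vt_con[where ks = "[]"] simp: listT_def)
  next
    case (Suc k)
    let ?i = "length w - Suc k"
    have d: "drop ?i w = w ! ?i # drop (length w - k) w"
      using Cons_nth_drop_Suc[of ?i w] Suc.prems by (simp add: Suc_diff_Suc)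
    have "coded (enc_list (drop ?i w))" unfolding coded_def
      by (rule exI[of _ ?i]) (auto simp: M_def vl_def)
    then have c: "coded (VCon ''cons'' [if w ! ?i then vtrue else vfalse, enc_list (drop (length w - k) w)])"
      unfolding d by simp
    have FCc: "FC ''cons'' = arrows [boolT, listT] (Sort ''list'')" using FC by (simp add: listT_def)
    have "vt (Sort ''list'') (VCon ''cons'' [if w ! ?i then vtrue else vfalse, enc_list (drop (length w - k) w)])"
      by (rule vt_con[OF FCc _ _ c]) (use bool Suc in \<open>auto simp: less_Suc_eq\<close>)
    then show ?case unfolding d listT_def by simp
  qed
  have vL: "vt listT (enc_list w)" using list[of "length w"] by simp
  have ve: "venv ?\<Gamma> ?\<gamma>" using vL szL by (auto simp: venv_def)
  have ev: "eval p ?\<gamma> goal_expr vtrue" using acc by (simp add: prog_accepts_def goal_expr_def)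
  have cf: "cfok ?\<gamma> goal_expr" by (auto simp: cfok_def goal_expr_def subs_def)
  have fa: "fa FC 0 goal_expr" "evars goal_expr \<subseteq> dom ?\<gamma>" by (auto simp: goal_expr_def)
  note C = complete_forD[OF eval_complete[OF ev] t fa(1) cf ve fa(2)]
  obtain z where z: "frc boolT vtrue z" using frc_exists C(1) by blast
  then obtain \<rho> where \<rho>: "fenv ?\<Gamma> ?\<gamma> \<rho>" "aev acall \<rho> goal_expr [] z" using C(2) by blast
  have "frc listT (enc_list w) (\<rho> ''x'')" using \<rho>(1) by (simp add: fenv_def)
  then have "\<rho> ''x'' \<le> M" "vl (\<rho> ''x'') = enc_list w" by (auto simp: listT_def frc_data_iff)
  \<comment> \<open>The code demanded of the input need not be 0, because a constant of the program
    may have the same value; equality of values is what \<open>le\<close> asks for.\<close>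
  then have "le (\<rho> ''x'') 0" by (simp add: le_def vl_def)
  then have "aev acall (\<lambda>_. 0) goal_expr [] z"
    by (intro aev_mono[OF _ _ \<rho>(2)]) (auto simp: goal_expr_def)
  moreover have "z \<le> M" "vl z = vtrue" using z by (auto simp: boolT_def frc_data_iff vtrue_def)
  ultimately have "goal acall" using code_bound unfolding goal_def M_def by (meson le_less_trans)
  then show ?thesis by (rule goal_mono[rotated]) (use R in \<open>auto simp: acall_def\<close>)
qed

end

section \<open>Acceptance as a bounded formula\<close>

text \<open>A formula is written as a function of the level at which it is placed.\<close>

definition fTT :: "nat \<Rightarrow> fm" where "fTT k = FNeg (FAnd (FEq 0 0) (FNeg (FEq 0 0)))"
definition fNot :: "(nat \<Rightarrow> fm) \<Rightarrow> nat \<Rightarrow> fm" where "fNot f k = FNeg (f k)"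
definition fAnd :: "(nat \<Rightarrow> fm) \<Rightarrow> (nat \<Rightarrow> fm) \<Rightarrow> nat \<Rightarrow> fm" where "fAnd f g k = FAnd (f k) (g k)"
definition fOr :: "(nat \<Rightarrow> fm) \<Rightarrow> (nat \<Rightarrow> fm) \<Rightarrow> nat \<Rightarrow> fm" where "fOr f g = fNot (fAnd (fNot f) (fNot g))"
definition fImp :: "(nat \<Rightarrow> fm) \<Rightarrow> (nat \<Rightarrow> fm) \<Rightarrow> nat \<Rightarrow> fm" where "fImp f g = fNot (fAnd f (fNot g))"
text \<open>The body receives the level \<open>k\<close> as the name of the variable being bound.
  Formulas can thus be composed as in higher-order abstract syntax while the result uses plain
  levels.\<close>

definition fEx :: "nat \<Rightarrow> (nat \<Rightarrow> nat \<Rightarrow> fm) \<Rightarrow> nat \<Rightarrow> fm" where "fEx y F k = FEx y (F k (Suc k))"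
definition fAll :: "nat \<Rightarrow> (nat \<Rightarrow> nat \<Rightarrow> fm) \<Rightarrow> nat \<Rightarrow> fm" where
  "fAll y F = fNot (fEx y (\<lambda>x. fNot (F x)))"
definition fEq :: "nat \<Rightarrow> nat \<Rightarrow> nat \<Rightarrow> fm" where "fEq x y k = FEq x y"
definition fSuc :: "nat \<Rightarrow> nat \<Rightarrow> nat \<Rightarrow> fm" where "fSuc x y k = FSuc x y"
definition fSym :: "nat \<Rightarrow> nat \<Rightarrow> nat \<Rightarrow> fm" where "fSym a x k = FSym a x"
definition fMem :: "nat \<Rightarrow> nat \<Rightarrow> nat \<Rightarrow> fm" where "fMem x y k = FMem x y"
definition fAndL :: "(nat \<Rightarrow> fm) list \<Rightarrow> nat \<Rightarrow> fm" where "fAndL fs = foldr fAnd fs fTT"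
definition fOrL :: "(nat \<Rightarrow> fm) list \<Rightarrow> nat \<Rightarrow> fm" where "fOrL fs = foldr fOr fs (fNot fTT)"

lemma sat_f[simp]:
  "sat w k e (fTT k)"
  "sat w k e (fNot f k) \<longleftrightarrow> \<not> sat w k e (f k)"
  "sat w k e (fAnd f g k) \<longleftrightarrow> sat w k e (f k) \<and> sat w k e (g k)"
  "sat w k e (fOr f g k) \<longleftrightarrow> sat w k e (f k) \<or> sat w k e (g k)"
  "sat w k e (fImp f g k) \<longleftrightarrow> (sat w k e (f k) \<longrightarrow> sat w k e (g k))"
  "y < k \<Longrightarrow> sat w k e (fEx y F k) \<longleftrightarrow> (\<exists>v<e y. sat w (Suc k) (e(k := v)) (F k (Suc k)))"
  "y < k \<Longrightarrow> sat w k e (fAll y F k) \<longleftrightarrow> (\<forall>v<e y. sat w (Suc k) (e(k := v)) (F k (Suc k)))"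
  "x < k \<Longrightarrow> y < k \<Longrightarrow> sat w k e (fEq x y k) \<longleftrightarrow> e x = e y"
  "x < k \<Longrightarrow> y < k \<Longrightarrow> sat w k e (fSuc x y k) \<longleftrightarrow> e y = Suc (e x)"
  "x < k \<Longrightarrow> sat w k e (fSym a x k) \<longleftrightarrow> inp w (e x) = a"
  "x < k \<Longrightarrow> y < k \<Longrightarrow> sat w k e (fMem x y k) \<longleftrightarrow> e x \<in> set_decode (e y)"
  by (auto simp: fTT_def fNot_def fAnd_def fOr_def fImp_def fEx_def fAll_def fEq_def fSuc_def fSym_def fMem_def)

lemma sat_fAndL[simp]: "sat w k e (fAndL fs k) \<longleftrightarrow> (\<forall>f \<in> set fs. sat w k e (f k))"
  by (induction fs) (auto simp: fAndL_def)

lemma sat_fOrL[simp]: "sat w k e (fOrL fs k) \<longleftrightarrow> (\<exists>f \<in> set fs. sat w k e (f k))"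
  by (induction fs) (auto simp: fOrL_def)

fun fExL :: "nat \<Rightarrow> nat \<Rightarrow> (nat list \<Rightarrow> nat \<Rightarrow> fm) \<Rightarrow> nat \<Rightarrow> fm" where
  "fExL u 0 F = F []"
| "fExL u (Suc n) F = fEx u (\<lambda>x. fExL u n (\<lambda>xs. F (x # xs)))"

definition fAllL :: "nat \<Rightarrow> nat \<Rightarrow> (nat list \<Rightarrow> nat \<Rightarrow> fm) \<Rightarrow> nat \<Rightarrow> fm" where
  "fAllL u n F = fNot (fExL u n (\<lambda>xs. fNot (F xs)))"

definition upds :: "(nat \<Rightarrow> nat) \<Rightarrow> nat \<Rightarrow> nat list \<Rightarrow> nat \<Rightarrow> nat" where
  "upds e k vs i = (if k \<le> i \<and> i < k + length vs then vs ! (i - k) else e i)"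

lemma upds_less[simp]: "i < k \<Longrightarrow> upds e k vs i = e i"
  by (simp add: upds_def)

lemma map_upd_less:
  assumes "\<And>x. x \<in> set xs \<Longrightarrow> x < (k::nat)" shows "map (e(k := v)) xs = map e xs"
proof (rule map_cong[OF refl])
  fix x assume "x \<in> set xs"
  then show "(e(k := v)) x = e x" using assms[of x] by simp
qed

lemma upds_Cons: "upds e k (v # vs) = upds (e(k := v)) (Suc k) vs"
  by (auto simp: upds_def fun_eq_iff nth_Cons' Suc_diff_le)

lemma map_upds: "length vs = n \<Longrightarrow> map (upds e k vs) [k..<k + n] = vs"
  by (auto simp: upds_def intro: nth_equalityI)

lemma sat_fExL:
  "u < k \<Longrightarrow> sat w k e (fExL u n F k) \<longleftrightarrow>
    (\<exists>vs. length vs = n \<and> (\<forall>v \<in> set vs. v < e u) \<and> sat w (k + n) (upds e k vs) (F [k..<k + n] (k + n)))"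
proof (induction n arbitrary: k e F)
  case 0
  have "upds e k [] = e" by (auto simp: upds_def)
  then show ?case by simp
next
  case (Suc n)
  have r: "[k..<Suc (k + n)] = k # [Suc k..<Suc (k + n)]" by (simp add: upt_conv_Cons del: upt_Suc)
  have "sat w k e (fExL u (Suc n) F k) \<longleftrightarrow> (\<exists>v<e u. \<exists>vs. length vs = n \<and> (\<forall>v \<in> set vs. v < e u) \<and>
      sat w (k + Suc n) (upds e k (v # vs)) (F [k..<k + Suc n] (k + Suc n)))"
    using Suc.prems Suc.IH[of "Suc k"] by (simp add: upds_Cons r del: upt_Suc)
  also have "\<dots> \<longleftrightarrow> (\<exists>vs. length vs = Suc n \<and> (\<forall>v \<in> set vs. v < e u) \<and>
      sat w (k + Suc n) (upds e k vs) (F [k..<k + Suc n] (k + Suc n)))"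
    by (auto simp: length_Suc_conv simp del: upt_Suc) (metis length_Cons list.set_intros set_ConsD)+
  finally show ?case .
qed

lemma sat_fAllL:
  "u < k \<Longrightarrow> sat w k e (fAllL u n F k) \<longleftrightarrow>
    (\<forall>vs. length vs = n \<longrightarrow> (\<forall>v \<in> set vs. v < e u) \<longrightarrow> sat w (k + n) (upds e k vs) (F [k..<k + n] (k + n)))"
  by (simp add: fAllL_def sat_fExL) blast

fun isOff :: "nat \<Rightarrow> nat \<Rightarrow> nat \<Rightarrow> nat \<Rightarrow> fm" where
  "isOff 0 a x = fEq x a"
| "isOff (Suc j) a x = fEx x (\<lambda>y. fAnd (fSuc y x) (isOff j a y))"

lemma sat_isOff[simp]: "a < k \<Longrightarrow> x < k \<Longrightarrow> sat w k e (isOff j a x k) \<longleftrightarrow> e x = e a + j"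
proof (induction j arbitrary: x k e)
  case (Suc j)
  then show ?case by auto
qed simp

definition isUP :: "nat \<Rightarrow> nat \<Rightarrow> nat \<Rightarrow> nat \<Rightarrow> fm" where
  "isUP c x y = fAnd (fMem x c) (fAnd (fMem y c) (fAll c (\<lambda>z. fImp (fMem z c) (fOr (fEq z x) (fEq z y)))))"

lemma sat_isUP[simp]:
  "c < k \<Longrightarrow> x < k \<Longrightarrow> y < k \<Longrightarrow> sat w k e (isUP c x y k) \<longleftrightarrow> e c = set_encode {e x, e y}"
proof -
  assume a: "c < k" "x < k" "y < k"
  have "sat w k e (isUP c x y k) \<longleftrightarrow> set_decode (e c) = {e x, e y}"
    using a set_decode_bound[of _ "e c"] by (auto simp: isUP_def)
  also have "\<dots> \<longleftrightarrow> e c = set_encode {e x, e y}"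
    by (metis finite.emptyI finite.insertI set_decode_inverse set_encode_inverse)
  finally show ?thesis .
qed

definition isPr :: "nat \<Rightarrow> nat \<Rightarrow> nat \<Rightarrow> nat \<Rightarrow> fm" where
  "isPr c x y = fEx c (\<lambda>a. fEx c (\<lambda>b. fAnd (isUP a x x) (fAnd (isUP b x y) (isUP c a b))))"

lemma sat_isPr[simp]:
  "c < k \<Longrightarrow> x < k \<Longrightarrow> y < k \<Longrightarrow> sat w k e (isPr c x y k) \<longleftrightarrow> e c = pr (e x) (e y)"
proof -
  assume a: "c < k" "x < k" "y < k"
  have "set_encode {e x} < pr (e x) (e y)" "set_encode {e x, e y} < pr (e x) (e y)"
    unfolding pr_def by (rule mem_less_set_encode; simp)+
  then show ?thesis using a by (auto simp: isPr_def pr_def)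
qed

text \<open>In Ackermann's coding the exponential 2 ^ y is the code of the singleton of y, so one
  level of the tower is one use of \<open>isUP\<close> with both members equal.\<close>

fun isTow :: "nat \<Rightarrow> nat \<Rightarrow> nat \<Rightarrow> nat \<Rightarrow> fm" where
  "isTow 0 a z = fEq z a"
| "isTow (Suc j) a z = fEx z (\<lambda>y. fAnd (isTow j a y) (isUP z y y))"

lemma sat_isTow[simp]: "a < k \<Longrightarrow> z < k \<Longrightarrow> sat w k e (isTow j a z k) \<longleftrightarrow> e z = exp2 j (e a)"
proof (induction j arbitrary: z k e)
  case (Suc j)
  then show ?case by (auto simp: less_exp)
qed simp

lemma enc_list_inject[simp]: "enc_list us = enc_list vs \<longleftrightarrow> us = vs"
proof (induction us arbitrary: vs)
  case Nil
  then show ?case by (cases vs) auto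
next
  case (Cons b us)
  then show ?case by (cases vs) (auto simp: vtrue_def vfalse_def)
qed

text \<open>In the formulas below variable 0 is the number 0, variable 1 the length of the input, and
  variable 2 a number beyond it.\<close>

fun sufF :: "bool list \<Rightarrow> nat \<Rightarrow> nat \<Rightarrow> fm" where
  "sufF [] x = fEq x 1"
| "sufF (b # us) x = fAnd (fSym (if b then 2 else 1) x) (fEx 2 (\<lambda>y. fAnd (fSuc x y) (sufF us y)))"

text \<open>The comparison with \<open>M\<close> needs no order relation: numbers below the length
  of the input are recognised by a non-blank symbol, and the remaining ones are the length plus a
  constant offset.\<close>

definition dataF :: "val list \<Rightarrow> nat \<Rightarrow> nat \<Rightarrow> fm" where
  "dataF cst x = fOr (fNot (fSym 0 x)) (fOrL (map (\<lambda>j. isOff j 1 x) [0..<Suc (length cst)]))"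

text \<open>The constant with index \<open>j\<close> has code \<open>length w + 1 + j\<close>, hence
  the offset \<open>Suc j\<close>. If \<open>v\<close> is a list of bits, it may also be a suffix of
  the input; its bits are known when the formula is built and are compared one by one.\<close>

definition valF :: "val list \<Rightarrow> val \<Rightarrow> nat \<Rightarrow> nat \<Rightarrow> fm" where
  "valF cst v x = fOr (fOrL (map (\<lambda>j. isOff (Suc j) 1 x) (filter (\<lambda>j. cst ! j = v) [0..<length cst])))
     (if v \<in> range enc_list then sufF (inv enc_list v) x else fNot fTT)"

text \<open>Different suffixes have different values. Two distinct codes of one value therefore
  involve a constant, so that running through the finitely many constants decides equality.\<close>

definition veqF :: "val list \<Rightarrow> nat \<Rightarrow> nat \<Rightarrow> nat \<Rightarrow> fm" where
  "veqF cst x y = fOr (fAnd (fEq x y) (dataF cst x)) (fOrL (map (\<lambda>v. fAnd (valF cst v x) (valF cst v y)) cst))"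

definition conF :: "val list \<Rightarrow> string \<Rightarrow> nat list \<Rightarrow> nat \<Rightarrow> nat \<Rightarrow> fm" where
  "conF cst c ys d = fAnd (fAndL (map (dataF cst) ys)) (fOr
     (fOrL (map (\<lambda>j. case cst ! j of
          VCon c' us \<Rightarrow> if c' = c \<and> length us = length ys
            then fAnd (isOff (Suc j) 1 d) (fAndL (map (\<lambda>(v, y). valF cst v y) (zip us ys))) else fNot fTT
        | _ \<Rightarrow> fNot fTT) [0..<length cst]))
     (if c = ''nil'' \<and> ys = [] then fEq d 1
      else if c = ''cons'' \<and> length ys = 2
      then fOrL (map (\<lambda>b. fAnd (fSym (if b then 2 else 1) d) (fAnd (valF cst (if b then vtrue else vfalse) (ys ! 0))
             (fEx 2 (\<lambda>z. fAnd (fSuc d z) (veqF cst z (ys ! 1)))))) [True, False])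
      else fNot fTT))"

definition leF :: "val list \<Rightarrow> nat \<Rightarrow> nat \<Rightarrow> nat \<Rightarrow> fm" where
  "leF cst x y = fOr (veqF cst x y) (fAnd (fNot (dataF cst x)) (fAnd (fNot (dataF cst y))
     (fAll x (\<lambda>z. fImp (fMem z x) (fMem z y)))))"

fun tup :: "nat list \<Rightarrow> nat \<Rightarrow> nat" where
  "tup [] d = d"
| "tup (x # xs) d = pr x (tup xs d)"

lemma tup_inject: "length xs = length ys \<Longrightarrow> tup xs d = tup ys d' \<longleftrightarrow> xs = ys \<and> d = d'"
  by (induction xs ys rule: list_induct2) auto

fun tupF :: "nat list \<Rightarrow> nat \<Rightarrow> nat \<Rightarrow> nat \<Rightarrow> fm" where
  "tupF [] d z = fEq z d"
| "tupF (x # xs) d z = fEx z (\<lambda>t. fAnd (tupF xs d t) (isPr z x t))"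

lemma sat_tupF[simp]:
  "(\<And>x. x \<in> set xs \<Longrightarrow> x < k) \<Longrightarrow> d < k \<Longrightarrow> z < k \<Longrightarrow> sat w k e (tupF xs d z k) \<longleftrightarrow> e z = tup (map e xs) (e d)"
proof (induction xs arbitrary: z k e)
  case (Cons x xs)
  have lt: "\<And>y. y \<in> set xs \<Longrightarrow> y < Suc k" "d < Suc k" "k < Suc k"
    using Cons.prems(1)[of _] Cons.prems(2) by (auto intro: less_SucI)
  have ne: "x \<noteq> k" "z \<noteq> k" "d \<noteq> k" "x < Suc k" "z < Suc k" using Cons.prems(1)[of x] Cons.prems(2,3) by auto
  have m: "map (e(k := v)) xs = map e xs" for v by (rule map_upd_less) (use Cons.prems(1) in auto)
  have v: "sat w (Suc k) (e(k := v)) (tupF xs d k (Suc k)) \<longleftrightarrow> v = tup (map e xs) (e d)" for v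
  proof -
    have "sat w (Suc k) (e(k := v)) (tupF xs d k (Suc k)) \<longleftrightarrow> (e(k := v)) k = tup (map (e(k := v)) xs) ((e(k := v)) d)"
      by (rule Cons.IH[OF lt])
    then show ?thesis using ne by (simp add: m)
  qed
  show ?case using Cons.prems(3) v ne pr_less by auto
qed simp

definition names :: "prog \<Rightarrow> string list" where
  "names p = remdups (map fst p)"

definition index :: "prog \<Rightarrow> string \<Rightarrow> nat" where
  "index p f = (LEAST i. i < length (names p) \<and> names p ! i = f)"

text \<open>The number of arguments is part of the tag because \<open>tup\<close> does not show
  where the arguments end and the result begins.\<close>

definition tag :: "prog \<Rightarrow> string \<Rightarrow> nat \<Rightarrow> nat" where
  "tag p f n = index p f + length (names p) * n"

definition entry :: "prog \<Rightarrow> string \<Rightarrow> nat list \<Rightarrow> nat \<Rightarrow> nat" where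
  "entry p f ds d = pr (tag p f (length ds)) (tup ds d)"

lemma index_less: "f \<in> set (names p) \<Longrightarrow> index p f < length (names p) \<and> names p ! index p f = f"
  unfolding index_def by (rule LeastI_ex) (auto simp: in_set_conv_nth)

lemma entry_inject:
  assumes "entry p f ds d = entry p f' ds' d'" "f \<in> set (names p)" "f' \<in> set (names p)"
  shows "f = f' \<and> ds = ds' \<and> d = d'"
proof -
  let ?N = "length (names p)"
  have t: "index p f + ?N * length ds = index p f' + ?N * length ds'" "tup ds d = tup ds' d'"
    using assms(1) unfolding entry_def tag_def pr_inject by blast+
  note i = index_less[OF assms(2)] index_less[OF assms(3)]
  have "(index p f + ?N * length ds) mod ?N = index p f" "(index p f' + ?N * length ds') mod ?N = index p f'"
    using i(1)[THEN conjunct1] i(2)[THEN conjunct1] by (simp_all only: mod_mult_self2 mod_less)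
  then have e: "index p f = index p f'" using t(1) by metis
  then have "length ds = length ds'" using t(1) i(1)[THEN conjunct1] by auto
  then have "ds = ds' \<and> d = d'" using t(2) tup_inject by blast
  moreover have "f = f'" using i e by metis
  ultimately show ?thesis by simp
qed

definition relF :: "prog \<Rightarrow> nat \<Rightarrow> string \<Rightarrow> nat list \<Rightarrow> nat \<Rightarrow> nat \<Rightarrow> fm" where
  "relF p r f ds d = (if f \<in> set (names p) then fEx r (\<lambda>z. fAnd (fMem z r)
     (fEx z (\<lambda>t. fAnd (isOff (tag p f (length ds)) 0 t) (fEx z (\<lambda>q. fAnd (tupF ds d q) (isPr z t q))))))
   else fNot fTT)"

definition rel :: "prog \<Rightarrow> nat \<Rightarrow> string \<Rightarrow> nat list \<Rightarrow> nat \<Rightarrow> bool" where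
  "rel p r f ds d \<longleftrightarrow> f \<in> set (names p) \<and> entry p f ds d \<in> set_decode r"

lemma sat_relF[simp]:
  assumes "\<And>x. x \<in> set ds \<Longrightarrow> x < k" "d < k" "r < k" "0 < k" "e 0 = 0"
  shows "sat w k e (relF p r f ds d k) \<longleftrightarrow> rel p (e r) f (map e ds) (e d)"
proof -
  have m: "map (e(k := a, Suc k := b, Suc (Suc k) := c)) ds = map e ds" for a b c
  proof (rule map_cong[OF refl])
    fix x assume "x \<in> set ds"
    then show "(e(k := a, Suc k := b, Suc (Suc k) := c)) x = e x" using assms(1)[of x] by simp
  qed
  have lt: "x < Suc (Suc (Suc k))" if "x \<in> set ds" for x using assms(1)[OF that] by simp
  have "entry p f (map e ds) (e d) \<in> set_decode (e r) \<longleftrightarrow>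
    (\<exists>z<e r. z \<in> set_decode (e r) \<and> (\<exists>t<z. t = tag p f (length ds) \<and> (\<exists>q<z. q = tup (map e ds) (e d) \<and> z = pr t q)))"
    using set_decode_bound pr_less by (auto simp: entry_def)
  moreover have T: "sat w (Suc (Suc (Suc k))) (e(k := a, Suc k := b, Suc (Suc k) := c))
      (tupF ds d (Suc (Suc k)) (Suc (Suc (Suc k)))) \<longleftrightarrow> c = tup (map e ds) (e d)" for a b c
  proof (subst sat_tupF)
    have "(e(k := a, Suc k := b, Suc (Suc k) := c)) d = e d" using assms(2) by simp
    then show "(e(k := a, Suc k := b, Suc (Suc k) := c)) (Suc (Suc k)) =
      tup (map (e(k := a, Suc k := b, Suc (Suc k) := c)) ds) ((e(k := a, Suc k := b, Suc (Suc k) := c)) d)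
       \<longleftrightarrow> c = tup (map e ds) (e d)" unfolding m by simp
  qed (use lt assms in auto)
  have "r \<noteq> k" "r < Suc k" using assms by auto
  ultimately show ?thesis using assms(3,4,5) by (simp add: relF_def rel_def T del: sat_tupF)
qed

primrec evalF :: "prog \<Rightarrow> val list \<Rightarrow> nat \<Rightarrow> nat \<Rightarrow> (string \<Rightarrow> nat) \<Rightarrow> expr \<Rightarrow> nat list \<Rightarrow> nat \<Rightarrow> nat \<Rightarrow> fm" where
  "evalF p cst r u \<rho> (EVar x) = (\<lambda>ys d. if ys = [] then leF cst d (\<rho> x) else fNot fTT)"
| "evalF p cst r u \<rho> (ECon c) = (\<lambda>ys d. conF cst c ys d)"
| "evalF p cst r u \<rho> (EFun f) = (\<lambda>ys d. if ys = [] then relF p r f [] d else fNot fTT)"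
| "evalF p cst r u \<rho> (EIf a b c) = (\<lambda>ys d. if ys = [] then fOr
     (fAnd (fEx u (\<lambda>z. fAnd (valF cst vtrue z) (evalF p cst r u \<rho> a [] z))) (evalF p cst r u \<rho> b [] d))
     (fAnd (fEx u (\<lambda>z. fAnd (valF cst vfalse z) (evalF p cst r u \<rho> a [] z))) (evalF p cst r u \<rho> c [] d))
   else fNot fTT)"
| "evalF p cst r u \<rho> (EChoose es) = (\<lambda>ys d. if ys = []
     then fOrL (map (\<lambda>g. g [] d) (map (evalF p cst r u \<rho>) es)) else fNot fTT)"
| "evalF p cst r u \<rho> (EPair a b) = (\<lambda>ys d. if ys = [] then fAnd (valF cst vstar d)
     (fAnd (fEx u (\<lambda>z. evalF p cst r u \<rho> a [] z)) (fEx u (\<lambda>z. evalF p cst r u \<rho> b [] z))) else fNot fTT)"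
| "evalF p cst r u \<rho> (EApp a b) = (\<lambda>ys d. fEx u (\<lambda>y. fAnd (evalF p cst r u \<rho> b [] y)
     (fOr (evalF p cst r u \<rho> a (y # ys) d)
       (if ys = [] then fEx u (\<lambda>A. fAnd (fNot (dataF cst A)) (fAnd (evalF p cst r u \<rho> a [] A)
          (fEx A (\<lambda>z. fAnd (isPr z y d) (fMem z A))))) else fNot fTT))))"

primrec shapeF :: "val list \<Rightarrow> nat \<Rightarrow> pat \<Rightarrow> nat \<Rightarrow> nat \<Rightarrow> fm" where
  "shapeF cst u (PVar x) = (\<lambda>d. fTT)"
| "shapeF cst u (PCon c ps) = (\<lambda>d. fExL u (length ps) (\<lambda>ys. fAnd (conF cst c ys d)
     (fAndL (map (\<lambda>i. (map (shapeF cst u) ps ! i) (ys ! i)) [0..<length ps]))))"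

primrec matchF :: "val list \<Rightarrow> nat \<Rightarrow> (string \<Rightarrow> nat) \<Rightarrow> pat \<Rightarrow> nat \<Rightarrow> nat \<Rightarrow> fm" where
  "matchF cst u \<rho> (PVar x) = (\<lambda>d. fEq (\<rho> x) d)"
| "matchF cst u \<rho> (PCon c ps) = (\<lambda>d. fExL u (length ps) (\<lambda>ys. fAnd (conF cst c ys d)
     (fAndL (map (\<lambda>i. (map (matchF cst u \<rho>) ps ! i) (ys ! i)) [0..<length ps]))))"

lemma shapeF_PCon: "shapeF cst u (PCon c ps) d = fExL u (length ps) (\<lambda>ys. fAnd (conF cst c ys d)
     (fAndL (map (\<lambda>i. shapeF cst u (ps ! i) (ys ! i)) [0..<length ps])))"
proof -
  have "map (\<lambda>i. (map (shapeF cst u) ps ! i) (ys ! i)) [0..<length ps]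
      = map (\<lambda>i. shapeF cst u (ps ! i) (ys ! i)) [0..<length ps]" for ys by (rule map_cong) auto
  then show ?thesis by (simp only: shapeF.simps)
qed

lemma matchF_PCon: "matchF cst u \<rho> (PCon c ps) d = fExL u (length ps) (\<lambda>ys. fAnd (conF cst c ys d)
     (fAndL (map (\<lambda>i. matchF cst u \<rho> (ps ! i) (ys ! i)) [0..<length ps])))"
proof -
  have "map (\<lambda>i. (map (matchF cst u \<rho>) ps ! i) (ys ! i)) [0..<length ps]
      = map (\<lambda>i. matchF cst u \<rho> (ps ! i) (ys ! i)) [0..<length ps]" for ys by (rule map_cong) auto
  then show ?thesis by (simp only: matchF.simps)
qed

text \<open>Applied both to levels, when the formula is built, and to the values they denote. The
  default 0 fits both readings since variable 0 is always in scope and has value 0.\<close>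

definition env_of :: "string list \<Rightarrow> nat list \<Rightarrow> string \<Rightarrow> nat" where
  "env_of xs vs x = (case map_of (zip xs vs) x of Some v \<Rightarrow> v | None \<Rightarrow> 0)"

definition partialF :: "prog \<Rightarrow> val list \<Rightarrow> nat \<Rightarrow> nat \<Rightarrow> string \<Rightarrow> nat \<Rightarrow> nat \<Rightarrow> fm" where
  "partialF p cst r u f n = fAllL u n (\<lambda>ds. fAll u (\<lambda>A. fImp (fAnd (fNot (dataF cst A))
     (fAll u (\<lambda>x. fAll u (\<lambda>y. fImp (fEx A (\<lambda>z. fAnd (isPr z x y) (fMem z A))) (relF p r f (ds @ [x]) y)))))
     (relF p r f ds A)))"

text \<open>Earlier clauses with another number of patterns are dropped in advance, as
  \<open>list_all2\<close> fails on lists of different lengths.\<close>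

definition clauseF :: "prog \<Rightarrow> val list \<Rightarrow> nat \<Rightarrow> nat \<Rightarrow> nat \<Rightarrow> nat \<Rightarrow> fm" where
  "clauseF p cst r u j = (case p ! j of (f, ls, s) \<Rightarrow>
     fAllL u (length (lhs_vars ls)) (\<lambda>vs. fAllL u (length ls) (\<lambda>ds. fAll u (\<lambda>d. fImp
       (fAnd (fAndL (map (\<lambda>i. matchF cst u (env_of (lhs_vars ls) vs) (ls ! i) (ds ! i)) [0..<length ls]))
       (fAnd (fAndL (map (\<lambda>i. fNot (fAndL (map (\<lambda>m. shapeF cst u (fst (snd (p ! i)) ! m) (ds ! m)) [0..<length ls])))
           (filter (\<lambda>i. fst (p ! i) = f \<and> length (fst (snd (p ! i))) = length ls) [0..<j])))
         (evalF p cst r u (env_of (lhs_vars ls) vs) s [] d)))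
       (relF p r f ds d)))))"

definition closedF :: "prog \<Rightarrow> val list \<Rightarrow> nat \<Rightarrow> nat \<Rightarrow> nat \<Rightarrow> fm" where
  "closedF p cst r u = fAnd
     (fAndL (map (\<lambda>f. fAndL (map (partialF p cst r u f) [0..<arity p f])) (names p)))
     (fAndL (map (clauseF p cst r u) [0..<length p]))"

definition goalF :: "prog \<Rightarrow> val list \<Rightarrow> nat \<Rightarrow> nat \<Rightarrow> nat \<Rightarrow> fm" where
  "goalF p cst r u = fEx u (\<lambda>z. fAnd (valF cst vtrue z)
     (evalF p cst r u (\<lambda>_. 0) (EApp (EFun (main_fun p)) (EVar ''x'')) [] z))"

section \<open>Correctness of the formulas\<close>

context abstraction
begin

definition env_ok :: "nat \<Rightarrow> (nat \<Rightarrow> nat) \<Rightarrow> bool" where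
  "env_ok k e \<longleftrightarrow> 3 \<le> k \<and> e 0 = 0 \<and> e 1 = length w \<and> length w < e 2"

lemma env_ok_upd[simp]: "env_ok k e \<Longrightarrow> env_ok (Suc k) (e(k := v))"
  by (auto simp: env_ok_def)

lemma env_ok_upds[simp]: "env_ok k e \<Longrightarrow> env_ok (k + n) (upds e k vs)"
  by (auto simp: env_ok_def)

lemma env_okD: "env_ok k e \<Longrightarrow> 0 < k \<and> 1 < k \<and> 2 < k \<and> e 0 = 0 \<and> e 1 = length w \<and> e (Suc 0) = length w \<and> length w < e 2"
  by (auto simp: env_ok_def)

lemma sat_sufF[simp]:
  "env_ok k e \<Longrightarrow> x < k \<Longrightarrow> sat w k e (sufF us x k) \<longleftrightarrow> e x \<le> length w \<and> drop (e x) w = us"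
proof (induction us arbitrary: x k e)
  case Nil
  then show ?case using env_okD[OF Nil(1)] by auto
next
  case (Cons b us)
  have IH: "sat w (Suc k) (e(k := v)) (sufF us k (Suc k)) \<longleftrightarrow> v \<le> length w \<and> drop v w = us" for v
    by (subst Cons.IH[OF env_ok_upd[OF Cons.prems(1)]]) simp_all
  have 1: "sat w k e (sufF (b # us) x k) \<longleftrightarrow> inp w (e x) = (if b then 2 else 1) \<and>
      (\<exists>v<e 2. v = Suc (e x) \<and> v \<le> length w \<and> drop v w = us)"
    using Cons.prems env_okD[OF Cons.prems(1)] IH by auto
  have 2: "inp w (e x) = (if b then 2 else 1) \<longleftrightarrow> e x < length w \<and> w ! e x = b" by (auto simp: inp_def)
  have 3: "e x \<le> length w \<and> drop (e x) w = b # us \<longleftrightarrow>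
     e x < length w \<and> w ! e x = b \<and> drop (Suc (e x)) w = us"
  proof (cases "e x < length w")
    case True
    then have "drop (e x) w = w ! e x # drop (Suc (e x)) w" by (simp add: Cons_nth_drop_Suc)
    then show ?thesis using True by auto
  qed simp
  show ?case unfolding 1 2 3 using env_okD[OF Cons.prems(1)] by auto
qed

lemma sat_dataF[simp]: "env_ok k e \<Longrightarrow> x < k \<Longrightarrow> sat w k e (dataF cst x k) \<longleftrightarrow> e x \<le> M"
proof -
  assume a: "env_ok k e" "x < k"
  then have "sat w k e (dataF cst x k) \<longleftrightarrow> e x < length w \<or> (\<exists>j<Suc (length cst). e x = length w + j)"
    using env_okD[OF a(1)] by (auto simp: dataF_def inp_def simp del: upt_Suc)
  also have "\<dots> \<longleftrightarrow> e x \<le> M"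
  proof (cases "e x < length w")
    case False
    then obtain j where "e x = length w + j" by (metis le_iff_add not_less)
    then show ?thesis by (auto simp: M_def)
  qed (simp add: M_def)
  finally show ?thesis .
qed

lemma sat_valF[simp]:
  "env_ok k e \<Longrightarrow> x < k \<Longrightarrow> sat w k e (valF cst v x k) \<longleftrightarrow> e x \<le> M \<and> vl (e x) = v"
proof -
  assume a: "env_ok k e" "x < k"
  have inj: "inv enc_list (enc_list us) = us" for us by (rule inv_f_f) (auto intro: injI)
  have "sat w k e (valF cst v x k) \<longleftrightarrow> (\<exists>j<length cst. cst ! j = v \<and> e x = Suc (length w + j)) \<or>
     (\<exists>us. v = enc_list us \<and> e x \<le> length w \<and> drop (e x) w = us)"
    using a env_okD[OF a(1)] inj by (auto simp: valF_def)
  also have "\<dots> \<longleftrightarrow> e x \<le> M \<and> vl (e x) = v"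
  proof (cases "e x \<le> length w")
    case True
    then show ?thesis by (auto simp: vl_def M_def)
  next
    case False
    then obtain j where j: "e x = Suc (length w + j)" by (metis less_imp_Suc_add not_le)
    then show ?thesis by (auto simp: vl_def M_def)
  qed
  finally show ?thesis .
qed

lemma vl_suffix_inject: "x \<le> length w \<Longrightarrow> y \<le> length w \<Longrightarrow> vl x = vl y \<longleftrightarrow> x = y"
  by (auto simp: vl_def) (metis diff_diff_cancel length_drop)

lemma vl_cst: "x \<le> M \<Longrightarrow> \<not> x \<le> length w \<Longrightarrow> vl x \<in> set cst"
  by (auto simp: vl_def M_def)

lemma sat_veqF[simp]:
  "env_ok k e \<Longrightarrow> x < k \<Longrightarrow> y < k \<Longrightarrow> sat w k e (veqF cst x y k) \<longleftrightarrow> e x \<le> M \<and> e y \<le> M \<and> vl (e x) = vl (e y)"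
proof -
  assume a: "env_ok k e" "x < k" "y < k"
  have "vl (e y) \<in> set cst" if "e x \<le> M" "e y \<le> M" "vl (e x) = vl (e y)" "e x \<noteq> e y"
    using that vl_suffix_inject[of "e x" "e y"] vl_cst[of "e x"] vl_cst[of "e y"] by metis
  then show ?thesis using a by (auto simp: veqF_def)
qed

lemma sat_leF[simp]:
  "env_ok k e \<Longrightarrow> x < k \<Longrightarrow> y < k \<Longrightarrow> sat w k e (leF cst x y k) \<longleftrightarrow> le (e x) (e y)"
  using set_decode_bound[of _ "e x"] by (auto simp: leF_def le_def)

lemma sat_conF[simp]:
  assumes e: "env_ok k e" and d: "d < k" and ys: "\<And>y. y \<in> set ys \<Longrightarrow> y < k"
  shows "sat w k e (conF cst c ys d k) \<longleftrightarrow> con c (map e ys) (e d)"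
proof -
  note ok = env_okD[OF e]
  let ?D = "\<forall>y \<in> set ys. e y \<le> M" and ?vs = "map vl (map e ys)"
  define X where "X j = (case cst ! j of
          VCon c' us \<Rightarrow> if c' = c \<and> length us = length ys
            then fAnd (isOff (Suc j) 1 d) (fAndL (map (\<lambda>(v, y). valF cst v y) (zip us ys))) else fNot fTT
        | _ \<Rightarrow> fNot fTT)" for j
  define Y where "Y = (if c = ''nil'' \<and> ys = [] then fEq d 1
      else if c = ''cons'' \<and> length ys = 2
      then fOrL (map (\<lambda>b. fAnd (fSym (if b then 2 else 1) d) (fAnd (valF cst (if b then vtrue else vfalse) (ys ! 0))
             (fEx 2 (\<lambda>z. fAnd (fSuc d z) (veqF cst z (ys ! 1)))))) [True, False])
      else fNot fTT)"
  have zip: "(\<forall>(v, y) \<in> set (zip us ys). e y \<le> M \<and> vl (e y) = v) \<longleftrightarrow> us = ?vs"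
    if "length us = length ys" ?D for us
    using that
  proof (induction us ys rule: list_induct2)
    case (Cons v us y ys)
    then show ?case by auto
  qed simp
  have satz: "sat w k e (fAndL (map (\<lambda>(v, y). valF cst v y) (zip us ys)) k) \<longleftrightarrow>
      (\<forall>(v, y) \<in> set (zip us ys). e y \<le> M \<and> vl (e y) = v)" for us
    using e ys by (force dest: set_zip_rightD)
  have X: "sat w k e (X j k) \<longleftrightarrow> e d = Suc (length w + j) \<and> cst ! j = VCon c ?vs" if D: ?D for j
  proof (cases "cst ! j")
    case (VCon c' us)
    show ?thesis
    proof (cases "c' = c \<and> length us = length ys")
      case True
      then show ?thesis using VCon d ok satz[of us] zip[of us] D by (auto simp: X_def)
    next
      case False
      then have "\<not> (c' = c \<and> us = ?vs)" by auto
      then show ?thesis using VCon False by (auto simp: X_def)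
    qed
  qed (auto simp: X_def)
  have Y: "sat w k e (Y k) \<longleftrightarrow> e d \<le> length w \<and> enc_list (drop (e d) w) = VCon c ?vs" if D: ?D
  proof (cases "e d < length w")
    case True
    then have dr: "drop (e d) w = w ! e d # drop (Suc (e d)) w" by (simp add: Cons_nth_drop_Suc)
    have sx: "vl (Suc (e d)) = enc_list (drop (Suc (e d)) w)" "Suc (e d) \<le> M" using True by (auto simp: vl_def M_def)
    show ?thesis
    proof (cases "c = ''cons'' \<and> length ys = 2")
      case c: True
      then obtain y1 y2 where y: "ys = [y1, y2]" by (auto simp: numeral_2_eq_2 length_Suc_conv)
      have y12: "y1 < k" "y2 < k" "y2 \<noteq> k" "d \<noteq> k" "e y1 \<le> M" "e y2 \<le> M" "Suc (e d) < e 2"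
        using y ys[of y1] ys[of y2] d D ok True by auto
      have S: "sat w k e (fEx 2 (\<lambda>z. fAnd (fSuc d z) (veqF cst z y2)) k) \<longleftrightarrow> vl (Suc (e d)) = vl (e y2)"
        using y12 ok e d sx(2) by auto
      have V: "sat w k e (valF cst v y1 k) \<longleftrightarrow> vl (e y1) = v" for v using y12 e by simp
      have "Y = fOrL (map (\<lambda>b. fAnd (fSym (if b then 2 else 1) d) (fAnd (valF cst (if b then vtrue else vfalse) y1)
             (fEx 2 (\<lambda>z. fAnd (fSuc d z) (veqF cst z y2))))) [True, False])"
        unfolding Y_def using c y by simp
      then have "sat w k e (Y k) \<longleftrightarrow> (\<exists>b. inp w (e d) = (if b then 2 else 1) \<and>
          vl (e y1) = (if b then vtrue else vfalse) \<and> vl (Suc (e d)) = vl (e y2))"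
        using d by (simp add: S V ex_bool_eq)
      also have "\<dots> \<longleftrightarrow> vl (e y1) = (if w ! e d then vtrue else vfalse) \<and> vl (Suc (e d)) = vl (e y2)"
        using True by (auto simp: inp_def ex_bool_eq)
      finally show ?thesis using dr sx(1) c y True by auto
    next
      case False
      then have "\<not> sat w k e (Y k)" using True d ok by (auto simp: Y_def)
      moreover have "\<not> (c = ''cons'' \<and> length ?vs = 2)" using False by simp
      ultimately show ?thesis using dr by (auto simp: numeral_2_eq_2)
    qed
  next
    case False
    then show ?thesis using d ok by (auto simp: Y_def inp_def)
  qed
  have "sat w k e (conF cst c ys d k) \<longleftrightarrow> ?D \<and> ((\<exists>j<length cst. sat w k e (X j k)) \<or> sat w k e (Y k))"
    using e ys by (auto simp: conF_def X_def[symmetric] Y_def[symmetric])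
  also have "\<dots> \<longleftrightarrow> ?D \<and> ((\<exists>j<length cst. e d = Suc (length w + j) \<and> cst ! j = VCon c ?vs) \<or>
      e d \<le> length w \<and> enc_list (drop (e d) w) = VCon c ?vs)" using X Y by blast
  also have "\<dots> \<longleftrightarrow> con c (map e ys) (e d)"
  proof (cases "e d \<le> length w")
    case True
    then show ?thesis by (auto simp: con_def vl_def M_def)
  next
    case False
    then obtain j where j: "e d = Suc (length w + j)" by (metis less_imp_Suc_add not_le)
    then show ?thesis by (auto simp: con_def vl_def M_def)
  qed
  finally show ?thesis .
qed

lemma sat_step:
  assumes IH: "\<And>k e ys d. env_ok k e \<Longrightarrow> d < k \<Longrightarrow> (\<And>y. y \<in> set ys \<Longrightarrow> y < k) \<Longrightarrow> r < k \<Longrightarrow> u' < k \<Longrightarrow>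
      e u' = u \<Longrightarrow> (\<And>x. \<rho> x < k) \<Longrightarrow>
      sat w k e (evalF p cst r u' \<rho> s ys d k) \<longleftrightarrow> aev (rel p (e r)) (\<lambda>x. e (\<rho> x)) s (map e ys) (e d)"
    and "env_ok k e" "r < k" "u' < k" "e u' = u" "\<And>x. \<rho> x < k"
  shows "sat w (Suc k) (e(k := v)) (evalF p cst r u' \<rho> s [] k (Suc k)) \<longleftrightarrow>
      aev (rel p (e r)) (\<lambda>x. e (\<rho> x)) s [] v"
proof -
  have "sat w (Suc k) (e(k := v)) (evalF p cst r u' \<rho> s [] k (Suc k)) \<longleftrightarrow>
      aev (rel p ((e(k := v)) r)) (\<lambda>x. (e(k := v)) (\<rho> x)) s (map (e(k := v)) []) ((e(k := v)) k)"
    by (rule IH[OF env_ok_upd[OF assms(2)]]) (use assms in \<open>auto intro: less_SucI\<close>)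
  moreover have "(\<lambda>x. (e(k := v)) (\<rho> x)) = (\<lambda>x. e (\<rho> x))" using assms(6) less_irrefl by force
  moreover have "r \<noteq> k" using assms(3) by auto
  ultimately show ?thesis by (simp only: list.map fun_upd_same fun_upd_other simp_thms)
qed

lemma sat_evalF:
  assumes "env_ok k e" "d < k" "\<And>y. y \<in> set ys \<Longrightarrow> y < k" "r < k" "u' < k" "e u' = u" "\<And>x. \<rho> x < k"
  shows "sat w k e (evalF p cst r u' \<rho> s ys d k) \<longleftrightarrow> aev (rel p (e r)) (\<lambda>x. e (\<rho> x)) s (map e ys) (e d)"
  using assms
proof (induction s arbitrary: k e ys d)
  case (EVar x)
  then show ?case by auto
next
  case (ECon c)
  then show ?case by auto
next
  case (EFun f)
  then have "sat w k e (relF p r f [] d k) \<longleftrightarrow> rel p (e r) f (map e []) (e d)"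
    using env_okD[OF EFun(1)] by (intro sat_relF) auto
  then show ?case by simp
next
  case (EIf a b c)
  have z: "sat w (Suc k) (e(k := v)) (evalF p cst r u' \<rho> a [] k (Suc k)) \<longleftrightarrow>
      aev (rel p (e r)) (\<lambda>x. e (\<rho> x)) a [] v" for v
    by (rule sat_step[OF EIf.IH(1) EIf.prems(1,4-7)])
  have b: "sat w k e (evalF p cst r u' \<rho> b [] d k) \<longleftrightarrow> aev (rel p (e r)) (\<lambda>x. e (\<rho> x)) b [] (e d)"
    by (rule EIf.IH(2)[where ys = "[]", unfolded list.map]) (use EIf.prems in auto)
  have c: "sat w k e (evalF p cst r u' \<rho> c [] d k) \<longleftrightarrow> aev (rel p (e r)) (\<lambda>x. e (\<rho> x)) c [] (e d)"
    by (rule EIf.IH(3)[where ys = "[]", unfolded list.map]) (use EIf.prems in auto)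
  show ?case using EIf.prems z b c by auto
next
  case (EChoose es)
  have "sat w k e (evalF p cst r u' \<rho> s [] d k) \<longleftrightarrow> aev (rel p (e r)) (\<lambda>x. e (\<rho> x)) s [] (e d)"
    if "s \<in> set es" for s
    by (rule EChoose.IH[OF that, where ys = "[]", unfolded list.map]) (use EChoose.prems in auto)
  then show ?case by auto
next
  case (EPair a b)
  have a: "sat w (Suc k) (e(k := v)) (evalF p cst r u' \<rho> a [] k (Suc k)) \<longleftrightarrow>
      aev (rel p (e r)) (\<lambda>x. e (\<rho> x)) a [] v" for v
    by (rule sat_step[OF EPair.IH(1) EPair.prems(1,4-7)])
  have b: "sat w (Suc k) (e(k := v)) (evalF p cst r u' \<rho> b [] k (Suc k)) \<longleftrightarrow>
      aev (rel p (e r)) (\<lambda>x. e (\<rho> x)) b [] v" for v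
    by (rule sat_step[OF EPair.IH(2) EPair.prems(1,4-7)])
  show ?case using EPair.prems a b by auto
next
  case (EApp a b)
  have m: "map (e(k := v)) ys = map e ys" for v by (rule map_upd_less) (use EApp.prems(3) in auto)
  have b: "sat w (Suc k) (e(k := v)) (evalF p cst r u' \<rho> b [] k (Suc k)) \<longleftrightarrow>
      aev (rel p (e r)) (\<lambda>x. e (\<rho> x)) b [] v" for v
    by (rule sat_step[OF EApp.IH(2) EApp.prems(1,4-7)])
  have a: "sat w (Suc k) (e(k := v)) (evalF p cst r u' \<rho> a (k # ys) d (Suc k)) \<longleftrightarrow>
      aev (rel p (e r)) (\<lambda>x. e (\<rho> x)) a (v # map e ys) (e d)" for v
  proof -
    have "sat w (Suc k) (e(k := v)) (evalF p cst r u' \<rho> a (k # ys) d (Suc k)) \<longleftrightarrow>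
      aev (rel p ((e(k := v)) r)) (\<lambda>x. (e(k := v)) (\<rho> x)) a (map (e(k := v)) (k # ys)) ((e(k := v)) d)"
      by (rule EApp.IH(1)[OF env_ok_upd[OF EApp.prems(1)]]) (use EApp.prems in \<open>auto intro: less_SucI\<close>)
    moreover have "(\<lambda>x. (e(k := v)) (\<rho> x)) = (\<lambda>x. e (\<rho> x))" using EApp.prems(7) less_irrefl by force
    moreover have "r \<noteq> k" "d \<noteq> k" using EApp.prems by auto
    ultimately show ?thesis using m by (simp only: list.map fun_upd_same fun_upd_other simp_thms)
  qed
  have A: "sat w (Suc (Suc k)) (e(k := v, Suc k := A)) (evalF p cst r u' \<rho> a [] (Suc k) (Suc (Suc k))) \<longleftrightarrow>
      aev (rel p (e r)) (\<lambda>x. e (\<rho> x)) a [] A" for v A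
  proof -
    have "sat w (Suc (Suc k)) ((e(k := v))(Suc k := A)) (evalF p cst r u' \<rho> a [] (Suc k) (Suc (Suc k))) \<longleftrightarrow>
      aev (rel p ((e(k := v)) r)) (\<lambda>x. (e(k := v)) (\<rho> x)) a [] A"
      by (rule sat_step[OF EApp.IH(1) env_ok_upd[OF EApp.prems(1)]]) (use EApp.prems in \<open>auto intro: less_SucI\<close>)
    moreover have "(\<lambda>x. (e(k := v)) (\<rho> x)) = (\<lambda>x. e (\<rho> x))" using EApp.prems(7) less_irrefl by force
    moreover have "r \<noteq> k" using EApp.prems by auto
    ultimately show ?thesis by (simp only: fun_upd_other simp_thms)
  qed
  have mem: "(\<exists>z<A. z = pr v x \<and> z \<in> set_decode A) \<longleftrightarrow> pr v x \<in> set_decode A" for A v x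
    using set_decode_bound by auto
  have ok: "env_ok (Suc (Suc k)) (e(k := v, Suc k := A))" for v A using EApp.prems(1) by simp
  have lt: "d < Suc (Suc (Suc k))" "k \<noteq> d" "Suc k \<noteq> d" "Suc (Suc k) \<noteq> d" "u' < Suc k" "u' \<noteq> k" using EApp.prems by auto
  have F: "sat w (Suc (Suc k)) (e(k := v, Suc k := A)) (fEx (Suc k) (\<lambda>z. fAnd (isPr z k d) (fMem z (Suc k))) (Suc (Suc k)))
      \<longleftrightarrow> pr v (e d) \<in> set_decode A" for v A
    using lt mem[of A v "e d"] by auto
  have D: "sat w (Suc (Suc k)) (e(k := v, Suc k := A)) (dataF cst (Suc k) (Suc (Suc k))) \<longleftrightarrow> A \<le> M" for v A
    using sat_dataF[OF ok, of "Suc k" v A] by simp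
  have G: "sat w (Suc k) (e(k := v)) (fEx u' (\<lambda>A. fAnd (fNot (dataF cst A)) (fAnd (evalF p cst r u' \<rho> a [] A)
          (fEx A (\<lambda>z. fAnd (isPr z k d) (fMem z A))))) (Suc k)) \<longleftrightarrow>
      (\<exists>A<u. M < A \<and> pr v (e d) \<in> set_decode A \<and> aev (rel p (e r)) (\<lambda>x. e (\<rho> x)) a [] A)" for v
    using EApp.prems(6) lt A F D by (auto simp: not_le simp del: fun_upd_apply simp: fun_upd_other)
  show ?case using EApp.prems(5,6) lt a b G by (auto simp del: fun_upd_apply)
qed

lemma sat_list:
  assumes "length ys = length ps" "\<And>i. i < length ps \<Longrightarrow> sat w k e (F (ps ! i) (ys ! i) k) \<longleftrightarrow> P (ps ! i) (e (ys ! i))"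
  shows "sat w k e (fAndL (map (\<lambda>i. F (ps ! i) (ys ! i)) [0..<length ps]) k) \<longleftrightarrow> list_all2 P ps (map e ys)"
  using assms by (auto simp: list_all2_conv_all_nth)

lemma sat_shapeF:
  assumes "env_ok k e" "d < k" "u' < k" "e u' = u"
  shows "sat w k e (shapeF cst u' l d k) \<longleftrightarrow> ashape l (e d)"
  using assms
proof (induction l arbitrary: k e d)
  case (PCon c ps)
  let ?n = "length ps" and ?ys = "[k..<k + length ps]"
  have "sat w k e (shapeF cst u' (PCon c ps) d k) \<longleftrightarrow>
    (\<exists>vs. length vs = ?n \<and> (\<forall>v \<in> set vs. v < u) \<and> con c vs (e d) \<and> list_all2 ashape ps vs)"
  proof -
    have "sat w (k + ?n) (upds e k vs) (fAnd (conF cst c ?ys d)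
     (fAndL (map (\<lambda>i. shapeF cst u' (ps ! i) (?ys ! i)) [0..<length ps])) (k + ?n)) \<longleftrightarrow>
      con c vs (e d) \<and> list_all2 ashape ps vs" if l: "length vs = ?n" for vs
    proof -
      have m: "map (upds e k vs) ?ys = vs" by (rule map_upds[OF l])
      have "sat w (k + ?n) (upds e k vs) (shapeF cst u' (ps ! i) (?ys ! i) (k + ?n)) \<longleftrightarrow>
          ashape (ps ! i) (upds e k vs (?ys ! i))" if "i < ?n" for i
        using PCon.IH[of "ps ! i" "k + ?n" "upds e k vs" "?ys ! i"] that PCon.prems by simp
      then have "sat w (k + ?n) (upds e k vs) (fAndL (map (\<lambda>i. shapeF cst u' (ps ! i) (?ys ! i)) [0..<length ps]) (k + ?n))
        \<longleftrightarrow> list_all2 ashape ps (map (upds e k vs) ?ys)"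
        by (intro sat_list[where F = "shapeF cst u'"]) auto
      moreover have "sat w (k + ?n) (upds e k vs) (conF cst c ?ys d (k + ?n)) \<longleftrightarrow>
          con c (map (upds e k vs) ?ys) (upds e k vs d)"
        using PCon.prems by (intro sat_conF) auto
      ultimately show ?thesis using PCon.prems m by simp
    qed
    then show ?thesis using PCon.prems unfolding shapeF_PCon matchF_PCon by (simp add: sat_fExL) blast
  qed
  also have "\<dots> \<longleftrightarrow> ashape (PCon c ps) (e d)"
    unfolding ashape.simps amatch.simps by (metis con_bound list_all2_lengthD)
  finally show ?case .
qed simp

lemma sat_matchF:
  assumes "env_ok k e" "d < k" "u' < k" "e u' = u" "\<And>x. \<rho> x < k"
  shows "sat w k e (matchF cst u' \<rho> l d k) \<longleftrightarrow> amatch (\<lambda>x. e (\<rho> x)) l (e d)"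
  using assms
proof (induction l arbitrary: k e d)
  case (PCon c ps)
  let ?n = "length ps" and ?ys = "[k..<k + length ps]" and ?m = "amatch (\<lambda>x. e (\<rho> x))"
  have "sat w k e (matchF cst u' \<rho> (PCon c ps) d k) \<longleftrightarrow>
    (\<exists>vs. length vs = ?n \<and> (\<forall>v \<in> set vs. v < u) \<and> con c vs (e d) \<and> list_all2 ?m ps vs)"
  proof -
    have "sat w (k + ?n) (upds e k vs) (fAnd (conF cst c ?ys d)
     (fAndL (map (\<lambda>i. matchF cst u' \<rho> (ps ! i) (?ys ! i)) [0..<length ps])) (k + ?n)) \<longleftrightarrow>
      con c vs (e d) \<and> list_all2 ?m ps vs" if l: "length vs = ?n" for vs
    proof -
      have m: "map (upds e k vs) ?ys = vs" by (rule map_upds[OF l])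
      have \<rho>: "(\<lambda>x. upds e k vs (\<rho> x)) = (\<lambda>x. e (\<rho> x))" using PCon.prems(5) by auto
      have "sat w (k + ?n) (upds e k vs) (matchF cst u' \<rho> (ps ! i) (?ys ! i) (k + ?n)) \<longleftrightarrow>
          ?m (ps ! i) (upds e k vs (?ys ! i))" if "i < ?n" for i
        using PCon.IH[of "ps ! i" "k + ?n" "upds e k vs" "?ys ! i"] that PCon.prems \<rho> by (simp add: trans_less_add1)
      then have "sat w (k + ?n) (upds e k vs) (fAndL (map (\<lambda>i. matchF cst u' \<rho> (ps ! i) (?ys ! i)) [0..<length ps]) (k + ?n))
        \<longleftrightarrow> list_all2 ?m ps (map (upds e k vs) ?ys)"
        by (intro sat_list[where F = "matchF cst u' \<rho>"]) auto
      moreover have "sat w (k + ?n) (upds e k vs) (conF cst c ?ys d (k + ?n)) \<longleftrightarrow>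
          con c (map (upds e k vs) ?ys) (upds e k vs d)"
        using PCon.prems by (intro sat_conF) auto
      ultimately show ?thesis using PCon.prems m by simp
    qed
    then show ?thesis using PCon.prems unfolding shapeF_PCon matchF_PCon by (simp add: sat_fExL) blast
  qed
  also have "\<dots> \<longleftrightarrow> ?m (PCon c ps) (e d)"
    unfolding ashape.simps amatch.simps by (metis con_bound list_all2_lengthD)
  finally show ?case .
qed simp

lemma sat_partialF:
  assumes e: "env_ok k e" and r: "r < k" and u': "u' < k" "e u' = u"
  shows "sat w k e (partialF p cst r u' f n k) \<longleftrightarrow> (\<forall>ds A. length ds = n \<longrightarrow> (\<forall>d \<in> set ds. d < u) \<longrightarrow>
    M < A \<longrightarrow> A < u \<longrightarrow> (\<forall>x<u. \<forall>y<u. pr x y \<in> set_decode A \<longrightarrow> rel p (e r) f (ds @ [x]) y) \<longrightarrow> rel p (e r) f ds A)"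
proof -
  define body where "body ds = fAll u' (\<lambda>A. fImp (fAnd (fNot (dataF cst A))
     (fAll u' (\<lambda>x. fAll u' (\<lambda>y. fImp (fEx A (\<lambda>z. fAnd (isPr z x y) (fMem z A))) (relF p r f (ds @ [x]) y)))))
     (relF p r f ds A))" for ds
  have body: "sat w k e (body ds k) \<longleftrightarrow> (\<forall>A<u. M < A \<longrightarrow>
      (\<forall>x<u. \<forall>y<u. pr x y \<in> set_decode A \<longrightarrow> rel p (e r) f (map e ds @ [x]) y) \<longrightarrow> rel p (e r) f (map e ds) A)"
    if e: "env_ok k e" and r: "r < k" and u': "u' < k" "e u' = u" and ds: "\<And>d. d \<in> set ds \<Longrightarrow> d < k" for k e ds
  proof -
    note ok = env_okD[OF e]
    have ok1: "env_ok (Suc k) (e(k := A))" for A using e by (rule env_ok_upd)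
    have m1: "map (e(k := A)) ds = map e ds" for A by (rule map_upd_less[OF ds])
    have m3: "map (e(k := A, Suc k := x, Suc (Suc k) := y)) (ds @ [Suc k]) = map e ds @ [x]" for A x y
    proof -
      have "map (e(k := A, Suc k := x, Suc (Suc k) := y)) ds = map e ds"
      proof (rule map_cong[OF refl])
        fix d assume "d \<in> set ds"
        then show "(e(k := A, Suc k := x, Suc (Suc k) := y)) d = e d" using ds[of d] by simp
      qed
      then show ?thesis by simp
    qed
    have R3: "sat w (Suc (Suc (Suc k))) (e(k := A, Suc k := x, Suc (Suc k) := y))
        (relF p r f (ds @ [Suc k]) (Suc (Suc k)) (Suc (Suc (Suc k)))) \<longleftrightarrow> rel p (e r) f (map e ds @ [x]) y" for A x y
    proof (subst sat_relF)
      show "rel p ((e(k := A, Suc k := x, Suc (Suc k) := y)) r) f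
         (map (e(k := A, Suc k := x, Suc (Suc k) := y)) (ds @ [Suc k]))
         ((e(k := A, Suc k := x, Suc (Suc k) := y)) (Suc (Suc k))) \<longleftrightarrow> rel p (e r) f (map e ds @ [x]) y"
        unfolding m3 using r by simp
    qed (use ds r ok in \<open>auto intro: less_SucI\<close>)
    have R1: "sat w (Suc k) (e(k := A)) (relF p r f ds k (Suc k)) \<longleftrightarrow> rel p (e r) f (map e ds) A" for A
    proof (subst sat_relF)
      show "rel p ((e(k := A)) r) f (map (e(k := A)) ds) ((e(k := A)) k) \<longleftrightarrow> rel p (e r) f (map e ds) A"
        unfolding m1 using r by simp
    qed (use ds r ok in \<open>auto intro: less_SucI\<close>)
    have D: "sat w (Suc k) (e(k := A)) (dataF cst k (Suc k)) \<longleftrightarrow> A \<le> M" for A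
      using sat_dataF[OF ok1, of k A] by simp
    have E: "sat w (Suc (Suc (Suc k))) (e(k := A, Suc k := x, Suc (Suc k) := y))
        (fEx k (\<lambda>z. fAnd (isPr z (Suc k) (Suc (Suc k))) (fMem z k)) (Suc (Suc (Suc k)))) \<longleftrightarrow> pr x y \<in> set_decode A" for A x y
      using set_decode_bound by auto
    have ne: "u' \<noteq> k" "u' \<noteq> Suc k" using u' by auto
    show ?thesis unfolding body_def using u' ne by (simp add: R1 R3 D E not_le fun_upd_other less_SucI del: fun_upd_apply) blast
  qed
  have "sat w (k + n) (upds e k vs) (body [k..<k + n] (k + n)) \<longleftrightarrow> (\<forall>A<u. M < A \<longrightarrow>
      (\<forall>x<u. \<forall>y<u. pr x y \<in> set_decode A \<longrightarrow> rel p (e r) f (vs @ [x]) y) \<longrightarrow> rel p (e r) f vs A)"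
    if "length vs = n" for vs
  proof -
    have m: "map (upds e k vs) [k..<k + n] = vs" by (rule map_upds[OF that])
    show ?thesis by (subst body) (use e r u' m in auto)
  qed
  then show ?thesis unfolding partialF_def body_def[symmetric] using u' by (simp add: sat_fAllL) blast
qed

lemma aev_cong: "(\<And>x. x \<in> evars s \<Longrightarrow> \<rho> x = \<rho>' x) \<Longrightarrow> aev R \<rho> s ys d \<longleftrightarrow> aev R \<rho>' s ys d"
  using aev_mono[of R R s \<rho> \<rho>'] aev_mono[of R R s \<rho>' \<rho>] by auto

text \<open>\<open>clause_closed\<close> quantifies over environments on all variable names, the
  formula only over values for the variables of the left-hand side. \<open>env_of\<close> translates
  between the two, and agreement on these variables suffices because matching and evaluating the
  clause depend on nothing else.\<close>

lemma sat_clauseF: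
  assumes e: "env_ok k e" and r: "r < k" and u': "u' < k" "e u' = u" and j: "j < length p"
    and vars: "\<And>f ls s. (f, ls, s) \<in> set p \<Longrightarrow> evars s \<subseteq> set (lhs_vars ls)"
  shows "sat w k e (clauseF p cst r u' j k) \<longleftrightarrow> clause_closed (rel p (e r)) j"
proof -
  obtain f ls s where pj: "p ! j = (f, ls, s)" by (cases "p ! j")
  then have mem: "(f, ls, s) \<in> set p" using j nth_mem by metis
  let ?xs = "lhs_vars ls" and ?n = "length (lhs_vars ls)" and ?l = "length ls"
  let ?no = "\<lambda>ds. \<forall>i<j. fst (p ! i) = f \<longrightarrow> \<not> list_all2 ashape (fst (snd (p ! i))) ds"
  define head where "head vs ds d = fAnd (fAndL (map (\<lambda>i. matchF cst u' (env_of ?xs vs) (ls ! i) (ds ! i)) [0..<length ls]))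
       (fAnd (fAndL (map (\<lambda>i. fNot (fAndL (map (\<lambda>m. shapeF cst u' (fst (snd (p ! i)) ! m) (ds ! m)) [0..<length ls])))
           (filter (\<lambda>i. fst (p ! i) = f \<and> length (fst (snd (p ! i))) = length ls) [0..<j])))
         (evalF p cst r u' (env_of ?xs vs) s [] d))" for vs ds d
  have head: "sat w k e (head vs ds d k) \<longleftrightarrow> list_all2 (amatch (\<lambda>x. e (env_of ?xs vs x))) ls (map e ds) \<and>
      ?no (map e ds) \<and> aev (rel p (e r)) (\<lambda>x. e (env_of ?xs vs x)) s [] (e d)"
    if e: "env_ok k e" and r: "r < k" and u': "u' < k" "e u' = u" and ds: "\<And>d. d \<in> set ds \<Longrightarrow> d < k"
      and len: "length ds = ?l" and vs: "\<And>d. d \<in> set vs \<Longrightarrow> d < k" and d: "d < k" for k e vs ds d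
  proof -
    have \<rho>: "env_of ?xs vs x < k" for x
      using vs env_okD[OF e] by (auto simp: env_of_def split: option.split dest!: map_of_SomeD set_zip_rightD)
    have "sat w k e (fAndL (map (\<lambda>i. matchF cst u' (env_of ?xs vs) (ls ! i) (ds ! i)) [0..<length ls]) k) \<longleftrightarrow>
        list_all2 (amatch (\<lambda>x. e (env_of ?xs vs x))) ls (map e ds)"
      by (rule sat_list[where F = "matchF cst u' (env_of ?xs vs)"])
        (use len sat_matchF[OF e _ u' \<rho>] ds in auto)
    moreover have "sat w k e (fAndL (map (\<lambda>m. shapeF cst u' (qs ! m) (ds ! m)) [0..<length ls]) k) \<longleftrightarrow>
        list_all2 ashape qs (map e ds)" if "length qs = length ls" for qs
      unfolding that[symmetric]
      by (rule sat_list[where F = "shapeF cst u'"]) (use len that sat_shapeF[OF e _ u'] ds in auto)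
    moreover have "sat w k e (evalF p cst r u' (env_of ?xs vs) s [] d k) \<longleftrightarrow>
        aev (rel p (e r)) (\<lambda>x. e (env_of ?xs vs x)) s (map e []) (e d)"
      by (rule sat_evalF[OF e d _ r u' \<rho>]) simp
    moreover have "?no (map e ds) \<longleftrightarrow> (\<forall>i<j. fst (p ! i) = f \<longrightarrow> length (fst (snd (p ! i))) = length ls \<longrightarrow>
        \<not> list_all2 ashape (fst (snd (p ! i))) (map e ds))" using len by (metis length_map list_all2_lengthD)
    ultimately show ?thesis unfolding head_def by auto
  qed
  have body: "sat w k e (fAll u' (\<lambda>d. fImp (head vs ds d) (relF p r f ds d)) k) \<longleftrightarrow>
      (\<forall>d<u. list_all2 (amatch (\<lambda>x. e (env_of ?xs vs x))) ls (map e ds) \<and>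
      ?no (map e ds) \<and> aev (rel p (e r)) (\<lambda>x. e (env_of ?xs vs x)) s [] d \<longrightarrow> rel p (e r) f (map e ds) d)"
    if e: "env_ok k e" and r: "r < k" and u': "u' < k" "e u' = u" and ds: "\<And>d. d \<in> set ds \<Longrightarrow> d < k"
      and len: "length ds = ?l" and vs: "\<And>d. d \<in> set vs \<Longrightarrow> d < k" for k e vs ds
  proof -
    note ok = env_okD[OF e]
    have lt: "env_of ?xs vs x < k" for x
      using vs ok by (auto simp: env_of_def split: option.split dest!: map_of_SomeD set_zip_rightD)
    have \<rho>: "(\<lambda>x. (e(k := d)) (env_of ?xs vs x)) = (\<lambda>x. e (env_of ?xs vs x))" for d
      using lt less_irrefl by force
    have m: "map (e(k := d)) ds = map e ds" for d by (rule map_upd_less[OF ds])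
    have upd: "(e(k := d)) r = e r" "(e(k := d)) k = d" "(e(k := d)) u' = u" for d using r u' by auto
    have H: "sat w (Suc k) (e(k := d)) (head vs ds k (Suc k)) \<longleftrightarrow>
       list_all2 (amatch (\<lambda>x. e (env_of ?xs vs x))) ls (map e ds) \<and>
       ?no (map e ds) \<and> aev (rel p (e r)) (\<lambda>x. e (env_of ?xs vs x)) s [] d" for d
      by (subst head[OF env_ok_upd[OF e]])
        (unfold \<rho> m upd, use r u' ds vs len in \<open>auto intro: less_SucI\<close>)
    have R: "sat w (Suc k) (e(k := d)) (relF p r f ds k (Suc k)) \<longleftrightarrow> rel p (e r) f (map e ds) d" for d
      by (subst sat_relF) (unfold m upd, use r ds ok in \<open>auto intro: less_SucI\<close>)
    show ?thesis using u' by (simp add: H R)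
  qed
  have "sat w k e (clauseF p cst r u' j k) \<longleftrightarrow> (\<forall>vs. length vs = ?n \<longrightarrow> (\<forall>v\<in>set vs. v < u) \<longrightarrow>
     (\<forall>ds. length ds = ?l \<longrightarrow> (\<forall>v\<in>set ds. v < u) \<longrightarrow>
      (\<forall>d<u. list_all2 (amatch (env_of ?xs vs)) ls ds \<and> ?no ds \<and> aev (rel p (e r)) (env_of ?xs vs) s [] d \<longrightarrow>
         rel p (e r) f ds d)))"
  proof -
    have "sat w (k + ?n) (upds e k vs) (fAllL u' ?l (\<lambda>ds. fAll u' (\<lambda>d. fImp (head [k..<k + ?n] ds d) (relF p r f ds d))) (k + ?n)) \<longleftrightarrow>
      (\<forall>ds. length ds = ?l \<longrightarrow> (\<forall>v\<in>set ds. v < u) \<longrightarrow>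
      (\<forall>d<u. list_all2 (amatch (env_of ?xs vs)) ls ds \<and> ?no ds \<and> aev (rel p (e r)) (env_of ?xs vs) s [] d \<longrightarrow>
         rel p (e r) f ds d))" if len: "length vs = ?n" for vs
    proof -
      let ?e1 = "upds e k vs" and ?k1 = "k + ?n"
      have e1: "env_ok ?k1 ?e1" using e by simp
      have "sat w (?k1 + ?l) (upds ?e1 ?k1 ds)
          (fAll u' (\<lambda>d. fImp (head [k..<k + ?n] [?k1..<?k1 + ?l] d) (relF p r f [?k1..<?k1 + ?l] d)) (?k1 + ?l)) \<longleftrightarrow>
        (\<forall>d<u. list_all2 (amatch (env_of ?xs vs)) ls ds \<and> ?no ds \<and> aev (rel p (e r)) (env_of ?xs vs) s [] d \<longrightarrow>
         rel p (e r) f ds d)" if l2: "length ds = ?l" for ds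
      proof -
        let ?e2 = "upds ?e1 ?k1 ds"
        have m: "map ?e2 [?k1..<?k1 + ?l] = ds" by (rule map_upds[OF l2])
        have ru: "?e2 r = e r" "?e2 u' = u" using r u' by auto
        have \<rho>: "(\<lambda>x. ?e2 (env_of ?xs [k..<k + ?n] x)) = env_of ?xs vs"
        proof
          fix x
          have z: "map_of (zip ?xs (map ?e2 [k..<k + ?n])) x = map_option ?e2 (map_of (zip ?xs [k..<k + ?n]) x)"
            by (simp add: map_of_zip_map zip_map2 map_of_map)
          have "map ?e2 [k..<k + ?n] = map ?e1 [k..<k + ?n]" by (rule map_cong) auto
          then have "map ?e2 [k..<k + ?n] = vs" using map_upds[OF len] by simp
          moreover have "?e2 0 = 0" using env_okD[OF e] by simp
          ultimately show "?e2 (env_of ?xs [k..<k + ?n] x) = env_of ?xs vs x"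
            using z unfolding env_of_def
            by (cases "map_of (zip ?xs [k..<k + ?n]) x") (simp_all only: option.simps)
        qed
        show ?thesis
          by (subst body[OF env_ok_upds[OF e1]]) (unfold m ru \<rho>, use r u' in auto)
      qed
      then show ?thesis using u' by (simp add: sat_fAllL)
    qed
    then show ?thesis unfolding clauseF_def pj prod.case head_def[symmetric] using u' by (simp add: sat_fAllL)
  qed
  also have "\<dots> \<longleftrightarrow> clause_closed (rel p (e r)) j"
  proof
    assume L: "\<forall>vs. length vs = ?n \<longrightarrow> (\<forall>v\<in>set vs. v < u) \<longrightarrow>
     (\<forall>ds. length ds = ?l \<longrightarrow> (\<forall>v\<in>set ds. v < u) \<longrightarrow>
      (\<forall>d<u. list_all2 (amatch (env_of ?xs vs)) ls ds \<and> ?no ds \<and> aev (rel p (e r)) (env_of ?xs vs) s [] d \<longrightarrow>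
         rel p (e r) f ds d))"
    show "clause_closed (rel p (e r)) j" unfolding clause_closed_def pj prod.case
    proof (intro allI impI)
      fix \<rho> ds d
      assume a: "\<forall>x \<in> set ?xs. \<rho> x < u" "\<forall>d \<in> set ds. d < u" "d < u" "list_all2 (amatch \<rho>) ls ds" "?no ds"
        "aev (rel p (e r)) \<rho> s [] d"
      let ?vs = "map \<rho> ?xs"
      have eq: "env_of ?xs ?vs x = \<rho> x" if "x \<in> set ?xs" for x
        using that by (simp add: env_of_def map_of_zip_map)
      have "amatch (env_of ?xs ?vs) l = amatch \<rho> l" if "l \<in> set ls" for l
        by (intro ext amatch_cong eq) (use that in \<open>auto simp: lhs_vars_def\<close>)
      then have "list_all2 (amatch (env_of ?xs ?vs)) ls ds" using a(4) by (auto simp: list_all2_conv_all_nth)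
      moreover have "aev (rel p (e r)) (env_of ?xs ?vs) s [] d"
        using a(6) aev_cong[of s "env_of ?xs ?vs" \<rho>] eq vars[OF mem] by blast
      moreover have "length ds = ?l" using a(4) by (simp add: list_all2_lengthD)
      ultimately show "rel p (e r) f ds d" using L[rule_format, of ?vs ds d] a by auto
    qed
  next
    assume R: "clause_closed (rel p (e r)) j"
    show "\<forall>vs. length vs = ?n \<longrightarrow> (\<forall>v\<in>set vs. v < u) \<longrightarrow>
     (\<forall>ds. length ds = ?l \<longrightarrow> (\<forall>v\<in>set ds. v < u) \<longrightarrow>
      (\<forall>d<u. list_all2 (amatch (env_of ?xs vs)) ls ds \<and> ?no ds \<and> aev (rel p (e r)) (env_of ?xs vs) s [] d \<longrightarrow>
         rel p (e r) f ds d))"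
    proof (intro allI impI)
      fix vs ds d
      assume a: "length vs = ?n" "\<forall>v\<in>set vs. v < u" "length ds = ?l" "\<forall>v\<in>set ds. v < u" "d < u"
       "list_all2 (amatch (env_of ?xs vs)) ls ds \<and> ?no ds \<and> aev (rel p (e r)) (env_of ?xs vs) s [] d"
      have "env_of ?xs vs x < u" for x
        using a(2) code_bound by (auto simp: env_of_def split: option.split dest!: map_of_SomeD set_zip_rightD)
      then show "rel p (e r) f ds d" using R a unfolding clause_closed_def pj prod.case by blast
    qed
  qed
  finally show ?thesis .
qed

lemma sat_closedF:
  assumes e: "env_ok k e" and r: "r < k" and u': "u' < k" "e u' = u"
    and vars: "\<And>f ls s. (f, ls, s) \<in> set p \<Longrightarrow> evars s \<subseteq> set (lhs_vars ls)"
  shows "sat w k e (closedF p cst r u' k) \<longleftrightarrow> closed (rel p (e r))"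
proof -
  have n: "set (names p) = fst ` set p" by (auto simp: names_def)
  define Q where "Q f ds A \<longleftrightarrow> ((\<forall>d \<in> set ds. d < u) \<longrightarrow> M < A \<longrightarrow> A < u \<longrightarrow>
    (\<forall>x<u. \<forall>y<u. pr x y \<in> set_decode A \<longrightarrow> rel p (e r) f (ds @ [x]) y) \<longrightarrow> rel p (e r) f ds A)" for f ds A
  have "sat w k e (partialF p cst r u' f n k) \<longleftrightarrow> (\<forall>ds A. length ds = n \<longrightarrow> Q f ds A)" for f n
    unfolding Q_def by (rule sat_partialF[OF e r u'])
  then have 1: "sat w k e (fAndL (map (\<lambda>f. fAndL (map (partialF p cst r u' f) [0..<arity p f])) (names p)) k) \<longleftrightarrow>
      (\<forall>f \<in> fst ` set p. \<forall>ds A. length ds < arity p f \<longrightarrow> Q f ds A)" by (auto simp: n)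
  have "sat w k e (clauseF p cst r u' j k) \<longleftrightarrow> clause_closed (rel p (e r)) j" if "j < length p" for j
    by (rule sat_clauseF[OF e r u' that]) (use vars in blast)
  then have 2: "sat w k e (fAndL (map (clauseF p cst r u') [0..<length p]) k) \<longleftrightarrow>
      (\<forall>j<length p. clause_closed (rel p (e r)) j)" by auto
  show ?thesis unfolding closedF_def closed_def sat_f(3) 1 2 Q_def ..
qed

lemma sat_goalF:
  assumes e: "env_ok k e" and r: "r < k" and u': "u' < k" "e u' = u"
  shows "sat w k e (goalF p cst r u' k) \<longleftrightarrow> goal (rel p (e r))"
proof -
  have "sat w (Suc k) (e(k := v)) (evalF p cst r u' (\<lambda>_. 0) goal_expr [] k (Suc k)) \<longleftrightarrow>
      aev (rel p (e r)) (\<lambda>x. e 0) goal_expr [] v" for v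
    by (rule sat_step[OF sat_evalF e r u']) (use env_okD[OF e] in auto)
  moreover have "sat w (Suc k) (e(k := v)) (valF cst vtrue k (Suc k)) \<longleftrightarrow> v \<le> M \<and> vl v = vtrue" for v
    using sat_valF[OF env_ok_upd[OF e], of k v vtrue] by simp
  ultimately show ?thesis unfolding goalF_def goal_def goal_expr_def[symmetric]
    using u' env_okD[OF e] by (simp add: conj_assoc)
qed

end

section \<open>Cons-free programs decide elementary problems\<close>

lemma set_encode_less: "A \<subseteq> {..<B} \<Longrightarrow> set_encode A < 2 ^ B"
proof -
  assume A: "A \<subseteq> {..<B}"
  have "sum ((^) (2::nat)) A \<le> sum ((^) 2) {..<B}" using A by (intro sum_mono2) auto
  also have "\<dots> < 2 ^ B" by (induction B) auto
  finally show ?thesis unfolding set_encode_def .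
qed

lemma pr_bound: "x < B \<Longrightarrow> y < B \<Longrightarrow> pr x y < 2 ^ 2 ^ B"
  unfolding pr_def by (intro set_encode_less) (auto intro!: set_encode_less simp del: set_encode_insert)

lemma tup_bound: "(\<And>x. x \<in> set xs \<Longrightarrow> x < u) \<Longrightarrow> d < u \<Longrightarrow> tup xs d < exp2 (2 * length xs) u"
proof (induction xs)
  case (Cons x xs)
  let ?B = "exp2 (2 * length xs) u"
  have "x < u" "u \<le> ?B" using Cons.prems(1)[of x] exp2_ge by auto
  moreover have "tup xs d < ?B" using Cons by auto
  ultimately have "pr x (tup xs d) < 2 ^ 2 ^ ?B" by (intro pr_bound) auto
  then show ?case by simp
qed simp

lemma entry_bound:
  assumes "\<And>x. x \<in> set ds \<Longrightarrow> x < u" "d < u" "tag p f (length ds) < u"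
  shows "entry p f ds d < exp2 (2 * length ds + 2) u"
proof -
  let ?B = "exp2 (2 * length ds) u"
  have "u \<le> ?B" by (rule exp2_ge)
  then have "pr (tag p f (length ds)) (tup ds d) < 2 ^ 2 ^ ?B"
    using assms tup_bound[of ds u d] by (intro pr_bound) auto
  then show ?thesis by (simp add: entry_def)
qed

lemma tag_less: "f \<in> set (names p) \<Longrightarrow> n \<le> a \<Longrightarrow> tag p f n < length (names p) * (a + 1)"
proof -
  assume a: "f \<in> set (names p)" "n \<le> a"
  have "tag p f n < length (names p) + length (names p) * n" using index_less[OF a(1)] by (simp add: tag_def)
  also have "\<dots> = length (names p) * (n + 1)" by simp
  also have "\<dots> \<le> length (names p) * (a + 1)" using a(2) by (intro mult_le_mono) auto
  finally show ?thesis .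
qed

context abstraction
begin

text \<open>Each arrow costs three levels: two for forming pairs and one for forming a set of them.
  The base \<open>M + 2\<close> leaves room for the odd marker, which is below twice the
  base.\<close>

lemma codes_tower: "codes \<sigma> \<subseteq> {..<exp2 (3 * size \<sigma>) (M + 2)}"
proof (induction \<sigma>)
  case (Arrow s t)
  let ?B = "exp2 (3 * (size s + size t)) (M + 2)"
  have ge: "exp2 (3 * size s) (M + 2) \<le> ?B" "exp2 (3 * size t) (M + 2) \<le> ?B" "M + 2 \<le> ?B"
    by (rule exp2_mono_height exp2_ge; simp)+
  have "A < exp2 3 ?B" if A: "A \<in> codes (Arrow s t)" for A
  proof -
    have "z < 2 ^ 2 ^ ?B" if z: "z \<in> set_decode A" for z
    proof -
      from A z consider "z = 2 * M + 1" | x y where "x \<in> codes s" "y \<in> codes t" "z = pr x y" by auto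
      then show ?thesis
      proof cases
        case 1
        have "z < 2 * ?B" using 1 ge(3) by simp
        also have "\<dots> \<le> 2 ^ ?B" by (rule double_le_exp)
        also have "\<dots> \<le> 2 ^ 2 ^ ?B" by (simp add: less_imp_le less_exp)
        finally show ?thesis .
      next
        case 2
        then have "x < ?B" "y < ?B" using Arrow ge(1,2) by fastforce+
        then show ?thesis unfolding 2(3) by (rule pr_bound)
      qed
    qed
    then have "set_encode (set_decode A) < 2 ^ 2 ^ 2 ^ ?B" by (intro set_encode_less) auto
    then show ?thesis by (simp add: numeral_3_eq_3)
  qed
  moreover have "3 * size (Arrow s t) = 3 + 3 * (size s + size t)" by simp
  ultimately show ?case using exp2_exp2[of 3 "3 * (size s + size t)" "M + 2"] by auto
next
  case (Prod s t)
  have "M < exp2 (3 * size (Prod s t)) (M + 2)" using exp2_ge[of "M + 2"] by (rule less_le_trans[rotated]) simp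
  then show ?case by (auto simp del: exp2.simps)
qed auto

text \<open>An arbitrary closed relation is cut down to at most \<open>a\<close> arguments and to
  codes below \<open>u\<close>. What remains is finite and hence a number, and it is still closed,
  because the rules only draw conclusions inside these limits. The height 2 * a + 3 consists of two
  levels for each argument, two for the tag and one for the set of entries.\<close>

lemma restrict_relation:
  assumes ar: "\<And>f. arity p f \<le> a" "\<And>f ls s. (f, ls, s) \<in> set p \<Longrightarrow> length ls \<le> a"
    and tg: "length (names p) * (a + 1) \<le> u" and T: "exp2 (2 * a + 3) u \<le> T" and R: "closed R"
  shows "\<exists>r<T. closed (rel p r) \<and> (\<forall>f d. rel p r f [] d \<longrightarrow> R f [] d)"
proof -
  define G where "G = {entry p f ds d | f ds d. f \<in> set (names p) \<and> length ds \<le> a \<and> (\<forall>x \<in> set ds. x < u) \<and> d < u \<and> R f ds d}"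
  have n: "set (names p) = fst ` set p" by (auto simp: names_def)
  have G: "G \<subseteq> {..<exp2 (2 * a + 2) u}"
  proof
    fix z assume "z \<in> G"
    then obtain f ds d where z: "z = entry p f ds d" "f \<in> set (names p)" "length ds \<le> a" "\<forall>x \<in> set ds. x < u" "d < u"
      unfolding G_def by blast
    have "z < exp2 (2 * length ds + 2) u"
      unfolding z(1) using z tag_less[OF z(2,3)] tg by (intro entry_bound) auto
    also have "\<dots> \<le> exp2 (2 * a + 2) u" using z by (intro exp2_mono_height) simp
    finally show "z \<in> {..<exp2 (2 * a + 2) u}" by simp
  qed
  then have fin: "finite G" by (rule finite_subset) simp
  let ?r = "set_encode G"
  have "?r < 2 ^ exp2 (2 * a + 2) u" by (rule set_encode_less[OF G])
  also have "\<dots> \<le> T" using T by (simp add: numeral_3_eq_3 numeral_2_eq_2)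
  finally have rT: "?r < T" .
  have rel: "rel p ?r f ds d \<longleftrightarrow> f \<in> set (names p) \<and> length ds \<le> a \<and> (\<forall>x \<in> set ds. x < u) \<and> d < u \<and> R f ds d" for f ds d
  proof
    assume "rel p ?r f ds d"
    then have f: "f \<in> set (names p)" and "entry p f ds d \<in> G" using fin by (auto simp: rel_def)
    then obtain f' ds' d' where 1: "entry p f ds d = entry p f' ds' d'" "f' \<in> set (names p)"
      "length ds' \<le> a \<and> (\<forall>x \<in> set ds'. x < u) \<and> d' < u \<and> R f' ds' d'" unfolding G_def by blast
    then show "f \<in> set (names p) \<and> length ds \<le> a \<and> (\<forall>x \<in> set ds. x < u) \<and> d < u \<and> R f ds d"
      using entry_inject[OF 1(1) f 1(2)] by auto
  qed (use fin in \<open>auto simp: rel_def G_def\<close>)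
  have "closed (rel p ?r)" unfolding closed_def
  proof (intro conjI ballI allI impI)
    fix f ds A
    assume f: "f \<in> fst ` set p" and len: "length ds < arity p f" and ds: "\<forall>d\<in>set ds. d < u" and A: "M < A" "A < u"
      and H: "\<forall>x<u. \<forall>y<u. pr x y \<in> set_decode A \<longrightarrow> rel p ?r f (ds @ [x]) y"
    have "\<forall>x<u. \<forall>y<u. pr x y \<in> set_decode A \<longrightarrow> R f (ds @ [x]) y" using H unfolding rel by blast
    then have "R f ds A" using R f len ds A unfolding closed_def by blast
    moreover have "length ds \<le> a" using len ar(1)[of f] by simp
    ultimately show "rel p ?r f ds A" using f ds A unfolding rel n by blast
  next
    fix j assume j: "j < length p"
    obtain f ls s where pj: "p ! j = (f, ls, s)" by (cases "p ! j")
    then have mem: "(f, ls, s) \<in> set p" using j nth_mem by metis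
    have Rj: "clause_closed R j" using R j unfolding closed_def by blast
    show "clause_closed (rel p ?r) j" unfolding clause_closed_def pj prod.case
    proof (intro allI impI)
      fix \<rho> ds d
      assume x: "\<forall>x \<in> set (lhs_vars ls). \<rho> x < u" "\<forall>d \<in> set ds. d < u" "d < u" "list_all2 (amatch \<rho>) ls ds"
        "\<forall>i<j. fst (p ! i) = f \<longrightarrow> \<not> list_all2 ashape (fst (snd (p ! i))) ds"
        "aev (rel p ?r) \<rho> s [] d"
      have "aev R \<rho> s [] d" by (rule aev_mono[OF _ _ x(6)]) (auto simp: rel)
      then have "R f ds d" using Rj x unfolding clause_closed_def pj prod.case by blast
      moreover have "length ds \<le> a" using ar(2)[OF mem] list_all2_lengthD[OF x(4)] by simp
      moreover have "f \<in> set (names p)" unfolding n using mem by force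
      ultimately show "rel p ?r f ds d" using x unfolding rel by blast
    qed
  qed
  then show ?thesis using rT rel by blast
qed

end

text \<open>A data expression contains neither variables nor calls nor \<open>choose\<close>. Its
  value is the same in all environments, which is why finitely many constants suffice for a whole
  program.\<close>

lemma dexp_det: "is_dexp t \<Longrightarrow> eval p \<gamma> t z \<Longrightarrow> eval p \<gamma>' t z' \<Longrightarrow> z = z'"
proof (induction arbitrary: z z' rule: is_dexp.induct)
  case (1 ds c)
  obtain bs where bs: "z = VCon c bs" "length bs = length ds" "\<forall>i<length ds. eval p \<gamma> (ds ! i) (bs ! i)"
    using eval_apps_con[OF 1(2)] by blast
  obtain bs' where bs': "z' = VCon c bs'" "length bs' = length ds" "\<forall>i<length ds. eval p \<gamma>' (ds ! i) (bs' ! i)"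
    using eval_apps_con[OF 1(3)] by blast
  have "bs ! i = bs' ! i" if "i < length ds" for i
    using 1(1) bs(3) bs'(3) that nth_mem[OF that] by blast
  then have "bs = bs'" using bs bs' by (intro nth_equalityI) auto
  then show ?case using bs bs' by simp
next
  case (2 a b)
  from 2(5) obtain v w where "z = VPair v w" "eval p \<gamma> a v" "eval p \<gamma> b w"
    by (cases rule: eval.cases) auto
  moreover from 2(6) obtain v' w' where "z' = VPair v' w'" "eval p \<gamma>' a v'" "eval p \<gamma>' b w'"
    by (cases rule: eval.cases) auto
  ultimately show ?case using 2(3,4) by blast
qed

lemma finite_strict_subs: "finite (strict_subs e)"
  by (induction e) auto

fun subterms :: "val \<Rightarrow> val set" where
  "subterms (VCon c vs) = insert (VCon c vs) (\<Union> (subterms ` set vs))"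
| "subterms v = {v}"

lemma finite_subterms: "finite (subterms v)"
  by (induction v) auto

lemma subterms_refl: "v \<in> subterms v"
  by (cases v) auto

lemma subterms_closed: "VCon c vs \<in> subterms v \<Longrightarrow> v' \<in> set vs \<Longrightarrow> v' \<in> subterms v"
  by (induction v) (auto intro: subterms_refl)

lemma constants_exist:
  obtains cst where "vstar \<in> set cst" "vtrue \<in> set cst" "vfalse \<in> set cst"
    "\<And>c vs v. VCon c vs \<in> set cst \<Longrightarrow> v \<in> set vs \<Longrightarrow> v \<in> set cst"
    "\<And>f ls s t \<gamma> z. (f, ls, s) \<in> set p \<Longrightarrow> t \<in> subs s \<Longrightarrow> is_dexp t \<Longrightarrow> eval p \<gamma> t z \<Longrightarrow> col z \<in> set cst"
proof -
  define D where "D = {t. \<exists>(f, ls, s) \<in> set p. t \<in> subs s \<and> is_dexp t}"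
  \<comment> \<open>For a data expression with a value, \<open>SOME\<close> picks that unique value.
    For one without, it picks something arbitrary, which merely adds an entry to the finite
    list.\<close>
  define V where "V = (\<lambda>t. col (SOME z. \<exists>\<gamma>. eval p \<gamma> t z)) ` D"
  define C where "C = \<Union> (subterms ` ({vstar, vtrue, vfalse} \<union> V))"
  have "D \<subseteq> (\<Union>(f, ls, s) \<in> set p. subs s)" unfolding D_def by auto
  then have "finite D" by (rule finite_subset) (auto simp: subs_def finite_strict_subs)
  then have "finite C" unfolding C_def V_def by (auto simp: finite_subterms)
  then obtain cst where cst: "set cst = C" using finite_list by blast
  have in_C: "v \<in> C" if "v \<in> {vstar, vtrue, vfalse} \<union> V" for v
    using that subterms_refl unfolding C_def by blast
  have "col z \<in> C" if "(f, ls, s) \<in> set p" "t \<in> subs s" "is_dexp t" "eval p \<gamma> t z" for f ls s t \<gamma> z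
  proof -
    have "\<exists>\<gamma>. eval p \<gamma> t (SOME z. \<exists>\<gamma>. eval p \<gamma> t z)" using that(4) by (rule_tac someI_ex) blast
    then have "z = (SOME z. \<exists>\<gamma>. eval p \<gamma> t z)" using dexp_det[OF that(3,4)] by blast
    moreover have "t \<in> D" using that unfolding D_def by blast
    ultimately show ?thesis using in_C unfolding V_def by blast
  qed
  moreover have "v \<in> C" if "VCon c vs \<in> C" "v \<in> set vs" for c vs v
    using that subterms_closed unfolding C_def by blast
  ultimately show ?thesis using that[of cst] in_C unfolding cst by blast
qed

theorem wf_cf_ELEMENTARY:
  assumes wf: "wf_cf_prog K p" and acc: "accepted_problem p = X" and nil: "[] \<notin> X"
  shows "X \<in> ELEMENTARY"
proof -
  obtain FC FD where tpo: "typed_prog_order FC FD K p"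
    and fa: "\<And>f ls s. (f, ls, s) \<in> set p \<Longrightarrow> fa FC 0 s \<and> list_all (pat_fa FC) ls"
    and ar: "same_arities p" and cf: "cons_free p"
    using wf unfolding wf_cf_prog_def by blast
  have p: "p \<noteq> []" "FD (main_fun p) = Arrow listT boolT" "FC ''true'' = boolT" "FC ''false'' = boolT" "FC ''nil'' = listT"
      "FC ''cons'' = Arrow boolT (Arrow listT listT)" "\<And>c. ctor_type (FC c)"
    and cl: "\<And>f ls s. (f, ls, s) \<in> set p \<Longrightarrow> distinct (lhs_vars ls) \<and> evars s \<subseteq> set (lhs_vars ls) \<and>
        (\<exists>\<Gamma> t. typed FC FD \<Gamma> (apps (EFun f) (map pexp ls)) t \<and> typed FC FD \<Gamma> s t)"
    using tpo unfolding typed_prog_order_def by blast+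
  have "\<exists>H. \<forall>c \<in> set p. case c of (f, ls, s) \<Rightarrow>
      \<exists>\<Gamma> t. btyped H FC FD \<Gamma> (apps (EFun f) (map pexp ls)) t \<and> btyped H FC FD \<Gamma> s t"
  proof (rule common_bound)
    show "\<forall>c \<in> set p. \<exists>H. case c of (f, ls, s) \<Rightarrow>
      \<exists>\<Gamma> t. btyped H FC FD \<Gamma> (apps (EFun f) (map pexp ls)) t \<and> btyped H FC FD \<Gamma> s t"
    proof
      fix c assume c: "c \<in> set p"
      obtain f ls s where fls: "c = (f, ls, s)" by (cases c)
      then obtain \<Gamma> t where "typed FC FD \<Gamma> (apps (EFun f) (map pexp ls)) t" "typed FC FD \<Gamma> s t" using cl c by blast
      then obtain H1 H2 where "btyped H1 FC FD \<Gamma> (apps (EFun f) (map pexp ls)) t" "btyped H2 FC FD \<Gamma> s t"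
        using typed_btyped by blast
      then have "btyped (H1 + H2) FC FD \<Gamma> (apps (EFun f) (map pexp ls)) t" "btyped (H1 + H2) FC FD \<Gamma> s t"
        by (auto elim: btyped_mono)
      then show "\<exists>H. case c of (f, ls, s) \<Rightarrow>
        \<exists>\<Gamma> t. btyped H FC FD \<Gamma> (apps (EFun f) (map pexp ls)) t \<and> btyped H FC FD \<Gamma> s t" unfolding fls by blast
    qed
  qed (auto split: prod.splits, blast intro: btyped_mono)
  then obtain H where H: "\<And>f ls s. (f, ls, s) \<in> set p \<Longrightarrow>
      \<exists>\<Gamma> t. btyped H FC FD \<Gamma> (apps (EFun f) (map pexp ls)) t \<and> btyped H FC FD \<Gamma> s t" by blast
  obtain cst where cst: "vstar \<in> set cst" "vtrue \<in> set cst" "vfalse \<in> set cst"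
    "\<And>c vs v. VCon c vs \<in> set cst \<Longrightarrow> v \<in> set vs \<Longrightarrow> v \<in> set cst"
    "\<And>f ls s t \<gamma> z. (f, ls, s) \<in> set p \<Longrightarrow> t \<in> subs s \<Longrightarrow> is_dexp t \<Longrightarrow> eval p \<gamma> t z \<Longrightarrow> col z \<in> set cst"
    using constants_exist[of p] by blast
  define a where "a = Max (insert 0 ((\<lambda>(f, ls, s). length ls) ` set p))"
  have a1: "length ls \<le> a" if "(f, ls, s) \<in> set p" for f ls s
    unfolding a_def using that by (intro Max_ge) force+
  have a2: "arity p f \<le> a" for f
  proof (cases "arity p f")
    case (Suc n)
    then obtain ls s where "(f, ls, s) \<in> set p" "length ls = arity p f" using arity_clause[of n p f] by auto
    then show ?thesis using a1 by metis
  qed simp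
  \<comment> \<open>Chosen so that n + c0 is at least \<open>M + 2\<close>, the base of the tower
    for codes, and at least the number of tags of function symbols with up to \<open>a\<close>
    arguments.\<close>
  define c0 where "c0 = length cst + 2 + length (names p) * (a + 1)"
  define j where "j = 3 * H"
  \<comment> \<open>The lower part \<open>j\<close> of the tower bounds the codes of all types of
    size at most \<open>H\<close>; another 2 * a + 3 levels bound the relations between such
    codes.\<close>
  define J where "J = j + (2 * a + 3)"
  \<comment> \<open>Says that the number of height \<open>J\<close> over n + c0 lies strictly below
    variable 2. This first becomes true one above that number, whence the \<open>+ 1\<close> in
    \<open>?T\<close>.\<close>
  define \<phi> where "\<phi> = fEx 2 (\<lambda>x. fAnd (isOff c0 1 x) (fEx 2 (\<lambda>z. isTow J x z))) 3"
  \<comment> \<open>The quantifier over \<open>r\<close> is bounded by variable 2, which at this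
    point is the bound for relations, and stands for the quantifier over all closed
    relations.\<close>
  define \<psi> where "\<psi> = fEx 2 (\<lambda>x. fAnd (isOff c0 1 x) (fEx 2 (\<lambda>u. fAnd (isTow j x u)
    (fAll 2 (\<lambda>r. fImp (closedF p cst r u) (goalF p cst r u)))))) 3"
  let ?T = "\<lambda>n. exp2 J (n + c0) + 1"
  show ?thesis
  proof (rule ELEMENTARY_fmI[OF nil, of ?T \<phi> \<psi>])
    show "tower_bounded ?T"
      by (intro tower_bounded_add tower_bounded_exp2 tower_bounded_const tower_bounded_id)
    fix w :: "bool list"
    define n where "n = length w"
    define x where "x = n + c0"
    define u where "u = exp2 j x"
    define T where "T = exp2 J x + 1"
    have xu: "x \<le> u" "u < T" "x < T" "n < x"
      using exp2_ge[of x j] exp2_mono_height[of j J x] exp2_ge[of x J] by (auto simp: u_def T_def J_def x_def c0_def)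
    interpret A: abstraction p cst w u
      by unfold_locales (use cst cl xu in \<open>auto simp: x_def c0_def n_def\<close>)
    have M: "A.M + 2 \<le> x" by (simp add: A.M_def x_def c0_def n_def)
    interpret B: typed_abstraction p cst w u FC FD H
    proof unfold_locales
      fix \<sigma> :: ty assume s: "size \<sigma> \<le> H"
      have "exp2 (3 * size \<sigma>) (A.M + 2) \<le> exp2 j (A.M + 2)" using s by (intro exp2_mono_height) (simp add: j_def)
      also have "\<dots> \<le> u" unfolding u_def by (rule exp2_mono[OF M])
      finally show "A.codes \<sigma> \<subseteq> {..<u}" using A.codes_tower[of \<sigma>] by fastforce
    qed (use cst(1,5) p(7) H fa ar cf cl in blast)+
    have vars: "\<And>f ls s. (f, ls, s) \<in> set p \<Longrightarrow> evars s \<subseteq> set (lhs_vars ls)" using cl by blast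
    have big: "exp2 (2 * a + 3) u \<le> T" unfolding u_def exp2_exp2 T_def J_def by (simp add: add.commute)
    have "prog_accepts p w \<longleftrightarrow> (\<forall>r<T. A.closed (rel p r) \<longrightarrow> A.goal (rel p r))"
    proof
      assume "prog_accepts p w"
      then show "\<forall>r<T. A.closed (rel p r) \<longrightarrow> A.goal (rel p r)" using B.goal_complete[OF p(1-6)] by blast
    next
      assume r: "\<forall>r<T. A.closed (rel p r) \<longrightarrow> A.goal (rel p r)"
      show "prog_accepts p w"
      proof (rule A.goal_sound)
        fix R assume R: "A.closed R"
        have tags: "length (names p) * (a + 1) \<le> u" using xu by (simp add: x_def c0_def)
        have "\<exists>r<T. A.closed (rel p r) \<and> (\<forall>f d. rel p r f [] d \<longrightarrow> R f [] d)"
          by (rule A.restrict_relation[OF a2 _ tags big R]) (use a1 in blast)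
        then obtain r0 where
          "r0 < T" "A.closed (rel p r0)" "\<forall>f d. rel p r0 f [] d \<longrightarrow> R f [] d" by blast
        then show "A.goal R" using r A.goal_mono[of "rel p r0" R] by blast
      qed (use vars in blast)
    qed
    moreover have "sat w 3 (env3 n T) \<psi> \<longleftrightarrow> (\<forall>r<T. A.closed (rel p r) \<longrightarrow> A.goal (rel p r))"
    proof -
      let ?e = "\<lambda>r. (env3 n T)(3 := x, 4 := u, 5 := r)"
      have ok: "A.env_ok 6 (?e r)" for r using xu by (auto simp: A.env_ok_def env3_def n_def)
      have "sat w 6 (?e r) (closedF p cst 5 4 6) \<longleftrightarrow> A.closed (rel p r)" for r
        using A.sat_closedF[OF ok, of 5 4 r] vars by simp
      moreover have "sat w 6 (?e r) (goalF p cst 5 4 6) \<longleftrightarrow> A.goal (rel p r)" for r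
        using A.sat_goalF[OF ok, of 5 4 r] by simp
      moreover have "env3 n T 2 = T" "env3 n T 1 = n" by (auto simp: env3_def)
      ultimately show ?thesis using xu unfolding \<psi>_def
        by (auto simp: x_def[symmetric] u_def[symmetric] eval_nat_numeral)
    qed
    moreover have "sat w 3 (env3 n t) \<phi> \<longleftrightarrow> exp2 J x < t" for t
    proof -
      have "env3 n t 2 = t" "env3 n t 1 = n" by (auto simp: env3_def)
      moreover have "x \<le> exp2 J x" by (rule exp2_ge)
      ultimately show ?thesis unfolding \<phi>_def by (auto simp: x_def[symmetric])
    qed
    ultimately show "length w \<le> ?T (length w) \<and> sat w 3 (env3 (length w) (?T (length w))) \<phi> \<and>
      (\<forall>t. length w \<le> t \<longrightarrow> t < ?T (length w) \<longrightarrow> \<not> sat w 3 (env3 (length w) t) \<phi>) \<and>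
      (sat w 3 (env3 (length w) (?T (length w))) \<psi> \<longleftrightarrow> w \<in> X)"
      using xu acc unfolding n_def[symmetric] x_def[symmetric] T_def[symmetric] accepted_problem_def
      by (auto simp: T_def)
  qed
qed

section \<open>Result sets of expressions and calls\<close>

text \<open>Passing to sets of results turns the evaluation rules into equations, so that programs
  can be run by rewriting even though they are non-deterministic.\<close>

definition EV :: "prog \<Rightarrow> (string \<Rightarrow> val option) \<Rightarrow> expr \<Rightarrow> val set" where
  "EV p \<gamma> e = {w. eval p \<gamma> e w}"

definition CALL :: "prog \<Rightarrow> string \<Rightarrow> val list \<Rightarrow> val set" where
  "CALL p f vs = {w. call p f vs w}"

lemma EV_EVar: "EV p \<gamma> (EVar x) = set_option (\<gamma> x)"
proof -
  have "eval p \<gamma> (EVar x) w \<longleftrightarrow> \<gamma> x = Some w" for w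
  proof
    assume "eval p \<gamma> (EVar x) w"
    then show "\<gamma> x = Some w" by cases auto
  qed (rule ev_var)
  then show ?thesis by (auto simp: EV_def)
qed

lemma EV_ECon: "EV p \<gamma> (ECon c) = {VCon c []}"
proof -
  have "eval p \<gamma> (ECon c) w \<longleftrightarrow> w = VCon c []" for w
    using eval_apps_con[of p \<gamma> c "[]" w] ev_con[of "[]" "[]" p \<gamma> c] by auto
  then show ?thesis by (auto simp: EV_def)
qed

lemma EV_EFun: "EV p \<gamma> (EFun f) = CALL p f []"
proof -
  have "eval p \<gamma> (EFun f) w \<longleftrightarrow> call p f [] w" for w
  proof
    assume "eval p \<gamma> (EFun f) w"
    then show "call p f [] w" by cases auto
  qed (rule ev_fun)
  then show ?thesis by (auto simp: EV_def CALL_def)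
qed

lemma EV_EIf: "EV p \<gamma> (EIf a b c) =
  (if vtrue \<in> EV p \<gamma> a then EV p \<gamma> b else {}) \<union> (if vfalse \<in> EV p \<gamma> a then EV p \<gamma> c else {})"
proof -
  have "eval p \<gamma> (EIf a b c) w \<longleftrightarrow> eval p \<gamma> a vtrue \<and> eval p \<gamma> b w \<or> eval p \<gamma> a vfalse \<and> eval p \<gamma> c w" for w
  proof
    assume "eval p \<gamma> (EIf a b c) w"
    then show "eval p \<gamma> a vtrue \<and> eval p \<gamma> b w \<or> eval p \<gamma> a vfalse \<and> eval p \<gamma> c w" by cases auto
  qed (auto intro: ev_if_true ev_if_false)
  then show ?thesis by (auto simp: EV_def)
qed

lemma EV_EChoose: "EV p \<gamma> (EChoose es) = (\<Union>e \<in> set es. EV p \<gamma> e)"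
proof -
  have "eval p \<gamma> (EChoose es) w \<longleftrightarrow> (\<exists>e \<in> set es. eval p \<gamma> e w)" for w
  proof
    assume "eval p \<gamma> (EChoose es) w"
    then show "\<exists>e \<in> set es. eval p \<gamma> e w" by cases auto
  qed (auto intro: ev_choose)
  then show ?thesis by (auto simp: EV_def)
qed

lemma EV_EApp:
  assumes "\<not> con_headed a"
  shows "EV p \<gamma> (EApp a b) = {w. \<exists>f vs v. VFun f vs \<in> EV p \<gamma> a \<and> v \<in> EV p \<gamma> b \<and> w \<in> CALL p f (vs @ [v])}"
proof -
  have "eval p \<gamma> (EApp a b) w \<longleftrightarrow> (\<exists>f vs v. eval p \<gamma> a (VFun f vs) \<and> eval p \<gamma> b v \<and> call p f (vs @ [v]) w)" for w
  proof
    assume "eval p \<gamma> (EApp a b) w"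
    then show "\<exists>f vs v. eval p \<gamma> a (VFun f vs) \<and> eval p \<gamma> b v \<and> call p f (vs @ [v]) w"
    proof cases
      case (ev_con bs ss c)
      then have "con_headed (EApp a b)" by (simp add: con_headed_apps)
      then show ?thesis using assms by simp
    qed auto
  qed (auto intro: ev_app)
  then show ?thesis by (auto simp: EV_def CALL_def)
qed

text \<open>A computed counterpart of the existential \<open>match_env\<close>: on concrete patterns
  simplification selects the clause and its environment.\<close>

fun pm :: "pat \<Rightarrow> val \<Rightarrow> (string \<Rightarrow> val option) option"
  and pml :: "pat list \<Rightarrow> val list \<Rightarrow> (string \<Rightarrow> val option) option" where
  "pm (PVar x) v = Some [x \<mapsto> v]"
| "pm (PCon c ps) (VCon c' vs) = (if c = c' then pml ps vs else None)"
| "pm (PCon c ps) (VPair _ _) = None"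
| "pm (PCon c ps) (VFun _ _) = None"
| "pml [] [] = Some Map.empty"
| "pml (l # ls) (v # vs) = (case pm l v of None \<Rightarrow> None | Some \<gamma> \<Rightarrow>
     (case pml ls vs of None \<Rightarrow> None | Some \<gamma>' \<Rightarrow> Some (\<gamma> ++ \<gamma>')))"
| "pml [] (_ # _) = None"
| "pml (_ # _) [] = None"

lemma pm_sound:
  "pm l v = Some \<gamma> \<Longrightarrow> distinct (pvars l) \<Longrightarrow> dom \<gamma> = set (pvars l) \<and> pinst \<gamma> l = v"
  "pml ls vs = Some \<gamma> \<Longrightarrow> distinct (lhs_vars ls) \<Longrightarrow> match_env ls vs \<gamma>"
proof (induction l v and ls vs arbitrary: \<gamma> and \<gamma> rule: pm_pml.induct)
  case (2 c ps c' vs)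
  then show ?case by (auto simp: lhs_vars_def match_env_def split: if_splits)
next
  case (6 l ls v vs)
  obtain \<gamma>1 \<gamma>2 where g: "pm l v = Some \<gamma>1" "pml ls vs = Some \<gamma>2" "\<gamma> = \<gamma>1 ++ \<gamma>2"
    using "6.prems"(1) by (auto split: option.splits)
  have d: "distinct (pvars l)" "distinct (lhs_vars ls)" "set (pvars l) \<inter> set (lhs_vars ls) = {}"
    using "6.prems"(2) by (auto simp: lhs_vars_def)
  have 1: "dom \<gamma>1 = set (pvars l)" "pinst \<gamma>1 l = v" using "6.IH"(1)[OF g(1) d(1)] by auto
  have 2: "dom \<gamma>2 = set (lhs_vars ls)" "vs = map (pinst \<gamma>2) ls"
    using "6.IH"(2)[OF g(1,2) d(2)] by (auto simp: match_env_def)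
  have "pinst \<gamma> l = pinst \<gamma>1 l"
    by (rule pinst_cong) (use d 1 2 g in \<open>auto simp: map_add_def split: option.split\<close>)
  moreover have "pinst \<gamma> l' = pinst \<gamma>2 l'" if "l' \<in> set ls" for l'
  proof (rule pinst_cong)
    fix x assume "x \<in> set (pvars l')"
    then have "x \<in> dom \<gamma>2" using that 2 by (auto simp: lhs_vars_def)
    then show "\<gamma> x = \<gamma>2 x" using g by (auto simp: map_add_def)
  qed
  ultimately show ?case using 1 2 g by (auto simp: match_env_def lhs_vars_def)
qed (auto simp: match_env_def lhs_vars_def dom_def)

lemma pm_complete: "pm l (pinst \<gamma> l) \<noteq> None"
proof (induction l)
  case (PCon c ps)
  have "(\<And>l. l \<in> set ls \<Longrightarrow> pm l (pinst \<gamma> l) \<noteq> None) \<Longrightarrow> pml ls (map (pinst \<gamma>) ls) \<noteq> None" for ls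
    by (induction ls) (auto split: option.splits)
  then show ?case using PCon by simp
qed simp

lemma pml_complete: "match_env ls vs \<gamma> \<Longrightarrow> pml ls vs \<noteq> None"
proof -
  have "pml ls (map (pinst \<gamma>) ls) \<noteq> None"
  proof (induction ls)
    case (Cons l ls)
    then show ?case using pm_complete[of l \<gamma>] by (auto split: option.splits)
  qed simp
  then show "match_env ls vs \<gamma> \<Longrightarrow> pml ls vs \<noteq> None" by (simp add: match_env_def)
qed

lemma pinst_unique: "pinst \<gamma> l = pinst \<gamma>' l \<Longrightarrow> x \<in> set (pvars l) \<Longrightarrow> the (\<gamma> x) = the (\<gamma>' x)"
  by (induction l) auto

lemma match_env_unique: "match_env ls vs \<gamma> \<Longrightarrow> match_env ls vs \<gamma>' \<Longrightarrow> \<gamma> = \<gamma>'"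
proof
  fix x assume m: "match_env ls vs \<gamma>" "match_env ls vs \<gamma>'"
  then have d: "dom \<gamma> = set (lhs_vars ls)" "dom \<gamma>' = set (lhs_vars ls)" by (auto simp: match_env_def)
  show "\<gamma> x = \<gamma>' x"
  proof (cases "x \<in> set (lhs_vars ls)")
    case True
    then obtain l where "l \<in> set ls" "x \<in> set (pvars l)" by (auto simp: lhs_vars_def)
    then have "the (\<gamma> x) = the (\<gamma>' x)" using m pinst_unique[of \<gamma> l \<gamma>' x] by (auto simp: match_env_def)
    moreover have "\<gamma> x \<noteq> None" "\<gamma>' x \<noteq> None" using True d by blast+
    ultimately show ?thesis by auto
  next
    case False
    then have "x \<notin> dom \<gamma>" "x \<notin> dom \<gamma>'" using d by auto
    then show ?thesis by (simp add: domIff)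
  qed
qed

lemma match_env_iff: "distinct (lhs_vars ls) \<Longrightarrow> match_env ls vs \<gamma> \<longleftrightarrow> pml ls vs = Some \<gamma>"
  using pm_sound(2) pml_complete match_env_unique by blast

fun sel :: "clause list \<Rightarrow> string \<Rightarrow> val list \<Rightarrow> ((string \<Rightarrow> val option) \<times> expr) option" where
  "sel [] f vs = None"
| "sel ((g, ls, s) # q) f vs = (if g = f then case pml ls vs of Some \<gamma> \<Rightarrow> Some (\<gamma>, s) | None \<Rightarrow> sel q f vs
     else sel q f vs)"

lemma sel_append: "sel (q @ q') f vs = (case sel q f vs of Some r \<Rightarrow> Some r | None \<Rightarrow> sel q' f vs)"
  by (induction q f vs rule: sel.induct) (auto split: option.splits)

lemma sel_iff:
  assumes "\<And>g ls s. (g, ls, s) \<in> set q \<Longrightarrow> distinct (lhs_vars ls)"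
  shows "sel q f vs = Some (\<gamma>, s) \<longleftrightarrow> (\<exists>j<length q. \<exists>ls. q ! j = (f, ls, s) \<and> match_env ls vs \<gamma> \<and>
     (\<forall>i<j. \<not> clause_matches (q ! i) f vs))"
  using assms
proof (induction q)
  case (Cons c q)
  obtain g ls0 s0 where c: "c = (g, ls0, s0)" by (cases c)
  have d: "distinct (lhs_vars ls0)" using Cons.prems[of g ls0 s0] c by simp
  have IH: "sel q f vs = Some (\<gamma>, s) \<longleftrightarrow> (\<exists>j<length q. \<exists>ls. q ! j = (f, ls, s) \<and> match_env ls vs \<gamma> \<and>
     (\<forall>i<j. \<not> clause_matches (q ! i) f vs))"
    using Cons.prems by (intro Cons.IH) (meson list.set_intros(2))
  have m: "clause_matches c f vs \<longleftrightarrow> g = f \<and> pml ls0 vs \<noteq> None"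
    using match_env_iff[OF d] by (auto simp: c clause_matches_def)
  have "(\<exists>j<length (c # q). \<exists>ls. (c # q) ! j = (f, ls, s) \<and> match_env ls vs \<gamma> \<and>
     (\<forall>i<j. \<not> clause_matches ((c # q) ! i) f vs)) \<longleftrightarrow>
    (g = f \<and> s0 = s \<and> pml ls0 vs = Some \<gamma>) \<or> (\<not> clause_matches c f vs \<and>
     (\<exists>j<length q. \<exists>ls. q ! j = (f, ls, s) \<and> match_env ls vs \<gamma> \<and> (\<forall>i<j. \<not> clause_matches (q ! i) f vs)))"
    by (simp add: Ex_less_Suc2 All_less_Suc2 c match_env_iff[OF d]) blast
  also have "\<dots> \<longleftrightarrow> (g = f \<and> s0 = s \<and> pml ls0 vs = Some \<gamma>) \<or> (\<not> clause_matches c f vs \<and> sel q f vs = Some (\<gamma>, s))"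
    unfolding IH ..
  also have "\<dots> \<longleftrightarrow> sel (c # q) f vs = Some (\<gamma>, s)" unfolding m by (auto simp: c split: option.split)
  finally show ?case by simp
qed simp

lemma CALL_sel:
  assumes "\<And>g ls s. (g, ls, s) \<in> set p \<Longrightarrow> distinct (lhs_vars ls)"
  shows "CALL p f vs = (if length vs < arity p f then {VFun f vs} else {}) \<union>
    (case sel p f vs of Some (\<gamma>, s) \<Rightarrow> EV p \<gamma> s | None \<Rightarrow> {})"
proof -
  have S: "sel p f vs = Some (\<gamma>, s) \<longleftrightarrow> (\<exists>j<length p. \<exists>ls. p ! j = (f, ls, s) \<and> match_env ls vs \<gamma> \<and>
     (\<forall>i<j. \<not> clause_matches (p ! i) f vs))" for \<gamma> s
    by (rule sel_iff) (use assms in blast)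
  have "call p f vs w \<longleftrightarrow> (length vs < arity p f \<and> w = VFun f vs) \<or>
      (\<exists>\<gamma> s. sel p f vs = Some (\<gamma>, s) \<and> eval p \<gamma> s w)" for w
  proof
    assume "call p f vs w"
    then show "(length vs < arity p f \<and> w = VFun f vs) \<or> (\<exists>\<gamma> s. sel p f vs = Some (\<gamma>, s) \<and> eval p \<gamma> s w)"
      by cases (use S in blast)+
  next
    assume "(length vs < arity p f \<and> w = VFun f vs) \<or> (\<exists>\<gamma> s. sel p f vs = Some (\<gamma>, s) \<and> eval p \<gamma> s w)"
    then show "call p f vs w"
      using S by (blast intro: call_partial call_clause)
  qed
  then show ?thesis by (auto simp: CALL_def EV_def split: option.split)
qed

section \<open>Simulating Turing machines by cons-free programs\<close>

text \<open>\<open>Fail k\<close> and \<open>FailB\<close> receive a type but no clause, so that a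
  call has no result at all; they express an abandoned branch. The variants ending in X take one
  further argument, which is either a guessed number or the counter of a loop.\<close>

datatype fs = Main | Start | Load | Run nat | Wr nat | Blank | Filt | Inc | IncX
  | Zero nat | Dec nat | DecX nat | Eq nat | EqX nat | Mem nat | Nb nat | Any nat | AnyX nat
  | Fail nat | FailB

instance fs :: countable by countable_datatype

definition name :: "fs \<Rightarrow> string" where
  "name f = replicate (to_nat f) CHR ''f''"

lemma name_inject[simp]: "name f = name g \<longleftrightarrow> f = g"
  by (auto simp: name_def dest: arg_cong[of _ _ length])

definition symc :: "nat \<Rightarrow> string" where
  "symc a = CHR ''s'' # replicate a CHR ''s''"

lemma symc_inject[simp]: "symc a = symc b \<longleftrightarrow> a = b"
  by (auto simp: symc_def dest: arg_cong[of _ _ length])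

abbreviation fc :: "fs \<Rightarrow> expr list \<Rightarrow> expr" where "fc f es \<equiv> apps (EFun (name f)) es"
abbreviation "tt \<equiv> ECon ''true''"
abbreviation "ff \<equiv> ECon ''false''"
abbreviation "xc \<equiv> EVar ''c''"
abbreviation "xv \<equiv> EVar ''v''"
abbreviation "xu \<equiv> EVar ''u''"
abbreviation "xj \<equiv> EVar ''j''"
abbreviation "xb \<equiv> EVar ''b''"
abbreviation "xt \<equiv> EVar ''t''"
abbreviation "xh \<equiv> EVar ''h''"
abbreviation "pc \<equiv> PVar ''c''"
abbreviation "pv \<equiv> PVar ''v''"
abbreviation "pu \<equiv> PVar ''u''"
abbreviation "pj \<equiv> PVar ''j''"
abbreviation "pb \<equiv> PVar ''b''"
abbreviation "pt \<equiv> PVar ''t''"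
abbreviation "ph \<equiv> PVar ''h''"

definition eqE :: "expr \<Rightarrow> expr \<Rightarrow> expr" where
  "eqE a b = EIf a b (EIf b ff tt)"

definition syms :: "tm \<Rightarrow> nat list" where "syms T = sorted_list_of_set (tm_symbols T)"
definition stts :: "tm \<Rightarrow> nat list" where "stts T = sorted_list_of_set (tm_states T)"

definition move :: "nat \<Rightarrow> int \<Rightarrow> expr" where
  "move J d = (if d = 0 then xh else if d = 1 then fc Inc [xc, xh] else fc (Dec J) [xc, xh])"

text \<open>Numbers below \<open>n + 1\<close> are the suffixes of the input \<open>c\<close>. A number of level \<open>k + 1\<close> is a set
  of numbers of level \<open>k\<close> (its binary digits), given by a function of type
  \<open>bool \<Rightarrow> level k\<close> that returns any member on \<open>true\<close> and any non-member on \<open>false\<close>; its type has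
  order 1 since the elements occur only as results. Arithmetic is cyclic, and positions on the tape are
  numbers of level \<open>J\<close>. A tape maps each symbol to any position carrying it.\<close>

fun cl :: "tm \<Rightarrow> nat \<Rightarrow> fs \<Rightarrow> (pat list \<times> expr) list" where
  "cl T J Main = [([PCon ''cons'' [pb, pv]], fc Start [apps (ECon ''cons'') [xb, xv]])]"
| "cl T J Start = [([pc], fc Load [xc, xc, fc Blank [xc], fc (Zero J) [xc]])]"
| "cl T J Load = [([pc, PCon ''nil'' [], pt, ph], fc (Run (tm_start T)) [xc, xt, fc (Zero J) [xc]]),
     ([pc, PCon ''cons'' [PCon ''true'' [], pv], pt, ph],
       fc Load [xc, xv, fc (Wr 2) [xc, xt, xh], fc Inc [xc, xh]]),
     ([pc, PCon ''cons'' [pb, pv], pt, ph],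
       fc Load [xc, xv, fc (Wr 1) [xc, xt, xh], fc Inc [xc, xh]])]"
| "cl T J (Run q) = [([pc, pt, ph],
     if q = tm_acc T then tt else if q = tm_rej T then ff
     else EChoose (map (\<lambda>a. case tm_delta T q a of (q', a', d) \<Rightarrow>
       EIf (fc (Eq J) [xc, EApp xt (ECon (symc a)), xh])
         (fc (Run q') [xc, fc (Wr a') [xc, xt, xh], move J d]) (fc FailB [])) (syms T)))]"
| "cl T J (Wr a) = [([pc, pt, ph, PCon (symc a) []],
       EChoose [xh, fc Filt [xc, xh, EApp xt (ECon (symc a))]]),
     ([pc, pt, ph, pb], fc Filt [xc, xh, EApp xt xb])]"
| "cl T J Blank = [([pc, PCon (symc 0) []], fc (Any J) [xc])]"
| "cl T J Filt = [([pc, ph, pj], EIf (fc (Eq J) [xc, xj, xh]) (fc (Fail J) []) xj)]"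
| "cl T J Inc = [([pc, ph], fc IncX [xc, xh, fc (Any J) [xc]])]"
| "cl T J IncX = [([pc, ph, pj], EIf (fc (Eq J) [xc, fc (Dec J) [xc, xj], xh]) xj (fc (Fail J) []))]"
| "cl T J (Zero 0) = [([pc], ECon ''nil'')]"
| "cl T J (Zero (Suc k)) = [([pc, PCon ''false'' []], fc (Any k) [xc])]"
| "cl T J (Dec 0) = [([pc, PCon ''nil'' []], xc), ([pc, PCon ''cons'' [pb, pv]], xv)]"
| "cl T J (Dec (Suc k)) = [([pc, pv, pb], fc (DecX k) [xc, xv, xb, fc (Any k) [xc]])]"
| "cl T J (DecX k) = [([pc, pv, pb, pj],
     EIf (eqE xb (eqE (fc (Mem k) [xc, xv, xj]) (fc (Nb k) [xc, xv, xj]))) (fc (Fail k) []) xj)]"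
| "cl T J (Eq 0) = [([pc, PCon ''nil'' [], PCon ''nil'' []], tt),
     ([pc, PCon ''cons'' [pb, pv], PCon ''cons'' [pj, pu]], fc (Eq 0) [xc, xv, xu]),
     ([pc, pv, pu], ff)]"
| "cl T J (Eq (Suc k)) = [([pc, pv, pu], fc (EqX k) [xc, xv, xu, fc (Dec k) [xc, fc (Zero k) [xc]]])]"
| "cl T J (EqX k) = [([pc, pv, pu, pj], EIf (eqE (fc (Mem k) [xc, xv, xj]) (fc (Mem k) [xc, xu, xj]))
     (EIf (fc (Eq k) [xc, xj, fc (Zero k) [xc]]) tt (fc (EqX k) [xc, xv, xu, fc (Dec k) [xc, xj]])) ff)]"
| "cl T J (Mem k) = [([pc, pv, pj], EChoose
     [EIf (fc (Eq k) [xc, EApp xv tt, xj]) tt (fc FailB []),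
      EIf (fc (Eq k) [xc, EApp xv ff, xj]) ff (fc FailB [])])]"
| "cl T J (Nb k) = [([pc, pv, pj], EIf (fc (Eq k) [xc, xj, fc (Zero k) [xc]]) tt
     (EIf (fc (Mem k) [xc, xv, fc (Dec k) [xc, xj]]) ff (fc (Nb k) [xc, xv, fc (Dec k) [xc, xj]])))]"
| "cl T J (Any k) = [([pc], fc (AnyX k) [xc, fc (Dec k) [xc, fc (Zero k) [xc]]])]"
| "cl T J (AnyX k) = [([pc, pj], EChoose [xj, EIf (fc (Eq k) [xc, xj, fc (Zero k) [xc]]) (fc (Fail k) [])
     (fc (AnyX k) [xc, fc (Dec k) [xc, xj]])])]"
| "cl T J (Fail k) = []"
| "cl T J FailB = []"

text \<open>\<open>Main\<close> comes first because the first clause determines the main function.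
  \<open>DecX\<close>, \<open>EqX\<close>, \<open>Mem\<close> and \<open>Nb\<close> at
  \<open>k\<close> handle the digits of numbers of level \<open>k + 1\<close> and thus exist for
  \<open>k < J\<close> only.\<close>

definition keys :: "tm \<Rightarrow> nat \<Rightarrow> fs list" where
  "keys T J = [Main, Start, Load, Blank, Filt, Inc, IncX] @ map Run (stts T) @ map Wr (syms T) @
     concat (map (\<lambda>k. [Zero k, Dec k, Eq k, Any k, AnyX k]) [0..<Suc J]) @
     concat (map (\<lambda>k. [DecX k, EqX k, Mem k, Nb k]) [0..<J])"

definition block :: "tm \<Rightarrow> nat \<Rightarrow> fs \<Rightarrow> clause list" where
  "block T J f = map (\<lambda>(ls, s). (name f, ls, s)) (cl T J f)"

definition sim :: "tm \<Rightarrow> nat \<Rightarrow> prog" where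
  "sim T J = concat (map (block T J) (keys T J))"

lemma set_sim: "(g, ls, s) \<in> set (sim T J) \<longleftrightarrow> (\<exists>f \<in> set (keys T J). g = name f \<and> (ls, s) \<in> set (cl T J f))"
  by (auto simp: sim_def block_def)

lemma cl_linear: "(ls, s) \<in> set (cl T J f) \<Longrightarrow> distinct (lhs_vars ls)"
  by (cases "(T, J, f)" rule: cl.cases) (auto simp: lhs_vars_def)

definition far :: "fs \<Rightarrow> nat" where
  "far f = (case f of Main \<Rightarrow> 1 | Start \<Rightarrow> 1 | Load \<Rightarrow> 4 | Run q \<Rightarrow> 3 | Wr a \<Rightarrow> 4 | Blank \<Rightarrow> 2 | Filt \<Rightarrow> 3
    | Inc \<Rightarrow> 2 | IncX \<Rightarrow> 3 | Zero k \<Rightarrow> (if k = 0 then 1 else 2) | Dec k \<Rightarrow> (if k = 0 then 2 else 3) | DecX k \<Rightarrow> 4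
    | Eq k \<Rightarrow> 3 | EqX k \<Rightarrow> 4 | Mem k \<Rightarrow> 3 | Nb k \<Rightarrow> 3 | Any k \<Rightarrow> 1 | AnyX k \<Rightarrow> 2 | Fail k \<Rightarrow> 0 | FailB \<Rightarrow> 0)"

lemma cl_arity: "(ls, s) \<in> set (cl T J f) \<Longrightarrow> length ls = far f"
  by (cases "(T, J, f)" rule: cl.cases) (auto simp: far_def)

lemma cl_nonempty: "f \<in> set (keys T J) \<Longrightarrow> cl T J f \<noteq> []"
  by (cases "(T, J, f)" rule: cl.cases) (auto simp: keys_def)

lemma arity_sim: "f \<in> set (keys T J) \<Longrightarrow> arity (sim T J) (name f) = far f"
proof -
  assume f: "f \<in> set (keys T J)"
  obtain ls s where "(ls, s) \<in> set (cl T J f)" using cl_nonempty[OF f] by (metis list.set_sel(1) surj_pair)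
  then have "(name f, ls, s) \<in> set (sim T J)" using f set_sim by blast
  then have "find (\<lambda>(g, _, _). g = name f) (sim T J) \<noteq> None" by (auto simp: find_None_iff)
  then obtain g ls' s' where F: "find (\<lambda>(g, _, _). g = name f) (sim T J) = Some (g, ls', s')"
    by (metis not_Some_eq prod_cases3)
  then have "g = name f" "(g, ls', s') \<in> set (sim T J)"
    unfolding find_Some_iff by (auto, metis nth_mem)
  then have "length ls' = far f" using cl_arity by (auto simp: set_sim)
  then show ?thesis using F by (simp add: arity_def)
qed

lemma arity_fail: "f \<notin> set (keys T J) \<Longrightarrow> arity (sim T J) (name f) = 0"
  using arity_clause[of 0 "sim T J" "name f"] by (auto simp: set_sim)

lemma sel_block_other: "g \<noteq> f \<Longrightarrow> sel (block T J g) (name f) vs = None"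
proof -
  assume "g \<noteq> f"
  then have "sel (map (\<lambda>(ls, s). (name g, ls, s)) cs) (name f) vs = None" for cs by (induction cs) auto
  then show ?thesis unfolding block_def .
qed

lemma sel_sim: "sel (sim T J) (name f) vs = (if f \<in> set (keys T J) then sel (block T J f) (name f) vs else None)"
proof -
  have "sel (concat (map (block T J) ks)) (name f) vs = (if f \<in> set ks then sel (block T J f) (name f) vs else None)" for ks
  proof (induction ks)
    case (Cons g ks)
    show ?case
    proof (cases "g = f")
      case True
      then show ?thesis using Cons.IH by (auto simp: sel_append split: option.split)
    next
      case False
      then show ?thesis using Cons.IH sel_block_other[OF False] by (simp add: sel_append)
    qed
  qed simp
  then show ?thesis unfolding sim_def .
qed

fun first :: "prog \<Rightarrow> (pat list \<times> expr) list \<Rightarrow> val list \<Rightarrow> val set" where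
  "first p [] vs = {}"
| "first p ((ls, s) # cs) vs = (case pml ls vs of Some \<gamma> \<Rightarrow> EV p \<gamma> s | None \<Rightarrow> first p cs vs)"

lemma CALL_sim:
  "CALL (sim T J) (name f) vs = (if f \<in> set (keys T J) then
     (if length vs < far f then {VFun (name f) vs} else first (sim T J) (cl T J f) vs) else {})"
proof -
  have lin: "distinct (lhs_vars ls)" if "(g, ls, s) \<in> set (sim T J)" for g ls s
    using that cl_linear by (auto simp: set_sim)
  have "(case sel (map (\<lambda>(ls, s). (name f, ls, s)) cs) (name f) vs of Some (\<gamma>, s) \<Rightarrow> EV p \<gamma> s | None \<Rightarrow> {}) = first p cs vs" for cs p
  proof (induction cs)
    case (Cons c cs)
    obtain ls s where "c = (ls, s)" by (cases c)
    then show ?case using Cons by (cases "pml ls vs") simp_all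
  qed simp
  then have F: "(case sel (block T J f) (name f) vs of Some (\<gamma>, s) \<Rightarrow> EV p \<gamma> s | None \<Rightarrow> {}) = first p (cl T J f) vs" for p
    unfolding block_def .
  have short: "first p cs vs = {}" if "\<And>ls s. (ls, s) \<in> set cs \<Longrightarrow> length ls \<noteq> length vs" for cs p
    using that
  proof (induction cs)
    case (Cons c cs)
    obtain ls s where c: "c = (ls, s)" by (cases c)
    have len: "pml ls vs = Some \<gamma> \<Longrightarrow> length ls = length vs" for ls vs \<gamma>
      by (induction ls arbitrary: vs \<gamma>) (case_tac [!] vs, auto split: option.splits)
    then have "pml ls vs = None" using Cons.prems[of ls s] c by (metis list.set_intros(1) not_Some_eq)
    then show ?case using Cons c by auto
  qed simp
  have C: "CALL (sim T J) (name f) vs = (if length vs < arity (sim T J) (name f) then {VFun (name f) vs} else {}) \<union>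
    (case sel (sim T J) (name f) vs of Some (\<gamma>, s) \<Rightarrow> EV (sim T J) \<gamma> s | None \<Rightarrow> {})"
    by (rule CALL_sel) (rule lin)
  show ?thesis
  proof (cases "f \<in> set (keys T J)")
    case True
    have "first (sim T J) (cl T J f) vs = {}" if "length vs < far f"
      using short[of "cl T J f"] cl_arity that by fastforce
    then show ?thesis unfolding C sel_sim using True F by (auto simp: arity_sim)
  next
    case False
    then show ?thesis unfolding C sel_sim by (auto simp: arity_fail)
  qed
qed

text \<open>Arguments are reduced to values before a call, so a non-deterministic argument
  contributes one call for each of its values. The shorter applications built on the way are partial
  and have exactly one value for each choice of arguments.\<close>

lemma EV_fc:
  assumes "f \<in> set (keys T J)" "length es \<le> far f"
  shows "EV (sim T J) \<gamma> (fc f es) = (\<Union>vs \<in> listset (map (EV (sim T J) \<gamma>) es). CALL (sim T J) (name f) vs)"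
  using assms(2)
proof (induction es rule: rev_induct)
  case Nil
  then show ?case by (simp add: EV_EFun)
next
  case (snoc e es)
  have app: "listset (As @ [A]) = {vs @ [v] | vs v. vs \<in> listset As \<and> v \<in> A}" for As :: "val set list" and A
  proof (induction As)
    case Nil
    then show ?case by (auto simp: set_Cons_def)
  next
    case (Cons B As)
    show ?case unfolding append_Cons listset.simps Cons.IH
      by (auto simp: set_Cons_def)
  qed
  have len: "length vs = length es" if "vs \<in> listset (map (EV (sim T J) \<gamma>) es)" for vs
    using that by (induction es arbitrary: vs) (auto simp: set_Cons_def)
  have IH: "EV (sim T J) \<gamma> (fc f es) = VFun (name f) ` listset (map (EV (sim T J) \<gamma>) es)"
    using snoc len assms(1) by (auto simp: CALL_sim)
  have "\<not> con_headed (fc f es)" by (simp add: con_headed_apps)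
  then show ?case by (auto simp: EV_EApp IH app)
qed

lemma EV_fail: "EV (sim T J) \<gamma> (fc (Fail k) []) = {}" "EV (sim T J) \<gamma> (fc FailB []) = {}"
  by (auto simp: EV_EFun CALL_sim keys_def)

lemma in_keys[simp]:
  "Main \<in> set (keys T J)" "Start \<in> set (keys T J)" "Load \<in> set (keys T J)" "Blank \<in> set (keys T J)"
  "Filt \<in> set (keys T J)" "Inc \<in> set (keys T J)" "IncX \<in> set (keys T J)"
  "finite (tm_states T) \<Longrightarrow> Run q \<in> set (keys T J) \<longleftrightarrow> q \<in> tm_states T"
  "finite (tm_symbols T) \<Longrightarrow> Wr a \<in> set (keys T J) \<longleftrightarrow> a \<in> tm_symbols T"
  "Zero k \<in> set (keys T J) \<longleftrightarrow> k \<le> J" "Dec k \<in> set (keys T J) \<longleftrightarrow> k \<le> J" "Eq k \<in> set (keys T J) \<longleftrightarrow> k \<le> J"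
  "Any k \<in> set (keys T J) \<longleftrightarrow> k \<le> J" "AnyX k \<in> set (keys T J) \<longleftrightarrow> k \<le> J"
  "DecX k \<in> set (keys T J) \<longleftrightarrow> k < J" "EqX k \<in> set (keys T J) \<longleftrightarrow> k < J" "Mem k \<in> set (keys T J) \<longleftrightarrow> k < J"
  "Nb k \<in> set (keys T J) \<longleftrightarrow> k < J" "Fail k \<notin> set (keys T J)" "FailB \<notin> set (keys T J)"
  by (auto simp: keys_def stts_def syms_def)

abbreviation (input) vb :: "bool \<Rightarrow> val" where "vb b \<equiv> (if b then vtrue else vfalse)"

lemma vb_neq[simp]: "vtrue \<noteq> vfalse" "vfalse \<noteq> vtrue"
  by (auto simp: vtrue_def vfalse_def)

definition ite :: "val set \<Rightarrow> val set \<Rightarrow> val set \<Rightarrow> val set" where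
  "ite A B C = (if vtrue \<in> A then B else {}) \<union> (if vfalse \<in> A then C else {})"

lemma ite_vb[simp]: "ite {vb b} B C = (if b then B else C)" "ite {vtrue} B C = B" "ite {vfalse} B C = C"
  by (auto simp: ite_def)

definition ap :: "prog \<Rightarrow> val \<Rightarrow> val \<Rightarrow> val set" where
  "ap p v u = {w. \<exists>f vs. v = VFun f vs \<and> w \<in> CALL p f (vs @ [u])}"

locale sim_loc =
  fixes T :: tm and J :: nat and inp :: "bool list"
  assumes valid: "valid_tm T"
begin

abbreviation "ev \<equiv> EV (sim T J)"
abbreviation "C f vs \<equiv> CALL (sim T J) (name f) vs"
abbreviation "app \<equiv> ap (sim T J)"
abbreviation "cv \<equiv> enc_list inp"

lemma fin[simp]: "finite (tm_states T)" "finite (tm_symbols T)"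
  using valid by (auto simp: valid_tm_def)

lemma ev_basic[simp]:
  "ev \<gamma> (EVar x) = set_option (\<gamma> x)" "ev \<gamma> (ECon c) = {VCon c []}"
  "ev \<gamma> (EIf a b d) = ite (ev \<gamma> a) (ev \<gamma> b) (ev \<gamma> d)"
  "ev \<gamma> (EChoose es) = (\<Union>e \<in> set es. ev \<gamma> e)"
  "ev \<gamma> (EApp (EVar x) b) = (\<Union>v \<in> set_option (\<gamma> x). \<Union>u \<in> ev \<gamma> b. app v u)"
  "ev \<gamma> (EFun (name FailB)) = {}" "ev \<gamma> (EFun (name (Fail k))) = {}"
  using EV_fail[of T J \<gamma>] by (auto simp: EV_EVar EV_ECon EV_EIf ite_def EV_EChoose EV_EApp ap_def)

lemma UN_set_Cons: "(\<Union>vs \<in> set_Cons A B. F vs) = (\<Union>x \<in> A. \<Union>xs \<in> B. F (x # xs))"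
  by (auto simp: set_Cons_def)

lemma ev_fc[simp]:
  "f \<in> set (keys T J) \<Longrightarrow> 1 \<le> far f \<Longrightarrow> ev \<gamma> (EApp (EFun (name f)) a) = (\<Union>x \<in> ev \<gamma> a. C f [x])"
  "f \<in> set (keys T J) \<Longrightarrow> 2 \<le> far f \<Longrightarrow> ev \<gamma> (EApp (EApp (EFun (name f)) a) b) = (\<Union>x \<in> ev \<gamma> a. \<Union>y \<in> ev \<gamma> b. C f [x, y])"
  "f \<in> set (keys T J) \<Longrightarrow> 3 \<le> far f \<Longrightarrow> ev \<gamma> (EApp (EApp (EApp (EFun (name f)) a) b) c) =
     (\<Union>x \<in> ev \<gamma> a. \<Union>y \<in> ev \<gamma> b. \<Union>z \<in> ev \<gamma> c. C f [x, y, z])"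
  "f \<in> set (keys T J) \<Longrightarrow> 4 \<le> far f \<Longrightarrow> ev \<gamma> (EApp (EApp (EApp (EApp (EFun (name f)) a) b) c) d) =
     (\<Union>x \<in> ev \<gamma> a. \<Union>y \<in> ev \<gamma> b. \<Union>z \<in> ev \<gamma> c. \<Union>u \<in> ev \<gamma> d. C f [x, y, z, u])"
  using EV_fc[of f T J "[a]" \<gamma>] EV_fc[of f T J "[a, b]" \<gamma>] EV_fc[of f T J "[a, b, c]" \<gamma>] EV_fc[of f T J "[a, b, c, d]" \<gamma>]
  by (simp_all add: UN_set_Cons)

lemma ev_eqE[simp]: "ev \<gamma> (eqE a b) = ite (ev \<gamma> a) (ev \<gamma> b) (ite (ev \<gamma> b) {vfalse} {vtrue})"
  by (simp add: eqE_def vtrue_def vfalse_def)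


section \<open>Result equations of the single clauses\<close>

lemma C_Zero0: "C (Zero 0) [c] = {VCon ''nil'' []}"
  by (subst CALL_sim, simp add: far_def map_add_def)+

lemma C_ZeroS: "Suc k \<le> J \<Longrightarrow> C (Zero (Suc k)) [c] = {VFun (name (Zero (Suc k))) [c]}"
  "Suc k \<le> J \<Longrightarrow> C (Zero (Suc k)) [c, vb b] = (if b then {} else C (Any k) [c])"
  by (cases b; (subst CALL_sim, simp add: far_def map_add_def vtrue_def vfalse_def)+)+

lemma C_Dec0: "C (Dec 0) [c, VCon ''nil'' []] = {c}" "C (Dec 0) [c, VCon ''cons'' [x, v]] = {v}"
  by (subst CALL_sim, simp add: far_def map_add_def)+

lemma C_DecS: "Suc k \<le> J \<Longrightarrow> C (Dec (Suc k)) [c, v] = {VFun (name (Dec (Suc k))) [c, v]}"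
  "Suc k \<le> J \<Longrightarrow> C (Dec (Suc k)) [c, v, b] = (\<Union>j \<in> C (Any k) [c]. C (DecX k) [c, v, b, j])"
  by (subst CALL_sim, simp add: far_def map_add_def)+

lemma C_DecX: "k < J \<Longrightarrow> C (DecX k) [c, v, b, j] =
   ite (ite {b} (ite (C (Mem k) [c, v, j]) (C (Nb k) [c, v, j]) (ite (C (Nb k) [c, v, j]) {vfalse} {vtrue}))
     (ite (ite (C (Mem k) [c, v, j]) (C (Nb k) [c, v, j]) (ite (C (Nb k) [c, v, j]) {vfalse} {vtrue})) {vfalse} {vtrue})) {} {j}"
  by (subst CALL_sim, simp add: far_def map_add_def)+

lemma C_Eq0: "C (Eq 0) [c, VCon ''nil'' [], VCon ''nil'' []] = {vtrue}"
  "C (Eq 0) [c, VCon ''nil'' [], VCon ''cons'' ys] = {vfalse}"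
  "C (Eq 0) [c, VCon ''cons'' [x, v], VCon ''nil'' []] = {vfalse}"
  "C (Eq 0) [c, VCon ''cons'' [x, v], VCon ''cons'' [y, u]] = C (Eq 0) [c, v, u]"
  by (subst CALL_sim, simp add: far_def map_add_def vtrue_def vfalse_def)+

lemma C_EqS: "Suc k \<le> J \<Longrightarrow> C (Eq (Suc k)) [c, v, u] =
   (\<Union>z \<in> C (Zero k) [c]. \<Union>j \<in> C (Dec k) [c, z]. C (EqX k) [c, v, u, j])"
  by (subst CALL_sim, simp add: far_def map_add_def, blast?)+

lemma C_EqX: "k < J \<Longrightarrow> C (EqX k) [c, v, u, j] =
   ite (ite (C (Mem k) [c, v, j]) (C (Mem k) [c, u, j]) (ite (C (Mem k) [c, u, j]) {vfalse} {vtrue}))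
     (ite (\<Union>z \<in> C (Zero k) [c]. C (Eq k) [c, j, z]) {vtrue} (\<Union>d \<in> C (Dec k) [c, j]. C (EqX k) [c, v, u, d])) {vfalse}"
  by (subst CALL_sim, simp add: far_def map_add_def vtrue_def vfalse_def)+

lemma C_Mem: "k < J \<Longrightarrow> C (Mem k) [c, v, j] =
   ite (\<Union>a \<in> app v vtrue. C (Eq k) [c, a, j]) {vtrue} {} \<union> ite (\<Union>a \<in> app v vfalse. C (Eq k) [c, a, j]) {vfalse} {}"
  by (subst CALL_sim, simp add: far_def map_add_def vtrue_def vfalse_def)+

lemma C_Nb: "k < J \<Longrightarrow> C (Nb k) [c, v, j] = ite (\<Union>z \<in> C (Zero k) [c]. C (Eq k) [c, j, z]) {vtrue}
   (ite (\<Union>d \<in> C (Dec k) [c, j]. C (Mem k) [c, v, d]) {vfalse} (\<Union>d \<in> C (Dec k) [c, j]. C (Nb k) [c, v, d]))"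
  by (subst CALL_sim, simp add: far_def map_add_def vtrue_def vfalse_def)+

lemma C_Any: "k \<le> J \<Longrightarrow> C (Any k) [c] = (\<Union>z \<in> C (Zero k) [c]. \<Union>j \<in> C (Dec k) [c, z]. C (AnyX k) [c, j])"
  by (subst CALL_sim, simp add: far_def map_add_def, blast?)+

lemma C_AnyX: "k \<le> J \<Longrightarrow> C (AnyX k) [c, j] = {j} \<union> ite (\<Union>z \<in> C (Zero k) [c]. C (Eq k) [c, j, z]) {}
   (\<Union>d \<in> C (Dec k) [c, j]. C (AnyX k) [c, d])"
  by (subst CALL_sim, simp add: far_def map_add_def)+

lemma ev_cons: "\<gamma> x = Some u \<Longrightarrow> \<gamma> y = Some v \<Longrightarrow>
   ev \<gamma> (EApp (EApp (ECon ''cons'') (EVar x)) (EVar y)) = {VCon ''cons'' [u, v]}"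
proof -
  have 1: "eval p \<gamma> (EVar x) u \<longleftrightarrow> \<gamma> x = Some u" for p x u
    using EV_EVar[of p \<gamma> x] by (auto simp: EV_def)
  assume uv: "\<gamma> x = Some u" "\<gamma> y = Some v"
  have "eval (sim T J) \<gamma> (apps (ECon ''cons'') [EVar x, EVar y]) w \<longleftrightarrow> w = VCon ''cons'' [u, v]" for w
  proof
    assume "eval (sim T J) \<gamma> (apps (ECon ''cons'') [EVar x, EVar y]) w"
    from eval_apps_con[OF this] obtain bs where bs: "w = VCon ''cons'' bs" "length bs = 2"
      "\<forall>i<2. eval (sim T J) \<gamma> ([EVar x, EVar y] ! i) (bs ! i)" by auto
    have "eval (sim T J) \<gamma> (EVar x) (bs ! 0)" "eval (sim T J) \<gamma> (EVar y) (bs ! 1)"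
      using bs(3)[rule_format, of 0] bs(3)[rule_format, of 1] by auto
    then have "bs ! 0 = u" "bs ! 1 = v" using uv by (auto simp: 1)
    then have "bs = [u, v]" using bs(2) by (cases bs; cases "tl bs") auto
    then show "w = VCon ''cons'' [u, v]" using bs by simp
  next
    assume "w = VCon ''cons'' [u, v]"
    then show "eval (sim T J) \<gamma> (apps (ECon ''cons'') [EVar x, EVar y]) w"
      using ev_con[of "[u, v]" "[EVar x, EVar y]" "sim T J" \<gamma> "''cons''"] uv by (simp add: 1 less_Suc_eq)
  qed
  then show ?thesis by (auto simp: EV_def)
qed

lemma C_Main: "C Main [VCon ''nil'' []] = {}"
  by (subst CALL_sim, simp add: far_def)

lemma C_Main_cons: "C Main [VCon ''cons'' [x, v]] = C Start [VCon ''cons'' [x, v]]"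
  by (subst CALL_sim, simp add: far_def map_add_def ev_cons)

lemma C_Start: "C Start [c] = (\<Union>t \<in> C Blank [c]. \<Union>h \<in> C (Zero J) [c]. C Load [c, c, t, h])"
  by (subst CALL_sim, simp add: far_def map_add_def)+

lemma two[simp]: "0 \<in> tm_symbols T" "1 \<in> tm_symbols T" "2 \<in> tm_symbols T" "Suc 0 \<in> tm_symbols T" "tm_start T \<in> tm_states T"
  using valid by (auto simp: valid_tm_def)

lemma C_Load: "C Load [c, VCon ''nil'' [], t, h] = (\<Union>z \<in> C (Zero J) [c]. C (Run (tm_start T)) [c, t, z])"
  "C Load [c, VCon ''cons'' [vb b, v], t, h] = (\<Union>t' \<in> C (Wr (if b then 2 else 1)) [c, t, h]. \<Union>h' \<in> C Inc [c, h]. C Load [c, v, t', h'])"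
  by (cases b; (subst CALL_sim, simp add: far_def map_add_def vtrue_def vfalse_def)+)+

lemma C_Wr: "a \<in> tm_symbols T \<Longrightarrow> C (Wr a) [c, t, h] = {VFun (name (Wr a)) [c, t, h]}"
  "a \<in> tm_symbols T \<Longrightarrow> C (Wr a) [c, t, h, VCon (symc a') []] = (if a' = a then {h} else {}) \<union>
    (\<Union>j \<in> app t (VCon (symc a') []). C Filt [c, h, j])"
  by (subst CALL_sim, simp add: far_def map_add_def)+

lemma C_Blank: "C Blank [c] = {VFun (name Blank) [c]}"
  "C Blank [c, VCon (symc a) []] = (if a = 0 then C (Any J) [c] else {})"
  by (subst CALL_sim, simp add: far_def map_add_def)+

lemma C_Filt: "C Filt [c, h, j] = ite (C (Eq J) [c, j, h]) {} {j}"
  by (subst CALL_sim, simp add: far_def map_add_def)+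

lemma C_Inc: "C Inc [c, h] = (\<Union>j \<in> C (Any J) [c]. C IncX [c, h, j])"
  by (subst CALL_sim, simp add: far_def map_add_def)+

lemma C_IncX: "C IncX [c, h, j] = ite (\<Union>d \<in> C (Dec J) [c, j]. C (Eq J) [c, d, h]) {j} {}"
  by (subst CALL_sim, simp add: far_def map_add_def)+

lemma C_Run: "q \<in> tm_states T \<Longrightarrow> C (Run q) [c, t, h] = (if q = tm_acc T then {vtrue} else if q = tm_rej T then {vfalse} else
   \<Union>a \<in> tm_symbols T. case tm_delta T q a of (q', a', d) \<Rightarrow>
     ite (\<Union>j \<in> app t (VCon (symc a) []). C (Eq J) [c, j, h])
       (\<Union>t' \<in> C (Wr a') [c, t, h]. \<Union>h' \<in> (if d = 0 then {h} else if d = 1 then C Inc [c, h] else C (Dec J) [c, h]).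
         C (Run q') [c, t', h']) {})"
proof -
  assume q: "q \<in> tm_states T"
  have *: "q' \<in> tm_states T \<and> a' \<in> tm_symbols T" if "a \<in> tm_symbols T" "tm_delta T q a = (q', a', d)" for a q' a' d
    using valid q that unfolding valid_tm_def by fastforce
  let ?\<gamma> = "[''c'' \<mapsto> c] ++ ([''t'' \<mapsto> t] ++ ([''h'' \<mapsto> h] ++ Map.empty))"
  let ?B = "\<lambda>a r. case r of (q', a', d) \<Rightarrow> ite (\<Union>j \<in> app t (VCon (symc a) []). C (Eq J) [c, j, h])
       (\<Union>t' \<in> C (Wr a') [c, t, h]. \<Union>h' \<in> (if d = 0 then {h} else if d = 1 then C Inc [c, h] else C (Dec J) [c, h]).
         C (Run q') [c, t', h']) {}"
  have B: "ev ?\<gamma> (case tm_delta T q a of (q', a', d) \<Rightarrow>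
       EIf (fc (Eq J) [xc, EApp xt (ECon (symc a)), xh])
         (fc (Run q') [xc, fc (Wr a') [xc, xt, xh], move J d]) (fc FailB [])) = ?B a (tm_delta T q a)"
    if a: "a \<in> tm_symbols T" for a
  proof -
    obtain q' a' d where D: "tm_delta T q a = (q', a', d)" by (cases "tm_delta T q a")
    have "ev ?\<gamma> (move J d) = (if d = 0 then {h} else if d = 1 then C Inc [c, h] else C (Dec J) [c, h])"
      by (simp add: move_def far_def map_add_def)
    then show ?thesis using *[OF a D] by (simp add: D far_def map_add_def)
  qed
  have "C (Run q) [c, t, h] = ev ?\<gamma> (snd (hd (cl T J (Run q))))"
    using q by (subst CALL_sim) (simp add: far_def)
  then show ?thesis using B by (simp add: syms_def vtrue_def vfalse_def cong: SUP_cong)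
qed

lemma ap_VFun: "ap p (VFun f vs) u = CALL p f (vs @ [u])"
  by (auto simp: ap_def)

lemma ite_eq: "ite {vb x} {vb y} (ite {vb y} {vfalse} {vtrue}) = {vb (x = y)}"
  by (cases x; cases y) simp_all

section \<open>Numbers of all levels and their arithmetic\<close>

definition N :: "nat \<Rightarrow> nat" where "N k = exp2 k (length inp + 1)"

lemma N_pos[simp]: "N k > 0"
  by (cases k) (auto simp: N_def)

lemma N_Suc: "N (Suc k) = 2 ^ N k"
  by (simp add: N_def)

text \<open>A relation and not a function, as a number has many representatives: set members may be
  returned in any representation. At level 0 the number \<open>x\<close> is the suffix of length
  \<open>x\<close>. At a higher level the results on either truth value must represent the digits of
  that value exactly, with nothing missing and nothing else.\<close>

primrec R :: "nat \<Rightarrow> val \<Rightarrow> nat \<Rightarrow> bool" where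
  "R 0 v x \<longleftrightarrow> x < N 0 \<and> v = enc_list (drop (length inp - x) inp)"
| "R (Suc k) v x \<longleftrightarrow> x < N (Suc k) \<and> (\<forall>b.
     (\<forall>u \<in> app v (vb b). \<exists>j<N k. (j \<in> set_decode x) = b \<and> R k u j) \<and>
     (\<forall>j<N k. (j \<in> set_decode x) = b \<longrightarrow> (\<exists>u \<in> app v (vb b). R k u j)))"

definition Rs :: "nat \<Rightarrow> val set \<Rightarrow> nat set \<Rightarrow> bool" where
  "Rs k U S \<longleftrightarrow> (\<forall>u \<in> U. \<exists>j \<in> S. R k u j) \<and> (\<forall>j \<in> S. \<exists>u \<in> U. R k u j)"

declare R.simps(2)[simp del]

lemma R_less: "R k v x \<Longrightarrow> x < N k"
  by (cases k) (auto simp: R.simps)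

lemma R_Suc: "R (Suc k) v x \<longleftrightarrow> x < N (Suc k) \<and> (\<forall>b. Rs k (app v (vb b)) {j. j < N k \<and> (j \<in> set_decode x) = b})"
  unfolding R.simps Rs_def by blast

lemma RsD: "Rs k U S \<Longrightarrow> u \<in> U \<Longrightarrow> \<exists>j \<in> S. R k u j" "Rs k U S \<Longrightarrow> j \<in> S \<Longrightarrow> \<exists>u \<in> U. R k u j"
  by (auto simp: Rs_def)

lemma Rs_single: "R k v x \<Longrightarrow> Rs k {v} {x}"
  by (auto simp: Rs_def)

lemma Rs_empty: "Rs k {} {}"
  by (auto simp: Rs_def)

lemma Rs_union: "Rs k U S \<Longrightarrow> Rs k U' S' \<Longrightarrow> Rs k (U \<union> U') (S \<union> S')"
  by (auto simp: Rs_def)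

text \<open>Sequencing of non-deterministic computations. Whatever representative the first one
  returns, the second only has to be correct for the number represented.\<close>

lemma Rs_UN:
  assumes "Rs k U S" "\<And>u j. u \<in> U \<Longrightarrow> j \<in> S \<Longrightarrow> R k u j \<Longrightarrow> Rs k' (F u) (G j)"
  shows "Rs k' (\<Union>u \<in> U. F u) (\<Union>j \<in> S. G j)"
  unfolding Rs_def
proof (intro conjI ballI)
  fix w assume "w \<in> (\<Union>u \<in> U. F u)"
  then obtain u where u: "u \<in> U" "w \<in> F u" by blast
  then obtain j where "j \<in> S" "R k u j" using RsD(1)[OF assms(1)] by blast
  then show "\<exists>i \<in> (\<Union>j \<in> S. G j). R k' w i" using RsD(1)[OF assms(2)] u by blast
next
  fix i assume "i \<in> (\<Union>j \<in> S. G j)"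
  then obtain j where j: "j \<in> S" "i \<in> G j" by blast
  then obtain u where "u \<in> U" "R k u j" using RsD(2)[OF assms(1)] by blast
  then show "\<exists>w \<in> (\<Union>u \<in> U. F u). R k' w i" using RsD(2)[OF assms(2)] j by blast
qed

lemma Rs_UN_eq:
  assumes "Rs k U S" "\<And>u j. u \<in> U \<Longrightarrow> j \<in> S \<Longrightarrow> R k u j \<Longrightarrow> F u = G j"
  shows "(\<Union>u \<in> U. F u) = (\<Union>j \<in> S. G j)"
proof (intro equalityI subsetI)
  fix w assume "w \<in> (\<Union>u \<in> U. F u)"
  then obtain u where u: "u \<in> U" "w \<in> F u" by blast
  then obtain j where "j \<in> S" "R k u j" using RsD(1)[OF assms(1)] by blast
  then show "w \<in> (\<Union>j \<in> S. G j)" using assms(2) u by blast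
next
  fix w assume "w \<in> (\<Union>j \<in> S. G j)"
  then obtain j where j: "j \<in> S" "w \<in> G j" by blast
  then obtain u where "u \<in> U" "R k u j" using RsD(2)[OF assms(1)] by blast
  then show "w \<in> (\<Union>u \<in> U. F u)" using assms(2) j by blast
qed

definition prd :: "nat \<Rightarrow> nat \<Rightarrow> nat" where
  "prd k x = (if x = 0 then N k - 1 else x - 1)"

text \<open>Zero, cyclic predecessor and equality are the whole interface of a level: enumeration,
  membership and the three operations of the next level are programmed from these. Equality yields
  exactly one truth value, so it can safely control a conditional.\<close>

definition spec :: "nat \<Rightarrow> bool" where
  "spec k \<longleftrightarrow> Rs k (C (Zero k) [cv]) {0} \<and> (\<forall>v x. R k v x \<longrightarrow> Rs k (C (Dec k) [cv, v]) {prd k x}) \<and>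
     (\<forall>v u x y. R k v x \<longrightarrow> R k u y \<longrightarrow> C (Eq k) [cv, v, u] = {vb (x = y)})"

lemma spec_eq: "spec k \<Longrightarrow> R k v x \<Longrightarrow> R k u y \<Longrightarrow> C (Eq k) [cv, v, u] = {vb (x = y)}"
  by (auto simp: spec_def)

lemma spec_zero: "spec k \<Longrightarrow> Rs k (C (Zero k) [cv]) {0}"
  by (auto simp: spec_def)

lemma spec_dec: "spec k \<Longrightarrow> R k v x \<Longrightarrow> Rs k (C (Dec k) [cv, v]) {prd k x}"
  by (auto simp: spec_def)

lemma spec_is_zero: 
  assumes "spec k" "R k v x"
  shows "(\<Union>z \<in> C (Zero k) [cv]. C (Eq k) [cv, v, z]) = {vb (x = 0)}"
proof -
  have "(\<Union>z \<in> C (Zero k) [cv]. C (Eq k) [cv, v, z]) = (\<Union>y \<in> {0}. {vb (x = y)})"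
    by (rule Rs_UN_eq[OF spec_zero[OF assms(1)]]) (rule spec_eq[OF assms])
  then show ?thesis by simp
qed

lemma spec_AnyX: "k \<le> J \<Longrightarrow> spec k \<Longrightarrow> R k u x \<Longrightarrow> Rs k (C (AnyX k) [cv, u]) {..x}"
proof (induction x arbitrary: u)
  case 0
  then show ?case by (simp add: C_AnyX spec_is_zero Rs_single)
next
  case (Suc x)
  have "Rs k (\<Union>d \<in> C (Dec k) [cv, u]. C (AnyX k) [cv, d]) (\<Union>j \<in> {x}. {..j})"
    by (rule Rs_UN[of k _ _]) (use Suc spec_dec[OF Suc.prems(2,3)] in \<open>auto simp: prd_def\<close>)
  then have "Rs k ({u} \<union> (\<Union>d \<in> C (Dec k) [cv, u]. C (AnyX k) [cv, d])) ({Suc x} \<union> {..x})"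
    by (intro Rs_union Rs_single Suc.prems) simp
  moreover have "{Suc x} \<union> {..x} = {..Suc x}" by auto
  ultimately show ?case using Suc.prems by (simp add: C_AnyX spec_is_zero)
qed

text \<open>Since arithmetic is cyclic, the predecessor of zero is the greatest number. Loops start
  there and count down to zero.\<close>

lemma spec_last:
  assumes "spec k" shows "Rs k (\<Union>z \<in> C (Zero k) [cv]. C (Dec k) [cv, z]) {N k - 1}"
proof -
  have "Rs k (\<Union>z \<in> C (Zero k) [cv]. C (Dec k) [cv, z]) (\<Union>j \<in> {0}. {prd k j})"
    by (rule Rs_UN[OF spec_zero[OF assms]]) (rule spec_dec[OF assms])
  then show ?thesis by (simp add: prd_def)
qed

lemma spec_Any:
  assumes "k \<le> J" "spec k" shows "Rs k (C (Any k) [cv]) {..<N k}"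
proof -
  have "C (Any k) [cv] = (\<Union>j \<in> (\<Union>z \<in> C (Zero k) [cv]. C (Dec k) [cv, z]). C (AnyX k) [cv, j])"
    by (simp add: C_Any[OF assms(1)])
  moreover have "Rs k \<dots> (\<Union>j \<in> {N k - 1}. {..j})"
    by (rule Rs_UN[OF spec_last[OF assms(2)]]) (rule spec_AnyX[OF assms])
  moreover have "{..N k - 1} = {..<N k}" by (metis N_pos Suc_pred' lessThan_Suc_atMost)
  ultimately show ?thesis by simp
qed

text \<open>Here the complement pays off: \<open>j\<close> is among the results of \<open>v\<close>
  on exactly one of the two truth values, so exactly one alternative of the \<open>choose\<close>
  has a result, and the answer is deterministic.\<close>

lemma spec_Mem:
  assumes "k < J" "spec k" "R (Suc k) v x" "R k u j"
  shows "C (Mem k) [cv, v, u] = {vb (j \<in> set_decode x)}"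
proof -
  have "(\<Union>a \<in> app v (vb b). C (Eq k) [cv, a, u]) = (\<Union>i \<in> {i. i < N k \<and> (i \<in> set_decode x) = b}. {vb (i = j)})" for b
  proof (rule Rs_UN_eq)
    show "Rs k (app v (vb b)) {i. i < N k \<and> (i \<in> set_decode x) = b}" using assms(3) unfolding R_Suc by blast
  qed (rule spec_eq[OF assms(2) _ assms(4)])
  from this[of True] this[of False] show ?thesis using R_less[OF assms(4)]
    by (auto simp: C_Mem[OF assms(1)] ite_def split: if_splits)
qed

lemma spec_Mem_pred:
  assumes "k < J" "spec k" "R (Suc k) v x" "R k u (Suc j)"
  shows "(\<Union>d \<in> C (Dec k) [cv, u]. C (Mem k) [cv, v, d]) = {vb (j \<in> set_decode x)}"
proof -
  have "(\<Union>d \<in> C (Dec k) [cv, u]. C (Mem k) [cv, v, d]) = (\<Union>i \<in> {prd k (Suc j)}. {vb (i \<in> set_decode x)})"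
    by (rule Rs_UN_eq[OF spec_dec[OF assms(2,4)]]) (rule spec_Mem[OF assms(1-3)])
  then show ?thesis by (simp add: prd_def)
qed

text \<open>When one is subtracted, the borrow reaches digit \<open>j\<close> exactly if all lower
  digits are 0; this is the test for that.\<close>

lemma spec_Nb:
  assumes "k < J" "spec k" "R (Suc k) v x"
  shows "R k u j \<Longrightarrow> C (Nb k) [cv, v, u] = {vb (\<forall>i<j. i \<notin> set_decode x)}"
proof (induction j arbitrary: u)
  case 0
  then show ?case using assms by (simp add: C_Nb spec_is_zero)
next
  case (Suc j)
  have "(\<Union>d \<in> C (Dec k) [cv, u]. C (Nb k) [cv, v, d]) = (\<Union>i \<in> {j}. {vb (\<forall>i<j. i \<notin> set_decode x)})"
    by (rule Rs_UN_eq[of k]) (use Suc spec_dec[OF assms(2) Suc.prems] in \<open>auto simp: prd_def\<close>)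
  then have "C (Nb k) [cv, v, u] = ite {vb (j \<in> set_decode x)} {vfalse} {vb (\<forall>i<j. i \<notin> set_decode x)}"
    by (subst C_Nb[OF assms(1)]) (simp only: spec_is_zero[OF assms(2) Suc.prems] spec_Mem_pred[OF assms Suc.prems],
      simp)
  then show ?case by (simp add: All_less_Suc)
qed

lemma spec_EqX:
  assumes "k < J" "spec k" "R (Suc k) v x" "R (Suc k) u y"
  shows "R k d j \<Longrightarrow> C (EqX k) [cv, v, u, d] = {vb (\<forall>i\<le>j. (i \<in> set_decode x) = (i \<in> set_decode y))}"
proof (induction j arbitrary: d)
  case 0
  then show ?case using assms by (auto simp: C_EqX spec_is_zero spec_Mem)
next
  case (Suc j)
  have "(\<Union>e \<in> C (Dec k) [cv, d]. C (EqX k) [cv, v, u, e]) = (\<Union>i \<in> {j}. {vb (\<forall>i\<le>j. (i \<in> set_decode x) = (i \<in> set_decode y))})"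
    by (rule Rs_UN_eq[of k]) (use Suc spec_dec[OF assms(2) Suc.prems] in \<open>auto simp: prd_def\<close>)
  then have "C (EqX k) [cv, v, u, d] = ite (ite {vb (Suc j \<in> set_decode x)} {vb (Suc j \<in> set_decode y)}
      (ite {vb (Suc j \<in> set_decode y)} {vfalse} {vtrue}))
    {vb (\<forall>i\<le>j. (i \<in> set_decode x) = (i \<in> set_decode y))} {vfalse}"
    by (subst C_EqX[OF assms(1)]) (simp only: spec_is_zero[OF assms(2) Suc.prems] spec_Mem[OF assms(1-3) Suc.prems]
      spec_Mem[OF assms(1,2,4) Suc.prems], simp)
  moreover have "(\<forall>i\<le>Suc j. P i) \<longleftrightarrow> P (Suc j) \<and> (\<forall>i\<le>j. P i)" for P
    by (auto simp: le_Suc_eq)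
  ultimately show ?case by simp
qed

text \<open>The guess is kept if \<open>b\<close> is the digit of the predecessor at this place,
  namely the old digit flipped if the borrow arrives there.\<close>

lemma spec_DecX:
  assumes "k < J" "spec k" "R (Suc k) v x" "R k u j"
  shows "C (DecX k) [cv, v, vb b, u] = (if b = ((j \<in> set_decode x) \<noteq> (\<forall>i<j. i \<notin> set_decode x)) then {u} else {})"
  by (subst C_DecX[OF assms(1)]) (simp only: spec_Mem[OF assms] spec_Nb[OF assms] ite_eq, cases b, auto)

text \<open>Binary subtraction of one: the borrow flips precisely those digits below which
  everything is 0.\<close>

lemma set_decode_pred:
  "j \<in> set_decode x \<longleftrightarrow> (j \<in> set_decode (Suc x)) \<noteq> (\<forall>i<j. i \<notin> set_decode (Suc x))"
proof (induction j arbitrary: x)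
  case 0
  then show ?case by (simp add: set_decode_0)
next
  case (Suc j)
  show ?case
  proof (cases "even x")
    case True
    then have "Suc x div 2 = x div 2" "0 \<in> set_decode (Suc x)" by (auto simp: set_decode_0)
    then show ?thesis by (auto simp: set_decode_Suc)
  next
    case False
    then have "Suc x div 2 = Suc (x div 2)" "0 \<notin> set_decode (Suc x)" by (auto simp: set_decode_0 elim!: oddE)
    then show ?thesis using Suc.IH[of "x div 2"] by (simp add: set_decode_Suc All_less_Suc2)
  qed
qed

lemma set_decode_bounded: "j \<in> set_decode x \<Longrightarrow> x < 2 ^ n \<Longrightarrow> j < n"
proof (rule ccontr)
  assume j: "j \<in> set_decode x" "x < 2 ^ n" "\<not> j < n"
  then have "x div 2 ^ j = 0" by (intro div_less less_le_trans[OF j(2)] power_increasing) auto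
  then show False using j(1) by (simp add: set_decode_def)
qed

lemma set_decode_minus_one: "j \<in> set_decode (2 ^ n - 1) \<longleftrightarrow> j < n"
proof (induction n arbitrary: j)
  case (Suc n)
  have "(2 ^ Suc n - 1 :: nat) = Suc (2 * (2 ^ n - 1))"
    by (cases "2 ^ n :: nat") auto
  then show ?case using Suc.IH by (cases j) (simp_all add: set_decode_0)
qed simp

lemma spec_Suc:
  assumes J: "Suc k \<le> J" and spec: "spec k"
  shows "spec (Suc k)"
proof -
  have k: "k < J" "k \<le> J" using J by auto
  \<comment> \<open>Zero is the empty set of digits: no clause applies on \<open>true\<close>, and
    on \<open>false\<close> every number of the lower level is returned.\<close>
  have "R (Suc k) (VFun (name (Zero (Suc k))) [cv]) 0"
    unfolding R_Suc
    using spec_Any[OF k(2) spec] C_ZeroS(2)[OF J, of cv True] C_ZeroS(2)[OF J, of cv False]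
    by (auto simp: ap_def Rs_empty lessThan_def)
  then have zero: "Rs (Suc k) (C (Zero (Suc k)) [cv]) {0}"
    by (simp add: C_ZeroS(1)[OF J] Rs_single)
  have dec: "Rs (Suc k) (C (Dec (Suc k)) [cv, v]) {prd (Suc k) x}" if v: "R (Suc k) v x" for v x
  proof -
    \<comment> \<open>For x = 0 the borrow reaches every place and flips all digits to 1, which is
      the greatest number. The rule for borrowing is thus cyclic without a special case.\<close>
    have bit: "j \<in> set_decode (prd (Suc k) x) \<longleftrightarrow> (j \<in> set_decode x) \<noteq> (\<forall>i<j. i \<notin> set_decode x)" if "j < N k" for j
    proof (cases x)
      case 0
      then show ?thesis using that set_decode_minus_one[of j "N k"] by (simp add: prd_def N_Suc)
    next
      case (Suc y)
      then show ?thesis using set_decode_pred[of j y] by (simp add: prd_def)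
    qed
    have "Rs k (app (VFun (name (Dec (Suc k))) [cv, v]) (vb b)) {j. j < N k \<and> (j \<in> set_decode (prd (Suc k) x)) = b}" for b
    proof -
      have "app (VFun (name (Dec (Suc k))) [cv, v]) (vb b) = (\<Union>u \<in> C (Any k) [cv]. C (DecX k) [cv, v, vb b, u])"
        by (simp only: ap_VFun C_DecS(2)[OF J] append_Cons append_Nil)
      moreover have "Rs k \<dots> (\<Union>j \<in> {..<N k}. if b = (j \<in> set_decode (prd (Suc k) x)) then {j} else {})"
      proof (rule Rs_UN[OF spec_Any[OF k(2) spec]])
        fix u j assume "j \<in> {..<N k}" "R k u j"
        then have "C (DecX k) [cv, v, vb b, u] = (if b = (j \<in> set_decode (prd (Suc k) x)) then {u} else {})"
          by (simp only: spec_DecX[OF k(1) spec v] bit lessThan_iff)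
        then show "Rs k (C (DecX k) [cv, v, vb b, u]) (if b = (j \<in> set_decode (prd (Suc k) x)) then {j} else {})"
          using \<open>R k u j\<close> by (simp add: Rs_single Rs_empty)
      qed
      moreover have "(\<Union>j \<in> {..<N k}. if b = (j \<in> set_decode (prd (Suc k) x)) then {j} else {}) =
        {j. j < N k \<and> (j \<in> set_decode (prd (Suc k) x)) = b}" by (auto split: if_splits)
      ultimately show ?thesis by metis
    qed
    moreover have "prd (Suc k) x < N (Suc k)" using R_less[OF v] by (auto simp: prd_def)
    ultimately show ?thesis by (simp only: C_DecS(1)[OF J] Rs_single R_Suc simp_thms)
  qed
  have eq: "C (Eq (Suc k)) [cv, v, u] = {vb (x = y)}" if v: "R (Suc k) v x" "R (Suc k) u y" for v u x y
  proof -
    have "C (Eq (Suc k)) [cv, v, u] = (\<Union>j \<in> (\<Union>z \<in> C (Zero k) [cv]. C (Dec k) [cv, z]). C (EqX k) [cv, v, u, j])"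
      by (simp add: C_EqS[OF J])
    also have "\<dots> = (\<Union>j \<in> {N k - 1}. {vb (\<forall>i\<le>j. (i \<in> set_decode x) = (i \<in> set_decode y))})"
      by (rule Rs_UN_eq[OF spec_last[OF spec]]) (rule spec_EqX[OF k(1) spec v])
    finally have "C (Eq (Suc k)) [cv, v, u] = {vb (\<forall>i\<le>N k - 1. (i \<in> set_decode x) = (i \<in> set_decode y))}"
      by simp
    moreover have "(\<forall>i\<le>N k - 1. (i \<in> set_decode x) = (i \<in> set_decode y)) \<longleftrightarrow> x = y"
    proof
      assume e: "\<forall>i\<le>N k - 1. (i \<in> set_decode x) = (i \<in> set_decode y)"
      have "x < 2 ^ N k" "y < 2 ^ N k" using R_less[OF v(1)] R_less[OF v(2)] by (auto simp: N_Suc)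
      then have "\<And>i. i \<in> set_decode x \<Longrightarrow> i \<le> N k - 1" "\<And>i. i \<in> set_decode y \<Longrightarrow> i \<le> N k - 1"
        by (fastforce dest: set_decode_bounded)+
      then have "set_decode x = set_decode y" using e by blast
      then show "x = y" by (metis set_decode_inverse)
    qed simp
    ultimately show ?thesis by (simp only:)
  qed
  show ?thesis unfolding spec_def using zero dec eq by blast
qed

lemma spec_0: "spec 0"
proof -
  let ?e = "\<lambda>x. enc_list (drop (length inp - x) inp)"
  have e: "?e (Suc x) = VCon ''cons'' [vb (inp ! (length inp - Suc x)), ?e x]" if "x < length inp" for x
  proof -
    have "drop (length inp - Suc x) inp = inp ! (length inp - Suc x) # drop (length inp - x) inp"
      using that Cons_nth_drop_Suc[of "length inp - Suc x" inp] by (simp add: Suc_diff_Suc)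
    then show ?thesis by simp
  qed
  have eq: "C (Eq 0) [cv, ?e x, ?e y] = {vb (x = y)}" if "x \<le> length inp" "y \<le> length inp" for x y
    using that
  proof (induction x arbitrary: y)
    case 0
    then show ?case by (cases y) (simp_all add: C_Eq0 e)
  next
    case (Suc x)
    then show ?case by (cases y) (simp_all add: C_Eq0 e)
  qed
  have dec: "C (Dec 0) [cv, ?e x] = {?e (prd 0 x)}" if "x \<le> length inp" for x
    using that by (cases x) (simp_all add: C_Dec0 e prd_def N_def)
  have N: "N 0 = Suc (length inp)" by (simp add: N_def)
  have "R 0 (VCon ''nil'' []) 0" by (simp add: N)
  then have zero: "Rs 0 (C (Zero 0) [cv]) {0}" unfolding C_Zero0 by (rule Rs_single)
  have "Rs 0 (C (Dec 0) [cv, v]) {prd 0 x}" if "R 0 v x" for v x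
  proof -
    have "C (Dec 0) [cv, v] = {?e (prd 0 x)}" using that dec[of x] by (simp add: N)
    moreover have "R 0 (?e (prd 0 x)) (prd 0 x)" using that by (simp add: prd_def N) linarith
    ultimately show ?thesis by (simp only: Rs_single)
  qed
  moreover have "C (Eq 0) [cv, v, u] = {vb (x = y)}" if "R 0 v x" "R 0 u y" for v u x y
    using that eq[of x y] by (simp add: N)
  ultimately show ?thesis unfolding spec_def using zero by blast
qed

lemma spec: "k \<le> J \<Longrightarrow> spec k"
  by (induction k) (auto intro: spec_0 spec_Suc)

declare N_pos[simp del]

section \<open>Tape positions, tapes and runs of the machine\<close>

lemmas specJ = spec[of J, OF order_refl]

text \<open>The two-way infinite tape is wound around the cycle of numbers of level
  \<open>J\<close>, with cells left of the origin at its upper end. Cells at distance at most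
  \<open>L\<close> from the origin stay distinct if 2 * L + 1 \<le> \<open>N J\<close>.\<close>

definition pos :: "int \<Rightarrow> nat" where "pos i = nat (i mod int (N J))"

lemma pos_less[simp]: "pos i < N J"
  using N_pos[of J] by (simp add: pos_def nat_less_iff)

lemma int_pos: "int (pos i) = i mod int (N J)"
  using N_pos[of J] by (simp add: pos_def)

lemma pos_0[simp]: "pos 0 = 0"
  by (simp add: pos_def)

lemma pos_inj:
  assumes "2 * L + 1 \<le> int (N J)" "\<bar>i\<bar> \<le> L" "\<bar>j\<bar> \<le> L"
  shows "pos i = pos j \<longleftrightarrow> i = j"
proof
  assume "pos i = pos j"
  then have "i mod int (N J) = j mod int (N J)" using int_pos by metis
  then have d: "int (N J) dvd i - j" by (simp add: mod_eq_dvd_iff)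
  show "i = j"
  proof (rule ccontr)
    assume "i \<noteq> j"
    then have "int (N J) \<le> \<bar>i - j\<bar>" using zdvd_imp_le[of "int (N J)" "\<bar>i - j\<bar>"] d by simp
    then show False using assms by linarith
  qed
qed simp

lemma prd_pos: "prd J (pos i) = pos (i - 1)"
proof -
  have "int (prd J (pos i)) = int (pos (i - 1))"
  proof (cases "pos i = 0")
    case True
    then have "(i - 1) mod int (N J) = (0 - 1) mod int (N J)"
      using int_pos[of i] by (metis mod_diff_left_eq of_nat_0)
    also have "\<dots> = int (N J) - 1" using N_pos[of J] by (simp add: zmod_minus1)
    finally show ?thesis using True N_pos[of J] by (simp add: prd_def int_pos of_nat_diff Suc_leI)
  next
    case False
    have "(i - 1) mod int (N J) = (int (pos i) - 1) mod int (N J)"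
      unfolding int_pos by (simp add: mod_diff_left_eq)
    also have "\<dots> = int (pos i) - 1" using False pos_less[of i] by (intro mod_pos_pos_trivial) linarith+
    finally show ?thesis using False by (simp add: prd_def int_pos of_nat_diff)
  qed
  then show ?thesis by simp
qed

lemma prd_eq_pos: "y < N J \<Longrightarrow> prd J y = pos i \<longleftrightarrow> y = pos (i + 1)"
proof
  assume y: "y < N J" "prd J y = pos i"
  have *: "pos (int x) = x" if "x < N J" for x using that by (simp add: pos_def)
  show "y = pos (i + 1)"
  proof (cases "y = 0")
    case True
    then have "int (N J) - 1 = i mod int (N J)"
      using y int_pos[of i] N_pos[of J] by (simp add: prd_def of_nat_diff Suc_leI)
    then have "(i + 1) mod int (N J) = int (N J) mod int (N J)" by (metis diff_add_cancel mod_add_left_eq)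
    then show ?thesis using True by (simp add: pos_def)
  next
    case False
    then have "int y - 1 = i mod int (N J)" using y int_pos[of i] by (simp add: prd_def of_nat_diff)
    then have "(i + 1) mod int (N J) = int y mod int (N J)" by (metis diff_add_cancel mod_add_left_eq)
    then show ?thesis using *[OF y(1)] by (simp add: pos_def)
  qed
qed (simp add: prd_pos)

text \<open>The successor is found by guessing a number and keeping it if its predecessor is the
  given one. As the predecessor is a bijection of the cycle, exactly one number survives.\<close>

lemma spec_Inc:
  assumes "R J v (pos i)"
  shows "Rs J (C Inc [cv, v]) {pos (i + 1)}"
proof -
  have "C IncX [cv, v, j] = (if y = pos (i + 1) then {j} else {})" if j: "R J j y" for j y
  proof -
    have "(\<Union>d \<in> C (Dec J) [cv, j]. C (Eq J) [cv, d, v]) = (\<Union>z \<in> {prd J y}. {vb (z = pos i)})"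
      by (rule Rs_UN_eq[OF spec_dec[OF specJ j]]) (rule spec_eq[OF specJ _ assms])
    then show ?thesis using prd_eq_pos[OF R_less[OF j]] by (simp add: C_IncX)
  qed
  then have "Rs J (\<Union>j \<in> C (Any J) [cv]. C IncX [cv, v, j]) (\<Union>y \<in> {..<N J}. if y = pos (i + 1) then {y} else {})"
    by (intro Rs_UN[OF spec_Any[OF order_refl specJ]]) (auto simp: Rs_empty intro: Rs_single)
  moreover have "(\<Union>y \<in> {..<N J}. if y = pos (i + 1) then {y} else {}) = {pos (i + 1)}" by auto
  ultimately show ?thesis by (simp add: C_Inc)
qed

definition TR :: "val \<Rightarrow> (nat \<Rightarrow> nat) \<Rightarrow> bool" where
  "TR t \<tau> \<longleftrightarrow> (\<forall>a \<in> tm_symbols T. Rs J (app t (VCon (symc a) [])) {x. x < N J \<and> \<tau> x = a})"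

lemma TR_Blank: "TR (VFun (name Blank) [cv]) (\<lambda>_. 0)"
  unfolding TR_def
proof
  fix a
  have "{x. x < N J \<and> (0 :: nat) = a} = (if a = 0 then {..<N J} else {})" by auto
  then show "Rs J (app (VFun (name Blank) [cv]) (VCon (symc a) [])) {x. x < N J \<and> 0 = a}"
    using spec_Any[OF order_refl specJ] by (simp only: ap_VFun append_Cons append_Nil C_Blank) (simp add: Rs_empty)
qed

text \<open>\<open>Filt\<close> takes the overwritten position away from every symbol, and the
  written symbol gets it back through the extra alternative in its clause.\<close>

lemma TR_Wr:
  assumes "a \<in> tm_symbols T" "TR t \<tau>" "R J h x"
  shows "TR (VFun (name (Wr a)) [cv, t, h]) (\<tau>(x := a))"
  unfolding TR_def
proof
  fix a' assume a': "a' \<in> tm_symbols T"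
  have F: "C Filt [cv, h, j] = (if y = x then {} else {j})" if "R J j y" for j y
    using spec_eq[OF specJ that assms(3)] by (simp add: C_Filt)
  have "Rs J (\<Union>j \<in> app t (VCon (symc a') []). C Filt [cv, h, j])
      (\<Union>y \<in> {y. y < N J \<and> \<tau> y = a'}. if y = x then {} else {y})"
    by (rule Rs_UN[of J]) (use assms(2) a' in \<open>auto simp: TR_def F Rs_single Rs_empty\<close>)
  moreover have "Rs J (if a' = a then {h} else {}) (if a' = a then {x} else {})"
    using assms(3) by (simp add: Rs_single Rs_empty)
  ultimately have "Rs J (app (VFun (name (Wr a)) [cv, t, h]) (VCon (symc a') []))
      ((if a' = a then {x} else {}) \<union> (\<Union>y \<in> {y. y < N J \<and> \<tau> y = a'}. if y = x then {} else {y}))"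
    by (simp only: ap_VFun append_Cons append_Nil C_Wr(2)[OF assms(1)] Rs_union)
  moreover have "(if a' = a then {x} else {}) \<union> (\<Union>y \<in> {y. y < N J \<and> \<tau> y = a'}. if y = x then {} else {y}) =
      {y. y < N J \<and> (\<tau>(x := a)) y = a'}"
    using R_less[OF assms(3)] by auto
  ultimately show "Rs J (app (VFun (name (Wr a)) [cv, t, h]) (VCon (symc a') [])) {y. y < N J \<and> (\<tau>(x := a)) y = a'}"
    by metis
qed

text \<open>Only the window of cells reachable by the head is compared. Outside it different cells
  share a position, so that the contents cannot all be represented.\<close>

definition tape :: "int \<Rightarrow> val \<Rightarrow> (int \<Rightarrow> nat) \<Rightarrow> bool" where
  "tape L t tp \<longleftrightarrow> (\<exists>\<tau>. TR t \<tau> \<and> (\<forall>i. \<bar>i\<bar> \<le> L \<longrightarrow> \<tau> (pos i) = tp i))"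

lemma tape_Wr:
  assumes "2 * L + 1 \<le> int (N J)" "\<bar>i\<bar> \<le> L" "a \<in> tm_symbols T" "tape L t tp" "R J h (pos i)"
  shows "\<exists>t'. C (Wr a) [cv, t, h] = {t'} \<and> tape L t' (tp(i := a))"
proof -
  obtain \<tau> where \<tau>: "TR t \<tau>" "\<And>i. \<bar>i\<bar> \<le> L \<Longrightarrow> \<tau> (pos i) = tp i" using assms(4) by (auto simp: tape_def)
  have "tape L (VFun (name (Wr a)) [cv, t, h]) (tp(i := a))"
    unfolding tape_def
    by (rule exI[of _ "\<tau>(pos i := a)"]) (use TR_Wr[OF assms(3) \<tau>(1) assms(5)] \<tau>(2) pos_inj[OF assms(1) _ assms(2)] in auto)
  then show ?thesis using C_Wr(1)[OF assms(3)] by blast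
qed

text \<open>\<open>m\<close> is the number of steps left. A step moves the head by at most one cell,
  so \<open>\<bar>h\<bar> + int m \<le> L\<close> keeps it inside the window. As the tape answers
  with positions for a given symbol, the scanned symbol is guessed; wrong guesses have no result, so
  the outcome is a single truth value.\<close>

lemma spec_Run:
  assumes L: "2 * L + 1 \<le> int (N J)"
  shows "\<bar>h\<bar> + int m \<le> L \<Longrightarrow> tape L t tp \<Longrightarrow> (\<And>i. tp i \<in> tm_symbols T) \<Longrightarrow> R J hv (pos h) \<Longrightarrow> q \<in> tm_states T \<Longrightarrow>
     fst ((tm_step T ^^ m) (q, tp, h)) = tm_acc T \<or> fst ((tm_step T ^^ m) (q, tp, h)) = tm_rej T \<Longrightarrow>
     C (Run q) [cv, t, hv] = {vb (fst ((tm_step T ^^ m) (q, tp, h)) = tm_acc T)}"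
proof (induction m arbitrary: q tp h t hv)
  case 0
  then show ?case using valid by (auto simp: C_Run valid_tm_def)
next
  case (Suc m)
  show ?case
  proof (cases "q = tm_acc T \<or> q = tm_rej T")
    case True
    then have "tm_step T (q, tp, h) = (q, tp, h)" by (auto simp: tm_step_def)
    then have E: "(tm_step T ^^ Suc m) (q, tp, h) = (tm_step T ^^ m) (q, tp, h)" by (simp add: funpow_swap1)
    show ?thesis unfolding E by (rule Suc.IH) (use Suc.prems E in auto)
  next
    case False
    obtain q' a' d where D: "tm_delta T q (tp h) = (q', a', d)" by (cases "tm_delta T q (tp h)")
    have v: "q' \<in> tm_states T" "a' \<in> tm_symbols T" "d \<in> {-1, 0, 1}"
      using valid Suc.prems(3)[of h] Suc.prems(5) D unfolding valid_tm_def by fastforce+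
    have "tm_step T (q, tp, h) = (q', tp(h := a'), h + d)" using False D by (simp add: tm_step_def)
    then have E: "(tm_step T ^^ Suc m) (q, tp, h) = (tm_step T ^^ m) (q', tp(h := a'), h + d)"
      by (simp add: funpow_swap1)
    have h: "\<bar>h\<bar> \<le> L" using Suc.prems(1) by simp
    obtain \<tau> where \<tau>: "TR t \<tau>" "\<And>i. \<bar>i\<bar> \<le> L \<Longrightarrow> \<tau> (pos i) = tp i" using Suc.prems(2) by (auto simp: tape_def)
    obtain t' where t': "C (Wr a') [cv, t, hv] = {t'}" "tape L t' (tp(h := a'))"
      using tape_Wr[OF L h v(2) Suc.prems(2,4)] by blast
    define H where "H d = (if d = 0 then {hv} else if d = 1 then C Inc [cv, hv] else C (Dec J) [cv, hv])" for d :: int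
    have H: "Rs J (H d) {pos (h + d)}"
      using v(3) Suc.prems(4) spec_Inc[OF Suc.prems(4)] spec_dec[OF specJ Suc.prems(4)]
      by (auto simp: H_def prd_pos Rs_single)
    let ?r = "{vb (fst ((tm_step T ^^ m) (q', tp(h := a'), h + d)) = tm_acc T)}"
    have "(\<Union>h' \<in> H d. C (Run q') [cv, t', h']) = (\<Union>y \<in> {pos (h + d)}. ?r)"
    proof (rule Rs_UN_eq[OF H])
      fix u j assume "j \<in> {pos (h + d)}" "R J u j"
      then show "C (Run q') [cv, t', u] = ?r"
        by (intro Suc.IH) (use Suc.prems(1,3,6) t'(2) v E in \<open>auto simp: fun_upd_def\<close>)
    qed
    then have res: "(\<Union>t'' \<in> C (Wr a') [cv, t, hv]. \<Union>h' \<in> H d. C (Run q') [cv, t'', h']) = ?r"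
      using t'(1) by simp
    \<comment> \<open>Comparisons that come out false lead to the empty set and contribute nothing.
      The branch of \<open>a\<close> survives exactly if some position carrying \<open>a\<close> is
      that of the head.\<close>
    have test: "ite (\<Union>j \<in> app t (VCon (symc a) []). C (Eq J) [cv, j, hv]) X {} = (if a = tp h then X else {})"
      if a: "a \<in> tm_symbols T" for a X
    proof -
      have "(\<Union>j \<in> app t (VCon (symc a) []). C (Eq J) [cv, j, hv]) = (\<Union>x \<in> {x. x < N J \<and> \<tau> x = a}. {vb (x = pos h)})"
        by (rule Rs_UN_eq[of J]) (use \<tau>(1) a spec_eq[OF specJ _ Suc.prems(4)] in \<open>auto simp: TR_def\<close>)
      then show ?thesis using \<tau>(2)[OF h] by (auto simp: ite_def split: if_splits)
    qed
    have "C (Run q) [cv, t, hv] = (\<Union>a \<in> tm_symbols T. case tm_delta T q a of (q', a', d) \<Rightarrow>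
       if a = tp h then (\<Union>t'' \<in> C (Wr a') [cv, t, hv]. \<Union>h' \<in> H d. C (Run q') [cv, t'', h']) else {})"
      unfolding C_Run[OF Suc.prems(5)] H_def[symmetric] using False by (simp add: test cong: SUP_cong)
    also have "\<dots> = (\<Union>a \<in> {tp h}. ?r)"
      using Suc.prems(3)[of h] res D by (auto split: if_splits)
    finally show ?thesis unfolding E by simp
  qed
qed

definition bits :: "bool list \<Rightarrow> int \<Rightarrow> nat" where
  "bits w = (\<lambda>i. if 0 \<le> i \<and> i < int (length w) then (if w ! nat i then 2 else 1) else 0)"

lemma bits_snoc: "bits (w @ [b]) = (bits w)(int (length w) := if b then 2 else 1)"
  by (auto simp: bits_def nth_append fun_eq_iff)

lemma tm_init_bits: "tm_init T w = (tm_start T, bits w, 0)"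
  by (simp add: tm_init_def bits_def)

text \<open>\<open>ws\<close> is the part already written to the tape and \<open>xs\<close> the part
  still to be read; the head stands on the first cell after \<open>ws\<close>. When everything is
  copied, the head is reset to the origin and the machine starts.\<close>

lemma spec_Load:
  assumes L: "2 * L + 1 \<le> int (N J)" "int (length inp) \<le> L" "int m \<le> L"
    and halt: "fst (tm_run T inp m) = tm_acc T \<or> fst (tm_run T inp m) = tm_rej T"
  shows "inp = ws @ xs \<Longrightarrow> tape L t (bits ws) \<Longrightarrow> R J hv (pos (int (length ws))) \<Longrightarrow>
     C Load [cv, enc_list xs, t, hv] = {vb (fst (tm_run T inp m) = tm_acc T)}"
proof (induction xs arbitrary: ws t hv)
  case Nil
  have tp: "tape L t (bits inp)" using Nil.prems by simp
  have "(\<Union>z \<in> C (Zero J) [cv]. C (Run (tm_start T)) [cv, t, z]) = (\<Union>z \<in> {0 :: nat}. {vb (fst (tm_run T inp m) = tm_acc T)})"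
  proof (rule Rs_UN_eq[OF spec_zero[OF specJ]])
    fix u j assume "j \<in> {0 :: nat}" "R J u j"
    moreover have "bits inp i \<in> tm_symbols T" for i by (auto simp: bits_def)
    ultimately show "C (Run (tm_start T)) [cv, t, u] = {vb (fst (tm_run T inp m) = tm_acc T)}"
      using spec_Run[OF L(1), of 0 m t "bits inp" u "tm_start T"] tp L(3) halt
      by (simp add: tm_run_def tm_init_bits)
  qed
  then show ?case by (simp add: C_Load(1))
next
  case (Cons b xs)
  let ?h = "int (length ws)"
  have h: "\<bar>?h\<bar> \<le> L" using L(2) Cons.prems(1) by simp
  have sym: "(if b then 2 else 1) \<in> tm_symbols T" by simp
  obtain t' where t': "C (Wr (if b then 2 else 1)) [cv, t, hv] = {t'}" "tape L t' ((bits ws)(?h := if b then 2 else 1))"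
    using tape_Wr[OF L(1) h sym Cons.prems(2,3)] by blast
  have "(\<Union>h' \<in> C Inc [cv, hv]. C Load [cv, enc_list xs, t', h']) =
      (\<Union>y \<in> {pos (?h + 1)}. {vb (fst (tm_run T inp m) = tm_acc T)})"
  proof (rule Rs_UN_eq[OF spec_Inc[OF Cons.prems(3)]])
    fix u j assume "j \<in> {pos (?h + 1)}" "R J u j"
    then have "R J u (pos (int (length (ws @ [b]))))" by (simp add: add.commute)
    moreover have "inp = (ws @ [b]) @ xs" using Cons.prems(1) by simp
    moreover have "tape L t' (bits (ws @ [b]))" unfolding bits_snoc by (rule t'(2))
    ultimately show "C Load [cv, enc_list xs, t', u] = {vb (fst (tm_run T inp m) = tm_acc T)}"
      using Cons.IH by blast
  qed
  then show ?case by (simp only: enc_list.simps C_Load(2) t'(1)) simp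
qed

lemma main_sim: "main_fun (sim T J) = name Main"
  by (simp add: main_fun_def sim_def keys_def block_def)

lemma accepts_iff: "prog_accepts (sim T J) inp \<longleftrightarrow> vtrue \<in> C Main [cv]"
proof -
  have "ev [''x'' \<mapsto> cv] (EApp (EFun (name Main)) (EVar ''x'')) = C Main [cv]"
    by (subst ev_fc(1)) (simp_all add: far_def)
  then show ?thesis unfolding prog_accepts_def main_sim EV_def by blast
qed

lemma sim_accepts:
  assumes L: "2 * L + 1 \<le> int (N J)" "int (length inp) \<le> L" "int m \<le> L"
    and halt: "fst (tm_run T inp m) = tm_acc T \<or> fst (tm_run T inp m) = tm_rej T" and ne: "inp \<noteq> []"
  shows "prog_accepts (sim T J) inp \<longleftrightarrow> fst (tm_run T inp m) = tm_acc T"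
proof -
  have "tape L (VFun (name Blank) [cv]) (bits [])"
    unfolding tape_def using TR_Blank by (intro exI[of _ "\<lambda>_. 0"]) (auto simp: bits_def)
  note tape = this
  have "C Start [cv] = (\<Union>h \<in> C (Zero J) [cv]. C Load [cv, cv, VFun (name Blank) [cv], h])"
    by (simp add: C_Start C_Blank)
  also have "\<dots> = (\<Union>x \<in> {0 :: nat}. {vb (fst (tm_run T inp m) = tm_acc T)})"
    by (rule Rs_UN_eq[OF spec_zero[OF specJ]], rule spec_Load[OF L halt, of "[]"]) (use tape in auto)
  finally have S: "C Start [cv] = {vb (fst (tm_run T inp m) = tm_acc T)}" by simp
  obtain b w where "inp = b # w" using ne by (cases inp) auto
  then have "C Main [cv] = C Start [cv]" by (simp only: enc_list.simps C_Main_cons)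
  then show ?thesis using S by (auto simp: accepts_iff)
qed

lemma sim_rejects_Nil: "inp = [] \<Longrightarrow> \<not> prog_accepts (sim T J) inp"
  unfolding accepts_iff by (simp add: C_Main)

end

text \<open>Running time plus input length is the radius \<open>L\<close> of the window; the level
  \<open>J\<close> is chosen so large that its 2 * L + 1 cells receive different positions.\<close>

lemma tower_bounded_halting:
  "\<exists>J. \<forall>n\<ge>1. 2 * (c * exp2 K (a * n ^ b) + n) + 1 \<le> exp2 J (n + 1)"
proof -
  have "tower_bounded (\<lambda>n. exp2 K (a * n ^ b))"
    by (intro tower_bounded_exp2 tower_bounded_mult tower_bounded_const tower_bounded_power tower_bounded_id)
  then have "tower_bounded (\<lambda>n. 2 * (c * exp2 K (a * n ^ b) + n) + 1)"
    by (intro tower_bounded_add tower_bounded_mult tower_bounded_const tower_bounded_id)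
  then show ?thesis unfolding tower_bounded_def .
qed

lemma ELEMENTARY_accepted:
  assumes "X \<in> ELEMENTARY"
  shows "\<exists>T J. valid_tm T \<and> accepted_problem (sim T J) = X"
proof -
  obtain K a b where "X \<in> TIME (\<lambda>n. exp2 K (a * n ^ b))" using assms by (auto simp: ELEMENTARY_def EXPTIME_def)
  then obtain T c where X: "[] \<notin> X" and T: "valid_tm T" and c: "\<And>w. w \<noteq> [] \<Longrightarrow>
      \<exists>t. t \<le> c * exp2 K (a * length w ^ b) \<and> (fst (tm_run T w t) = tm_acc T \<or> fst (tm_run T w t) = tm_rej T) \<and>
        (fst (tm_run T w t) = tm_acc T \<longleftrightarrow> w \<in> X)"
    unfolding TIME_def decides_in_time_def by blast
  obtain J where J: "\<And>n. n \<ge> 1 \<Longrightarrow> 2 * (c * exp2 K (a * n ^ b) + n) + 1 \<le> exp2 J (n + 1)"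
    using tower_bounded_halting by blast
  have "prog_accepts (sim T J) w \<longleftrightarrow> w \<in> X" for w
  proof -
    interpret sim_loc T J w by unfold_locales (rule T)
    show ?thesis
    proof (cases "w = []")
      case True
      then show ?thesis using sim_rejects_Nil X by simp
    next
      case False
      obtain t where t: "t \<le> c * exp2 K (a * length w ^ b)"
        "fst (tm_run T w t) = tm_acc T \<or> fst (tm_run T w t) = tm_rej T" "fst (tm_run T w t) = tm_acc T \<longleftrightarrow> w \<in> X"
        using c[OF False] by blast
      have "1 \<le> length w" using False by (cases w) auto
      note J[OF this]
      then have "int (2 * (c * exp2 K (a * length w ^ b) + length w) + 1) \<le> int (N J)"
        unfolding N_def of_nat_le_iff .
      then have "2 * int (c * exp2 K (a * length w ^ b) + length w) + 1 \<le> int (N J)" by simp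
      moreover have "int (length w) \<le> int (c * exp2 K (a * length w ^ b) + length w)"
        "int t \<le> int (c * exp2 K (a * length w ^ b) + length w)" using t(1) by linarith+
      ultimately show ?thesis using sim_accepts[OF _ _ _ t(2) False] t(3) by blast
    qed
  qed
  then have "accepted_problem (sim T J) = X" by (auto simp: accepted_problem_def)
  then show ?thesis using T by blast
qed

section \<open>Typing the simulation\<close>

text \<open>A type computed by recursion, so that the clauses are type-checked by simplification
  instead of by building derivations. \<open>None\<close> only means that no type is found in this
  way.\<close>

fun tyo :: "(string \<Rightarrow> ty) \<Rightarrow> (string \<Rightarrow> ty) \<Rightarrow> (string \<Rightarrow> ty) \<Rightarrow> expr \<Rightarrow> ty option" where
  "tyo FC FD \<Gamma> (EVar x) = Some (\<Gamma> x)"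
| "tyo FC FD \<Gamma> (ECon c) = Some (FC c)"
| "tyo FC FD \<Gamma> (EFun f) = Some (FD f)"
| "tyo FC FD \<Gamma> (EIf a b c) = (if tyo FC FD \<Gamma> a = Some boolT \<and> tyo FC FD \<Gamma> b = tyo FC FD \<Gamma> c then tyo FC FD \<Gamma> c else None)"
| "tyo FC FD \<Gamma> (EChoose es) = (case map (tyo FC FD \<Gamma>) es of [] \<Rightarrow> None | t # ts \<Rightarrow> if \<forall>t' \<in> set ts. t' = t then t else None)"
| "tyo FC FD \<Gamma> (EPair a b) = None"
| "tyo FC FD \<Gamma> (EApp a b) = (case tyo FC FD \<Gamma> a of Some (Arrow s t) \<Rightarrow> if tyo FC FD \<Gamma> b = Some s then Some t else None | _ \<Rightarrow> None)"

lemma tyo_typed: "tyo FC FD \<Gamma> e = Some t \<Longrightarrow> typed FC FD \<Gamma> e t"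
proof (induction e arbitrary: t)
  case (EChoose es)
  then have "es \<noteq> []" "\<forall>e \<in> set es. tyo FC FD \<Gamma> e = Some t" by (auto split: list.splits if_splits)
  then show ?case using EChoose.IH by (intro typed.intros) auto
qed (auto split: if_splits option.splits ty.splits intro: typed.intros)

definition "symT = Sort ''sym''"

fun A :: "nat \<Rightarrow> ty" where
  "A 0 = listT"
| "A (Suc k) = Arrow boolT (A k)"

fun fty :: "nat \<Rightarrow> fs \<Rightarrow> ty" where
  "fty J Main = Arrow listT boolT"
| "fty J Start = Arrow listT boolT"
| "fty J Load = arrows [listT, listT, Arrow symT (A J), A J] boolT"
| "fty J (Run q) = arrows [listT, Arrow symT (A J), A J] boolT"
| "fty J (Wr a) = arrows [listT, Arrow symT (A J), A J, symT] (A J)"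
| "fty J Blank = arrows [listT, symT] (A J)"
| "fty J Filt = arrows [listT, A J, A J] (A J)"
| "fty J Inc = arrows [listT, A J] (A J)"
| "fty J IncX = arrows [listT, A J, A J] (A J)"
| "fty J (Zero k) = Arrow listT (A k)"
| "fty J (Dec k) = arrows [listT, A k] (A k)"
| "fty J (DecX k) = arrows [listT, A (Suc k), boolT, A k] (A k)"
| "fty J (Eq k) = arrows [listT, A k, A k] boolT"
| "fty J (EqX k) = arrows [listT, A (Suc k), A (Suc k), A k] boolT"
| "fty J (Mem k) = arrows [listT, A (Suc k), A k] boolT"
| "fty J (Nb k) = arrows [listT, A (Suc k), A k] boolT"
| "fty J (Any k) = Arrow listT (A k)"
| "fty J (AnyX k) = arrows [listT, A k] (A k)"
| "fty J (Fail k) = A k"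
| "fty J FailB = boolT"

definition FD :: "nat \<Rightarrow> string \<Rightarrow> ty" where "FD J s = fty J (inv name s)"

lemma FD_name[simp]: "FD J (name f) = fty J f"
  by (simp add: FD_def inv_f_f inj_def)

definition FC :: "string \<Rightarrow> ty" where
  "FC c = (if c = ''true'' \<or> c = ''false'' then boolT else if c = ''nil'' then listT
     else if c = ''cons'' then Arrow boolT (Arrow listT listT) else symT)"

lemma FC_simps[simp]: "FC ''true'' = boolT" "FC ''false'' = boolT" "FC ''nil'' = listT"
  "FC ''cons'' = Arrow boolT (Arrow listT listT)" "FC (symc a) = symT"
  by (auto simp: FC_def symc_def)

text \<open>The same few variable names are reused in all clauses, so the type of a name depends on
  the function symbol. One environment serves all clauses of a symbol.\<close>

definition env :: "nat \<Rightarrow> fs \<Rightarrow> string \<Rightarrow> ty" where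
  "env J f x = (if x = ''c'' then listT else if x = ''b'' then (case f of Wr a \<Rightarrow> symT | _ \<Rightarrow> boolT)
     else if x = ''t'' then Arrow symT (A J) else if x = ''h'' then A J
     else if x = ''j'' then (case f of Filt \<Rightarrow> A J | IncX \<Rightarrow> A J | DecX k \<Rightarrow> A k | EqX k \<Rightarrow> A k | Mem k \<Rightarrow> A k
       | Nb k \<Rightarrow> A k | AnyX k \<Rightarrow> A k | _ \<Rightarrow> boolT)
     else (case f of Dec k \<Rightarrow> A k | Eq k \<Rightarrow> A k | DecX k \<Rightarrow> A (Suc k) | EqX k \<Rightarrow> A (Suc k)
       | Mem k \<Rightarrow> A (Suc k) | Nb k \<Rightarrow> A (Suc k) | _ \<Rightarrow> listT))"

lemma ord_A: "ord_ty (A k) \<le> 1"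
  by (induction k) (auto simp: listT_def boolT_def)

lemma ord_env: "ord_ty (env J f x) \<le> 1"
  using ord_A[of J] by (auto simp: env_def listT_def boolT_def symT_def ord_A ord_A[unfolded One_nat_def] split: fs.split)

lemma arity_ty_simps: "arity_ty boolT = 0" "arity_ty listT = 0" "arity_ty symT = 0"
  by (auto simp: boolT_def listT_def symT_def)

abbreviation "tyI J f \<equiv> tyo FC (FD J) (env J f)"

lemma cl_typed:
  assumes "(ls, s) \<in> set (cl T J f)" "syms T \<noteq> []"
  shows "\<exists>t. tyI J f (apps (EFun (name f)) (map pexp ls)) = Some t \<and> tyI J f s = Some t"
\<comment> \<open>The body of \<open>Run\<close> is a \<open>choose\<close> whose alternatives
  depend on the transition table, so it is typed for an arbitrary list of symbols. The list has to
  be non-empty for the \<open>choose\<close> to have a type.\<close>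
proof (cases "\<exists>q. f = Run q")
  case True
  then obtain q where q: "f = Run q" by blast
  have m: "tyI J f (move J d) = Some (A J)" for d by (simp add: q move_def env_def)
  let ?e = "\<lambda>a. case tm_delta T q a of (q', a', d) \<Rightarrow>
       EIf (fc (Eq J) [xc, EApp xt (ECon (symc a)), xh])
         (fc (Run q') [xc, fc (Wr a') [xc, xt, xh], move J d]) (fc FailB [])"
  have e: "tyI J f (?e a) = Some boolT" for a
    using m by (cases "tm_delta T q a") (simp add: q env_def)
  have "tyI J f (EChoose (map ?e as)) = Some boolT" if "as \<noteq> []" for as
    using that e by (cases as) simp_all
  then have "tyI J f s = Some boolT" using assms by (auto simp: q)
  then show ?thesis using assms(1) by (auto simp: q env_def)
next
  case False
  then show ?thesis using assms(1)
    by (cases "(T, J, f)" rule: cl.cases) (auto simp: env_def eqE_def)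
qed

text \<open>Constructors occur as constants only. Such expressions are fully applied and cons-free
  for trivial reasons, and this covers all clauses except that of \<open>Main\<close>.\<close>

fun flat :: "expr \<Rightarrow> bool" where
  "flat (EIf a b c) \<longleftrightarrow> flat a \<and> flat b \<and> flat c"
| "flat (EChoose es) \<longleftrightarrow> list_all flat es"
| "flat (EPair a b) \<longleftrightarrow> flat a \<and> flat b"
| "flat (EApp a b) \<longleftrightarrow> \<not> con_headed a \<and> flat a \<and> flat b"
| "flat (ECon c) \<longleftrightarrow> FC c \<in> {boolT, listT, symT}"
| "flat _ \<longleftrightarrow> True"

lemma flat_subs: "flat e \<Longrightarrow> t \<in> subs e \<Longrightarrow> flat t"
  by (induction e) (auto simp: subs_def list_all_iff)

lemma flat_fa: "flat e \<Longrightarrow> \<not> con_headed e \<or> n = 0 \<Longrightarrow> fa FC n e"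
  by (induction e arbitrary: n) (auto simp: list_all_iff arity_ty_simps)

lemma flat_con: "flat (apps (ECon c) ss) \<Longrightarrow> ss = []"
  by (cases ss rule: rev_cases) (auto simp: con_headed_apps)

lemma cl_flat: "(ls, s) \<in> set (cl T J f) \<Longrightarrow> f \<noteq> Main \<Longrightarrow> flat s"
  by (cases "(T, J, f)" rule: cl.cases)
    (auto simp: eqE_def move_def list_all_iff split: prod.split)

lemma cl_vars: "(ls, s) \<in> set (cl T J f) \<Longrightarrow> evars s \<subseteq> set (lhs_vars ls)"
  by (cases "(T, J, f)" rule: cl.cases)
    (auto simp: eqE_def move_def lhs_vars_def split: prod.splits if_splits)

lemma cl_pat_fa: "(ls, s) \<in> set (cl T J f) \<Longrightarrow> list_all (pat_fa FC) ls"
  by (cases "(T, J, f)" rule: cl.cases) (auto simp: arity_ty_simps)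

lemma ctor_type_FC: "ctor_type (FC c)"
proof -
  have "ctor_type (arrows [boolT, listT] listT)" "ctor_type (arrows [] (Sort i))" for i
    unfolding ctor_type_def by (rule exI[of _ "[boolT, listT]"], simp add: boolT_def listT_def) (rule exI[of _ "[]"], simp)
  then show ?thesis by (auto simp: FC_def boolT_def listT_def symT_def)
qed

text \<open>Only \<open>Main\<close> applies a constructor to arguments, and the term it builds is
  its own pattern, so nothing new is constructed. The bound on the order is that of
  \<open>ord_env\<close>: the arrows of \<open>A k\<close> are nested on the result side, where they
  do not raise the order above 1.\<close>

lemma wf_cf_sim:
  assumes "valid_tm T" "K \<ge> 1"
  shows "wf_cf_prog K (sim T J)"
proof -
  have "0 \<in> tm_symbols T" "finite (tm_symbols T)" using assms(1) by (auto simp: valid_tm_def)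
  then have ne: "syms T \<noteq> []" by (auto simp: syms_def)
  have typed: "\<exists>\<Gamma> t. typed FC (FD J) \<Gamma> (apps (EFun (name f)) (map pexp ls)) t \<and> typed FC (FD J) \<Gamma> s t \<and>
      (\<forall>x \<in> set (lhs_vars ls). ord_ty (\<Gamma> x) \<le> K)" if "(ls, s) \<in> set (cl T J f)" for f ls s
    using cl_typed[OF that ne] tyo_typed ord_env le_trans[OF ord_env assms(2)] by metis
  have "typed_prog_order FC (FD J) K (sim T J)"
    unfolding typed_prog_order_def
  proof (intro conjI)
    show "sim T J \<noteq> []" "FD J (main_fun (sim T J)) = Arrow listT boolT"
      by (simp_all add: sim_def keys_def block_def main_fun_def)
    show "\<forall>(f, ls, s) \<in> set (sim T J). distinct (lhs_vars ls) \<and> evars s \<subseteq> set (lhs_vars ls) \<and>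
        (\<exists>\<Gamma> t. typed FC (FD J) \<Gamma> (apps (EFun f) (map pexp ls)) t \<and> typed FC (FD J) \<Gamma> s t \<and>
               (\<forall>x \<in> set (lhs_vars ls). ord_ty (\<Gamma> x) \<le> K))"
      using typed cl_linear cl_vars by (auto simp: set_sim) blast+
  qed (simp_all add: ctor_type_FC)
  moreover have full: "fa FC 0 s \<and> list_all (pat_fa FC) ls" if "(ls, s) \<in> set (cl T J f)" for f ls s
  proof (cases "f = Main")
    case True
    then show ?thesis using that by (auto simp: arity_ty_simps)
  next
    case False
    then show ?thesis using cl_flat[OF that] cl_pat_fa[OF that] flat_fa by blast
  qed
  moreover have "same_arities (sim T J)"
    using cl_arity by (fastforce simp: same_arities_def set_sim)
  moreover have "is_dexp t \<or> (\<exists>l \<in> set ls. t \<in> subs (pexp l))"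
    if "(ls, s) \<in> set (cl T J f)" "t \<in> subs s" "t = apps (ECon c) ss" for f ls s t c ss
  proof (cases "f = Main")
    case True
    have "con_headed t" using that(3) by (simp add: con_headed_apps)
    then show ?thesis using True that(1,2) by (auto simp: subs_def)
  next
    case False
    then have "flat t" using cl_flat that flat_subs by blast
    then have "ss = []" using flat_con that(3) by blast
    then show ?thesis using is_dexp.intros(1)[of "[]" c] that(3) by simp
  qed
  then have "cons_free (sim T J)" unfolding cons_free_def by (auto simp: set_sim) blast
  moreover have "\<forall>(f, ls, s) \<in> set (sim T J). fa FC 0 s \<and> list_all (pat_fa FC) ls"
    using full by (auto simp: set_sim)
  ultimately show ?thesis unfolding wf_cf_prog_def by blast
qed

theorem theorem2:
  fixes K :: nat and X :: "bool list set"
  assumes "K \<ge> 1" and "[] \<notin> X"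
  shows "(\<exists>p. wf_cf_prog K p \<and> accepted_problem p = X) \<longleftrightarrow> X \<in> ELEMENTARY"
proof
  assume "\<exists>p. wf_cf_prog K p \<and> accepted_problem p = X"
  then show "X \<in> ELEMENTARY" using wf_cf_ELEMENTARY assms(2) by blast
next
  assume "X \<in> ELEMENTARY"
  then obtain T J where "valid_tm T" "accepted_problem (sim T J) = X" using ELEMENTARY_accepted by blast
  then show "\<exists>p. wf_cf_prog K p \<and> accepted_problem p = X" using wf_cf_sim assms(1) by blast
qed

end
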